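(* Let $n\in\{3,4\}$. Let $Q\in C^1(\mathbb{R}^n)$ be radially symmetric and monotone decreasing (as a function of $|x|$). Assume that either $$Q(x)=\delta e^{-\lambda|x|^2}\quad\text{for some }\delta>0\text{ and }\lambda>0,$$ or $$Q(x)=e^{\xi(x)},\quad|x\cdot\nabla Q(x)|\leq C\ \text{ on }\mathbb{R}^n\text{ for some constant }C,\quad\frac{\xi(x)}{|x|^2}\to0\ \text{ as }|x|\to\infty.$$ Then for every $\kappa\in(\Lambda_1,\infty)$ there is no radially symmetric solution $u$ to $$(-\Delta)^{\frac n2}u=Qe^{nu}\quad\text{in }\mathbb{R}^n,\qquad\int_{\mathbb{R}^n}Qe^{nu}\,dx=\kappa.$$
   Context: $\Lambda_1:=(n-1)!\,|S^n|$, where $|S^n|$ is the volume of the unit sphere $S^n\subset\mathbb{R}^{n+1}$. Meaning of $(-\Delta)^{n/2}u=f$ in $\mathbb{R}^n$: for $n$ even, $(-\Delta)^{n/2}$ is the usual integer power of $-\Delta$ (equation in the sense of distributions). For $n$ odd and $f\in\mathcal{S}'(\mathbb{R}^n)$, $u$ is a solution if $u\in W^{n-1,1}_{loc}(\mathbb{R}^n)$, $\Delta^{\frac{n-1}{2}}u\in L_{\frac12}(\mathbb{R}^n)$ and for every $\varphi$ in the Schwartz space $\mathcal{S}(\mathbb{R}^n)$ $$\int_{\mathbb{R}^n}(-\Delta)^{\frac{n-1}{2}}u\,(-\Delta)^{\frac12}\varphi\,dx=\langle f,\varphi\rangle,$$ where $(-\Delta)^{1/2}$ is the operator with Fourier symbol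 $|\xi|$, and $$L_{\frac12}(\mathbb{R}^n):=\left\{u\in L^1_{loc}(\mathbb{R}^n):\int_{\mathbb{R}^n}\frac{|u(x)|}{1+|x|^{n+1}}\,dx<\infty\right\}.$$ *)

theory Defs
  imports "HOL-Analysis.Analysis"
begin

definition radially_symmetric :: "('a::real_normed_vector \<Rightarrow> 'b) \<Rightarrow> bool" where
  "radially_symmetric f \<longleftrightarrow> (\<forall>x y. norm x = norm y \<longrightarrow> f x = f y)"

definition radially_decreasing :: "('a::real_normed_vector \<Rightarrow> real) \<Rightarrow> bool" where
  "radially_decreasing f \<longleftrightarrow> (\<forall>x y. norm x \<le> norm y \<longrightarrow> f y \<le> f x)"


definition partial :: "'n::finite \<Rightarrow> (real ^ 'n \<Rightarrow> 'b::real_normed_vector) \<Rightarrow> real ^ 'n \<Rightarrow> 'b" where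
  "partial i f x = frechet_derivative f (at x) (axis i 1)"

text \<open>A multi-index is given as the list of the directions of differentiation; its order
  is the length of the list.\<close>

definition partials :: "'n::finite list \<Rightarrow> (real ^ 'n \<Rightarrow> 'b::real_normed_vector) \<Rightarrow> real ^ 'n \<Rightarrow> 'b" where
  "partials is f = foldr partial is f"

definition gradient :: "(real ^ 'n::finite \<Rightarrow> real) \<Rightarrow> real ^ 'n \<Rightarrow> real ^ 'n" where
  "gradient f x = (\<chi> i. partial i f x)"

definition C1_function :: "(real ^ 'n::finite \<Rightarrow> real) \<Rightarrow> bool" where
  "C1_function f \<longleftrightarrow> (\<forall>x. f differentiable (at x)) \<and> continuous_on UNIV (gradient f)"

definition smooth :: "(real ^ 'n::finite \<Rightarrow> 'b::real_normed_vector) \<Rightarrow> bool" where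
  "smooth f \<longleftrightarrow> (\<forall>is x. partials is f differentiable (at x))"

definition test_function :: "(real ^ 'n::finite \<Rightarrow> complex) \<Rightarrow> bool" where
  "test_function \<phi> \<longleftrightarrow> smooth \<phi> \<and> compact (closure {x. \<phi> x \<noteq> 0})"

definition schwartz :: "(real ^ 'n::finite \<Rightarrow> complex) \<Rightarrow> bool" where
  "schwartz \<phi> \<longleftrightarrow> smooth \<phi> \<and>
     (\<forall>is k. bounded (range (\<lambda>x. norm x ^ k *\<^sub>R partials is \<phi> x)))"

definition neg_laplacian ::
  "(real ^ 'n::finite \<Rightarrow> 'b::real_normed_vector) \<Rightarrow> real ^ 'n \<Rightarrow> 'b" where
  "neg_laplacian f x = - (\<Sum>i\<in>UNIV. partial i (partial i f) x)"

definition fourier :: "(real ^ 'n::finite \<Rightarrow> complex) \<Rightarrow> real ^ 'n \<Rightarrow> complex" where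
  "fourier \<phi> \<xi> = (LINT x|lebesgue. \<phi> x * cis (- (x \<bullet> \<xi>)))"

text \<open>The operator with Fourier symbol \<open>|\<xi>|\<close>; the factor \<open>(2\<pi>)\<^sup>-\<^sup>n\<close> belongs to the inverse of
  the Fourier transform as normalised above.\<close>

definition half_laplacian :: "(real ^ 'n::finite \<Rightarrow> complex) \<Rightarrow> real ^ 'n \<Rightarrow> complex" where
  "half_laplacian \<phi> x =
     (1 / (2 * pi) ^ CARD('n)) *\<^sub>R (LINT \<xi>|lebesgue. norm \<xi> *\<^sub>R (fourier \<phi> \<xi> * cis (x \<bullet> \<xi>)))"


definition locally_integrable :: "(real ^ 'n::finite \<Rightarrow> real) \<Rightarrow> bool" where
  "locally_integrable u \<longleftrightarrow> (\<forall>K. compact K \<longrightarrow> u absolutely_integrable_on K)"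

text \<open>The pairing of a function with a test function. The test functions are complex-valued.\<close>

definition pairing :: "(real ^ 'n::finite \<Rightarrow> real) \<Rightarrow> (real ^ 'n \<Rightarrow> complex) \<Rightarrow> complex" where
  "pairing f \<phi> = (LINT x|lebesgue. f x *\<^sub>R \<phi> x)"

definition weak_partials ::
  "'n::finite list \<Rightarrow> (real ^ 'n \<Rightarrow> real) \<Rightarrow> (real ^ 'n \<Rightarrow> real) \<Rightarrow> bool" where
  "weak_partials is u v \<longleftrightarrow> locally_integrable u \<and> locally_integrable v \<and>
     (\<forall>\<phi>. test_function \<phi> \<longrightarrow> pairing u (partials is \<phi>) = (-1) ^ length is * pairing v \<phi>)"

definition sobolev_1_loc :: "nat \<Rightarrow> (real ^ 'n::finite \<Rightarrow> real) \<Rightarrow> bool" where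
  "sobolev_1_loc m u \<longleftrightarrow> locally_integrable u \<and>
     (\<forall>is. length is \<le> m \<longrightarrow> (\<exists>v. weak_partials is u v))"

text \<open>\<open>(-\<Delta>)\<^sup>m u = v\<close> in the sense of distributions, for locally integrable \<open>u\<close> and \<open>v\<close>.\<close>

definition weak_neg_laplacian_power ::
  "nat \<Rightarrow> (real ^ 'n::finite \<Rightarrow> real) \<Rightarrow> (real ^ 'n \<Rightarrow> real) \<Rightarrow> bool" where
  "weak_neg_laplacian_power m u v \<longleftrightarrow> locally_integrable u \<and> locally_integrable v \<and>
     (\<forall>\<phi>. test_function \<phi> \<longrightarrow> pairing u ((neg_laplacian ^^ m) \<phi>) = pairing v \<phi>)"

definition L_half :: "(real ^ 'n::finite \<Rightarrow> real) \<Rightarrow> bool" where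
  "L_half u \<longleftrightarrow> locally_integrable u \<and>
     integrable lebesgue (\<lambda>x. \<bar>u x\<bar> / (1 + norm x ^ (CARD('n) + 1)))"

text \<open>\<open>(-\<Delta>)\<^sup>n\<^sup>/\<^sup>2 u = f\<close> on the whole space, \<open>n\<close> being its dimension, for an integrable right-hand
  side \<open>f\<close>. Such an \<open>f\<close> is a tempered distribution, acting on Schwartz functions by the integral
  pairing. For odd \<open>n\<close> the function \<open>v\<close> is \<open>(-\<Delta>)\<^sup>m u\<close> with \<open>2 m + 1 = n\<close>, which the weak equation
  determines up to a null set; it lies in \<open>L_half\<close> if and only if \<open>\<Delta>\<^sup>m u = (-1)\<^sup>m v\<close> does.\<close>

definition solves_half_n_laplace :: "(real ^ 'n::finite \<Rightarrow> real) \<Rightarrow> (real ^ 'n \<Rightarrow> real) \<Rightarrow> bool" where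
  "solves_half_n_laplace u f \<longleftrightarrow> integrable lebesgue f \<and>
     (if even CARD('n) then weak_neg_laplacian_power (CARD('n) div 2) u f
      else sobolev_1_loc (CARD('n) - 1) u \<and>
        (\<exists>v. weak_neg_laplacian_power ((CARD('n) - 1) div 2) u v \<and> L_half v \<and>
          (\<forall>\<phi>. schwartz \<phi> \<longrightarrow> pairing v (half_laplacian \<phi>) = pairing f \<phi>)))"


text \<open>Surface measure on the unit sphere of a Euclidean space of dimension \<open>d\<close>, obtained from
  polar coordinates: \<open>\<sigma>(A)\<close> is \<open>d\<close> times the volume of the cone over \<open>A\<close> with apex \<open>0\<close>.\<close>

definition sphere_surface :: "'a::euclidean_space set \<Rightarrow> real" where
  "sphere_surface A = real DIM('a) * measure lebesgue {r *\<^sub>R x | r x. 0 \<le> r \<and> r \<le> 1 \<and> x \<in> A}"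

text \<open>\<open>'n option\<close> has one element more than \<open>'n\<close>, so the sphere below is the \<open>n\<close>-dimensional unit
  sphere in the space of dimension \<open>n + 1\<close>.\<close>

definition Lambda1 :: "'n::finite itself \<Rightarrow> real" where
  "Lambda1 _ = fact (CARD('n) - 1) * sphere_surface (sphere (0 :: real ^ 'n option) 1)"

end

theory Submission
  imports Defs "HOL-Probability.Probability" "HOL-Real_Asymp.Real_Asymp"
begin

text \<open>Write \<open>\<rho> = |x|\<^sup>2\<close>, \<open>f = Q e\<^sup>n\<^sup>u\<close>, \<open>\<kappa> = \<integral>f\<close> and \<open>\<gamma> = \<Lambda>\<^sub>1 / 2\<close>. Testing the equation with radial functions
  gives \<open>u = U (\<rho>) + A + B \<rho>\<close> almost everywhere, where \<open>2 \<rho> U' (\<rho>) = V (\<rho>) = -\<integral>f (y) g (|y| / |x|) dy / \<gamma>\<close>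
  and \<open>g (|y| / r)\<close> is the mean of \<open>x \<bullet> (x - y) / |x - y|\<^sup>2\<close> over the sphere \<open>|x| = r\<close>. In dimension 3 the
  half Laplacian is tested on Gaussians only; superposing them yields differences of Poisson kernels,
  and the resulting Stieltjes transforms determine the function \<open>v = -\<Delta>u\<close> up to an additive constant.
  Since \<open>0 \<le> g \<le> 1\<close>, \<open>U\<close> decays at most logarithmically, so the factor \<open>K = Q e\<^sup>n\<^sup>(\<^sup>A\<^sup>+\<^sup>B\<^sup>\<rho>\<^sup>)\<close> cannot
  grow like a Gaussian, and both forms of \<open>Q\<close> then force \<open>K\<close> to be decreasing. Comparing \<open>f\<close> with its
  dilations gives \<open>-\<integral>f V \<le> \<kappa>\<close>, which is the Pohozaev inequality without derivatives of \<open>Q\<close>. Symmetrising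
  with \<open>g (s) + g (1 / s) = 1\<close> turns the left-hand side into \<open>\<kappa>\<^sup>2 / (2 \<gamma>)\<close>, hence \<open>\<kappa> \<le> 2 \<gamma> = \<Lambda>\<^sub>1\<close>.\<close>

subsection \<open>Smooth functions of one real variable\<close>

text \<open>The logarithmic potential of \<open>f\<close> is never formed: integrability of
  \<open>f\<close> leaves log |y| uncontrolled at infinity. Its radial derivative has a kernel with
  values in [0, 1], so \<open>V\<close> always exists, and \<open>U\<close> may be any primitive of
  V (\<rho>) / (2 \<rho>); the constant of integration joins \<open>A\<close>. As \<open>u\<close>
  is known only almost everywhere and in the sense of distributions, the remainder \<open>u\<close>
  - \<open>U\<close> is identified by pairing. Radial functions supported in a shell are of the form
  \<Delta>^2 \<eta> with compactly supported \<eta> when their integrals against 1 and \<rho>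
  vanish, and annihilating all of them leaves only A + B \<rho>. In dimension 3 the half Laplacian
  of a Schwartz function decays only like |x|^(-4), just enough to be paired with \<open>v\<close>
  in \<open>L_half\<close>. For Gaussians an explicit integral formula makes this quantitative. The
  additive constant left open in \<open>v\<close> does no harm, because \<open>v\<close> is paired
  only with functions \<zeta> = -\<Delta>\<eta>, whose integral is zero.\<close>

fun times_differentiable_on :: "nat \<Rightarrow> real set \<Rightarrow> (real \<Rightarrow> real) \<Rightarrow> bool" where
  "times_differentiable_on 0 S g \<longleftrightarrow> True"
| "times_differentiable_on (Suc k) S g \<longleftrightarrow>
     (\<forall>x\<in>S. g field_differentiable at x) \<and> times_differentiable_on k S (deriv g)"

text \<open>Relative to an open set, because the powers \<open>\<rho> powr a\<close> are smooth only
  for \<rho> > 0; functions that vanish near the origin are glued together on the whole line with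
  \<open>smooth_real_on_Un\<close>.\<close>

definition smooth_real_on :: "real set \<Rightarrow> (real \<Rightarrow> real) \<Rightarrow> bool" where
  "smooth_real_on S g \<longleftrightarrow> (\<forall>k. times_differentiable_on k S g)"

lemma times_differentiable_on_cong:
  assumes "open S" "\<And>x. x \<in> S \<Longrightarrow> f x = g x"
  shows "times_differentiable_on k S f = times_differentiable_on k S g"
  using assms
proof (induction k arbitrary: f g)
  case (Suc k)
  have ev: "\<forall>\<^sub>F y in nhds x. f y = g y" if "x \<in> S" for x
    using that Suc.prems eventually_nhds_in_open eventually_mono by (metis (mono_tags, lifting))
  have "deriv f x = deriv g x" if "x \<in> S" for x
    using deriv_cong_ev[OF ev[OF that]] by simp
  moreover have "f field_differentiable at x \<longleftrightarrow> g field_differentiable at x" if "x \<in> S" for x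
    unfolding field_differentiable_def
    using DERIV_cong_ev[OF refl ev[OF that] refl] by blast
  ultimately show ?case using Suc.IH[of "deriv f" "deriv g"] Suc.prems by auto
qed simp

lemma times_differentiable_on_Suc_I:
  assumes "open S" "\<And>x. x \<in> S \<Longrightarrow> (g has_real_derivative g' x) (at x)"
    "times_differentiable_on k S g'"
  shows "times_differentiable_on (Suc k) S g"
proof -
  have "times_differentiable_on k S (deriv g)"
    using times_differentiable_on_cong[OF assms(1), of g' "deriv g"] assms DERIV_imp_deriv by metis
  then show ?thesis
    using assms by (auto simp: field_differentiable_def)
qed

lemma times_differentiable_on_Suc_D:
  "times_differentiable_on (Suc k) S g \<Longrightarrow> times_differentiable_on k S g"
proof (induction k arbitrary: g)
  case (Suc k)
  then show ?case
    by (metis times_differentiable_on.simps(2))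
qed simp

lemma times_differentiable_on_const: "open S \<Longrightarrow> times_differentiable_on k S (\<lambda>_. c)"
proof (induction k arbitrary: c)
  case (Suc k)
  show ?case
    by (rule times_differentiable_on_Suc_I[OF Suc.prems(1) DERIV_const Suc.IH[OF Suc.prems]])
qed simp

lemma times_differentiable_on_add:
  assumes "open S" "times_differentiable_on k S f" "times_differentiable_on k S g"
  shows "times_differentiable_on k S (\<lambda>x. f x + g x)"
  using assms
proof (induction k arbitrary: f g)
  case (Suc k)
  show ?case
    by (rule times_differentiable_on_Suc_I[where g' = "\<lambda>x. deriv f x + deriv g x"])
      (use Suc in \<open>auto intro!: DERIV_add field_differentiable_derivI\<close>)
qed simp

lemma times_differentiable_on_mult:
  assumes "open S" "times_differentiable_on k S f" "times_differentiable_on k S g"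
  shows "times_differentiable_on k S (\<lambda>x. f x * g x)"
  using assms
proof (induction k arbitrary: f g)
  case (Suc k)
  have "times_differentiable_on k S f" "times_differentiable_on k S g"
    using Suc.prems times_differentiable_on_Suc_D by blast+
  then have "times_differentiable_on k S (\<lambda>x. deriv f x * g x + deriv g x * f x)"
    using Suc by (auto intro!: times_differentiable_on_add)
  moreover have "((\<lambda>x. f x * g x) has_real_derivative deriv f x * g x + deriv g x * f x) (at x)"
    if "x \<in> S" for x
    using that Suc.prems by (intro DERIV_mult) (auto intro!: field_differentiable_derivI)
  ultimately show ?case
    by (intro times_differentiable_on_Suc_I[OF Suc.prems(1)])
qed simp

lemma times_differentiable_on_affine:
  assumes "times_differentiable_on k UNIV f"
  shows "times_differentiable_on k UNIV (\<lambda>x. f (a * x + b))"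
  using assms
proof (induction k arbitrary: f)
  case (Suc k)
  have "((\<lambda>x. f (a * x + b)) has_real_derivative deriv f (a * x + b) * a) (at x)" for x
    by (rule DERIV_chain2[of f])
      (use Suc.prems in \<open>auto intro!: field_differentiable_derivI derivative_eq_intros\<close>)
  moreover have "times_differentiable_on k UNIV (\<lambda>x. deriv f (a * x + b) * a)"
    using Suc by (intro times_differentiable_on_mult times_differentiable_on_const) auto
  ultimately show ?case by (intro times_differentiable_on_Suc_I) auto
qed simp

lemma times_differentiable_on_powr:
  "times_differentiable_on k {0<..} (\<lambda>x. x powr a)"
proof (induction k arbitrary: a)
  case (Suc k)
  have "((\<lambda>x. x powr a) has_real_derivative a * x powr (a - 1)) (at x)" if "x > 0" for x
    using that by (auto intro!: derivative_eq_intros simp: powr_diff)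
  moreover have "times_differentiable_on k {0<..} (\<lambda>x. a * x powr (a - 1))"
    using Suc by (intro times_differentiable_on_mult times_differentiable_on_const) auto
  ultimately show ?case by (intro times_differentiable_on_Suc_I) auto
qed simp

lemma times_differentiable_on_Un:
  "times_differentiable_on k (S \<union> T) g \<longleftrightarrow>
    times_differentiable_on k S g \<and> times_differentiable_on k T g"
  by (induction k arbitrary: g) auto

lemma times_differentiable_on_subset:
  "times_differentiable_on k S g \<Longrightarrow> T \<subseteq> S \<Longrightarrow> times_differentiable_on k T g"
  by (induction k arbitrary: g) auto

lemma smooth_real_on_cong:
  "open S \<Longrightarrow> (\<And>x. x \<in> S \<Longrightarrow> f x = g x) \<Longrightarrow> smooth_real_on S f = smooth_real_on S g"
  unfolding smooth_real_on_def using times_differentiable_on_cong by blast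

lemma smooth_real_on_const: "open S \<Longrightarrow> smooth_real_on S (\<lambda>_. c)"
  by (simp add: smooth_real_on_def times_differentiable_on_const)

lemma smooth_real_on_add:
  "open S \<Longrightarrow> smooth_real_on S f \<Longrightarrow> smooth_real_on S g \<Longrightarrow> smooth_real_on S (\<lambda>x. f x + g x)"
  by (simp add: smooth_real_on_def times_differentiable_on_add)

lemma smooth_real_on_mult:
  "open S \<Longrightarrow> smooth_real_on S f \<Longrightarrow> smooth_real_on S g \<Longrightarrow> smooth_real_on S (\<lambda>x. f x * g x)"
  by (simp add: smooth_real_on_def times_differentiable_on_mult)

lemma smooth_real_on_affine:
  "smooth_real_on UNIV f \<Longrightarrow> smooth_real_on UNIV (\<lambda>x. f (a * x + b))"
  by (simp add: smooth_real_on_def times_differentiable_on_affine)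

lemma smooth_real_on_powr: "smooth_real_on {0<..} (\<lambda>x. x powr a)"
  by (simp add: smooth_real_on_def times_differentiable_on_powr)

lemma smooth_real_on_Un:
  "smooth_real_on (S \<union> T) g \<longleftrightarrow> smooth_real_on S g \<and> smooth_real_on T g"
  by (auto simp: smooth_real_on_def times_differentiable_on_Un)

lemma smooth_real_on_subset: "smooth_real_on S g \<Longrightarrow> T \<subseteq> S \<Longrightarrow> smooth_real_on T g"
  unfolding smooth_real_on_def using times_differentiable_on_subset by blast

lemma smooth_real_on_primitive:
  assumes "open S" "\<And>x. x \<in> S \<Longrightarrow> (g has_real_derivative g' x) (at x)" "smooth_real_on S g'"
  shows "smooth_real_on S g"
  unfolding smooth_real_on_def
proof
  fix k show "times_differentiable_on k S g"
    using assms times_differentiable_on_Suc_I[of S g g'] times_differentiable_on_Suc_D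
    unfolding smooth_real_on_def by blast
qed

lemma smooth_real_on_field_differentiable:
  "smooth_real_on S g \<Longrightarrow> x \<in> S \<Longrightarrow> g field_differentiable at x"
  unfolding smooth_real_on_def by (metis times_differentiable_on.simps(2))

lemma smooth_real_on_deriv: "smooth_real_on S g \<Longrightarrow> smooth_real_on S (deriv g)"
  unfolding smooth_real_on_def by (metis times_differentiable_on.simps(2))

lemma smooth_real_on_continuous_on: "smooth_real_on S g \<Longrightarrow> continuous_on S g"
  by (intro field_differentiable_imp_continuous_at continuous_at_imp_continuous_on ballI)
    (rule smooth_real_on_field_differentiable)

text \<open>Names all derivatives at once, so that later inductions run over the index of
  \<open>e\<close> instead of iterating \<open>deriv\<close>.\<close>

lemma smooth_real_on_derivative_chain:
  assumes "smooth_real_on UNIV g"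
  obtains e where "e 0 = g" "\<And>k x. (e k has_real_derivative e (Suc k) x) (at x)"
proof
  have "smooth_real_on UNIV ((deriv ^^ k) g)" for k
    by (induction k) (use assms smooth_real_on_deriv in auto)
  then show "((deriv ^^ k) g has_real_derivative (deriv ^^ Suc k) g x) (at x)" for k x
    using smooth_real_on_field_differentiable[of UNIV "(deriv ^^ k) g" x]
    by (auto intro!: field_differentiable_derivI)
qed simp

section \<open>Flat functions and bumps\<close>

definition exp_inverse_poly :: "real poly \<Rightarrow> real \<Rightarrow> real" where
  "exp_inverse_poly p x = (if x > 0 then poly p (1 / x) * exp (- (1 / x)) else 0)"

lemma tendsto_poly_mult_exp_neg: "((\<lambda>y. poly p y * exp (- y)) \<longlongrightarrow> (0::real)) at_top"
proof -
  have *: "((\<lambda>y::real. y ^ n * exp (- y)) \<longlongrightarrow> 0) at_top" for n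
    using tendsto_power_div_exp_0[of n] by (simp add: exp_minus field_simps)
  have "((\<lambda>y. (\<Sum>i\<le>degree p. coeff p i * (y ^ i * exp (- y)))) \<longlongrightarrow> (\<Sum>i\<le>degree p. coeff p i * 0)) at_top"
    by (intro tendsto_sum tendsto_mult_left *)
  then show ?thesis
    by (simp add: poly_altdef sum_distrib_right mult.assoc)
qed

text \<open>The polynomial factor in 1 / x closes the family of exp (-1 / x) under differentiation:
  away from 0 the derivative produces x^(-2) (p - p') (1 / x), and at 0 the exponential beats every
  power.\<close>

lemma exp_inverse_poly_derivative:
  "(exp_inverse_poly p has_real_derivative exp_inverse_poly ([:0, 0, 1:] * (p - pderiv p)) x) (at x)"
proof (cases "x = 0")
  case True
  \<comment> \<open>The extra factor [:0, 1:] is the 1 / x of the difference quotient at 0.\<close>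
  have "((\<lambda>y. poly ([:0, 1:] * p) y * exp (- y)) \<longlongrightarrow> 0) at_top"
    by (rule tendsto_poly_mult_exp_neg)
  then have "((\<lambda>x. poly ([:0, 1:] * p) (inverse x) * exp (- inverse x)) \<longlongrightarrow> 0) (at_right (0::real))"
    using filterlim_inverse_at_top_right by (rule filterlim_compose)
  then have "((\<lambda>x. exp_inverse_poly p x / x) \<longlongrightarrow> 0) (at_right 0)"
    by (rule Lim_transform_eventually)
      (auto simp: eventually_at_right_less exp_inverse_poly_def field_simps
        intro!: eventually_at_rightI[of 0 1])
  moreover have "((\<lambda>x. exp_inverse_poly p x / x) \<longlongrightarrow> 0) (at_left 0)"
    by (rule Lim_transform_eventually[OF tendsto_const])
      (auto simp: exp_inverse_poly_def intro!: eventually_at_leftI[of "-1" 0])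
  ultimately have "((\<lambda>x. exp_inverse_poly p x / x) \<longlongrightarrow> 0) (at 0)"
    by (simp add: filterlim_split_at)
  then show ?thesis
    using True by (simp add: has_field_derivative_iff exp_inverse_poly_def)
next
  case False
  then consider "x < 0" | "x > 0" by linarith
  then show ?thesis
  proof cases
    case 1
    have "\<forall>\<^sub>F y in nhds x. exp_inverse_poly p y = 0"
      using eventually_nhds_in_open[of "{..<0}" x] 1
      by (auto simp: exp_inverse_poly_def elim!: eventually_mono)
    from iffD2[OF DERIV_cong_ev[OF refl this refl] DERIV_const] show ?thesis
      using 1 by (simp add: exp_inverse_poly_def[of _ x])
  next
    case 2
    have "\<forall>\<^sub>F y in nhds x. exp_inverse_poly p y = poly p (1 / y) * exp (- (1 / y))"
      using eventually_nhds_in_open[of "{0<..}" x] 2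
      by (auto simp: exp_inverse_poly_def elim!: eventually_mono)
    moreover have "((\<lambda>y. poly p (1 / y) * exp (- (1 / y))) has_real_derivative
        exp_inverse_poly ([:0, 0, 1:] * (p - pderiv p)) x) (at x)"
      using 2 by (auto intro!: derivative_eq_intros DERIV_chain2[OF poly_DERIV]
          simp: exp_inverse_poly_def field_simps power2_eq_square)
    ultimately show ?thesis
      by (subst DERIV_cong_ev[OF refl _ refl])
  qed
qed

lemma smooth_exp_inverse_poly: "smooth_real_on UNIV (exp_inverse_poly p)"
  unfolding smooth_real_on_def
proof
  fix k show "times_differentiable_on k UNIV (exp_inverse_poly p)"
  proof (induction k arbitrary: p)
    case (Suc k)
    show ?case
      by (rule times_differentiable_on_Suc_I[OF open_UNIV exp_inverse_poly_derivative Suc.IH])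
  qed simp
qed

text \<open>\<open>m\<close> controls the steepness and not the support: for growing
  \<open>m\<close> the bumps tend to the indicator of the open interval while staying below 1, which
  is how smooth test functions reach intervals in the du Bois-Reymond lemma.\<close>

definition bump :: "real \<Rightarrow> real \<Rightarrow> real \<Rightarrow> real \<Rightarrow> real" where
  "bump m a b x = exp_inverse_poly 1 (m * (x - a)) * exp_inverse_poly 1 (m * (b - x))"

lemma smooth_bump: "smooth_real_on UNIV (bump m a b)"
proof -
  have "smooth_real_on UNIV (\<lambda>x. exp_inverse_poly 1 (m * x + (- (m * a))) *
      exp_inverse_poly 1 ((- m) * x + m * b))"
    by (intro smooth_real_on_mult smooth_real_on_affine smooth_exp_inverse_poly) auto
  then show ?thesis
    unfolding bump_def by (simp add: algebra_simps)
qed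

lemma bump_nonneg: "bump m a b x \<ge> 0"
  by (simp add: bump_def exp_inverse_poly_def)

lemma bump_le_1: "bump m a b x \<le> 1"
  by (auto simp: bump_def exp_inverse_poly_def intro!: mult_le_one)

lemma bump_eq_0: "m > 0 \<Longrightarrow> x \<notin> {a<..<b} \<Longrightarrow> bump m a b x = 0"
  by (auto simp: bump_def exp_inverse_poly_def zero_less_mult_iff)

lemma bump_pos: "m > 0 \<Longrightarrow> x \<in> {a<..<b} \<Longrightarrow> bump m a b x > 0"
  by (auto simp: bump_def exp_inverse_poly_def)

lemma bump_tendsto_indicator:
  "(\<lambda>k. bump (real (Suc k)) a b x) \<longlonglongrightarrow> indicator {a<..<b} x"
proof (cases "x \<in> {a<..<b}")
  case True
  have *: "(\<lambda>k. exp (- (1 / (real (Suc k) * c)))) \<longlonglongrightarrow> 1" for c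
  proof -
    have "(\<lambda>k. inverse (real (Suc k)) * inverse c) \<longlonglongrightarrow> 0 * inverse c"
      by (intro tendsto_mult_right LIMSEQ_inverse_real_of_nat)
    then have "(\<lambda>k. exp (- (1 / (real (Suc k) * c)))) \<longlonglongrightarrow> exp (- (0 * inverse c))"
      by (intro tendsto_intros) (simp add: field_simps)
    then show ?thesis by simp
  qed
  have "(\<lambda>k. exp (- (1 / (real (Suc k) * (x - a)))) * exp (- (1 / (real (Suc k) * (b - x))))) \<longlonglongrightarrow> 1 * 1"
    by (intro tendsto_mult *)
  then show ?thesis
    using True by (simp add: bump_def exp_inverse_poly_def del: of_nat_Suc)
next
  case False
  then show ?thesis
    by (simp add: bump_eq_0 del: of_nat_Suc)
qed

subsection \<open>Smooth radial functions\<close>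

lemma has_derivative_of_real_nth:
  "((\<lambda>x::real ^ 'n::finite. complex_of_real (x $ i)) has_derivative (\<lambda>h. of_real (h $ i))) (at x)"
  by (intro has_derivative_of_real bounded_linear_imp_has_derivative bounded_linear_vec_nth)

lemma partial_has_derivative: "(F has_derivative D) (at x) \<Longrightarrow> partial i F x = D (axis i 1)"
  unfolding partial_def using frechet_derivative_at by metis

text \<open>For a chain \<open>e\<close> of successive derivatives, these are the derivatives of
  \<open>x \<mapsto> e 0 (|x|\<^sup>2)\<close>.\<close>

inductive radial_span :: "(nat \<Rightarrow> real \<Rightarrow> real) \<Rightarrow> (real ^ 'n::finite \<Rightarrow> complex) \<Rightarrow> bool"
  for e where
  base: "radial_span e (\<lambda>x. of_real (e k (x \<bullet> x)))"
| coord: "radial_span e F \<Longrightarrow> radial_span e (\<lambda>x. of_real (x $ i) * F x)"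
| add: "radial_span e F \<Longrightarrow> radial_span e G \<Longrightarrow> radial_span e (\<lambda>x. F x + G x)"
| scale: "radial_span e F \<Longrightarrow> radial_span e (\<lambda>x. of_real c * F x)"

locale derivative_chain =
  fixes e :: "nat \<Rightarrow> real \<Rightarrow> real"
  assumes chain: "\<And>k x. (e k has_real_derivative e (Suc k) x) (at x)"
begin

lemma has_derivative_radial:
  "((\<lambda>x::real ^ 'n::finite. complex_of_real (e k (x \<bullet> x))) has_derivative
    (\<lambda>h. of_real (e (Suc k) (x \<bullet> x) * (2 * (x \<bullet> h))))) (at x)"
proof -
  have "((\<lambda>x. e k (x \<bullet> x)) has_derivative (\<lambda>h. e (Suc k) (x \<bullet> x) * (2 * (x \<bullet> h)))) (at x)"
    by (rule has_derivative_eq_rhs[OF has_derivative_compose[of "\<lambda>x. x \<bullet> x"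
            "\<lambda>h. x \<bullet> h + h \<bullet> x" x UNIV "e k", OF _ chain[unfolded has_field_derivative_def]]])
      (auto intro!: derivative_eq_intros simp: inner_commute algebra_simps)
  then show ?thesis
    by (rule has_derivative_of_real)
qed

text \<open>Each partial derivative of e k (|x|^2) is 2 x_i e (k + 1) (|x|^2), and the other rules
  obey the product and sum rules. Smoothness and decay of all partials thereby reduce to one
  induction over \<open>radial_span\<close>.\<close>

lemma radial_span_derivative:
  fixes F :: "real ^ 'n::finite \<Rightarrow> complex"
  assumes "radial_span e F"
  shows "(\<forall>x. F differentiable (at x)) \<and> (\<forall>i. radial_span e (partial i F))"
  using assms
proof induction
  case (base k)
  have "partial i (\<lambda>x::real ^ 'n. complex_of_real (e k (x \<bullet> x))) =
      (\<lambda>x. of_real 2 * (of_real (x $ i) * of_real (e (Suc k) (x \<bullet> x))))" for i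
    by (rule ext, subst partial_has_derivative[OF has_derivative_radial])
      (simp add: inner_axis)
  then show ?case
    using has_derivative_radial unfolding differentiable_def
    by (auto intro!: radial_span.intros simp del: of_real_numeral)
next
  case (coord F i)
  have D: "((\<lambda>x. of_real (x $ i) * F x) has_derivative
      (\<lambda>h. of_real (x $ i) * frechet_derivative F (at x) h + of_real (h $ i) * F x)) (at x)" for x
    by (rule has_derivative_mult[of _ "\<lambda>h. of_real (h $ i)"])
      (use coord.IH in \<open>auto intro!: has_derivative_of_real_nth simp: frechet_derivative_works\<close>)
  have "partial j (\<lambda>x. of_real (x $ i) * F x) =
      (\<lambda>x. of_real (x $ i) * partial j F x + of_real (if i = j then 1 else 0) * F x)" for j
    by (rule ext, subst partial_has_derivative[OF D]) (simp add: partial_def axis_def)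
  then show ?case
    using D coord unfolding differentiable_def
    by (auto intro!: radial_span.intros simp del: of_real_1 of_real_0)
next
  case (add F G)
  have D: "((\<lambda>x. F x + G x) has_derivative
      (\<lambda>h. frechet_derivative F (at x) h + frechet_derivative G (at x) h)) (at x)" for x
    using add.IH by (intro has_derivative_add) (auto simp: frechet_derivative_works)
  have "partial j (\<lambda>x. F x + G x) = (\<lambda>x. partial j F x + partial j G x)" for j
    by (rule ext, subst partial_has_derivative[OF D]) (simp add: partial_def)
  then show ?case
    using D add unfolding differentiable_def by (auto intro!: radial_span.intros)
next
  case (scale F c)
  have D: "((\<lambda>x. of_real c * F x) has_derivative
      (\<lambda>h. of_real c * frechet_derivative F (at x) h)) (at x)" for x
    using scale.IH by (intro has_derivative_mult_right) (auto simp: frechet_derivative_works)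
  have "partial j (\<lambda>x. of_real c * F x) = (\<lambda>x. of_real c * partial j F x)" for j
    by (rule ext, subst partial_has_derivative[OF D]) (simp add: partial_def)
  then show ?case
    using D scale unfolding differentiable_def by (auto intro!: radial_span.intros)
qed

lemma radial_span_partials: "radial_span e F \<Longrightarrow> radial_span e (partials is F)"
  unfolding partials_def by (induction "is") (simp_all add: radial_span_derivative)

lemma smooth_radial: "smooth (\<lambda>x::real ^ 'n::finite. complex_of_real (e k (x \<bullet> x)))"
  unfolding smooth_def using radial_span_partials radial_span_derivative radial_span.base by blast

lemma neg_laplacian_radial:
  "neg_laplacian (\<lambda>x::real ^ 'n::finite. complex_of_real (e 0 (x \<bullet> x))) =
    (\<lambda>x. of_real (- (4 * (x \<bullet> x) * e 2 (x \<bullet> x) + 2 * real CARD('n) * e 1 (x \<bullet> x))))"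
proof
  fix x :: "real ^ 'n"
  have p1: "partial i (\<lambda>x::real ^ 'n. complex_of_real (e 0 (x \<bullet> x))) =
      (\<lambda>x. of_real (x $ i) * (2 * of_real (e 1 (x \<bullet> x))))" for i
    by (rule ext, subst partial_has_derivative[OF has_derivative_radial])
      (simp add: inner_axis)
  have D: "((\<lambda>x. of_real (x $ i) * (2 * of_real (e 1 (x \<bullet> x)))) has_derivative
      (\<lambda>h. of_real (x $ i) * (2 * of_real (e 2 (x \<bullet> x) * (2 * (x \<bullet> h)))) +
        of_real (h $ i) * (2 * complex_of_real (e 1 (x \<bullet> x))))) (at x)" for i
    using has_derivative_radial[of 1 x]
    by (intro has_derivative_mult[of _ "\<lambda>h. of_real (h $ i)"] has_derivative_mult_right
        has_derivative_of_real_nth) (simp add: numeral_2_eq_2)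
  have "partial i (partial i (\<lambda>x::real ^ 'n. complex_of_real (e 0 (x \<bullet> x)))) x =
      of_real (4 * e 2 (x \<bullet> x) * (x $ i * x $ i) + 2 * e 1 (x \<bullet> x))" for i
    unfolding p1 by (subst partial_has_derivative[OF D]) (simp add: inner_axis)
  then show "neg_laplacian (\<lambda>x::real ^ 'n. complex_of_real (e 0 (x \<bullet> x))) x =
      of_real (- (4 * (x \<bullet> x) * e 2 (x \<bullet> x) + 2 * real CARD('n) * e 1 (x \<bullet> x)))"
    unfolding neg_laplacian_def
    by (simp only: sum.distrib flip: sum_distrib_left of_real_sum of_real_minus)
      (simp add: inner_vec_def)
qed

end

lemma smooth_radial_function:
  assumes "smooth_real_on UNIV g"
  shows "smooth (\<lambda>x::real ^ 'n::finite. complex_of_real (g (x \<bullet> x)))"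
proof -
  obtain e where "e 0 = g" "derivative_chain e"
    using smooth_real_on_derivative_chain[OF assms] by (metis derivative_chain.intro)
  then show ?thesis using derivative_chain.smooth_radial by metis
qed

lemma neg_laplacian_radial_function:
  assumes "smooth_real_on UNIV g"
  shows "neg_laplacian (\<lambda>x::real ^ 'n::finite. complex_of_real (g (x \<bullet> x))) =
    (\<lambda>x. of_real (- (4 * (x \<bullet> x) * deriv (deriv g) (x \<bullet> x) + 2 * real CARD('n) * deriv g (x \<bullet> x))))"
proof -
  obtain e where e: "e 0 = g" "\<And>k x. (e k has_real_derivative e (Suc k) x) (at x)"
    using smooth_real_on_derivative_chain[OF assms] by blast
  have 1: "e 1 = deriv g" using e(2)[of 0] e(1) by (metis One_nat_def DERIV_imp_deriv ext)
  have "e 2 = deriv (deriv g)" using e(2)[of 1] by (metis 1 Suc_1 DERIV_imp_deriv ext)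
  with e 1 derivative_chain.neg_laplacian_radial[OF derivative_chain.intro[of e]]
  show ?thesis by simp
qed

lemma test_function_radial:
  assumes "smooth_real_on UNIV g" "\<And>\<rho>. \<rho> \<ge> B \<Longrightarrow> g \<rho> = 0"
  shows "test_function (\<lambda>x::real ^ 'n::finite. complex_of_real (g (x \<bullet> x)))"
proof -
  have "{x::real ^ 'n. complex_of_real (g (x \<bullet> x)) \<noteq> 0} \<subseteq> cball 0 (sqrt B)"
    by (auto simp: norm_eq_sqrt_inner intro!: real_sqrt_le_mono)
      (meson assms(2) linorder_le_cases)
  then have "compact (closure {x::real ^ 'n. complex_of_real (g (x \<bullet> x)) \<noteq> 0})"
    by (meson bounded_cball bounded_subset compact_closure)
  with smooth_radial_function[OF assms(1)] show ?thesis
    by (simp add: test_function_def)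
qed

text \<open>All partials lie in the radial span of the functions (-\<tau>)^k exp (-\<tau> \<rho>),
  so it suffices to bound |x|^k F over that span. Multiplication by a coordinate costs one power of
  |x|, hence the induction for all k at once.\<close>

lemma schwartz_gaussian:
  assumes "\<tau> > 0"
  shows "schwartz (\<lambda>x::real ^ 'n::finite. complex_of_real (exp (- \<tau> * (x \<bullet> x))))"
proof -
  define e where "e k \<rho> = (- \<tau>) ^ k * exp (- \<tau> * \<rho>)" for k \<rho>
  interpret derivative_chain e
    by unfold_locales
      (auto simp: e_def[abs_def] intro!: derivative_eq_intros)
  have bnd: "bounded (range (\<lambda>x. norm x ^ k *\<^sub>R F x))"
    if "radial_span e F" for F :: "real ^ 'n \<Rightarrow> complex" and k
    using that
  proof (induction arbitrary: k)
    case (base j)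
    have "norm (norm x ^ k *\<^sub>R complex_of_real (e j (x \<bullet> x))) \<le> \<tau> ^ j * (1 + fact k / \<tau> ^ k)" for x :: "real ^ 'n"
    proof -
      define z where "z = x \<bullet> x"
      have z: "z \<ge> 0" "z = (norm x)\<^sup>2" by (simp_all add: z_def power2_norm_eq_inner)
      \<comment> \<open>One term of the exponential series controls the power of z.\<close>
      have "(\<tau> * z) ^ k / fact k \<le> exp (\<tau> * z)"
        using sum_le_suminf[OF summable_exp, of "{k}" "\<tau> * z"] assms z
        by (simp add: exp_def field_simps)
      then have 1: "z ^ k * exp (- \<tau> * z) \<le> fact k / \<tau> ^ k"
        using assms by (simp add: exp_minus field_simps power_mult_distrib)
      \<comment> \<open>Passes to powers of z = |x|^2 without separating even and odd k: where |x| >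
        1 the exponent is doubled, elsewhere the power is at most 1.\<close>
      have "norm x ^ k \<le> 1 + z ^ k"
      proof (cases "norm x \<le> 1")
        case True
        then have "norm x ^ k \<le> 1" by (simp add: power_le_one)
        then show ?thesis using zero_le_power[OF z(1), of k] by linarith
      next
        case False
        then have "norm x ^ k \<le> norm x ^ (2 * k)" by (intro power_increasing) auto
        then show ?thesis by (simp add: z(2) power_mult)
      qed
      then have "norm x ^ k * exp (- \<tau> * z) \<le> (1 + z ^ k) * exp (- \<tau> * z)"
        by (intro mult_right_mono) auto
      also have "\<dots> \<le> 1 + fact k / \<tau> ^ k"
        using 1 assms z by (simp add: distrib_right add_mono)
      finally have "\<tau> ^ j * (norm x ^ k * exp (- \<tau> * z)) \<le> \<tau> ^ j * (1 + fact k / \<tau> ^ k)"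
        using assms by (intro mult_left_mono) auto
      moreover have "norm (norm x ^ k *\<^sub>R complex_of_real (e j (x \<bullet> x))) =
          \<tau> ^ j * (norm x ^ k * exp (- \<tau> * z))"
        using assms
        by (simp only: e_def z_def norm_scaleR norm_of_real abs_mult power_abs abs_norm_cancel) simp
      ultimately show ?thesis by (simp only:)
    qed
    then show ?case by (auto simp: bounded_iff)
  next
    case (coord F i)
    obtain C where C: "\<And>x. norm (norm x ^ Suc k *\<^sub>R F x) \<le> C"
      using coord.IH[of "Suc k"] by (auto simp: bounded_iff)
    have "norm (norm x ^ k *\<^sub>R (of_real (x $ i) * F x)) \<le> C" for x
    proof -
      have "norm (norm x ^ k *\<^sub>R (of_real (x $ i) * F x)) = norm x ^ k * norm (F x) * \<bar>x $ i\<bar>"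
        by (simp add: norm_mult)
      also have "\<dots> \<le> norm x ^ k * norm (F x) * norm x"
        by (intro mult_left_mono component_le_norm_cart) auto
      also have "\<dots> = norm (norm x ^ Suc k *\<^sub>R F x)"
        by simp
      finally show ?thesis using C[of x] by linarith
    qed
    then show ?case by (auto simp: bounded_iff)
  next
    case (add F G)
    show ?case
      using bounded_plus_comp[OF add.IH(1)[of k] add.IH(2)[of k]] by (simp add: scaleR_add_right)
  next
    case (scale F c)
    obtain C where C: "\<And>x. norm (norm x ^ k *\<^sub>R F x) \<le> C"
      using scale.IH[of k] by (auto simp: bounded_iff)
    have "norm (norm x ^ k *\<^sub>R (of_real c * F x)) \<le> \<bar>c\<bar> * C" for x
      using mult_left_mono[OF C[of x], of "\<bar>c\<bar>"] by (simp add: norm_mult mult_ac)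
    then show ?case by (auto simp: bounded_iff)
  qed
  have eq: "(\<lambda>x::real ^ 'n. complex_of_real (exp (- \<tau> * (x \<bullet> x)))) =
      (\<lambda>x. complex_of_real (e 0 (x \<bullet> x)))"
    by (simp add: e_def)
  show ?thesis
    unfolding schwartz_def eq
    using smooth_radial bnd radial_span_partials radial_span.base by blast
qed

subsection \<open>Integrals of radial functions\<close>

text \<open>A nonnegative derivative of a continuous primitive is automatically integrable. The
  finite set S admits integrands such as \<open>riesz_kernel\<close>, which has a logarithmic
  singularity at \<rho> = s^2.\<close>

lemma FTC_nonneg_Icc:
  fixes G g :: "real \<Rightarrow> real"
  assumes "a \<le> b" "finite S" "continuous_on {a..b} G"
    and deriv: "\<And>x. x \<in> {a<..<b} - S \<Longrightarrow> (G has_real_derivative g x) (at x)"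
    and nonneg: "\<And>x. x \<in> {a..b} \<Longrightarrow> 0 \<le> g x"
    and [measurable]: "g \<in> borel_measurable borel"
  shows "has_bochner_integral lborel (\<lambda>x. indicator {a..b} x * g x) (G b - G a)"
proof -
  have I: "(g has_integral G b - G a) {a..b}"
    using assms by (intro fundamental_theorem_of_calculus_interior_strong[of S])
      (auto simp: has_real_derivative_iff_has_vector_derivative)
  then have abs: "g absolutely_integrable_on {a..b}"
    using nonneg by (intro nonnegative_absolutely_integrable_1) auto
  then have "integrable lebesgue (\<lambda>x. indicator {a..b} x * g x)"
    by (simp add: set_integrable_def)
  moreover have "(LINT x|lebesgue. indicator {a..b} x * g x) = G b - G a"
    using set_lebesgue_integral_eq_integral(2)[OF abs] integral_unique[OF I]
    by (simp add: set_lebesgue_integral_def)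
  ultimately show ?thesis
    by (simp add: has_bochner_integral_iff integrable_completion integral_completion)
qed

lemma FTC_nonneg_atLeast:
  fixes G g :: "real \<Rightarrow> real"
  assumes "finite S" "continuous_on {a..} G"
    and deriv: "\<And>x. x > a \<Longrightarrow> x \<notin> S \<Longrightarrow> (G has_real_derivative g x) (at x)"
    and nonneg: "\<And>x. x \<ge> a \<Longrightarrow> 0 \<le> g x"
    and [measurable]: "g \<in> borel_measurable borel"
    and lim: "(G \<longlongrightarrow> T) at_top"
  shows "has_bochner_integral lborel (\<lambda>x. indicator {a..} x * g x) (T - G a)"
proof (rule has_bochner_integral_monotone_convergence)
  have *: "has_bochner_integral lborel (\<lambda>x. indicator {a..a + real i} x * g x) (G (a + real i) - G a)" for i
    using assms by (intro FTC_nonneg_Icc[of _ _ S]) (auto intro: continuous_on_subset)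
  show "integrable lborel (\<lambda>x. indicator {a..a + real i} x * g x)" for i
    using * has_bochner_integral_iff by blast
  have "(\<lambda>i. G (a + real i) - G a) \<longlonglongrightarrow> T - G a"
    by (intro tendsto_intros filterlim_compose[OF lim]
        filterlim_tendsto_add_at_top[OF tendsto_const] filterlim_real_sequentially)
  then show "(\<lambda>i. LINT x|lborel. indicator {a..a + real i} x * g x) \<longlonglongrightarrow> T - G a"
    using * by (simp add: has_bochner_integral_iff)
  show "AE x in lborel. mono (\<lambda>i. indicator {a..a + real i} x * g x)"
    using nonneg by (auto simp: mono_def indicator_def)
  show "AE x in lborel. (\<lambda>i. indicator {a..a + real i} x * g x) \<longlonglongrightarrow> indicator {a..} x * g x"
  proof (intro AE_I2 tendsto_eventually)
    fix x
    have "\<forall>\<^sub>F i in sequentially. x - a \<le> real i"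
      by (rule eventually_ge_at_top[THEN eventually_compose_filterlim, OF filterlim_real_sequentially])
    then show "\<forall>\<^sub>F i in sequentially. indicator {a..a + real i} x * g x = indicator {a..} x * g x"
      by eventually_elim (auto simp: indicator_def)
  qed
qed auto

text \<open>The density of \<rho> = |x|^2 under Lebesgue measure, that is, the derivative of the
  volume of the ball of radius sqrt \<rho>. The square is used in place of |x| because it is smooth
  in x.\<close>

definition radial_weight :: "nat \<Rightarrow> real \<Rightarrow> real" where
  "radial_weight n \<rho> =
    (if \<rho> > 0 then real n * unit_ball_vol n / 2 * \<rho> powr (real n / 2 - 1) else 0)"

lemma radial_weight_nonneg: "radial_weight n \<rho> \<ge> 0"
  by (simp add: radial_weight_def)

lemma radial_weight_measurable [measurable]: "radial_weight n \<in> borel_measurable borel"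
  unfolding radial_weight_def by measurable

lemma nn_integral_radial_weight:
  assumes "n > 0" "R > 0"
  shows "(\<integral>\<^sup>+\<rho>. ennreal (radial_weight n \<rho>) * indicator {..R} \<rho> \<partial>lborel) =
    ennreal (unit_ball_vol n * R powr (n / 2))"
proof -
  have "((\<lambda>\<rho>. unit_ball_vol n * \<rho> powr (n / 2)) has_real_derivative
      radial_weight n x) (at x)" if "x > 0" for x
    using that by (auto intro!: derivative_eq_intros simp: radial_weight_def)
  moreover have "continuous_on {0..R} (\<lambda>\<rho>. unit_ball_vol n * \<rho> powr (n / 2))"
    using assms by (intro continuous_on_mult continuous_on_const continuous_on_powr' continuous_on_id) auto
  ultimately have "has_bochner_integral lborel (\<lambda>\<rho>. indicator {0..R} \<rho> * radial_weight n \<rho>)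
      (unit_ball_vol n * R powr (n / 2) - unit_ball_vol n * 0 powr (n / 2))"
    using assms
    by (intro FTC_nonneg_Icc[of _ _ "{}"]) (auto simp: radial_weight_nonneg)
  then have "(\<integral>\<^sup>+\<rho>. ennreal (indicator {0..R} \<rho> * radial_weight n \<rho>) \<partial>lborel) =
      ennreal (unit_ball_vol n * R powr (n / 2))"
    by (subst nn_integral_eq_integral)
      (auto simp: has_bochner_integral_iff radial_weight_nonneg indicator_def)
  moreover have "ennreal (radial_weight n \<rho>) * indicator {..R} \<rho> =
      ennreal (indicator {0..R} \<rho> * radial_weight n \<rho>)" for \<rho>
    by (auto simp: radial_weight_def indicator_def)
  ultimately show ?thesis by simp
qed

text \<open>Both measures give {..R} the volume of the ball of radius sqrt R, and these rays form an
  intersection-stable generator of the Borel sets. For R \<le> 0 the preimage contains at most the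
  origin.\<close>

lemma distr_inner_self_lborel:
  "distr lborel borel (\<lambda>x::'a::euclidean_space. x \<bullet> x) =
    density lborel (\<lambda>\<rho>. ennreal (radial_weight DIM('a) \<rho>))"
proof (rule measure_eqI_generator_eq[where E = "range atMost" and \<Omega> = UNIV and A = "\<lambda>k. {..real k}"])
  let ?D = "distr lborel borel (\<lambda>x::'a. x \<bullet> x)"
  have em: "emeasure ?D {..R} = emeasure (density lborel (\<lambda>\<rho>. ennreal (radial_weight DIM('a) \<rho>))) {..R}" for R
  proof (cases "R > 0")
    case True
    have "(\<lambda>x::'a. x \<bullet> x) -` {..R} \<inter> space lborel = cball 0 (sqrt R)"
      using True by (auto simp: norm_eq_sqrt_inner)
    then show ?thesis
      using True by (simp add: emeasure_distr emeasure_density nn_integral_radial_weight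
          emeasure_cball powr_half_sqrt[symmetric] powr_powr flip: powr_realpow)
  next
    case False
    have "(\<lambda>x::'a. x \<bullet> x) -` {..R} \<inter> space lborel \<subseteq> {0}"
      using False by auto (metis inner_eq_zero_iff inner_ge_zero order_trans not_less order_antisym)
    then have "emeasure lborel ((\<lambda>x::'a. x \<bullet> x) -` {..R} \<inter> space lborel) \<le> emeasure lborel {0::'a}"
      by (intro emeasure_mono) auto
    moreover have "(\<integral>\<^sup>+\<rho>. ennreal (radial_weight DIM('a) \<rho>) * indicator {..R} \<rho> \<partial>lborel) =
        (\<integral>\<^sup>+\<rho>. 0 \<partial>(lborel :: real measure))"
      using False by (intro nn_integral_cong) (auto simp: radial_weight_def split: split_indicator)
    ultimately show ?thesis
      by (simp add: emeasure_distr emeasure_density)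
  qed
  show "emeasure ?D X = emeasure (density lborel (\<lambda>\<rho>. ennreal (radial_weight DIM('a) \<rho>))) X"
    if "X \<in> range atMost" for X
    using that em by auto
  show "emeasure ?D {..real k} \<noteq> \<infinity>" for k
  proof (cases "k > 0")
    case True
    then show ?thesis unfolding em
      by (simp add: emeasure_density nn_integral_radial_weight)
  next
    case False
    have "(\<integral>\<^sup>+\<rho>. ennreal (radial_weight DIM('a) \<rho>) * indicator {..real k} \<rho> \<partial>lborel) =
        (\<integral>\<^sup>+\<rho>. 0 \<partial>(lborel :: real measure))"
      using False by (intro nn_integral_cong) (auto simp: radial_weight_def split: split_indicator)
    then show ?thesis unfolding em
      by (simp add: emeasure_density)
  qed
  show "(\<Union>k. {..real k}) = UNIV"
    by (auto intro: real_arch_simple)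
  show "Int_stable (range (atMost :: real \<Rightarrow> real set))"
    by (auto simp: Int_stable_def)
  show "sets ?D = sigma_sets UNIV (range atMost)"
    by (simp add: borel_eq_atMost)
  show "sets (density lborel (\<lambda>\<rho>. ennreal (radial_weight DIM('a) \<rho>))) = sigma_sets UNIV (range atMost)"
    by (simp add: borel_eq_atMost)
qed auto

lemma integrable_radial_iff:
  fixes F :: "real \<Rightarrow> real"
  assumes [measurable]: "F \<in> borel_measurable borel"
  shows "integrable (lborel :: 'a::euclidean_space measure) (\<lambda>x. F (x \<bullet> x)) \<longleftrightarrow>
    integrable lborel (\<lambda>\<rho>. radial_weight DIM('a) \<rho> * F \<rho>)"
proof -
  have "integrable (lborel :: 'a measure) (\<lambda>x. F (x \<bullet> x)) \<longleftrightarrow>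
      integrable (distr lborel borel (\<lambda>x::'a. x \<bullet> x)) F"
    by (subst integrable_distr_eq) auto
  also have "\<dots> \<longleftrightarrow> integrable lborel (\<lambda>\<rho>. radial_weight DIM('a) \<rho> * F \<rho>)"
    unfolding distr_inner_self_lborel
    by (subst integrable_density) (auto simp: radial_weight_nonneg)
  finally show ?thesis .
qed

lemma integral_radial:
  fixes F :: "real \<Rightarrow> real"
  assumes [measurable]: "F \<in> borel_measurable borel"
  shows "(LINT x|(lborel :: 'a::euclidean_space measure). F (x \<bullet> x)) =
    (LINT \<rho>|lborel. radial_weight DIM('a) \<rho> * F \<rho>)"
proof -
  have "(LINT x|(lborel :: 'a measure). F (x \<bullet> x)) =
      (LINT \<rho>|distr lborel borel (\<lambda>x::'a. x \<bullet> x). F \<rho>)"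
    by (simp add: integral_distr)
  then show ?thesis
    unfolding distr_inner_self_lborel
    by (subst (asm) integral_density) (auto simp: radial_weight_nonneg)
qed

lemma AE_radial_iff:
  fixes P :: "real \<Rightarrow> bool"
  assumes [measurable]: "Measurable.pred borel P"
  shows "(AE x in (lborel :: 'a::euclidean_space measure). P (x \<bullet> x)) \<longleftrightarrow>
    (AE \<rho> in lborel. \<rho> > 0 \<longrightarrow> P \<rho>)"
proof -
  have "(AE x in (lborel :: 'a measure). P (x \<bullet> x)) \<longleftrightarrow>
      (AE \<rho> in distr lborel borel (\<lambda>x::'a. x \<bullet> x). P \<rho>)"
    by (subst AE_distr_iff) auto
  also have "\<dots> \<longleftrightarrow> (AE \<rho> in lborel. 0 < ennreal (radial_weight DIM('a) \<rho>) \<longrightarrow> P \<rho>)"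
    unfolding distr_inner_self_lborel by (subst AE_density) auto
  also have "\<dots> \<longleftrightarrow> (AE \<rho> in lborel. \<rho> > 0 \<longrightarrow> P \<rho>)"
    by (auto simp: radial_weight_def)
  finally show ?thesis .
qed

text \<open>The operator \<open>-\<Delta>\<close> on \<open>x \<mapsto> g (|x|\<^sup>2)\<close> in dimension \<open>n\<close>; with \<open>p = n / 2\<close> it is
  \<open>-4 \<rho>\<^sup>1\<^sup>-\<^sup>p (\<rho>\<^sup>p g')'\<close>.\<close>

definition radial_neg_laplacian :: "nat \<Rightarrow> (real \<Rightarrow> real) \<Rightarrow> real \<Rightarrow> real" where
  "radial_neg_laplacian n g \<rho> = - (4 * \<rho> * deriv (deriv g) \<rho> + 2 * real n * deriv g \<rho>)"

section \<open>Inverting the radial Laplacian\<close>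

lemma smooth_primitive:
  assumes "c < a" "smooth_real_on {c<..} E" "\<forall>x<a. E x = 0"
  shows "((\<lambda>x. integral {c..x} E) has_real_derivative E x) (at x)"
    and "x \<le> a \<Longrightarrow> integral {c..x} E = 0"
proof -
  have cont: "continuous_on {c..} E"
  proof -
    have "continuous_on ({c<..} \<union> {..<a}) E"
    proof (rule continuous_on_open_Un)
      show "continuous_on {..<a} E"
        using assms(3) by (subst continuous_on_cong[OF refl, of _ _ "\<lambda>_. 0"]) auto
    qed (use assms smooth_real_on_continuous_on in auto)
    then show ?thesis using assms(1) by (auto elim!: continuous_on_subset)
  qed
  \<comment> \<open>For x < c the interval is empty, so the value 0 is right there as well; this
    makes the primitive differentiable on the whole line and not only beyond c.\<close>
  have zero: "integral {c..x} E = 0" if "x \<le> a" for x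
  proof -
    have "integral {c..x} E = integral {c..x} (\<lambda>_. 0)"
      using that assms(3) by (intro integral_spike[of "{a}"]) auto
    then show ?thesis by simp
  qed
  then show "x \<le> a \<Longrightarrow> integral {c..x} E = 0" .
  show "((\<lambda>x. integral {c..x} E) has_real_derivative E x) (at x)"
  proof (cases "x < a")
    case True
    then have "\<forall>\<^sub>F y in nhds x. integral {c..y} E = 0"
      using eventually_nhds_in_open[of "{..<a}" x] zero by (auto elim!: eventually_mono)
    from iffD2[OF DERIV_cong_ev[OF refl this refl] DERIV_const] show ?thesis
      using True assms(3) by simp
  next
    case False
    have "((\<lambda>x. integral {c..x} E) has_real_derivative E x) (at x within {c..x + 1})"
      using False assms(1)
      by (intro integral_has_real_derivative continuous_on_subset[OF cont]) auto
    moreover have "at x within {c..x + 1} = at x"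
      using False assms(1) by (intro at_within_interior) auto
    ultimately show ?thesis by simp
  qed
qed

text \<open>Two integrations of -4 \<rho>^(1-p) (\<rho>^p \<Phi>')' = \<phi> with p = n / 2.
  Starting at c > 0, to the left of the support of \<phi>, avoids the singular powers at 0 and makes
  \<Phi> vanish up to a. The formulas for the derivatives are exported because the choice of
  constants in \<open>radial_test_functions\<close> depends on them.\<close>

lemma smooth_radial_inverse:
  assumes "0 < c" "c < a" "smooth_real_on UNIV \<phi>" "\<forall>x<a. \<phi> x = 0"
    and Phi_def: "\<Phi> = (\<lambda>x. integral {c..x} (\<lambda>\<rho>. - (\<rho> powr (- (n / 2)) / 4) *
        integral {c..\<rho>} (\<lambda>s. s powr (n / 2 - 1) * \<phi> s)))"
  shows "smooth_real_on UNIV \<Phi>"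
    and "\<And>x. x \<le> a \<Longrightarrow> \<Phi> x = 0"
    and "\<And>x. (\<Phi> has_real_derivative - (x powr (- (n / 2)) / 4) *
        integral {c..x} (\<lambda>s. s powr (n / 2 - 1) * \<phi> s)) (at x)"
    and "\<And>x. ((\<lambda>x. integral {c..x} (\<lambda>s. s powr (n / 2 - 1) * \<phi> s)) has_real_derivative
        x powr (n / 2 - 1) * \<phi> x) (at x)"
    and "radial_neg_laplacian n \<Phi> = \<phi>"
proof -
  define J where "J x = integral {c..x} (\<lambda>s. s powr (n / 2 - 1) * \<phi> s)" for x
  define E where "E x = - (x powr (- (n / 2)) / 4) * J x" for x
  have pos: "smooth_real_on {c<..} (\<lambda>x. x powr b)" for b
    using smooth_real_on_subset[OF smooth_real_on_powr] assms(1) by auto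
  have phi: "smooth_real_on {c<..} \<phi>"
    using assms(3) smooth_real_on_subset by blast
  note J = smooth_primitive[OF assms(2) smooth_real_on_mult[OF open_greaterThan pos phi, of "n / 2 - 1"],
      folded J_def]
  have J': "(J has_real_derivative x powr (n / 2 - 1) * \<phi> x) (at x)" for x
    using J(1)[of x] assms(4) by (simp add: J_def[abs_def])
  then show "\<And>x. ((\<lambda>x. integral {c..x} (\<lambda>s. s powr (n / 2 - 1) * \<phi> s)) has_real_derivative
        x powr (n / 2 - 1) * \<phi> x) (at x)"
    by (simp add: J_def[abs_def])
  have J0: "x \<le> a \<Longrightarrow> J x = 0" for x using J(2) assms(4) by simp
  have "smooth_real_on {c<..} J"
    by (rule smooth_real_on_primitive[OF _ J']) (auto intro!: smooth_real_on_mult pos phi)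
  then have "smooth_real_on {c<..} (\<lambda>x. (- (1 / 4) * x powr (- (n / 2))) * J x)"
    by (intro smooth_real_on_mult smooth_real_on_const pos) auto
  then have E: "smooth_real_on {c<..} E"
    by (simp add: E_def[abs_def])
  have E0: "\<forall>x<a. E x = 0" by (simp add: E_def J0)
  have PhiE: "\<Phi> = (\<lambda>x. integral {c..x} E)"
    by (simp add: Phi_def E_def[abs_def] J_def)
  have Phi': "(\<Phi> has_real_derivative E x) (at x)" for x
    using smooth_primitive(1)[OF assms(2) E E0] by (simp add: PhiE)
  then show "\<And>x. (\<Phi> has_real_derivative - (x powr (- (n / 2)) / 4) *
        integral {c..x} (\<lambda>s. s powr (n / 2 - 1) * \<phi> s)) (at x)"
    by (simp add: E_def J_def)
  show Phi0: "\<And>x. x \<le> a \<Longrightarrow> \<Phi> x = 0"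
    using smooth_primitive(2)[OF assms(2) E E0] by (simp add: PhiE)
  have "smooth_real_on {..<a} E"
    using smooth_real_on_cong[of "{..<a}" E "\<lambda>_. 0"] E0 by (simp add: smooth_real_on_const)
  then have "smooth_real_on UNIV E"
    using E smooth_real_on_Un[of "{c<..}" "{..<a}" E] assms(2)
    by (metis UNIV_eq_I Un_iff greaterThan_iff lessThan_iff linorder_not_le order_le_less_trans)
  then show "smooth_real_on UNIV \<Phi>"
    using Phi' smooth_real_on_primitive by blast
  show "radial_neg_laplacian n \<Phi> = \<phi>"
  proof
    fix x
    have d1: "deriv \<Phi> = E" using Phi' DERIV_imp_deriv by blast
    show "radial_neg_laplacian n \<Phi> x = \<phi> x"
    proof (cases "x < a")
      case True
      then have "\<forall>\<^sub>F y in nhds x. E y = 0"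
        using eventually_nhds_in_open[of "{..<a}" x] E0 by (auto elim!: eventually_mono)
      from iffD2[OF DERIV_cong_ev[OF refl this refl] DERIV_const]
      have "deriv E x = 0" by (rule DERIV_imp_deriv)
      then show ?thesis using True assms(4) E0 by (simp add: radial_neg_laplacian_def d1)
    next
      case False
      then have x: "x > 0" using assms by simp
      have "(E has_real_derivative (n / 2 * x powr (- (n / 2) - 1) / 4) * J x -
          x powr (- (n / 2)) / 4 * (x powr (n / 2 - 1) * \<phi> x)) (at x)"
        unfolding E_def using x by (auto intro!: derivative_eq_intros J' simp: field_simps)
      then have dE: "deriv E x = (n / 2 * x powr (- (n / 2) - 1) / 4) * J x -
          x powr (- (n / 2)) / 4 * (x powr (n / 2 - 1) * \<phi> x)"
        by (rule DERIV_imp_deriv)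
      have 1: "x * x powr (- (n / 2) - 1) = x powr (- (n / 2))"
        "x * (x powr (- (n / 2)) * x powr (n / 2 - 1)) = 1"
        using x by (simp_all add: powr_diff flip: powr_add)
      \<comment> \<open>A, B and C stand for the powers of x with exponents -p - 1, -p and p - 1,
        where p = n / 2. By the two facts 1 the coefficient of z becomes 1 and that of y becomes
        0.\<close>
      have 2: "- (4 * x * ((real n / 2 * A / 4) * y - B / 4 * (C * z)) + 2 * real n * (- (B / 4) * y)) =
          (x * (B * C)) * z + real n / 2 * (B - x * A) * y" for A B C y z :: real
        by (simp add: field_simps)
      have Ex: "E x = - (x powr (- (n / 2)) / 4) * J x" by (simp add: E_def)
      show ?thesis
        unfolding radial_neg_laplacian_def d1 dE Ex 2 using 1 by simp
    qed
  qed
qed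

text \<open>The two moment conditions are exactly what makes \<open>\<zeta>\<close> and \<open>\<eta>\<close> compactly supported.\<close>

lemma radial_test_functions:
  assumes "n > 0" "0 < a" "a < b" "smooth_real_on UNIV \<psi>" and psi0: "\<And>x. x \<notin> {a<..<b} \<Longrightarrow> \<psi> x = 0"
    and "((\<lambda>\<rho>. \<rho> powr (n / 2 - 1) * \<psi> \<rho>) has_integral 0) {a..b}"
    and "((\<lambda>\<rho>. \<rho> powr (n / 2) * \<psi> \<rho>) has_integral 0) {a..b}"
  obtains \<zeta> \<eta> where "smooth_real_on UNIV \<zeta>" "smooth_real_on UNIV \<eta>"
    "\<And>x. x \<ge> b \<Longrightarrow> \<zeta> x = 0" "\<And>x. x \<ge> b \<Longrightarrow> \<eta> x = 0" "\<And>x. x < a \<Longrightarrow> deriv \<zeta> x = 0"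
    "radial_neg_laplacian n \<zeta> = \<psi>" "radial_neg_laplacian n \<eta> = \<zeta>"
proof -
  define c where "c = a / 2"
  have c: "0 < c" "c < a" using assms by (auto simp: c_def)
  define P where "P x = integral {c..x} (\<lambda>s. s powr (n / 2 - 1) * \<psi> s)" for x
  define Z where "Z = (\<lambda>x. integral {c..x} (\<lambda>\<rho>. - (\<rho> powr (- (n / 2)) / 4) * P \<rho>))"
  have psi_a: "\<forall>x<a. \<psi> x = 0" using psi0 by auto
  note Zp = smooth_radial_inverse[OF c assms(4) psi_a Z_def[unfolded P_def], folded P_def]
  define M where "M x = integral {c..x} (\<lambda>s. s powr (n / 2 - 1) * Z s)" for x
  define W where "W = (\<lambda>x. integral {c..x} (\<lambda>\<rho>. - (\<rho> powr (- (n / 2)) / 4) * M \<rho>))"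
  have Z_a: "\<forall>x<a. Z x = 0" using Zp(2) by simp
  note Wp = smooth_radial_inverse[OF c Zp(1) Z_a W_def[unfolded M_def], folded M_def]
  \<comment> \<open>Beyond b the function Z is constant; adding z0 makes \<zeta> vanish there
    without changing the radial Laplacian.\<close>
  define z0 where "z0 = - Z b"
  define \<zeta> where "\<zeta> x = Z x + z0" for x
  define E where "E x = - z0 / (2 * n) - x powr (- (n / 2)) / 4 * M x" for x
  \<comment> \<open>The linear term solves the equation for the constant z0, because
    \<open>radial_neg_laplacian\<close> takes the identity to -2 n; the last bracket normalises the
    value at b to 0.\<close>
  define \<eta> where "\<eta> x = (W x - z0 / (2 * n) * x) - (W b - z0 / (2 * n) * b)" for x
  have moment: "((\<lambda>\<rho>. \<rho> powr q * \<psi> \<rho>) has_integral 0) {c..x}"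
    if "((\<lambda>\<rho>. \<rho> powr q * \<psi> \<rho>) has_integral 0) {a..b}" "x \<ge> b" for x q
  proof -
    have "((\<lambda>\<rho>. \<rho> powr q * \<psi> \<rho>) has_integral 0) {c..x}"
      using that assms(3) c psi0
      by (intro has_integral_on_superset[OF that(1)]) auto
    then show ?thesis .
  qed
  have P_b: "P x = 0" if "x \<ge> b" for x
    unfolding P_def using moment[OF assms(6) that] by (rule integral_unique)
  have const: "f y = f x" if "x \<le> y" "0 < x" and "\<And>z. z \<ge> x \<Longrightarrow> (f has_real_derivative 0) (at z)"
    for f and x y :: real
  proof (cases "x = y")
    case False
    have "continuous_on {x..y} f"
      using that(3) by (intro DERIV_atLeastAtMost_imp_continuous_on) blast
    then show ?thesis
      using False that by (intro DERIV_isconst_end) auto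
  qed simp
  have Z'0: "(Z has_real_derivative 0) (at x)" if "x \<ge> b" for x
    using Zp(3)[of x] P_b[OF that] by simp
  have Zb: "Z x = - z0" if "x \<ge> b" for x
    using const[of b x Z] that Z'0 assms(2,3) by (auto simp: z0_def)
  define N where "N x = integral {c..x} (\<lambda>s. s powr (n / 2) * \<psi> s)" for x
  have sm: "smooth_real_on {c<..} (\<lambda>x. x powr b)" for b
    using smooth_real_on_subset[OF smooth_real_on_powr] c(1) by auto
  have N': "(N has_real_derivative x powr (n / 2) * \<psi> x) (at x)" for x
    unfolding N_def
    by (rule smooth_primitive(1)[OF c(2)])
      (use sm assms(4) psi_a in \<open>auto intro!: smooth_real_on_mult intro: smooth_real_on_subset\<close>)
  \<comment> \<open>S is the integral of s^(p-1) \<zeta> (s) from 0 to x, with p = n / 2; up to a,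
    where Z vanishes, it reduces to the first summand. The derivative E of \<eta> is -x^(-p) S / 4,
    so \<eta> becomes constant beyond b once S vanishes there.\<close>
  define S where "S x = z0 / (n / 2) * x powr (n / 2) + M x" for x
  \<comment> \<open>Integration by parts expresses S through \<zeta>, P and the second moment N, so
    T is constant, with value 0 at c. At b the functions \<zeta>, P and N all vanish, and therefore
    so does S.\<close>
  define T where "T x = S x - x powr (n / 2) * \<zeta> x / (n / 2) - (x * P x - N x) / (2 * n)" for x
  have S': "(S has_real_derivative x powr (n / 2 - 1) * \<zeta> x) (at x)" if "x > 0" for x
    unfolding S_def \<zeta>_def using that assms(1)
    by (auto intro!: derivative_eq_intros Wp(4) simp: field_simps)
  have T': "(T has_real_derivative 0) (at x)" if "x > 0" for x
  proof -
    have 1: "x powr (n / 2) * x powr (- (n / 2)) = 1" "x * x powr (n / 2 - 1) = x powr (n / 2)"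
      using that by (simp_all add: powr_diff flip: powr_add)
    have "(T has_real_derivative x powr (n / 2 - 1) * \<zeta> x -
        ((n / 2 * x powr (n / 2 - 1)) * \<zeta> x + x powr (n / 2) * (- (x powr (- (n / 2)) / 4) * P x)) / (n / 2) -
        (P x + x * (x powr (n / 2 - 1) * \<psi> x) - x powr (n / 2) * \<psi> x) / (2 * n)) (at x)"
      unfolding T_def \<zeta>_def
      using that assms(1)
      by (auto intro!: derivative_eq_intros S'[unfolded \<zeta>_def] Zp(3) Zp(4) N' simp: P_def[symmetric] field_simps)
    moreover have "x powr (n / 2 - 1) * \<zeta> x -
        ((n / 2 * x powr (n / 2 - 1)) * \<zeta> x + x powr (n / 2) * (- (x powr (- (n / 2)) / 4) * P x)) / (n / 2) -
        (P x + x * (x powr (n / 2 - 1) * \<psi> x) - x powr (n / 2) * \<psi> x) / (2 * n) = 0"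
    proof -
      have "C * z - ((n / 2 * C) * z + A * (- (B / 4) * P x)) / (n / 2) - (P x + x * (C * w) - A * w) / (2 * n) =
          (A * B - 1) * P x / (2 * n) - (x * C - A) * w / (2 * n)" for A B C z w :: real
        using assms(1) by (simp add: field_simps)
      then show ?thesis by (simp only: 1) simp
    qed
    ultimately show ?thesis by simp
  qed
  have "T b = T c"
    by (rule const) (use c assms T' in auto)
  moreover have "T c = 0"
    using assms(1) c Zp(2)[of c]
    by (simp add: T_def S_def M_def \<zeta>_def P_def N_def)
  moreover have "\<zeta> b = 0" by (simp add: \<zeta>_def z0_def)
  moreover have "N b = 0"
    unfolding N_def using moment[OF assms(7) order_refl] by (rule integral_unique)
  ultimately have "S b = 0" by (simp add: T_def P_b)
  have zeta_b: "\<zeta> x = 0" if "x \<ge> b" for x using Zb[OF that] by (simp add: \<zeta>_def)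
  have S_b: "S x = 0" if "x \<ge> b" for x
  proof -
    have "(S has_real_derivative 0) (at z)" if "z \<ge> b" for z
      using S'[of z] zeta_b[OF that] that assms(2,3) by simp
    then show ?thesis using const[of b x S] that assms(2,3) \<open>S b = 0\<close> by simp
  qed
  have E0: "E x = 0" if "x \<ge> b" for x
  proof -
    have "x > 0" using that assms by simp
    then have "x powr (- (n / 2)) * S x = z0 / (n / 2) + x powr (- (n / 2)) * M x"
      unfolding S_def by (simp add: distrib_left powr_minus)
    then show ?thesis using assms(1) S_b[OF that] by (simp add: E_def field_simps)
  qed
  have eta': "(\<eta> has_real_derivative E x) (at x)" for x
    unfolding \<eta>_def E_def using Wp(3)[of x] assms(1)
    by (auto intro!: derivative_eq_intros)
  have eta_b: "\<eta> x = 0" if "x \<ge> b" for x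
  proof -
    have "(\<eta> has_real_derivative 0) (at z)" if "z \<ge> b" for z
      using eta'[of z] E0[OF that] by simp
    then have "\<eta> x = \<eta> b" using const[of b x \<eta>] that assms(2,3) by simp
    then show ?thesis by (simp add: \<eta>_def)
  qed
  show ?thesis
  proof (rule that[of \<zeta> \<eta>])
    show "smooth_real_on UNIV \<zeta>"
      unfolding \<zeta>_def by (intro smooth_real_on_add Zp(1) smooth_real_on_const) auto
    have lin: "smooth_real_on UNIV (\<lambda>x::real. c1 * x + c0)" for c1 c0
      by (rule smooth_real_on_primitive[where g' = "\<lambda>_. c1"])
        (auto intro!: derivative_eq_intros smooth_real_on_const)
    have "smooth_real_on UNIV (\<lambda>x. W x + (- (z0 / (2 * n)) * x + - (W b - z0 / (2 * n) * b)))"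
      by (intro smooth_real_on_add Wp(1) lin) auto
    then show "smooth_real_on UNIV \<eta>"
      by (simp add: \<eta>_def[abs_def] algebra_simps)
    show "\<And>x. x \<ge> b \<Longrightarrow> \<zeta> x = 0" "\<And>x. x \<ge> b \<Longrightarrow> \<eta> x = 0"
      using zeta_b eta_b by blast+
    have zeta': "deriv \<zeta> = deriv Z"
      unfolding \<zeta>_def using Zp(3) by (auto intro!: DERIV_imp_deriv derivative_eq_intros ext simp: DERIV_imp_deriv[OF Zp(3)])
    show "deriv \<zeta> x = 0" if "x < a" for x
      unfolding zeta' DERIV_imp_deriv[OF Zp(3)]
      using smooth_primitive(2)[OF c(2) smooth_real_on_mult[OF open_greaterThan sm
            smooth_real_on_subset[OF assms(4) subset_UNIV]] _ less_imp_le[OF that]] psi_a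
      by (simp add: P_def)
    show "radial_neg_laplacian n \<zeta> = \<psi>"
      using Zp(5) by (simp add: radial_neg_laplacian_def[abs_def] zeta')
    have eta1: "deriv \<eta> = (\<lambda>x. deriv W x + - z0 / (2 * n))"
      by (rule ext) (simp add: DERIV_imp_deriv[OF eta'] DERIV_imp_deriv[OF Wp(3)] E_def)
    have "deriv (deriv \<eta>) x = deriv (deriv W) x" for x
    proof -
      have "(deriv W has_real_derivative deriv (deriv W) x) (at x)"
        using smooth_real_on_field_differentiable[OF smooth_real_on_deriv[OF Wp(1)]]
        by (auto intro: field_differentiable_derivI)
      then show ?thesis
        unfolding eta1 by (auto intro!: DERIV_imp_deriv derivative_eq_intros)
    qed
    moreover have "2 * real n * (y + - z0 / (2 * real n)) = 2 * real n * y - z0" for y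
      using assms(1) by (simp add: field_simps)
    ultimately show "radial_neg_laplacian n \<eta> = \<zeta>"
      using Wp(5) by (simp add: radial_neg_laplacian_def[abs_def] eta1 \<zeta>_def fun_eq_iff)
  qed
qed

subsection \<open>A radial du Bois-Reymond lemma\<close>

text \<open>The positive and negative parts are densities of finite measures that agree on all rays,
  so they coincide almost everywhere; at each point one of the two is 0.\<close>

lemma AE_zero_if_integral_greaterThan_zero:
  fixes g :: "real \<Rightarrow> real"
  assumes g: "integrable lborel g"
    and zero: "\<And>x. (LINT y|lborel. indicator {x<..} y * g y) = 0"
  shows "AE x in lborel. g x = 0"
proof -
  have [measurable]: "g \<in> borel_measurable borel" using borel_measurable_integrable[OF g] by simp
  let ?p = "\<lambda>x. max 0 (g x)" and ?n = "\<lambda>x. max 0 (- g x)"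
  have int: "integrable lborel ?p" "integrable lborel ?n"
    using g by (auto intro!: integrable_max)
  have em: "emeasure (density lborel (\<lambda>x. ennreal (h x))) {x<..} = ennreal (LINT y|lborel. indicator {x<..} y * h y)"
    if "integrable lborel h" "\<And>x. h x \<ge> 0" for h :: "real \<Rightarrow> real" and x
  proof -
    have [measurable]: "h \<in> borel_measurable borel" using borel_measurable_integrable[OF that(1)] by simp
    have "integrable lborel (\<lambda>y. indicator {x<..} y * h y)"
      using integrable_mult_indicator[OF _ that(1), of "{x<..}"] by simp
    then have "ennreal (LINT y|lborel. indicator {x<..} y * h y) = (\<integral>\<^sup>+y. ennreal (indicator {x<..} y * h y) \<partial>lborel)"
      using that(2) by (intro nn_integral_eq_integral[symmetric]) (auto simp: indicator_def)
    also have "\<dots> = (\<integral>\<^sup>+y. ennreal (h y) * indicator {x<..} y \<partial>lborel)"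
      by (intro nn_integral_cong) (auto simp: indicator_def)
    finally show ?thesis by (simp add: emeasure_density)
  qed
  have "density lborel (\<lambda>x. ennreal (?p x)) = density lborel (\<lambda>x. ennreal (?n x))"
  proof (rule measure_eqI_lessThan)
    fix x
    show "emeasure (density lborel (\<lambda>x. ennreal (?p x))) {x<..} < \<infinity>"
      by (subst em) (use int in auto)
    have "(LINT y|lborel. indicator {x<..} y * ?p y) - (LINT y|lborel. indicator {x<..} y * ?n y) =
        (LINT y|lborel. indicator {x<..} y * ?p y - indicator {x<..} y * ?n y)"
      using integrable_mult_indicator[OF _ int(1), of "{x<..}"]
        integrable_mult_indicator[OF _ int(2), of "{x<..}"]
      by (intro Bochner_Integration.integral_diff[symmetric]) auto
    also have "\<dots> = (LINT y|lborel. indicator {x<..} y * g y)"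
      by (intro Bochner_Integration.integral_cong) (auto simp: indicator_def)
    finally show "emeasure (density lborel (\<lambda>x. ennreal (?p x))) {x<..} =
        emeasure (density lborel (\<lambda>x. ennreal (?n x))) {x<..}"
      using em[OF int(1), of x] em[OF int(2), of x] zero by simp
  qed auto
  then have "AE x in lborel. ennreal (?p x) = ennreal (?n x)"
    by (subst (asm) finite_density_unique)
      (use int(1) in \<open>auto simp: integrable_iff_bounded less_top[symmetric]\<close>)
  then show ?thesis
    by eventually_elim (auto simp: max_def split: if_splits)
qed

lemma integrable_mult_compactly_supported:
  fixes F \<psi> :: "real \<Rightarrow> real"
  assumes F: "integrable lborel (\<lambda>x. indicator {a..b} x * F x)"
    and "continuous_on UNIV \<psi>" "\<And>x. x \<notin> {a..b} \<Longrightarrow> \<psi> x = 0"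
  shows "integrable lborel (\<lambda>x. F x * \<psi> x)"
proof -
  have "bounded (\<psi> ` {a..b})"
    by (intro compact_imp_bounded compact_continuous_image continuous_on_subset[OF assms(2)]) auto
  then obtain C where C: "\<And>x. x \<in> {a..b} \<Longrightarrow> \<bar>\<psi> x\<bar> \<le> C"
    by (auto simp: bounded_iff simp del: atLeastAtMost_iff)
  have [measurable]: "\<psi> \<in> borel_measurable borel" using assms(2) by (rule borel_measurable_continuous_onI)
  have "integrable lborel (\<lambda>x. (indicator {a..b} x * F x) * \<psi> x)"
  proof (rule Bochner_Integration.integrable_bound)
    show "integrable lborel (\<lambda>x. C * (indicator {a..b} x * F x))" using F by auto
    show "(\<lambda>x. (indicator {a..b} x * F x) * \<psi> x) \<in> borel_measurable lborel"
      using borel_measurable_integrable[OF F] by auto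
    show "AE x in lborel. norm ((indicator {a..b} x * F x) * \<psi> x) \<le> norm (C * (indicator {a..b} x * F x))"
    proof (intro AE_I2)
      fix x
      show "norm ((indicator {a..b} x * F x) * \<psi> x) \<le> norm (C * (indicator {a..b} x * F x))"
        using C[of x] mult_right_mono[of "\<bar>\<psi> x\<bar>" "\<bar>C\<bar>" "\<bar>F x\<bar>"]
        by (cases "x \<in> {a..b}") (auto simp: abs_mult mult.commute)
    qed
  qed
  moreover have "(indicator {a..b} x * F x) * \<psi> x = F x * \<psi> x" for x
    using assms(3)[of x] by (auto simp: indicator_def)
  ultimately show ?thesis by simp
qed

lemma integrable_indicator_continuous:
  fixes F :: "real \<Rightarrow> real"
  assumes "continuous_on {a..b} F"
  shows "integrable lborel (\<lambda>x. indicator {a..b} x * F x)"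
  using borel_integrable_compact[OF compact_Icc assms] by simp

text \<open>Two fixed bumps serve as multipliers: any test function becomes orthogonal to 1 and
  \<rho> after a combination of them is subtracted. With A and B chosen so that H - A - B \<rho>
  annihilates both bumps, it annihilates every test function.\<close>

lemma radial_du_bois_reymond:
  fixes H :: "real \<Rightarrow> real"
  assumes n: "n > 0"
    and loc: "\<And>a b. 0 < a \<Longrightarrow> a < b \<Longrightarrow> integrable lborel (\<lambda>\<rho>. indicator {a..b} \<rho> * (radial_weight n \<rho> * H \<rho>))"
    and orth: "\<And>\<psi> a b. 0 < a \<Longrightarrow> a < b \<Longrightarrow> smooth_real_on UNIV \<psi> \<Longrightarrow> (\<And>x. x \<notin> {a<..<b} \<Longrightarrow> \<psi> x = 0) \<Longrightarrow>
      (LINT \<rho>|lborel. radial_weight n \<rho> * \<psi> \<rho>) = 0 \<Longrightarrow>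
      (LINT \<rho>|lborel. radial_weight n \<rho> * \<rho> * \<psi> \<rho>) = 0 \<Longrightarrow>
      (LINT \<rho>|lborel. radial_weight n \<rho> * H \<rho> * \<psi> \<rho>) = 0"
  shows "\<exists>A B. AE \<rho> in lborel. \<rho> > 0 \<longrightarrow> H \<rho> = A + B * \<rho>"
proof -
  define w where "w = radial_weight n"
  define T where "T \<psi> \<longleftrightarrow> smooth_real_on UNIV \<psi> \<and> (\<exists>a b. 0 < a \<and> a < b \<and> (\<forall>x. x \<notin> {a<..<b} \<longrightarrow> \<psi> x = 0))"
    for \<psi> :: "real \<Rightarrow> real"
  define I where "I F \<psi> = (LINT \<rho>|lborel. w \<rho> * F \<rho> * \<psi> \<rho>)" for F \<psi> :: "real \<Rightarrow> real"
  define L where "L F \<longleftrightarrow> (\<forall>a b. 0 < a \<longrightarrow> a < b \<longrightarrow> integrable lborel (\<lambda>\<rho>. indicator {a..b} \<rho> * (w \<rho> * F \<rho>)))"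
    for F :: "real \<Rightarrow> real"
  have int: "integrable lborel (\<lambda>\<rho>. w \<rho> * F \<rho> * \<psi> \<rho>)" if "T \<psi>" "L F" for F \<psi>
  proof -
    obtain a b where *: "0 < a" "a < b" "\<And>x. x \<notin> {a<..<b} \<Longrightarrow> \<psi> x = 0"
      using \<open>T \<psi>\<close> unfolding T_def by blast
    have "continuous_on UNIV \<psi>"
      using \<open>T \<psi>\<close> smooth_real_on_continuous_on unfolding T_def by blast
    moreover have "integrable lborel (\<lambda>\<rho>. indicator {a..b} \<rho> * (w \<rho> * F \<rho>))"
      using \<open>L F\<close> *(1,2) unfolding L_def by blast
    moreover have "\<psi> x = 0" if "x \<notin> {a..b}" for x
      using that by (intro *(3)) auto
    ultimately show ?thesis
      by - (rule integrable_mult_compactly_supported[where a = a and b = b])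
  qed
  have L1: "L F" if "continuous_on UNIV F" for F
    unfolding L_def
  proof (intro allI impI)
    fix a b :: real assume ab: "0 < a" "a < b"
    have "continuous_on {a..b} (\<lambda>\<rho>. (real n * unit_ball_vol n / 2 * \<rho> powr (real n / 2 - 1)) * F \<rho>)"
      using ab by (intro continuous_intros continuous_on_subset[OF that]) auto
    from integrable_indicator_continuous[OF this]
    show "integrable lborel (\<lambda>\<rho>. indicator {a..b} \<rho> * (w \<rho> * F \<rho>))"
      by (rule Bochner_Integration.integrable_cong[THEN iffD1, rotated 2])
        (use ab in \<open>auto simp: w_def radial_weight_def indicator_def\<close>)
  qed
  have LH: "L H" using loc by (simp add: L_def w_def)
  have Ladd: "L (\<lambda>x. F x + c * G x)" if "L F" "L G" for F G c
    unfolding L_def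
  proof (intro allI impI)
    fix a b :: real assume ab: "0 < a" "a < b"
    have "integrable lborel (\<lambda>\<rho>. indicator {a..b} \<rho> * (w \<rho> * F \<rho>) + c * (indicator {a..b} \<rho> * (w \<rho> * G \<rho>)))"
      using that ab by (auto simp: L_def)
    then show "integrable lborel (\<lambda>\<rho>. indicator {a..b} \<rho> * (w \<rho> * (F \<rho> + c * G \<rho>)))"
      by (simp add: algebra_simps)
  qed
  have Iadd1: "I (\<lambda>x. F x + c * G x) \<psi> = I F \<psi> + c * I G \<psi>" if "L F" "L G" "T \<psi>" for F G \<psi> c
  proof -
    have "I F \<psi> + c * I G \<psi> = (LINT \<rho>|lborel. w \<rho> * F \<rho> * \<psi> \<rho> + c * (w \<rho> * G \<rho> * \<psi> \<rho>))"
      unfolding I_def using int that by (subst Bochner_Integration.integral_add) auto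
    then show ?thesis by (simp add: I_def algebra_simps)
  qed
  have Iadd2: "I F (\<lambda>x. \<psi> x + c * \<phi> x) = I F \<psi> + c * I F \<phi>" if "L F" "T \<psi>" "T \<phi>" for F \<phi> \<psi> c
  proof -
    have "I F \<psi> + c * I F \<phi> = (LINT \<rho>|lborel. w \<rho> * F \<rho> * \<psi> \<rho> + c * (w \<rho> * F \<rho> * \<phi> \<rho>))"
      unfolding I_def using int that by (subst Bochner_Integration.integral_add) auto
    then show ?thesis by (simp add: I_def algebra_simps)
  qed
  have Tadd: "T (\<lambda>x. \<psi> x + c * \<phi> x)" if "T \<psi>" "T \<phi>" for \<phi> \<psi> c
  proof -
    obtain a b where *: "0 < a" "a < b" "\<forall>x. x \<notin> {a<..<b} \<longrightarrow> \<psi> x = 0"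
      using \<open>T \<psi>\<close> unfolding T_def by blast
    obtain a' b' where **: "0 < a'" "a' < b'" "\<forall>x. x \<notin> {a'<..<b'} \<longrightarrow> \<phi> x = 0"
      using \<open>T \<phi>\<close> unfolding T_def by blast
    have "smooth_real_on UNIV (\<lambda>x. \<psi> x + c * \<phi> x)"
      using that by (intro smooth_real_on_add smooth_real_on_mult smooth_real_on_const) (auto simp: T_def)
    moreover have "0 < min a a'" "min a a' < max b b'" using * ** by auto
    moreover have "\<psi> x + c * \<phi> x = 0" if "x \<notin> {min a a'<..<max b b'}" for x
    proof -
      have "x \<notin> {a<..<b}" "x \<notin> {a'<..<b'}" using that by auto
      then show ?thesis using *(3) **(3) by simp
    qed
    ultimately show ?thesis unfolding T_def by blast
  qed
  have Tb: "T (bump m a b)" if "m > 0" "0 < a" "a < b" for m a b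
    unfolding T_def
    by (intro conjI exI[of _ a] exI[of _ b] smooth_bump) (use that in \<open>auto intro!: bump_eq_0\<close>)
  \<comment> \<open>The supports [1, 2] and [3, 4] keep the weighted means of \<rho> apart, at most
    2 and at least 3, which makes the determinant D below positive.\<close>
  define p1 where "p1 = bump 1 1 2"
  define p2 where "p2 = bump 1 3 4"
  have Tp: "T p1" "T p2" unfolding p1_def p2_def by (auto intro!: Tb)
  have Lc: "L (\<lambda>_. 1)" "L (\<lambda>x. x)" by (auto intro!: L1 continuous_intros)
  define one where "one = (\<lambda>_::real. 1::real)"
  define ident where "ident = (\<lambda>x::real. x)"
  have L': "L one" "L ident" unfolding one_def ident_def by (fact Lc)+
  have pos: "I one p > 0" if "T p" "\<And>x. p x \<ge> 0" "\<And>x. x \<in> {a<..<b} \<Longrightarrow> p x > 0" "0 < a" "a < b" for p a b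
  proof -
    have "I one p \<ge> 0" unfolding I_def one_def
      using that by (intro integral_nonneg_AE) (auto simp: w_def radial_weight_nonneg)
    moreover have "I one p \<noteq> 0"
    proof
      assume "I one p = 0"
      then have "AE x in lborel. w x * one x * p x = 0"
        unfolding I_def using int[OF that(1) L'(1)] that(2)
        by (subst (asm) integral_nonneg_eq_0_iff_AE) (auto simp: w_def radial_weight_nonneg one_def)
      then have "AE x in lborel. x \<notin> {a<..<b}"
      proof eventually_elim
        case (elim x)
        have "w x * one x * p x > 0" if "x \<in> {a<..<b}"
          using that \<open>0 < a\<close> \<open>\<And>x. x \<in> {a<..<b} \<Longrightarrow> p x > 0\<close>[OF that] n
          by (auto simp: w_def one_def radial_weight_def intro!: mult_pos_pos)
        then show ?case using elim by fastforce
      qed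
      then have "emeasure lborel {a<..<b} = 0"
        by (subst (asm) AE_iff_measurable[of "{a<..<b}"]) auto
      then show False using \<open>a < b\<close> by simp
    qed
    ultimately show ?thesis by simp
  qed
  have a1: "I one p1 > 0"
    by (rule pos[of p1 1 2]) (use Tp in \<open>auto simp: p1_def intro!: bump_nonneg bump_pos\<close>)
  have a2: "I one p2 > 0"
    by (rule pos[of p2 3 4]) (use Tp in \<open>auto simp: p2_def intro!: bump_nonneg bump_pos\<close>)
  have b1: "I ident p1 \<le> 2 * I one p1"
  proof -
    have "I ident p1 \<le> (LINT \<rho>|lborel. 2 * (w \<rho> * one \<rho> * p1 \<rho>))"
      unfolding I_def using int[OF Tp(1) L'(1)] int[OF Tp(1) L'(2)]
    proof (intro integral_mono)
      fix x :: real
      have "p1 x * x \<le> p1 x * 2"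
        using bump_nonneg[of 1 1 2 x] bump_eq_0[of 1 x 1 2]
        by (cases "x < 2") (auto simp: p1_def intro!: mult_left_mono)
      then show "w x * ident x * p1 x \<le> 2 * (w x * one x * p1 x)"
        using mult_left_mono[of "p1 x * x" "p1 x * 2" "w x"]
        by (simp add: w_def radial_weight_nonneg ident_def one_def mult_ac)
    qed auto
    then show ?thesis by (simp add: I_def)
  qed
  have b2: "I ident p2 \<ge> 3 * I one p2"
  proof -
    have "(LINT \<rho>|lborel. 3 * (w \<rho> * one \<rho> * p2 \<rho>)) \<le> I ident p2"
      unfolding I_def using int[OF Tp(2) L'(1)] int[OF Tp(2) L'(2)]
    proof (intro integral_mono)
      fix x :: real
      have "p2 x * 3 \<le> p2 x * x"
        using bump_nonneg[of 1 3 4 x] bump_eq_0[of 1 x 3 4]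
        by (cases "x > 3") (auto simp: p2_def intro!: mult_left_mono)
      then show "3 * (w x * one x * p2 x) \<le> w x * ident x * p2 x"
        using mult_left_mono[of "p2 x * 3" "p2 x * x" "w x"]
        by (simp add: w_def radial_weight_nonneg ident_def one_def mult_ac)
    qed auto
    then show ?thesis by (simp add: I_def)
  qed
  define D where "D = I one p1 * I ident p2 - I one p2 * I ident p1"
  have "I one p1 * (3 * I one p2) \<le> I one p1 * I ident p2" "I one p2 * I ident p1 \<le> I one p2 * (2 * I one p1)"
    using a1 a2 b1 b2 by (auto intro!: mult_left_mono)
  then have "D \<ge> I one p1 * I one p2" by (simp add: D_def mult_ac)
  then have D: "D \<noteq> 0" using mult_pos_pos[OF a1 a2] by linarith
  \<comment> \<open>Cramer's rule for the two conditions that H - A - B \<rho> annihilates p1 and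
    p2.\<close>
  define B where "B = (I one p1 * I H p2 - I one p2 * I H p1) / D"
  define A where "A = (I H p1 * I ident p2 - I H p2 * I ident p1) / D"
  have AB: "A * I one p1 + B * I ident p1 = I H p1" "A * I one p2 + B * I ident p2 = I H p2"
  proof -
    have *: "A * D = I H p1 * I ident p2 - I H p2 * I ident p1" "B * D = I one p1 * I H p2 - I one p2 * I H p1"
      using D by (simp_all add: A_def B_def)
    have "(A * I one p1 + B * I ident p1) * D = (A * D) * I one p1 + (B * D) * I ident p1"
      by (simp add: algebra_simps)
    also have "\<dots> = I H p1 * D" by (simp only: *) (simp add: D_def algebra_simps)
    finally show "A * I one p1 + B * I ident p1 = I H p1" using D by simp
    have "(A * I one p2 + B * I ident p2) * D = (A * D) * I one p2 + (B * D) * I ident p2"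
      by (simp add: algebra_simps)
    also have "\<dots> = I H p2 * D" by (simp only: *) (simp add: D_def algebra_simps)
    finally show "A * I one p2 + B * I ident p2 = I H p2" using D by simp
  qed
  define G where "G x = H x + (- A) * one x + (- B) * ident x" for x
  have LG: "L G" unfolding G_def by (intro Ladd LH L')
  have IG: "I G \<psi> = I H \<psi> - A * I one \<psi> - B * I ident \<psi>" if "T \<psi>" for \<psi>
    using Iadd1[OF Ladd[OF LH L'(1)] L'(2) that, of "- A" "- B"] Iadd1[OF LH L'(1) that, of "- A"]
    by (simp add: G_def[abs_def])
  have G0: "I G \<psi> = 0" if "T \<psi>" for \<psi>
  proof -
    \<comment> \<open>Cramer's rule for the transposed system: the corrections that make the
      integrals of \<phi> against 1 and \<rho> vanish.\<close>
    define c1 where "c1 = (I one \<psi> * I ident p2 - I ident \<psi> * I one p2) / D"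
    define c2 where "c2 = (I ident \<psi> * I one p1 - I one \<psi> * I ident p1) / D"
    define \<phi> where "\<phi> x = \<psi> x + (- c1) * p1 x + (- c2) * p2 x" for x
    have *: "c1 * D = I one \<psi> * I ident p2 - I ident \<psi> * I one p2"
      "c2 * D = I ident \<psi> * I one p1 - I one \<psi> * I ident p1"
      using D by (simp_all add: c1_def c2_def)
    have T\<phi>: "T \<phi>" unfolding \<phi>_def by (intro Tadd Tp that)
    have I\<phi>: "I F \<phi> = I F \<psi> - c1 * I F p1 - c2 * I F p2" if "L F" for F
      using Iadd2[OF that Tadd[OF \<open>T \<psi>\<close> Tp(1)] Tp(2), of "- c1" "- c2"]
        Iadd2[OF that \<open>T \<psi>\<close> Tp(1), of "- c1"]
      by (simp add: \<phi>_def[abs_def])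
    have "I one \<phi> * D = I one \<psi> * D - (c1 * D) * I one p1 - (c2 * D) * I one p2"
      by (simp add: I\<phi> L' algebra_simps)
    also have "\<dots> = 0" by (simp only: *) (simp add: D_def algebra_simps)
    finally have m1: "I one \<phi> = 0" using D by simp
    have "I ident \<phi> * D = I ident \<psi> * D - (c1 * D) * I ident p1 - (c2 * D) * I ident p2"
      by (simp add: I\<phi> L' algebra_simps)
    also have "\<dots> = 0" by (simp only: *) (simp add: D_def algebra_simps)
    finally have m2: "I ident \<phi> = 0" using D by simp
    have "I H \<phi> = 0"
      using T\<phi> m1 m2 orth unfolding T_def I_def one_def ident_def w_def by auto
    then have "I G \<phi> = 0" using m1 m2 by (simp add: IG T\<phi>)
    moreover have "I G p1 = 0" "I G p2 = 0" using AB by (simp_all add: IG Tp)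
    ultimately show ?thesis using I\<phi>[OF LG] by simp
  qed
  \<comment> \<open>The integral over an interval is the limit of the pairings with steepening
    bumps, dominated by the absolute value of w G on [a, b].\<close>
  have ind0: "(LINT \<rho>|lborel. indicator {a<..<b} \<rho> * (w \<rho> * G \<rho>)) = 0" if "0 < a" for a b
  proof (cases "a < b")
    case True
    have L: "integrable lborel (\<lambda>\<rho>. indicator {a..b} \<rho> * (w \<rho> * G \<rho>))"
      using LG that True unfolding L_def by blast
    have meas: "(\<lambda>\<rho>. indicator {a..b} \<rho> * (w \<rho> * G \<rho>)) \<in> borel_measurable borel"
      using borel_measurable_integrable[OF L] by simp
    have eq1: "indicator {a<..<b} x * (w x * G x) = indicator {a<..<b} x * (indicator {a..b} x * (w x * G x))" for x
      by (auto simp: indicator_def)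
    have eq2: "w x * G x * bump (real (Suc k)) a b x = (indicator {a..b} x * (w x * G x)) * bump (real (Suc k)) a b x" for x k
      using bump_eq_0[of "real (Suc k)" x a b] by (cases "x \<in> {a..b}") (auto simp del: of_nat_Suc)
    have bm: "bump m a b \<in> borel_measurable borel" for m
      using smooth_real_on_continuous_on[OF smooth_bump] by (rule borel_measurable_continuous_onI)
    have "(\<lambda>k. I G (bump (real (Suc k)) a b)) \<longlonglongrightarrow> (LINT \<rho>|lborel. indicator {a<..<b} \<rho> * (w \<rho> * G \<rho>))"
      unfolding I_def
    proof (rule integral_dominated_convergence[where w = "\<lambda>x. \<bar>indicator {a..b} x * (w x * G x)\<bar>"])
      show "(\<lambda>\<rho>. indicator {a<..<b} \<rho> * (w \<rho> * G \<rho>)) \<in> borel_measurable lborel"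
        unfolding eq1 using meas by measurable
      show "(\<lambda>x. w x * G x * bump (real (Suc k)) a b x) \<in> borel_measurable lborel" for k
        unfolding eq2 using meas bm by measurable
      show "integrable lborel (\<lambda>x. \<bar>indicator {a..b} x * (w x * G x)\<bar>)" using L by (rule integrable_abs)
      show "AE x in lborel. (\<lambda>k. w x * G x * bump (real (Suc k)) a b x) \<longlonglongrightarrow> indicator {a<..<b} x * (w x * G x)"
        using tendsto_mult_left[OF bump_tendsto_indicator] by (simp add: mult.commute)
      show "AE x in lborel. norm (w x * G x * bump (real (Suc k)) a b x) \<le> \<bar>indicator {a..b} x * (w x * G x)\<bar>" for k
      proof (intro AE_I2)
        fix x
        show "norm (w x * G x * bump (real (Suc k)) a b x) \<le> \<bar>indicator {a..b} x * (w x * G x)\<bar>"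
          unfolding eq2 using bump_le_1[of "real (Suc k)" a b x] bump_nonneg[of "real (Suc k)" a b x]
          by (simp add: abs_mult mult_left_le del: of_nat_Suc)
      qed
    qed
    moreover have "I G (bump (real (Suc k)) a b) = 0" for k
      by (intro G0 Tb) (use that True in auto)
    ultimately show ?thesis by (simp add: LIMSEQ_const_iff)
  next
    case False
    then show ?thesis by simp
  qed
  \<comment> \<open>The intervals from 1 / (k + 1) to k + 1 exhaust the positive axis, and on each
    of them w G is integrable.\<close>
  have "AE \<rho> in lborel. indicator {1 / real (Suc k)<..<real (Suc k)} \<rho> * (w \<rho> * G \<rho>) = 0" for k
  proof (rule AE_zero_if_integral_greaterThan_zero)
    define a where "a = 1 / real (Suc k)"
    define b where "b = real (Suc k)"
    have a: "0 < a" by (simp add: a_def)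
    have "integrable lborel (\<lambda>\<rho>. indicator {a<..<b} \<rho> *\<^sub>R (indicator {a..b+a} \<rho> * (w \<rho> * G \<rho>)))"
      using LG a unfolding L_def b_def by (intro integrable_mult_indicator) auto
    moreover have "indicator {a<..<b} \<rho> *\<^sub>R (indicator {a..b+a} \<rho> * (w \<rho> * G \<rho>)) = indicator {a<..<b} \<rho> * (w \<rho> * G \<rho>)" for \<rho>
      using a by (auto simp: indicator_def)
    ultimately show "integrable lborel (\<lambda>\<rho>. indicator {1 / real (Suc k)<..<real (Suc k)} \<rho> * (w \<rho> * G \<rho>))"
      by (simp only: a_def b_def)
    fix x
    have "indicator {x<..} y * (indicator {a<..<b} y * (w y * G y)) = indicator {max a x<..<b} y * (w y * G y)" for y
      by (auto simp: indicator_def)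
    then have "(LINT y|lborel. indicator {x<..} y * (indicator {a<..<b} y * (w y * G y))) = 0"
      using ind0[of "max a x" b] a by (simp only:)
    then show "(LINT y|lborel. indicator {x<..} y * (indicator {1 / real (Suc k)<..<real (Suc k)} y * (w y * G y))) = 0"
      by (simp only: a_def b_def)
  qed
  then have "AE \<rho> in lborel. \<forall>k. indicator {1 / real (Suc k)<..<real (Suc k)} \<rho> * (w \<rho> * G \<rho>) = 0"
    unfolding AE_all_countable by blast
  then have "AE \<rho> in lborel. \<rho> > 0 \<longrightarrow> H \<rho> = A + B * \<rho>"
  proof eventually_elim
    case (elim \<rho>)
    show ?case
    proof
      assume \<rho>: "\<rho> > 0"
      obtain k where k: "real k > max \<rho> (1 / \<rho>)" using reals_Archimedean2 by blast
      then have "1 / real (Suc k) < \<rho>" "\<rho> < real (Suc k)"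
        using \<rho> by (auto simp: field_simps)
      then have "w \<rho> * G \<rho> = 0" using elim[rule_format, of k] by simp
      moreover have "w \<rho> \<noteq> 0"
        using \<rho> n unit_ball_vol_pos[of "real n"] by (simp add: w_def radial_weight_def less_imp_neq[symmetric])
      ultimately show "H \<rho> = A + B * \<rho>" by (simp add: G_def one_def ident_def)
    qed
  qed
  then show ?thesis by blast
qed

subsection \<open>Gaussians and the half Laplacian\<close>

lemma FTC_nonneg_greaterThan_0:
  fixes G g :: "real \<Rightarrow> real"
  assumes deriv: "\<And>x. x > 0 \<Longrightarrow> (G has_real_derivative g x) (at x)"
    and cont: "\<And>x. x > 0 \<Longrightarrow> isCont g x"
    and nonneg: "\<And>x. x > 0 \<Longrightarrow> 0 \<le> g x"
    and "(G \<longlongrightarrow> a) (at_right 0)" "(G \<longlongrightarrow> b) at_top"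
  shows "has_bochner_integral lborel (\<lambda>x. indicator {0<..} x * g x) (b - a)"
proof -
  have lim: "((G \<circ> real_of_ereal) \<longlongrightarrow> a) (at_right (ereal 0))"
    "((G \<circ> real_of_ereal) \<longlongrightarrow> b) (at_left \<infinity>)"
    using assms(4,5) by (simp_all add: ereal_tendsto_simps)
  have *: "set_integrable lborel (einterval (ereal 0) \<infinity>) g" "(LBINT x=ereal 0..\<infinity>. g x) = b - a"
    by (rule interval_integral_FTC_nonneg[of "ereal 0" \<infinity> G g a b, OF _ _ _ _ lim];
        use assms in \<open>auto simp: ereal_less_eq(3) intro!: AE_I2\<close>)+
  show ?thesis
    using * by (simp add: has_bochner_integral_iff set_integrable_def interval_integral_to_infinity_eq
        set_lebesgue_integral_def)
qed

text \<open>Takes the place of the error function in the explicit primitives below. Both limits are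
  wanted because in the subordination integrals the argument z sqrt t - y / (2 sqrt t) runs through
  the whole real line.\<close>

lemma gaussian_primitive:
  obtains \<Phi> :: "real \<Rightarrow> real" where "\<And>x. (\<Phi> has_real_derivative exp (- x\<^sup>2)) (at x)"
    "(\<Phi> \<longlongrightarrow> 0) at_bot" "(\<Phi> \<longlongrightarrow> sqrt pi) at_top" "\<Phi> 0 = sqrt pi / 2"
proof -
  define \<Phi> where "\<Phi> x = (LBINT u=ereal 0..ereal x. exp (- u\<^sup>2)) + sqrt pi / 2" for x :: real
  have zero: "\<Phi> 0 = sqrt pi / 2" by (simp add: \<Phi>_def)
  have d: "(\<Phi> has_real_derivative exp (- x\<^sup>2)) (at x)" for x
  proof -
    have "((\<lambda>u. LBINT y=ereal 0..ereal u. exp (- y\<^sup>2)) has_vector_derivative exp (- x\<^sup>2))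
        (at x within {min 0 x - 1..max 0 x + 1})"
      by (rule interval_integral_FTC2) (auto intro!: continuous_intros)
    moreover have "at x within {min 0 x - 1..max 0 x + 1} = at x"
      by (rule at_within_interior) auto
    ultimately have "((\<lambda>u. LBINT y=ereal 0..ereal u. exp (- y\<^sup>2)) has_real_derivative exp (- x\<^sup>2)) (at x)"
      by (simp add: has_real_derivative_iff_has_vector_derivative)
    then show ?thesis unfolding \<Phi>_def by (auto intro!: derivative_eq_intros)
  qed
  \<comment> \<open>The symmetry about 0 carries the limit at infinity over to minus
    infinity.\<close>
  have odd: "\<Phi> (- x) = sqrt pi - \<Phi> x" for x
  proof -
    have "((\<lambda>x. \<Phi> (- x) + \<Phi> x) has_real_derivative exp (- (- x)\<^sup>2) * (- 1) + exp (- x\<^sup>2)) (at x)" for x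
      by (intro DERIV_add d DERIV_chain2[OF d]) (auto intro!: derivative_eq_intros)
    then have "((\<lambda>x. \<Phi> (- x) + \<Phi> x) has_real_derivative 0) (at x)" for x by simp
    then have "\<Phi> (- x) + \<Phi> x = \<Phi> (- 0) + \<Phi> 0"
      using DERIV_isconst_all by blast
    then show ?thesis by (simp add: \<Phi>_def)
  qed
  have g: "has_bochner_integral lborel (\<lambda>x. indicator {0..} x *\<^sub>R exp (- x\<^sup>2)) (sqrt pi / 2)"
    by (rule gaussian_moment_0)
  have "((\<lambda>x::real. LBINT u:{0..x}. exp (- u\<^sup>2)) \<longlongrightarrow> (LBINT u:{0..}. exp (- u\<^sup>2))) at_top"
  proof (rule tendsto_set_lebesgue_integral_at_top)
    show "set_integrable lborel {0..} (\<lambda>u::real. exp (- u\<^sup>2))"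
      using g by (simp add: set_integrable_def has_bochner_integral_iff)
  qed auto
  then have "((\<lambda>x. (LBINT u:{0..x}. exp (- u\<^sup>2)) + sqrt pi / 2) \<longlongrightarrow> sqrt pi / 2 + sqrt pi / 2) at_top"
    using has_bochner_integral_integral_eq[OF g]
    by (intro tendsto_add tendsto_const) (simp only: set_lebesgue_integral_def)
  moreover have "\<forall>\<^sub>F x in at_top. (LBINT u:{0..x}. exp (- u\<^sup>2)) + sqrt pi / 2 = \<Phi> x"
    using eventually_ge_at_top[of 0]
  proof eventually_elim
    case (elim x)
    then show ?case
      using interval_integral_Icc[of 0 x "\<lambda>u. exp (- u\<^sup>2)"] by (simp add: \<Phi>_def)
  qed
  ultimately have top: "(\<Phi> \<longlongrightarrow> sqrt pi) at_top"
    by (auto dest: Lim_transform_eventually)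
  have "((\<lambda>x. sqrt pi - \<Phi> x) \<longlongrightarrow> sqrt pi - sqrt pi) at_top"
    by (intro tendsto_intros top)
  then have "((\<lambda>x. \<Phi> (- x)) \<longlongrightarrow> 0) at_top" by (simp add: odd)
  then have "(\<Phi> \<longlongrightarrow> 0) at_bot"
    by (simp add: filterlim_at_bot_mirror)
  then show ?thesis using that[OF d _ top zero] by blast
qed

lemma integral_one_minus_exp:
  assumes "z \<ge> 0"
  shows "has_bochner_integral lborel (\<lambda>s. indicator {0<..} s * (s powr (- (3 / 2)) * (1 - exp (- s * z\<^sup>2))))
    (2 * sqrt pi * z)"
proof -
  obtain \<Phi> :: "real \<Rightarrow> real" where \<Phi>: "\<And>x. (\<Phi> has_real_derivative exp (- x\<^sup>2)) (at x)"
    "(\<Phi> \<longlongrightarrow> 0) at_bot" "(\<Phi> \<longlongrightarrow> sqrt pi) at_top" "\<Phi> 0 = sqrt pi / 2"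
    using gaussian_primitive by blast
  show ?thesis
  proof (cases "z = 0")
    case True
    then show ?thesis by (simp add: has_bochner_integral_zero)
  next
    case False
    then have z: "z > 0" using assms by simp
    \<comment> \<open>Integration by parts, with -2 s^(-1/2) as primitive of s^(-3/2), leaves a
      Gaussian integral in the variable z sqrt s, which the second term evaluates.\<close>
    define G where "G s = - 2 * s powr (- (1 / 2)) * (1 - exp (- s * z\<^sup>2)) + 4 * z * \<Phi> (z * s powr (1 / 2))" for s
    have "has_bochner_integral lborel (\<lambda>s. indicator {0<..} s * (s powr (- (3 / 2)) * (1 - exp (- s * z\<^sup>2))))
      (4 * z * sqrt pi - 4 * z * (sqrt pi / 2))"
    proof (rule FTC_nonneg_greaterThan_0[where G = G])
      fix s :: real assume s: "s > 0"
      have p: "(z * s powr (1 / 2))\<^sup>2 = s * z\<^sup>2"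
        using s by (simp add: power_mult_distrib powr_half_sqrt)
      have "(G has_real_derivative (- 2 * ((- 1 / 2) * s powr (- (3 / 2))) * (1 - exp (- s * z\<^sup>2)) +
          (- 2 * s powr (- (1 / 2))) * (exp (- s * z\<^sup>2) * z\<^sup>2)) +
          4 * z * (exp (- (z * s powr (1 / 2))\<^sup>2) * (z * (1 / 2 * s powr (- (1 / 2)))))) (at s)"
        unfolding G_def using s
        by (auto intro!: derivative_eq_intros DERIV_chain2[OF \<Phi>(1)])
      moreover have "(- 2 * ((- 1 / 2) * s powr (- (3 / 2))) * (1 - exp (- s * z\<^sup>2)) +
          (- 2 * s powr (- (1 / 2))) * (exp (- s * z\<^sup>2) * z\<^sup>2)) +
          4 * z * (exp (- (z * s powr (1 / 2))\<^sup>2) * (z * (1 / 2 * s powr (- (1 / 2))))) =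
          s powr (- (3 / 2)) * (1 - exp (- s * z\<^sup>2))"
        unfolding p by (simp add: power2_eq_square algebra_simps)
      ultimately show "(G has_real_derivative s powr (- (3 / 2)) * (1 - exp (- s * z\<^sup>2))) (at s)"
        by (simp only:)
      show "isCont (\<lambda>s. s powr (- (3 / 2)) * (1 - exp (- s * z\<^sup>2))) s"
        using s by (intro continuous_intros) auto
      show "0 \<le> s powr (- (3 / 2)) * (1 - exp (- s * z\<^sup>2))"
        using s by simp
    next
      have c0: "isCont \<Phi> 0" using \<Phi>(1) DERIV_isCont by blast
      have "((\<lambda>s. \<Phi> (z * s powr (1 / 2))) \<longlongrightarrow> \<Phi> 0) (at_right 0)"
        by (rule isCont_tendsto_compose[OF c0]) real_asymp
      moreover have "((\<lambda>s. - 2 * s powr (- (1 / 2)) * (1 - exp (- s * z\<^sup>2))) \<longlongrightarrow> 0) (at_right 0)"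
        using z by real_asymp
      ultimately have "(G \<longlongrightarrow> 0 + 4 * z * \<Phi> 0) (at_right 0)"
        unfolding G_def by (intro tendsto_intros)
      then show "(G \<longlongrightarrow> 4 * z * (sqrt pi / 2)) (at_right 0)" by (simp add: \<Phi>(4))
      have "filterlim (\<lambda>s. z * s powr (1 / 2)) at_top at_top" using z by real_asymp
      then have "((\<lambda>s. \<Phi> (z * s powr (1 / 2))) \<longlongrightarrow> sqrt pi) at_top"
        by (rule filterlim_compose[OF \<Phi>(3)])
      moreover have "((\<lambda>s. - 2 * s powr (- (1 / 2)) * (1 - exp (- s * z\<^sup>2))) \<longlongrightarrow> 0) at_top"
        using z by real_asymp
      ultimately have "(G \<longlongrightarrow> 0 + 4 * z * sqrt pi) at_top"
        unfolding G_def by (intro tendsto_intros)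
      then show "(G \<longlongrightarrow> 4 * z * sqrt pi) at_top" by simp
    qed
    then show ?thesis by (simp add: mult_ac)
  qed
qed

text \<open>Completing the square: y^2 / (4 t) + t z^2 equals both (z sqrt t - y / (2 sqrt t))^2 + y
  z and (z sqrt t + y / (2 sqrt t))^2 - y z. The functions p and q come from these two forms; p + q
  isolates the weight t^(-1/2) and p - q the weight t^(-3/2).\<close>

lemma subordination_integrals:
  assumes "y > 0" "z > 0"
  shows "has_bochner_integral lborel
      (\<lambda>t. indicator {0<..} t * (t powr (- (1 / 2)) * exp (- y\<^sup>2 / (4 * t) - t * z\<^sup>2)))
      (sqrt pi * exp (- y * z) / z)" (is ?A)
    and "has_bochner_integral lborel
      (\<lambda>t. indicator {0<..} t * (y / 2 * t powr (- (3 / 2)) * exp (- y\<^sup>2 / (4 * t) - t * z\<^sup>2)))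
      (sqrt pi * exp (- y * z))" (is ?B)
proof -
  obtain \<Phi> :: "real \<Rightarrow> real" where \<Phi>: "\<And>x. (\<Phi> has_real_derivative exp (- x\<^sup>2)) (at x)"
    "(\<Phi> \<longlongrightarrow> 0) at_bot" "(\<Phi> \<longlongrightarrow> sqrt pi) at_top" "\<Phi> 0 = sqrt pi / 2"
    using gaussian_primitive by blast
  define E where "E t = exp (- y\<^sup>2 / (4 * t) - t * z\<^sup>2)" for t
  define p where "p t = exp (- y * z) * \<Phi> (z * t powr (1 / 2) - y / 2 * t powr (- (1 / 2)))" for t
  define q where "q t = exp (y * z) * \<Phi> (z * t powr (1 / 2) + y / 2 * t powr (- (1 / 2)))" for t
  have sq: "(z * t powr (1 / 2) + y / 2 * t powr (- (1 / 2)))\<^sup>2 = t * z\<^sup>2 + y\<^sup>2 / (4 * t) + y * z"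
    if "t > 0" for t
    using that by (simp add: power2_sum powr_minus powr_half_sqrt power_mult_distrib field_simps)
  have sq': "(z * t powr (1 / 2) - y / 2 * t powr (- (1 / 2)))\<^sup>2 = t * z\<^sup>2 + y\<^sup>2 / (4 * t) - y * z" if "t > 0" for t
    using that by (simp add: power2_diff powr_minus powr_half_sqrt power_mult_distrib field_simps)
  have p': "(p has_real_derivative E t * (z * (1 / 2 * t powr (- (1 / 2))) + y / 4 * t powr (- (3 / 2)))) (at t)"
    if "t > 0" for t
  proof -
    have "(p has_real_derivative exp (- y * z) * (exp (- (z * t powr (1 / 2) - y / 2 * t powr (- (1 / 2)))\<^sup>2) *
        (z * (1 / 2 * t powr (- (1 / 2))) + y / 4 * t powr (- (3 / 2))))) (at t)"
      unfolding p_def using that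
      by (auto intro!: derivative_eq_intros DERIV_chain2[OF \<Phi>(1)] simp: mult.commute)
    moreover have "- y * z + - (t * z\<^sup>2 + y\<^sup>2 / (4 * t) - y * z) = - y\<^sup>2 / (4 * t) - t * z\<^sup>2" by simp
    ultimately show ?thesis unfolding sq'[OF that] E_def mult.assoc[symmetric] exp_add[symmetric]
      by (simp only:)
  qed
  have q': "(q has_real_derivative E t * (z * (1 / 2 * t powr (- (1 / 2))) - y / 4 * t powr (- (3 / 2)))) (at t)"
    if "t > 0" for t
  proof -
    have "(q has_real_derivative exp (y * z) * (exp (- (z * t powr (1 / 2) + y / 2 * t powr (- (1 / 2)))\<^sup>2) *
        (z * (1 / 2 * t powr (- (1 / 2))) - y / 4 * t powr (- (3 / 2))))) (at t)"
      unfolding q_def using that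
      by (auto intro!: derivative_eq_intros DERIV_chain2[OF \<Phi>(1)] simp: mult.commute)
    moreover have "y * z + - (t * z\<^sup>2 + y\<^sup>2 / (4 * t) + y * z) = - y\<^sup>2 / (4 * t) - t * z\<^sup>2" by simp
    ultimately show ?thesis unfolding sq[OF that] E_def mult.assoc[symmetric] exp_add[symmetric]
      by (simp only:)
  qed
  have p0: "(p \<longlongrightarrow> exp (- y * z) * 0) (at_right 0)"
    unfolding p_def
    by (intro tendsto_intros filterlim_compose[OF \<Phi>(2)]) (use assms in real_asymp)
  have q0: "(q \<longlongrightarrow> exp (y * z) * sqrt pi) (at_right 0)"
    unfolding q_def
    by (intro tendsto_intros filterlim_compose[OF \<Phi>(3)]) (use assms in real_asymp)
  have p1: "(p \<longlongrightarrow> exp (- y * z) * sqrt pi) at_top"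
    unfolding p_def
    by (intro tendsto_intros filterlim_compose[OF \<Phi>(3)]) (use assms in real_asymp)
  have q1: "(q \<longlongrightarrow> exp (y * z) * sqrt pi) at_top"
    unfolding q_def
    by (intro tendsto_intros filterlim_compose[OF \<Phi>(3)]) (use assms in real_asymp)
  have "has_bochner_integral lborel (\<lambda>t. indicator {0<..} t * (t powr (- (1 / 2)) * E t))
      ((exp (- y * z) * sqrt pi + exp (y * z) * sqrt pi) / z - (exp (- y * z) * 0 + exp (y * z) * sqrt pi) / z)"
  proof (rule FTC_nonneg_greaterThan_0[where G = "\<lambda>t. (p t + q t) / z"])
    fix t :: real assume t: "t > 0"
    have "((\<lambda>t. (p t + q t) / z) has_real_derivative
        (E t * (z * (1 / 2 * t powr (- (1 / 2))) + y / 4 * t powr (- (3 / 2))) +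
        E t * (z * (1 / 2 * t powr (- (1 / 2))) - y / 4 * t powr (- (3 / 2)))) / z) (at t)"
      by (intro DERIV_cdivide DERIV_add p'[OF t] q'[OF t])
    then show "((\<lambda>t. (p t + q t) / z) has_real_derivative t powr (- (1 / 2)) * E t) (at t)"
      using assms by (simp add: field_simps)
    show "isCont (\<lambda>t. t powr (- (1 / 2)) * E t) t"
      unfolding E_def using t by (intro continuous_intros) auto
  next
    show "((\<lambda>t. (p t + q t) / z) \<longlongrightarrow> (exp (- y * z) * 0 + exp (y * z) * sqrt pi) / z) (at_right 0)"
      by (intro tendsto_divide tendsto_add p0 q0) (use assms in auto)
    show "((\<lambda>t. (p t + q t) / z) \<longlongrightarrow> (exp (- y * z) * sqrt pi + exp (y * z) * sqrt pi) / z) at_top"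
      by (intro tendsto_divide tendsto_add p1 q1) (use assms in auto)
  qed (simp add: E_def)
  moreover have "(exp (- y * z) * sqrt pi + exp (y * z) * sqrt pi) / z - (exp (- y * z) * 0 + exp (y * z) * sqrt pi) / z =
      sqrt pi * exp (- y * z) / z"
    by (simp add: add_divide_distrib)
  ultimately show ?A by (simp only: E_def)
  have "has_bochner_integral lborel (\<lambda>t. indicator {0<..} t * (y / 2 * t powr (- (3 / 2)) * E t))
      ((exp (- y * z) * sqrt pi - exp (y * z) * sqrt pi) - (exp (- y * z) * 0 - exp (y * z) * sqrt pi))"
  proof (rule FTC_nonneg_greaterThan_0[where G = "\<lambda>t. p t - q t"])
    fix t :: real assume t: "t > 0"
    have "((\<lambda>t. p t - q t) has_real_derivative
        (E t * (z * (1 / 2 * t powr (- (1 / 2))) + y / 4 * t powr (- (3 / 2))) -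
        E t * (z * (1 / 2 * t powr (- (1 / 2))) - y / 4 * t powr (- (3 / 2))))) (at t)"
      by (intro DERIV_diff p'[OF t] q'[OF t])
    then show "((\<lambda>t. p t - q t) has_real_derivative y / 2 * t powr (- (3 / 2)) * E t) (at t)"
      by (simp add: field_simps)
    show "isCont (\<lambda>t. y / 2 * t powr (- (3 / 2)) * E t) t"
      unfolding E_def using t by (intro continuous_intros) auto
  next
    show "((\<lambda>t. p t - q t) \<longlongrightarrow> exp (- y * z) * 0 - exp (y * z) * sqrt pi) (at_right 0)"
      by (intro tendsto_diff p0 q0)
    show "((\<lambda>t. p t - q t) \<longlongrightarrow> exp (- y * z) * sqrt pi - exp (y * z) * sqrt pi) at_top"
      by (intro tendsto_diff p1 q1)
  qed (use assms in \<open>simp add: E_def\<close>)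
  then show ?B by (simp add: E_def mult.commute)
qed

text \<open>Gamma integrals in the variable 1 / t. The exponents -3 and -2 arise when the
  subordination weights t^(-3/2) and t^(-1/2) meet the factor t^(-3/2) of the heat kernel.\<close>

lemma integral_inverse_power_exp:
  fixes A :: real
  assumes "A > 0"
  shows "has_bochner_integral lborel (\<lambda>t. indicator {0<..} t * (t powr (- 3) * exp (- A / (4 * t)))) (16 / A\<^sup>2)"
    and "has_bochner_integral lborel (\<lambda>t. indicator {0<..} t * (t powr (- 2) * exp (- A / (4 * t)))) (4 / A)"
proof -
  have "has_bochner_integral lborel (\<lambda>t. indicator {0<..} t * (t powr (- 3) * exp (- A / (4 * t)))) (16 / A\<^sup>2 - 0)"
  proof (rule FTC_nonneg_greaterThan_0[where G = "\<lambda>t. exp (- A / (4 * t)) * (4 / (A * t) + 16 / A\<^sup>2)"])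
    fix t :: real assume t: "t > 0"
    have 1: "t powr (- 3) = 1 / t ^ 3"
      using t by (simp add: powr_minus divide_inverse flip: powr_numeral)
    show "((\<lambda>t. exp (- A / (4 * t)) * (4 / (A * t) + 16 / A\<^sup>2)) has_real_derivative
        t powr (- 3) * exp (- A / (4 * t))) (at t)"
      unfolding 1 using t assms
      by (auto intro!: derivative_eq_intros simp: field_simps power2_eq_square power3_eq_cube)
    show "isCont (\<lambda>t. t powr (- 3) * exp (- A / (4 * t))) t"
      using t by (intro continuous_intros) auto
  next
    show "((\<lambda>t. exp (- A / (4 * t)) * (4 / (A * t) + 16 / A\<^sup>2)) \<longlongrightarrow> 0) (at_right 0)"
      using assms by real_asymp
    show "((\<lambda>t. exp (- A / (4 * t)) * (4 / (A * t) + 16 / A\<^sup>2)) \<longlongrightarrow> 16 / A\<^sup>2) at_top"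
      using assms by real_asymp
  qed auto
  then show "has_bochner_integral lborel (\<lambda>t. indicator {0<..} t * (t powr (- 3) * exp (- A / (4 * t)))) (16 / A\<^sup>2)"
    by simp
  have "has_bochner_integral lborel (\<lambda>t. indicator {0<..} t * (t powr (- 2) * exp (- A / (4 * t)))) (4 / A - 0)"
  proof (rule FTC_nonneg_greaterThan_0[where G = "\<lambda>t. exp (- A / (4 * t)) * (4 / A)"])
    fix t :: real assume t: "t > 0"
    have 1: "t powr (- 2) = 1 / t ^ 2"
      using t by (simp add: powr_minus divide_inverse flip: powr_numeral)
    show "((\<lambda>t. exp (- A / (4 * t)) * (4 / A)) has_real_derivative
        t powr (- 2) * exp (- A / (4 * t))) (at t)"
      unfolding 1 using t assms
      by (auto intro!: derivative_eq_intros simp: field_simps power2_eq_square)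
    show "isCont (\<lambda>t. t powr (- 2) * exp (- A / (4 * t))) t"
      using t by (intro continuous_intros) auto
  next
    show "((\<lambda>t. exp (- A / (4 * t)) * (4 / A)) \<longlongrightarrow> 0) (at_right 0)"
      using assms by real_asymp
    show "((\<lambda>t. exp (- A / (4 * t)) * (4 / A)) \<longlongrightarrow> 4 / A) at_top"
      using assms by real_asymp
  qed auto
  then show "has_bochner_integral lborel (\<lambda>t. indicator {0<..} t * (t powr (- 2) * exp (- A / (4 * t)))) (4 / A)"
    by simp
qed

section \<open>Fourier transforms of Gaussians\<close>

lemma gaussian_fourier_real:
  assumes a: "a > 0"
  shows "has_bochner_integral lborel (\<lambda>x::real. exp (- a * x\<^sup>2) *\<^sub>R cis (x * y))
    (complex_of_real (sqrt (pi / a) * exp (- y\<^sup>2 / (4 * a))))"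
proof -
  \<comment> \<open>Scaling by c turns the standard normal density into a multiple of exp (-a x^2),
    which reduces the claim to the characteristic function of the normal distribution.\<close>
  define c where "c = sqrt (2 * a)"
  have c: "c > 0" "c\<^sup>2 = 2 * a" using a by (simp_all add: c_def)
  define F where "F x = std_normal_density x *\<^sub>R iexp (y / c * x)" for x
  have intF: "integrable lborel F"
    unfolding F_def
    by (rule Bochner_Integration.integrable_bound[OF integrable_std_normal_moment[of 0]]) auto
  have "complex_of_real (exp (- (y / c)\<^sup>2 / 2)) = char std_normal_distribution (y / c)"
    by (simp add: char_std_normal_distribution)
  also have "\<dots> = (LINT x|lborel. F x)"
    unfolding char_def F_def by (subst integral_density) auto
  finally have F: "(LINT x|lborel. F x) = complex_of_real (exp (- (y / c)\<^sup>2 / 2))" by simp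
  have Fc: "F (0 + c * x) = (1 / sqrt (2 * pi)) *\<^sub>R (exp (- a * x\<^sup>2) *\<^sub>R cis (x * y))" for x
    using c(1) by (simp add: F_def std_normal_density_def power_mult_distrib c(2) cis_conv_exp mult.commute)
  have int: "integrable lborel (\<lambda>x. (1 / sqrt (2 * pi)) *\<^sub>R (exp (- a * x\<^sup>2) *\<^sub>R cis (x * y)))"
    using lborel_integrable_real_affine[OF intF, of c 0] c unfolding Fc by simp
  have "integrable lborel (\<lambda>x. sqrt (2 * pi) *\<^sub>R ((1 / sqrt (2 * pi)) *\<^sub>R (exp (- a * x\<^sup>2) *\<^sub>R cis (x * y))))"
    by (rule integrable_scaleR_right) (rule int)
  then have int': "integrable lborel (\<lambda>x. exp (- a * x\<^sup>2) *\<^sub>R cis (x * y))" by simp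
  have "complex_of_real (exp (- (y / c)\<^sup>2 / 2)) = c *\<^sub>R (LINT x|lborel. (1 / sqrt (2 * pi)) *\<^sub>R (exp (- a * x\<^sup>2) *\<^sub>R cis (x * y)))"
    using lborel_integral_real_affine[of c F 0] c(1) unfolding F Fc by simp
  also have "\<dots> = (c / sqrt (2 * pi)) *\<^sub>R (LINT x|lborel. exp (- a * x\<^sup>2) *\<^sub>R cis (x * y))"
    by (subst integral_scaleR_right) simp
  finally have "(LINT x|lborel. exp (- a * x\<^sup>2) *\<^sub>R cis (x * y)) =
      (sqrt (2 * pi) / c) *\<^sub>R complex_of_real (exp (- (y / c)\<^sup>2 / 2))"
    using c(1) by simp
  moreover have "sqrt (2 * pi) / c = sqrt (pi / a)"
    using a by (simp add: c_def real_sqrt_divide real_sqrt_mult)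
  moreover have "(y / c)\<^sup>2 / 2 = y\<^sup>2 / (4 * a)"
    using a by (simp add: power_divide c(2))
  ultimately show ?thesis
    using int' by (simp add: has_bochner_integral_iff scaleR_conv_of_real)
qed

lemma cis_sum: "finite A \<Longrightarrow> cis (\<Sum>x\<in>A. f x) = (\<Prod>x\<in>A. cis (f x))"
  by (induction A rule: finite_induct) (auto simp: cis_mult[symmetric])

lemma gaussian_fourier:
  fixes y :: "'a::euclidean_space"
  assumes a: "a > 0"
  shows "has_bochner_integral lborel (\<lambda>x. exp (- a * (x \<bullet> x)) *\<^sub>R cis (x \<bullet> y))
    (complex_of_real ((pi / a) powr (DIM('a) / 2) * exp (- (y \<bullet> y) / (4 * a))))"
proof -
  interpret product_sigma_finite "\<lambda>_::'a. lborel :: real measure"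
    by standard
  define g where "g b x = exp (- a * x\<^sup>2) *\<^sub>R cis (x * (y \<bullet> b))" for b :: 'a and x :: real
  note G = gaussian_fourier_real[OF a, folded g_def]
  have eq: "exp (- a * (x \<bullet> x)) *\<^sub>R cis (x \<bullet> y) = (\<Prod>b\<in>Basis. g b (x \<bullet> b))" for x :: 'a
  proof -
    have "exp (- a * (x \<bullet> x)) = (\<Prod>b\<in>Basis. exp (- a * (x \<bullet> b)\<^sup>2))"
      by (simp add: exp_sum[symmetric] sum_distrib_left euclidean_inner[of x x] power2_eq_square sum_negf)
    moreover have "cis (x \<bullet> y) = (\<Prod>b\<in>Basis. cis ((x \<bullet> b) * (y \<bullet> b)))"
      by (subst euclidean_inner) (simp add: cis_sum)
    ultimately show ?thesis
      by (simp add: g_def scaleR_conv_of_real prod.distrib)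
  qed
  have comp: "(\<Sum>b\<in>Basis. f b *\<^sub>R b) \<bullet> b' = f b'" if "b' \<in> Basis" for f :: "'a \<Rightarrow> real" and b'
    using that by simp
  have meas: "(\<lambda>x::'a. exp (- a * (x \<bullet> x)) *\<^sub>R cis (x \<bullet> y)) \<in> borel_measurable borel"
    by (intro borel_measurable_continuous_onI continuous_intros)
  have mT: "(\<lambda>f. \<Sum>b\<in>Basis. f b *\<^sub>R b) \<in> measurable (\<Pi>\<^sub>M b\<in>Basis. lborel) (borel :: 'a measure)"
    by measurable
  have gi: "integrable lborel (g b)" for b
    using gaussian_fourier_real[OF a, of "y \<bullet> b"] by (simp add: has_bochner_integral_iff g_def[abs_def])
  have gv: "(LINT x|lborel. g b x) = complex_of_real (sqrt (pi / a) * exp (- (y \<bullet> b)\<^sup>2 / (4 * a)))" for b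
    using gaussian_fourier_real[OF a, of "y \<bullet> b"] by (simp add: has_bochner_integral_iff g_def[abs_def])
  have "integrable (\<Pi>\<^sub>M b\<in>Basis. lborel) (\<lambda>x. \<Prod>b\<in>Basis. g b (x b))"
    by (rule product_integrable_prod) (auto intro: gi)
  then have int: "integrable lborel (\<lambda>x::'a. exp (- a * (x \<bullet> x)) *\<^sub>R cis (x \<bullet> y))"
    unfolding lborel_eq[where 'a = 'a]
    by (subst integrable_distr_eq[OF mT meas], subst eq) (simp add: comp)
  have "(LINT x|lborel. exp (- a * (x \<bullet> x)) *\<^sub>R cis (x \<bullet> y)) =
      (LINT x|(\<Pi>\<^sub>M b\<in>Basis. lborel). (\<Prod>b\<in>Basis. g b (x b)))"
    unfolding lborel_eq[where 'a = 'a]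
    by (subst integral_distr[OF mT meas], subst eq) (simp add: comp)
  also have "\<dots> = (\<Prod>b\<in>Basis. complex_of_real (sqrt (pi / a) * exp (- (y \<bullet> b)\<^sup>2 / (4 * a))))"
    by (subst product_integral_prod) (auto simp: gi gv)
  also have "\<dots> = complex_of_real (sqrt (pi / a) ^ DIM('a) * exp (\<Sum>b\<in>Basis. - (y \<bullet> b)\<^sup>2 / (4 * a)))"
    by (simp add: prod.distrib exp_sum)
  also have "(\<Sum>b\<in>Basis. - (y \<bullet> b)\<^sup>2 / (4 * a)) = - (y \<bullet> y) / (4 * a)"
    by (simp add: euclidean_inner[of y y] power2_eq_square sum_negf flip: sum_divide_distrib)
  also have "sqrt (pi / a) ^ DIM('a) = (pi / a) powr (DIM('a) / 2)"
    using a by (simp add: powr_half_sqrt[symmetric] powr_powr flip: powr_realpow)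
  finally show ?thesis
    using int by (simp add: has_bochner_integral_iff)
qed

lemma gaussian_integral:
  assumes a: "a > 0"
  shows "has_bochner_integral lborel (\<lambda>x::'a::euclidean_space. exp (- a * (x \<bullet> x)))
    ((pi / a) powr (DIM('a) / 2))"
proof -
  have "has_bochner_integral lborel (\<lambda>x::'a. complex_of_real (exp (- a * (x \<bullet> x))))
      (complex_of_real ((pi / a) powr (DIM('a) / 2)))"
    using gaussian_fourier[OF a, of "0::'a"] by (simp add: scaleR_conv_of_real)
  then show ?thesis
    by (simp only: has_bochner_integral_iff complex_of_real_integrable_eq integral_complex_of_real of_real_eq_iff)
qed

text \<open>The term of order k in the exponential series at a (1 + w); the factor exp a pays for
  the shift from w to 1 + w.\<close>

lemma power_mult_exp_neg_le:
  fixes a w :: real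
  assumes "a > 0" "w \<ge> 0"
  shows "(1 + w) ^ k * exp (- a * w) \<le> exp a * fact k / a ^ k"
proof -
  have *: "(a * (1 + w)) ^ k / fact k \<le> exp (a * (1 + w))"
    using sum_le_suminf[OF summable_exp, of "{k}" "a * (1 + w)"] assms
    by (simp add: exp_def field_simps)
  have "exp (a * (1 + w)) = exp a * exp (a * w)" by (simp add: distrib_left exp_add)
  then have "(1 + w) ^ k * a ^ k \<le> fact k * (exp a * exp (a * w))"
    using * by (simp only: power_mult_distrib divide_le_eq) (simp add: mult_ac)
  then show ?thesis using assms by (simp add: exp_minus field_simps)
qed

section \<open>The heat kernel of three-space as a function of \<rho> = |x|^2, and its half
  Laplacian\<close>

definition heat :: "real \<Rightarrow> real \<Rightarrow> real" where
  "heat t \<rho> = (4 * pi * t) powr (- (3 / 2)) * exp (- \<rho> / (4 * t))"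

lemma heat_eq: "t > 0 \<Longrightarrow> (2 * pi) ^ 3 * heat t \<rho> = (pi / t) powr (3 / 2) * exp (- \<rho> / (4 * t))"
proof -
  assume t: "t > 0"
  have "(2 * pi) ^ 3 = (2 * pi) powr 3" by simp
  also have "\<dots> = ((2 * pi) powr 2) powr (3 / 2)" by (simp add: powr_powr del: powr_numeral)
  finally have "(2 * pi) ^ 3 = ((2 * pi)\<^sup>2) powr (3 / 2)" by simp
  moreover have "(4 * pi * t) powr (- (3 / 2)) = (1 / (4 * pi * t)) powr (3 / 2)"
    using t by (simp add: powr_minus_divide powr_divide)
  moreover have "((2 * pi)\<^sup>2) powr (3 / 2) * (1 / (4 * pi * t)) powr (3 / 2) =
      ((2 * pi)\<^sup>2 * (1 / (4 * pi * t))) powr (3 / 2)"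
    by (rule powr_mult[symmetric])
  ultimately have "(2 * pi) ^ 3 * (4 * pi * t) powr (- (3 / 2)) = ((2 * pi)\<^sup>2 * (1 / (4 * pi * t))) powr (3 / 2)"
    by (simp only:)
  also have "(2 * pi)\<^sup>2 * (1 / (4 * pi * t)) = pi / t"
    using t by (simp add: power2_eq_square field_simps)
  finally show ?thesis by (simp add: heat_def)
qed

lemma heat_fourier:
  fixes x :: "'a::euclidean_space"
  assumes "t > 0" "DIM('a) = 3"
  shows "has_bochner_integral lborel (\<lambda>\<xi>. exp (- t * (\<xi> \<bullet> \<xi>)) *\<^sub>R cis (x \<bullet> \<xi>))
    (complex_of_real ((2 * pi) ^ 3 * heat t (x \<bullet> x)))"
proof -
  have "cis (\<xi> \<bullet> x) = cis (x \<bullet> \<xi>)" for \<xi> by (simp add: inner_commute)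
  moreover have "real DIM('a) / 2 = 3 / 2" using assms(2) by simp
  ultimately show ?thesis
    using gaussian_fourier[OF assms(1), of x] unfolding heat_eq[OF assms(1)] by (simp only:)
qed

text \<open>Since exp (-s |\<xi>|^2) has integral (pi / s)^(3/2) over three-space, integrability of
  a (s) s^(-3/2) is precisely absolute convergence of the double integral over s and \<xi>, and
  Fubini applies.\<close>

lemma gaussian_superposition:
  fixes a :: "real \<Rightarrow> real" and x :: "'a::euclidean_space"
  assumes dim: "DIM('a) = 3" and [measurable]: "a \<in> borel_measurable borel"
    and int: "integrable lborel (\<lambda>s. indicator {0<..} s * (a s * s powr (- (3 / 2))))"
  defines "M \<equiv> \<lambda>z. LINT s|lborel. indicator {0<..} s * (a s * exp (- s * z))"
  shows "integrable lborel (\<lambda>\<xi>::'a. M (\<xi> \<bullet> \<xi>) *\<^sub>R cis (x \<bullet> \<xi>))"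
    and "(LINT \<xi>|lborel. M (\<xi> \<bullet> \<xi>) *\<^sub>R cis (x \<bullet> \<xi>)) =
      complex_of_real ((2 * pi) ^ 3 * (LINT s|lborel. indicator {0<..} s * (a s * heat s (x \<bullet> x))))"
proof -
  define F where "F s \<xi> = (indicator {0<..} s * (a s * exp (- s * (\<xi> \<bullet> \<xi>)))) *\<^sub>R cis (x \<bullet> \<xi>)"
    for s and \<xi> :: 'a
  have cis_meas [measurable]: "(\<lambda>\<xi>. cis (x \<bullet> \<xi>)) \<in> borel_measurable borel"
    by (intro borel_measurable_continuous_onI continuous_intros)
  have [measurable]: "case_prod F \<in> borel_measurable (lborel \<Otimes>\<^sub>M lborel)"
    unfolding F_def by measurable
  have n1: "integrable lborel (\<lambda>\<xi>. F s \<xi>)" for s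
  proof (cases "s > 0")
    case True
    have "integrable lborel (\<lambda>\<xi>. a s *\<^sub>R (exp (- s * (\<xi> \<bullet> \<xi>)) *\<^sub>R cis (x \<bullet> \<xi>)))"
      by (rule integrable_scaleR_right)
        (use heat_fourier[OF True dim, of x] in \<open>simp add: has_bochner_integral_iff\<close>)
    then show ?thesis using True by (simp add: F_def[abs_def])
  qed (simp add: F_def)
  have n2: "(LINT \<xi>|lborel. norm (F s \<xi>)) = pi powr (3 / 2) * norm (indicator {0<..} s * (a s * s powr (- (3 / 2))))" for s
  proof (cases "s > 0")
    case True
    have "(LINT \<xi>|lborel. norm (F s \<xi>)) = (LINT \<xi>|lborel. \<bar>a s\<bar> * exp (- s * ((\<xi>::'a) \<bullet> \<xi>)))"
      using True by (simp add: F_def abs_mult)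
    also have "\<dots> = \<bar>a s\<bar> * (pi / s) powr (3 / 2)"
      using gaussian_integral[OF True, where 'a = 'a] dim by (simp add: has_bochner_integral_iff)
    finally show ?thesis
      using True by (simp add: powr_divide powr_minus_divide abs_mult)
  qed (simp add: F_def)
  have FI: "integrable (lborel \<Otimes>\<^sub>M lborel) (case_prod F)"
  proof (rule lborel_pair.Fubini_integrable)
    show "integrable lborel (\<lambda>s. LINT \<xi>|lborel. norm (case_prod F (s, \<xi>)))"
      using int by (simp add: n2)
    show "AE s in lborel. integrable lborel (\<lambda>\<xi>. case_prod F (s, \<xi>))" using n1 by simp
  qed auto
  have inner: "(LINT s|lborel. F s \<xi>) = M (\<xi> \<bullet> \<xi>) *\<^sub>R cis (x \<bullet> \<xi>)" for \<xi>
  proof (cases "integrable lborel (\<lambda>s. indicator {0<..} s * (a s * exp (- s * (\<xi> \<bullet> \<xi>))))")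
    case True
    then show ?thesis unfolding F_def M_def by (simp only: integral_scaleR_left)
  next
    case False
    \<comment> \<open>If the inner integral does not converge, both sides are 0 by convention;
      multiplying by the inverse phase shows that the two integrands are integrable
      together.\<close>
    then have "M (\<xi> \<bullet> \<xi>) = 0" unfolding M_def by (rule not_integrable_integral_eq)
    moreover have "\<not> integrable lborel (\<lambda>s. F s \<xi>)"
    proof
      assume "integrable lborel (\<lambda>s. F s \<xi>)"
      then have "integrable lborel (\<lambda>s. F s \<xi> * cis (- (x \<bullet> \<xi>)))" by auto
      moreover have "F s \<xi> * cis (- (x \<bullet> \<xi>)) = complex_of_real (indicator {0<..} s * (a s * exp (- s * (\<xi> \<bullet> \<xi>))))" for s
        by (simp add: F_def scaleR_conv_of_real cis_mult mult.assoc)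
      ultimately show False
        using False by (simp only: complex_of_real_integrable_eq)
    qed
    ultimately show ?thesis by (simp add: not_integrable_integral_eq)
  qed
  show "integrable lborel (\<lambda>\<xi>::'a. M (\<xi> \<bullet> \<xi>) *\<^sub>R cis (x \<bullet> \<xi>))"
    using lborel_pair.integrable_snd[OF FI] by (simp add: inner)
  have "(LINT \<xi>|lborel. M (\<xi> \<bullet> \<xi>) *\<^sub>R cis (x \<bullet> \<xi>)) = (LINT s|lborel. (LINT \<xi>|lborel. F s \<xi>))"
    using lborel_pair.Fubini_integral[OF FI] by (simp add: inner)
  also have "\<dots> = (LINT s|lborel. complex_of_real ((2 * pi) ^ 3 * (indicator {0<..} s * (a s * heat s (x \<bullet> x)))))"
  proof (rule Bochner_Integration.integral_cong[OF refl])
    fix s :: real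
    show "(LINT \<xi>|lborel. F s \<xi>) = complex_of_real ((2 * pi) ^ 3 * (indicator {0<..} s * (a s * heat s (x \<bullet> x))))"
    proof (cases "s > 0")
      case True
      have "(LINT \<xi>|lborel. F s \<xi>) = (LINT \<xi>|lborel. a s *\<^sub>R (exp (- s * (\<xi> \<bullet> \<xi>)) *\<^sub>R cis (x \<bullet> \<xi>)))"
        using True by (simp add: F_def)
      also have "\<dots> = a s *\<^sub>R complex_of_real ((2 * pi) ^ 3 * heat s (x \<bullet> x))"
        using has_bochner_integral_integral_eq[OF heat_fourier[OF True dim, of x]]
        by (simp only: integral_scaleR_right)
      finally show ?thesis using True by (simp add: scaleR_conv_of_real)
    qed (simp add: F_def)
  qed
  also have "\<dots> = complex_of_real ((2 * pi) ^ 3 * (LINT s|lborel. indicator {0<..} s * (a s * heat s (x \<bullet> x))))"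
    by (simp only: integral_complex_of_real integral_mult_right_zero)
  finally show "(LINT \<xi>|lborel. M (\<xi> \<bullet> \<xi>) *\<^sub>R cis (x \<bullet> \<xi>)) =
      complex_of_real ((2 * pi) ^ 3 * (LINT s|lborel. indicator {0<..} s * (a s * heat s (x \<bullet> x))))" .
qed

text \<open>The half Laplacian of the heat kernel, from
  \<open>2 \<surd>\<pi> |\<xi>| = \<integral>s\<^sup>-\<^sup>3\<^sup>/\<^sup>2 (1 - exp (-s |\<xi>|\<^sup>2)) ds\<close> over \<open>s > 0\<close>.\<close>

definition half_heat :: "real \<Rightarrow> real \<Rightarrow> real" where
  "half_heat t \<rho> = 1 / (2 * sqrt pi) *
    (LINT s|lborel. indicator {0<..} s * (s powr (- (3 / 2)) * (heat t \<rho> - heat (t + s) \<rho>)))"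

lemma heat_nonneg: "heat t \<rho> \<ge> 0"
  by (simp add: heat_def)

lemma heat_measurable [measurable (raw)]:
  assumes [measurable]: "f \<in> borel_measurable M" "g \<in> borel_measurable M"
  shows "(\<lambda>x. heat (f x) (g x)) \<in> borel_measurable M"
  unfolding heat_def by measurable

text \<open>Twice the bound on (1 + q)^4 exp (-q / 4) from \<open>power_mult_exp_neg_le\<close>. The
  fourth power covers the decay wanted for the heat kernel and for its time derivative; the factor 2
  absorbs |q / 4 - 3 / 2| \<le> 2 (1 + q) in the latter.\<close>

definition heat_bound :: real where
  "heat_bound = 2 * (exp (1 / 4) * fact 4 / (1 / 4) ^ 4)"

lemma heat_bound_pos: "heat_bound > 0"
  by (simp add: heat_bound_def)

lemma exp_neg_le_heat_bound:
  assumes "q \<ge> 0"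
  shows "(1 + q) ^ 4 * exp (- q / 4) \<le> heat_bound / 2"
  using power_mult_exp_neg_le[of "1 / 4" q 4] assms by (simp add: heat_bound_def)

lemma heat_le:
  assumes "t > 0" "\<rho> \<ge> 0"
  shows "heat t \<rho> \<le> heat_bound * (t + \<rho>) powr (- (3 / 2))"
proof -
  \<comment> \<open>The scale-invariant variable: t + \<rho> = t (1 + q), so only a function of q
    remains to be estimated.\<close>
  define q where "q = \<rho> / t"
  have q: "q \<ge> 0" "t + \<rho> = t * (1 + q)" using assms by (simp_all add: q_def field_simps)
  have "(4 * pi * t) powr (- (3 / 2)) \<le> t powr (- (3 / 2))"
    using assms pi_ge_two by (intro powr_mono2') (auto simp: mult_le_cancel_right1)
  then have "heat t \<rho> \<le> t powr (- (3 / 2)) * exp (- q / 4)"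
    unfolding heat_def by (auto intro!: mult_mono simp: q_def)
  also have "exp (- q / 4) \<le> heat_bound * (1 + q) powr (- (3 / 2))"
  proof -
    have "exp (- q / 4) * (1 + q) powr (3 / 2) \<le> exp (- q / 4) * (1 + q) powr 4"
      using q by (intro mult_left_mono powr_mono) auto
    also have "\<dots> = (1 + q) ^ 4 * exp (- q / 4)"
      using q by simp
    also have "\<dots> \<le> heat_bound"
      using exp_neg_le_heat_bound[OF q(1)] heat_bound_pos by linarith
    finally show ?thesis
      using q by (simp add: powr_minus_divide pos_le_divide_eq)
  qed
  finally have "heat t \<rho> \<le> t powr (- (3 / 2)) * (heat_bound * (1 + q) powr (- (3 / 2)))"
    by (simp add: mult_left_mono)
  also have "\<dots> = heat_bound * (t + \<rho>) powr (- (3 / 2))"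
    unfolding q(2) using assms q by (simp add: powr_mult)
  finally show ?thesis .
qed

lemma heat_deriv:
  assumes "t > 0"
  shows "((\<lambda>t. heat t \<rho>) has_real_derivative
    (4 * pi) powr (- (3 / 2)) * (t powr (- (5 / 2)) * ((\<rho> / t / 4 - 3 / 2) * exp (- \<rho> / (4 * t))))) (at t)"
proof -
  have h: "heat s \<rho> = (4 * pi) powr (- (3 / 2)) * (s powr (- (3 / 2)) * exp (- \<rho> / (4 * s)))" for s
    unfolding heat_def by (simp add: powr_mult)
  have 1: "t powr (- (3 / 2)) = t powr (- (5 / 2)) * t"
    using assms powr_add[of t "- (5 / 2)" 1] by simp
  have "((\<lambda>t. t powr (- (3 / 2)) * exp (- \<rho> / (4 * t))) has_real_derivative
      (- (3 / 2) * t powr (- (5 / 2))) * exp (- \<rho> / (4 * t)) + (exp (- \<rho> / (4 * t)) * (\<rho> / (4 * t\<^sup>2))) * t powr (- (3 / 2))) (at t)"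
    using assms by (auto intro!: derivative_eq_intros simp: field_simps power2_eq_square)
  moreover have "(- (3 / 2) * t powr (- (5 / 2))) * exp (- \<rho> / (4 * t)) + (exp (- \<rho> / (4 * t)) * (\<rho> / (4 * t\<^sup>2))) * t powr (- (3 / 2)) =
      t powr (- (5 / 2)) * ((\<rho> / t / 4 - 3 / 2) * exp (- \<rho> / (4 * t)))"
    unfolding 1 using assms by (simp add: field_simps power2_eq_square)
  ultimately show ?thesis
    unfolding h by (auto intro!: DERIV_cmult)
qed

text \<open>The first bound, from the mean value theorem in time, is the better one for small s, the
  second for large s; together they make the integral against s^(-3/2) converge at both
  ends.\<close>

lemma heat_diff_le:
  assumes "t > 0" "\<rho> \<ge> 0" "s > 0"
  shows "\<bar>heat t \<rho> - heat (t + s) \<rho>\<bar> \<le> s * (heat_bound * (t + \<rho>) powr (- (5 / 2)))"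
    and "\<bar>heat t \<rho> - heat (t + s) \<rho>\<bar> \<le> heat_bound * (t + \<rho>) powr (- (3 / 2))"
proof -
  obtain r where r: "t < r" "heat (t + s) \<rho> - heat t \<rho> = s *
      ((4 * pi) powr (- (3 / 2)) * (r powr (- (5 / 2)) * ((\<rho> / r / 4 - 3 / 2) * exp (- \<rho> / (4 * r)))))"
  proof -
    let ?D = "\<lambda>r. (4 * pi) powr (- (3 / 2)) * (r powr (- (5 / 2)) * ((\<rho> / r / 4 - 3 / 2) * exp (- \<rho> / (4 * r))))"
    have "\<exists>z>t. z < t + s \<and> heat (t + s) \<rho> - heat t \<rho> = (t + s - t) * ?D z"
    proof (rule MVT2)
      show "((\<lambda>t. heat t \<rho>) has_real_derivative ?D x) (at x)" if "t \<le> x" "x \<le> t + s" for x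
        using that assms by (intro heat_deriv) simp
    qed (use assms in simp)
    then obtain z where "z > t" "heat (t + s) \<rho> - heat t \<rho> = (t + s - t) * ?D z" by blast
    then show ?thesis using that[of z] by (simp only: add_diff_cancel_left')
  qed
  define q where "q = \<rho> / r"
  have r0: "r > 0" using r assms by simp
  have q: "q \<ge> 0" "r + \<rho> = r * (1 + q)" using assms r0 by (simp_all add: q_def field_simps)
  have "\<bar>(q / 4 - 3 / 2) * exp (- q / 4)\<bar> \<le> heat_bound * (1 + q) powr (- (5 / 2))"
  proof -
    have "\<bar>(q / 4 - 3 / 2) * exp (- q / 4)\<bar> * (1 + q) powr (5 / 2) = \<bar>q / 4 - 3 / 2\<bar> * exp (- q / 4) * (1 + q) powr (5 / 2)"
      by (simp add: abs_mult)
    also have "\<dots> \<le> (2 * (1 + q)) * exp (- q / 4) * (1 + q) powr 3"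
      using q by (intro mult_mono powr_mono) auto
    also have "\<dots> = 2 * ((1 + q) ^ 4 * exp (- q / 4))"
      using q by (simp add: power4_eq_xxxx power3_eq_cube)
    also have "\<dots> \<le> heat_bound"
      using exp_neg_le_heat_bound[OF q(1)] by linarith
    finally show ?thesis
      using q by (simp add: powr_minus_divide pos_le_divide_eq)
  qed
  then have "r powr (- (5 / 2)) * \<bar>(q / 4 - 3 / 2) * exp (- q / 4)\<bar> \<le>
      r powr (- (5 / 2)) * (heat_bound * (1 + q) powr (- (5 / 2)))"
    by (intro mult_left_mono) auto
  also have "\<dots> = heat_bound * (r + \<rho>) powr (- (5 / 2))"
    unfolding q(2) using r0 q by (simp add: powr_mult)
  also have "\<dots> \<le> heat_bound * (t + \<rho>) powr (- (5 / 2))"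
    using heat_bound_pos r assms by (intro mult_left_mono powr_mono2') auto
  finally have 1: "r powr (- (5 / 2)) * \<bar>(q / 4 - 3 / 2) * exp (- q / 4)\<bar> \<le> heat_bound * (t + \<rho>) powr (- (5 / 2))" .
  have c: "(4 * pi) powr (- (3 / 2)) \<le> 1"
    using pi_ge_two powr_mono[of "- (3 / 2)" 0 "4 * pi"] by simp
  have "\<bar>heat t \<rho> - heat (t + s) \<rho>\<bar> = s * ((4 * pi) powr (- (3 / 2)) * (r powr (- (5 / 2)) * \<bar>(q / 4 - 3 / 2) * exp (- q / 4)\<bar>))"
    using r(2) assms r0 by (subst abs_minus_commute) (simp add: abs_mult q_def)
  also have "\<dots> \<le> s * (1 * (r powr (- (5 / 2)) * \<bar>(q / 4 - 3 / 2) * exp (- q / 4)\<bar>))"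
    using assms c by (intro mult_left_mono mult_right_mono) auto
  also have "\<dots> \<le> s * (heat_bound * (t + \<rho>) powr (- (5 / 2)))"
    using assms 1 by (intro mult_left_mono) auto
  finally show "\<bar>heat t \<rho> - heat (t + s) \<rho>\<bar> \<le> s * (heat_bound * (t + \<rho>) powr (- (5 / 2)))" .
  have "heat (t + s) \<rho> \<le> heat_bound * (t + s + \<rho>) powr (- (3 / 2))"
    using heat_le[of "t + s" \<rho>] assms by simp
  also have "\<dots> \<le> heat_bound * (t + \<rho>) powr (- (3 / 2))"
    using heat_bound_pos assms by (intro mult_left_mono powr_mono2') auto
  finally show "\<bar>heat t \<rho> - heat (t + s) \<rho>\<bar> \<le> heat_bound * (t + \<rho>) powr (- (3 / 2))"
    using heat_le[of t \<rho>] assms heat_nonneg[of t \<rho>] heat_nonneg[of "t + s" \<rho>] by linarith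
qed

text \<open>At fixed t the half Laplacian of the heat kernel thus decays like |x|^(-4), the weight
  of \<open>L_half\<close> in dimension three, and can be paired with \<open>v\<close>. Integrating
  the two bounds of \<open>heat_diff_le\<close> against s^(-3/2) turns the power -5/2 of t + \<rho>
  into -2.\<close>

lemma heat_diff_integrable:
  assumes "t > 0" "\<rho> \<ge> 0"
  shows "integrable lborel (\<lambda>s. indicator {0<..} s * (s powr (- (3 / 2)) * (heat t \<rho> - heat (t + s) \<rho>)))"
    and "\<bar>half_heat t \<rho>\<bar> \<le> 2 * heat_bound / (t + \<rho>)\<^sup>2"
proof -
  define \<sigma> where "\<sigma> = t + \<rho>"
  define A where "A = heat_bound * \<sigma> powr (- (5 / 2))"
  have \<sigma>: "\<sigma> > 0" using assms by (simp add: \<sigma>_def)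
  have A: "A > 0" using \<sigma> heat_bound_pos by (simp add: A_def)
  have B: "heat_bound * (t + \<rho>) powr (- (3 / 2)) = A * \<sigma>"
    using \<sigma> powr_add[of \<sigma> "- (5 / 2)" 1] by (simp add: A_def \<sigma>_def[symmetric])
  define G where "G s = 4 * A * sqrt \<sigma> * arctan (sqrt s / sqrt \<sigma>)" for s
  \<comment> \<open>The minimum of s A and A \<sigma> is at most their harmonic mean 2 s A \<sigma>
    / (s + \<sigma>), a smooth majorant whose primitive against s^(-3/2) is an arctangent.\<close>
  define g where "g s = s powr (- (3 / 2)) * (2 * s * A * \<sigma> / (s + \<sigma>))" for s
  have g: "has_bochner_integral lborel (\<lambda>s. indicator {0<..} s * g s) (4 * A * sqrt \<sigma> * (pi / 2) - 0)"
  proof (rule FTC_nonneg_greaterThan_0[where G = G])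
    fix s :: real assume s: "s > 0"
    have p: "s powr (- (3 / 2)) = 1 / (s * sqrt s)"
      using s powr_add[of s 1 "1 / 2"] by (simp add: powr_minus_divide powr_half_sqrt)
    have e: "1 + (sqrt s / sqrt \<sigma>)\<^sup>2 = (s + \<sigma>) / \<sigma>"
      using s \<sigma> by (simp add: power_divide add_divide_distrib)
    have "(G has_real_derivative 4 * A * sqrt \<sigma> * (inverse (1 + (sqrt s / sqrt \<sigma>)\<^sup>2) * ((inverse (sqrt s) / 2) / sqrt \<sigma>))) (at s)"
      unfolding G_def
      by (intro DERIV_cmult DERIV_chain2[OF DERIV_arctan] DERIV_cdivide)
        (use DERIV_real_sqrt[OF s] in \<open>simp add: field_simps\<close>)
    also have "4 * A * sqrt \<sigma> * (inverse (1 + (sqrt s / sqrt \<sigma>)\<^sup>2) * ((inverse (sqrt s) / 2) / sqrt \<sigma>)) = g s"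
      unfolding e g_def p using s \<sigma> by (simp add: divide_simps)
    finally show "(G has_real_derivative g s) (at s)" .
    show "isCont g s" unfolding g_def using s \<sigma> by (intro continuous_intros) auto
    show "0 \<le> g s" unfolding g_def using s \<sigma> A by simp
  next
    have "((\<lambda>s. sqrt s / sqrt \<sigma>) \<longlongrightarrow> 0 / sqrt \<sigma>) (at_right 0)"
      using \<sigma> by (intro tendsto_intros) (auto intro!: tendsto_eq_intros)
    then have "(G \<longlongrightarrow> 4 * A * sqrt \<sigma> * arctan (0 / sqrt \<sigma>)) (at_right 0)"
      unfolding G_def by (intro tendsto_mult_left tendsto_arctan)
    then show "(G \<longlongrightarrow> 0) (at_right 0)" by simp
    have "filterlim (\<lambda>s. sqrt s / sqrt \<sigma>) at_top at_top" using \<sigma> by real_asymp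
    then show "(G \<longlongrightarrow> 4 * A * sqrt \<sigma> * (pi / 2)) at_top"
      unfolding G_def by (intro tendsto_intros filterlim_compose[OF tendsto_arctan_at_top])
  qed
  have le: "\<bar>indicator {0<..} s * (s powr (- (3 / 2)) * (heat t \<rho> - heat (t + s) \<rho>))\<bar> \<le> indicator {0<..} s * g s" for s
  proof (cases "s > 0")
    case True
    let ?d = "\<bar>heat t \<rho> - heat (t + s) \<rho>\<bar>"
    have d: "?d \<le> s * A" "?d \<le> A * \<sigma>"
      using heat_diff_le[OF assms True] B by (simp_all add: A_def \<sigma>_def)
    have "?d * (s + \<sigma>) \<le> (A * \<sigma>) * s + (s * A) * \<sigma>"
      unfolding distrib_left using d True \<sigma> by (intro add_mono mult_right_mono) auto
    then have "?d \<le> 2 * s * A * \<sigma> / (s + \<sigma>)"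
      using True \<sigma> by (simp add: pos_le_divide_eq mult_ac)
    then have "s powr (- (3 / 2)) * ?d \<le> g s"
      unfolding g_def by (intro mult_left_mono) auto
    then show ?thesis using True by (simp add: abs_mult)
  qed simp
  have ig: "integrable lborel (\<lambda>s. indicator {0<..} s * g s)" using g by (simp add: has_bochner_integral_iff)
  show int: "integrable lborel (\<lambda>s. indicator {0<..} s * (s powr (- (3 / 2)) * (heat t \<rho> - heat (t + s) \<rho>)))"
    by (rule Bochner_Integration.integrable_bound[OF ig]) (use le in \<open>auto intro: order_trans[OF _ abs_ge_self]\<close>)
  have "\<bar>LINT s|lborel. indicator {0<..} s * (s powr (- (3 / 2)) * (heat t \<rho> - heat (t + s) \<rho>))\<bar> \<le>
      (LINT s|lborel. \<bar>indicator {0<..} s * (s powr (- (3 / 2)) * (heat t \<rho> - heat (t + s) \<rho>))\<bar>)"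
    using integral_norm_bound by (metis (no_types, lifting) real_norm_def Bochner_Integration.integral_cong)
  also have "\<dots> \<le> (LINT s|lborel. indicator {0<..} s * g s)"
    using le int ig by (intro integral_mono) auto
  also have "\<dots> = 2 * pi * A * sqrt \<sigma>" using g by (simp add: has_bochner_integral_iff)
  finally have "\<bar>half_heat t \<rho>\<bar> \<le> 1 / (2 * sqrt pi) * (2 * pi * A * sqrt \<sigma>)"
    unfolding half_heat_def abs_mult[of "1 / (2 * sqrt pi)"] by (intro mult_mono) auto
  also have "\<dots> = sqrt pi * (A * sqrt \<sigma>)"
  proof -
    have "1 / (2 * r) * (2 * (r * r) * B * C) = r * (B * C)" if "r > 0" for r B C :: real
      using that by simp
    from this[of "sqrt pi" A "sqrt \<sigma>"] show ?thesis by simp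
  qed
  also have "A * sqrt \<sigma> = heat_bound / \<sigma>\<^sup>2"
  proof -
    have "\<sigma> powr (- (5 / 2)) * sqrt \<sigma> = \<sigma> powr (- 2)"
      using \<sigma> by (simp add: powr_half_sqrt[symmetric] flip: powr_add)
    then have "A * sqrt \<sigma> = heat_bound * \<sigma> powr (- 2)" unfolding A_def mult.assoc by (simp only:)
    then show ?thesis using \<sigma> by (simp add: powr_minus_divide)
  qed
  also have "sqrt pi * (heat_bound / \<sigma>\<^sup>2) \<le> 2 * (heat_bound / \<sigma>\<^sup>2)"
    using heat_bound_pos pi_less_4 \<sigma> real_sqrt_le_mono[of pi 4] by (intro mult_right_mono) auto
  finally show "\<bar>half_heat t \<rho>\<bar> \<le> 2 * heat_bound / (t + \<rho>)\<^sup>2" by (simp add: \<sigma>_def)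
qed

lemma norm_mult_gaussian_integrable:
  assumes "t > 0"
  shows "integrable lborel (\<lambda>\<xi>::'a::euclidean_space. norm \<xi> * exp (- t * (\<xi> \<bullet> \<xi>)))"
proof (rule Bochner_Integration.integrable_bound)
  have "integrable lborel (\<lambda>\<xi>::'a. exp (- (t / 2) * (\<xi> \<bullet> \<xi>)))"
    using gaussian_integral[of "t / 2", where 'a = 'a] assms by (simp add: has_bochner_integral_iff)
  then show "integrable lborel (\<lambda>\<xi>::'a. (1 + 2 / t) * exp (- (t / 2) * (\<xi> \<bullet> \<xi>)))" by simp
  show "AE \<xi>::'a in lborel. norm (norm \<xi> * exp (- t * (\<xi> \<bullet> \<xi>))) \<le> norm ((1 + 2 / t) * exp (- (t / 2) * (\<xi> \<bullet> \<xi>)))"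
  proof (intro AE_I2)
    fix \<xi> :: 'a
    have n: "norm \<xi> \<le> 1 + \<xi> \<bullet> \<xi>"
      unfolding power2_norm_eq_inner[symmetric] using zero_le_power2[of "norm \<xi> - 1"]
      by (simp add: power2_eq_square algebra_simps) (smt (verit) norm_ge_zero mult_nonneg_nonneg)
    have "1 + t / 2 * (\<xi> \<bullet> \<xi>) \<le> exp (t / 2 * (\<xi> \<bullet> \<xi>))" by (rule exp_ge_add_one_self)
    then have "(1 + \<xi> \<bullet> \<xi>) \<le> (1 + 2 / t) * exp (t / 2 * (\<xi> \<bullet> \<xi>))"
    proof -
      assume a: "1 + t / 2 * (\<xi> \<bullet> \<xi>) \<le> exp (t / 2 * (\<xi> \<bullet> \<xi>))"
      have "(1 + \<xi> \<bullet> \<xi>) \<le> (1 + 2 / t) * (1 + t / 2 * (\<xi> \<bullet> \<xi>))"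
        using assms by (simp add: field_simps)
      also have "\<dots> \<le> (1 + 2 / t) * exp (t / 2 * (\<xi> \<bullet> \<xi>))"
        using assms a by (intro mult_left_mono) auto
      finally show ?thesis .
    qed
    with n have "norm \<xi> * exp (- t * (\<xi> \<bullet> \<xi>)) \<le> ((1 + 2 / t) * exp (t / 2 * (\<xi> \<bullet> \<xi>))) * exp (- t * (\<xi> \<bullet> \<xi>))"
      by (intro mult_right_mono) auto
    also have "\<dots> = (1 + 2 / t) * exp (- (t / 2) * (\<xi> \<bullet> \<xi>))"
      by (simp add: mult.assoc flip: exp_add)
    finally show "norm (norm \<xi> * exp (- t * (\<xi> \<bullet> \<xi>))) \<le> norm ((1 + 2 / t) * exp (- (t / 2) * (\<xi> \<bullet> \<xi>)))"
      using assms by (simp add: abs_mult abs_of_pos add_pos_pos)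
  qed
qed simp

text \<open>With |\<xi>| written as in \<open>integral_one_minus_exp\<close>, integrating over \<xi>
  first leaves for each s a difference of two Gaussians, whose transform is \<open>heat t\<close> -
  \<open>heat (t + s)\<close> up to the factor (2 pi)^3. The phase has modulus one, so Fubini only
  asks for integrability of |\<xi>| exp (-t |\<xi>|^2).\<close>

lemma half_heat_fourier:
  fixes x :: "'a::euclidean_space"
  assumes t: "t > 0" and dim: "DIM('a) = 3"
  shows "(LINT \<xi>|lborel. (norm \<xi> * exp (- t * (\<xi> \<bullet> \<xi>))) *\<^sub>R cis (x \<bullet> \<xi>)) =
    complex_of_real ((2 * pi) ^ 3 * half_heat t (x \<bullet> x))"
proof -
  define F where "F \<xi> s = (indicator {0<..} s * (s powr (- (3 / 2)) * (1 - exp (- s * (norm \<xi>)\<^sup>2)))) *\<^sub>R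
      (exp (- t * (\<xi> \<bullet> \<xi>)) *\<^sub>R cis (x \<bullet> \<xi>))" for \<xi> :: 'a and s
  have cis_meas [measurable]: "(\<lambda>\<xi>. cis (x \<bullet> \<xi>)) \<in> borel_measurable borel"
    by (intro borel_measurable_continuous_onI continuous_intros)
  have [measurable]: "case_prod F \<in> borel_measurable (lborel \<Otimes>\<^sub>M lborel)"
    unfolding F_def by measurable
  have I: "has_bochner_integral lborel (F \<xi>) ((2 * sqrt pi * norm \<xi>) *\<^sub>R (exp (- t * (\<xi> \<bullet> \<xi>)) *\<^sub>R cis (x \<bullet> \<xi>)))" for \<xi>
    unfolding F_def by (rule has_bochner_integral_scaleR_left) (rule integral_one_minus_exp, simp)
  have n: "norm (F \<xi> s) = (indicator {0<..} s * (s powr (- (3 / 2)) * (1 - exp (- s * (norm \<xi>)\<^sup>2)))) * exp (- t * (\<xi> \<bullet> \<xi>))" for \<xi> s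
    by (cases "s > 0") (simp_all add: F_def abs_mult)
  have N: "(LINT s|lborel. norm (F \<xi> s)) = 2 * sqrt pi * (norm \<xi> * exp (- t * (\<xi> \<bullet> \<xi>)))" for \<xi>
    using has_bochner_integral_integral_eq[OF has_bochner_integral_mult_left[OF integral_one_minus_exp[OF norm_ge_zero[of \<xi>]], of "exp (- t * (\<xi> \<bullet> \<xi>))"]]
    unfolding n by simp
  have FI: "integrable (lborel \<Otimes>\<^sub>M lborel) (case_prod F)"
  proof (rule lborel_pair.Fubini_integrable)
    show "integrable lborel (\<lambda>\<xi>. LINT s|lborel. norm (case_prod F (\<xi>, s)))"
      using norm_mult_gaussian_integrable[OF t, where 'a = 'a] by (simp add: N)
    show "AE \<xi> in lborel. integrable lborel (\<lambda>s. case_prod F (\<xi>, s))"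
      using I by (auto simp: has_bochner_integral_iff)
  qed auto
  have "(LINT \<xi>|lborel. (2 * sqrt pi) *\<^sub>R ((norm \<xi> * exp (- t * (\<xi> \<bullet> \<xi>))) *\<^sub>R cis (x \<bullet> \<xi>))) =
      (LINT \<xi>|lborel. (LINT s|lborel. F \<xi> s))"
    using I by (simp add: has_bochner_integral_iff mult.assoc)
  also have "\<dots> = (LINT s|lborel. (LINT \<xi>|lborel. F \<xi> s))"
    using lborel_pair.Fubini_integral[OF FI] by simp
  also have "\<dots> = (LINT s|lborel. complex_of_real ((2 * pi) ^ 3 *
      (indicator {0<..} s * (s powr (- (3 / 2)) * (heat t (x \<bullet> x) - heat (t + s) (x \<bullet> x))))))"
  proof (rule Bochner_Integration.integral_cong[OF refl])
    fix s :: real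
    show "(LINT \<xi>|lborel. F \<xi> s) = complex_of_real ((2 * pi) ^ 3 *
      (indicator {0<..} s * (s powr (- (3 / 2)) * (heat t (x \<bullet> x) - heat (t + s) (x \<bullet> x)))))"
    proof (cases "s > 0")
      case True
      have e: "F \<xi> s = s powr (- (3 / 2)) *\<^sub>R (exp (- t * (\<xi> \<bullet> \<xi>)) *\<^sub>R cis (x \<bullet> \<xi>) -
          exp (- (t + s) * (\<xi> \<bullet> \<xi>)) *\<^sub>R cis (x \<bullet> \<xi>))" for \<xi>
      proof -
        have "exp (- (t + s) * (\<xi> \<bullet> \<xi>)) = exp (- s * (\<xi> \<bullet> \<xi>)) * exp (- t * (\<xi> \<bullet> \<xi>))"
          by (simp add: algebra_simps flip: exp_add)
        then show ?thesis
          using True by (simp add: F_def power2_norm_eq_inner algebra_simps)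
      qed
      have ts: "t + s > 0" using t True by simp
      have "has_bochner_integral lborel (\<lambda>\<xi>. F \<xi> s) (s powr (- (3 / 2)) *\<^sub>R
          (complex_of_real ((2 * pi) ^ 3 * heat t (x \<bullet> x)) - complex_of_real ((2 * pi) ^ 3 * heat (t + s) (x \<bullet> x))))"
        unfolding e
        by (intro has_bochner_integral_scaleR_right has_bochner_integral_diff heat_fourier t ts dim)
      from has_bochner_integral_integral_eq[OF this] show ?thesis
        using True by (simp add: scaleR_conv_of_real algebra_simps)
    qed (simp add: F_def)
  qed
  also have "\<dots> = complex_of_real ((2 * pi) ^ 3 * (2 * sqrt pi * half_heat t (x \<bullet> x)))"
    unfolding half_heat_def by (simp only: integral_complex_of_real integral_mult_right_zero) simp
  finally have "(2 * sqrt pi) *\<^sub>R (LINT \<xi>|lborel. (norm \<xi> * exp (- t * (\<xi> \<bullet> \<xi>))) *\<^sub>R cis (x \<bullet> \<xi>)) =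
      (2 * sqrt pi) *\<^sub>R complex_of_real ((2 * pi) ^ 3 * half_heat t (x \<bullet> x))"
    by (simp only: integral_scaleR_right) (simp add: scaleR_conv_of_real mult_ac)
  then show ?thesis by (subst (asm) scaleR_cancel_left) simp
qed

text \<open>The Poisson kernel of the upper half-space at height \<open>y\<close>, with symbol \<open>exp (-y |\<xi>|)\<close>, and its
  integral over the heights above \<open>y\<close>, with symbol \<open>exp (-y |\<xi>|) / |\<xi>|\<close>; hence the half Laplacian takes \<open>newton y\<close> to
  \<open>poisson y\<close>. Only differences in \<open>y\<close> are superpositions of heat kernels with an integrable weight.\<close>

definition poisson :: "real \<Rightarrow> real \<Rightarrow> real" where
  "poisson y \<rho> = y / (pi\<^sup>2 * (y\<^sup>2 + \<rho>)\<^sup>2)"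

definition newton :: "real \<Rightarrow> real \<Rightarrow> real" where
  "newton y \<rho> = 1 / (2 * pi\<^sup>2 * (y\<^sup>2 + \<rho>))"

section \<open>Subordination: Poisson kernels as superpositions of heat kernels\<close>

lemma half_heat_measurable [measurable (raw)]:
  assumes [measurable]: "f \<in> borel_measurable M" "g \<in> borel_measurable M"
  shows "(\<lambda>x. half_heat (f x) (g x)) \<in> borel_measurable M"
  unfolding half_heat_def by measurable

lemma heat_mult_powr_exp:
  assumes "t > 0"
  shows "t powr q * exp (- b / (4 * t)) * heat t \<rho> =
    1 / (8 * (pi * sqrt pi)) * (t powr (q - 3 / 2) * exp (- (b + \<rho>) / (4 * t)))"
proof -
  have "(4 * pi) powr (- (3 / 2)) = 1 / (8 * (pi * sqrt pi))"
  proof -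
    have "(4 * pi) powr (3 / 2) = (4 * pi) * (4 * pi) powr (1 / 2)"
      using powr_add[of "4 * pi" 1 "1 / 2"] by simp
    then show ?thesis by (simp add: powr_minus_divide powr_half_sqrt real_sqrt_mult)
  qed
  moreover have "heat t \<rho> = (4 * pi) powr (- (3 / 2)) * (t powr (- (3 / 2)) * exp (- \<rho> / (4 * t)))"
    unfolding heat_def by (simp add: powr_mult)
  moreover have "t powr q * t powr (- (3 / 2)) = t powr (q - 3 / 2)"
    by (simp flip: powr_add)
  moreover have "exp (- b / (4 * t)) * exp (- \<rho> / (4 * t)) = exp (- (b + \<rho>) / (4 * t))"
    by (simp add: add_divide_distrib diff_divide_distrib flip: exp_add)
  moreover have "a * b * (c * (d * e)) = c * ((a * d) * (b * e))" for a b c d e :: real by simp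
  ultimately show ?thesis by (simp only:)
qed

text \<open>Subordination densities: the Laplace transforms of this weight and of
  \<open>newton_weight\<close> at |\<xi>|^2 are exp (-y |\<xi>|) and exp (-y |\<xi>|) / |\<xi>|, so
  integrating heat kernels against them produces \<open>poisson y\<close> and
  \<open>newton y\<close>.\<close>

definition poisson_weight :: "real \<Rightarrow> real \<Rightarrow> real" where
  "poisson_weight y t = y / 2 * t powr (- (3 / 2)) * exp (- y\<^sup>2 / (4 * t)) / sqrt pi"

definition newton_weight :: "real \<Rightarrow> real \<Rightarrow> real" where
  "newton_weight y t = t powr (- (1 / 2)) * exp (- y\<^sup>2 / (4 * t)) / sqrt pi"

lemma weight_measurable [measurable]:
  "poisson_weight y \<in> borel_measurable borel" "newton_weight y \<in> borel_measurable borel"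
  unfolding poisson_weight_def[abs_def] newton_weight_def[abs_def] by measurable

lemma poisson_weight_heat:
  assumes "y > 0" "\<rho> \<ge> 0"
  shows "has_bochner_integral lborel (\<lambda>t. indicator {0<..} t * (poisson_weight y t * heat t \<rho>)) (poisson y \<rho>)"
proof -
  have A: "y\<^sup>2 + \<rho> > 0" using assms by (simp add: add_pos_nonneg)
  have "has_bochner_integral lborel (\<lambda>t. (y / (16 * pi\<^sup>2)) * (indicator {0<..} t * (t powr (- 3) * exp (- (y\<^sup>2 + \<rho>) / (4 * t)))))
      ((y / (16 * pi\<^sup>2)) * (16 / (y\<^sup>2 + \<rho>)\<^sup>2))"
    by (rule has_bochner_integral_mult_right) (rule integral_inverse_power_exp(1)[OF A])
  moreover have "(y / (16 * pi\<^sup>2)) * (16 / (y\<^sup>2 + \<rho>)\<^sup>2) = poisson y \<rho>"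
    by (simp add: poisson_def)
  moreover have "(y / (16 * pi\<^sup>2)) * (indicator {0<..} t * (t powr (- 3) * exp (- (y\<^sup>2 + \<rho>) / (4 * t)))) =
      indicator {0<..} t * (poisson_weight y t * heat t \<rho>)" for t
  proof (cases "t > 0")
    case True
    have "poisson_weight y t * heat t \<rho> = y / (2 * sqrt pi) * (t powr (- (3 / 2)) * exp (- y\<^sup>2 / (4 * t)) * heat t \<rho>)"
      by (simp add: poisson_weight_def)
    also have "\<dots> = y / (16 * (pi * (sqrt pi * sqrt pi))) * (t powr (- 3) * exp (- (y\<^sup>2 + \<rho>) / (4 * t)))"
      unfolding heat_mult_powr_exp[OF True] by simp
    finally show ?thesis using True by (simp add: power2_eq_square)
  qed simp
  ultimately show ?thesis by simp
qed

lemma newton_weight_heat: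
  assumes "y > 0" "\<rho> \<ge> 0"
  shows "has_bochner_integral lborel (\<lambda>t. indicator {0<..} t * (newton_weight y t * heat t \<rho>)) (newton y \<rho>)"
proof -
  have A: "y\<^sup>2 + \<rho> > 0" using assms by (simp add: add_pos_nonneg)
  have "has_bochner_integral lborel (\<lambda>t. (1 / (8 * pi\<^sup>2)) * (indicator {0<..} t * (t powr (- 2) * exp (- (y\<^sup>2 + \<rho>) / (4 * t)))))
      ((1 / (8 * pi\<^sup>2)) * (4 / (y\<^sup>2 + \<rho>)))"
    by (rule has_bochner_integral_mult_right) (rule integral_inverse_power_exp(2)[OF A])
  moreover have "(1 / (8 * pi\<^sup>2)) * (4 / (y\<^sup>2 + \<rho>)) = newton y \<rho>"
    by (simp add: newton_def)
  moreover have "(1 / (8 * pi\<^sup>2)) * (indicator {0<..} t * (t powr (- 2) * exp (- (y\<^sup>2 + \<rho>) / (4 * t)))) =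
      indicator {0<..} t * (newton_weight y t * heat t \<rho>)" for t
  proof (cases "t > 0")
    case True
    have "newton_weight y t * heat t \<rho> = 1 / sqrt pi * (t powr (- (1 / 2)) * exp (- y\<^sup>2 / (4 * t)) * heat t \<rho>)"
      by (simp add: newton_weight_def)
    also have "\<dots> = 1 / (8 * (pi * (sqrt pi * sqrt pi))) * (t powr (- 2) * exp (- (y\<^sup>2 + \<rho>) / (4 * t)))"
      unfolding heat_mult_powr_exp[OF True] by simp
    finally show ?thesis using True by (simp add: power2_eq_square)
  qed simp
  ultimately show ?thesis by simp
qed

lemma poisson_weight_exp:
  assumes "y > 0" "z > 0"
  shows "has_bochner_integral lborel (\<lambda>t. indicator {0<..} t * (poisson_weight y t * exp (- t * z\<^sup>2))) (exp (- y * z))"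
proof -
  have "has_bochner_integral lborel
      (\<lambda>t. (1 / sqrt pi) * (indicator {0<..} t * (y / 2 * t powr (- (3 / 2)) * exp (- y\<^sup>2 / (4 * t) - t * z\<^sup>2))))
      ((1 / sqrt pi) * (sqrt pi * exp (- y * z)))"
    by (rule has_bochner_integral_mult_right) (rule subordination_integrals(2)[OF assms])
  moreover have "(1 / sqrt pi) * (indicator {0<..} t * (y / 2 * t powr (- (3 / 2)) * exp (- y\<^sup>2 / (4 * t) - t * z\<^sup>2))) =
      indicator {0<..} t * (poisson_weight y t * exp (- t * z\<^sup>2))" for t
  proof -
    have e: "exp (- y\<^sup>2 / (4 * t) - t * z\<^sup>2) = exp (- y\<^sup>2 / (4 * t)) * exp (- t * z\<^sup>2)"
      by (simp flip: exp_add)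
    show ?thesis unfolding e poisson_weight_def by simp
  qed
  ultimately show ?thesis by simp
qed

lemma newton_weight_exp:
  assumes "y > 0" "z > 0"
  shows "has_bochner_integral lborel (\<lambda>t. indicator {0<..} t * (newton_weight y t * exp (- t * z\<^sup>2))) (exp (- y * z) / z)"
proof -
  have "has_bochner_integral lborel
      (\<lambda>t. (1 / sqrt pi) * (indicator {0<..} t * (t powr (- (1 / 2)) * exp (- y\<^sup>2 / (4 * t) - t * z\<^sup>2))))
      ((1 / sqrt pi) * (sqrt pi * exp (- y * z) / z))"
    by (rule has_bochner_integral_mult_right) (rule subordination_integrals(1)[OF assms])
  moreover have "(1 / sqrt pi) * (indicator {0<..} t * (t powr (- (1 / 2)) * exp (- y\<^sup>2 / (4 * t) - t * z\<^sup>2))) =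
      indicator {0<..} t * (newton_weight y t * exp (- t * z\<^sup>2))" for t
  proof -
    have e: "exp (- y\<^sup>2 / (4 * t) - t * z\<^sup>2) = exp (- y\<^sup>2 / (4 * t)) * exp (- t * z\<^sup>2)"
      by (simp flip: exp_add)
    show ?thesis unfolding e newton_weight_def by simp
  qed
  ultimately show ?thesis by simp
qed

lemma exp_norm_fourier:
  fixes x :: "'a::euclidean_space"
  assumes dim: "DIM('a) = 3" and y: "y > 0"
  shows "has_bochner_integral lborel (\<lambda>\<xi>. exp (- y * norm \<xi>) *\<^sub>R cis (x \<bullet> \<xi>))
    (complex_of_real ((2 * pi) ^ 3 * poisson y (x \<bullet> x)))"
proof -
  define M where "M z = (LINT s|lborel. indicator {0<..} s * (poisson_weight y s * exp (- s * z)))" for z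
  have "has_bochner_integral lborel (\<lambda>s. (y / (2 * sqrt pi)) * (indicator {0<..} s * (s powr (- 3) * exp (- y\<^sup>2 / (4 * s)))))
      ((y / (2 * sqrt pi)) * (16 / (y\<^sup>2)\<^sup>2))"
    using y by (intro has_bochner_integral_mult_right integral_inverse_power_exp) auto
  moreover have "(y / (2 * sqrt pi)) * (indicator {0<..} s * (s powr (- 3) * exp (- y\<^sup>2 / (4 * s)))) =
      indicator {0<..} s * (poisson_weight y s * s powr (- (3 / 2)))" for s
  proof -
    have "s powr (- 3) = s powr (- (3 / 2)) * s powr (- (3 / 2))" by (simp flip: powr_add)
    then show ?thesis by (simp add: poisson_weight_def)
  qed
  ultimately have "integrable lborel (\<lambda>s. indicator {0<..} s * (poisson_weight y s * s powr (- (3 / 2))))"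
    by (simp add: has_bochner_integral_iff)
  note sup = gaussian_superposition[OF dim weight_measurable(1) this, of x, folded M_def]
  have M: "M (\<xi> \<bullet> \<xi>) = exp (- y * norm \<xi>)" if "\<xi> \<noteq> 0" for \<xi> :: 'a
    using has_bochner_integral_integral_eq[OF poisson_weight_exp[OF y, of "norm \<xi>"]] that
    by (simp add: M_def power2_norm_eq_inner)
  \<comment> \<open>The subordination formula is stated for positive z only; the exceptional
    frequency 0 is a null set.\<close>
  have "AE \<xi>::'a in lborel. \<xi> \<noteq> 0"
    using AE_lborel_singleton[of "0::'a"] by simp
  then have ae: "AE \<xi>::'a in lborel. M (\<xi> \<bullet> \<xi>) *\<^sub>R cis (x \<bullet> \<xi>) = exp (- y * norm \<xi>) *\<^sub>R cis (x \<bullet> \<xi>)"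
    by eventually_elim (simp add: M)
  have meas: "(\<lambda>\<xi>. exp (- y * norm \<xi>) *\<^sub>R cis (x \<bullet> \<xi>)) \<in> borel_measurable lborel"
    by (simp, intro borel_measurable_continuous_onI continuous_intros)
  have "integrable lborel (\<lambda>\<xi>. exp (- y * norm \<xi>) *\<^sub>R cis (x \<bullet> \<xi>))"
    using sup(1) by (subst (asm) integrable_cong_AE[OF borel_measurable_integrable[OF sup(1)] meas ae])
  moreover have "(LINT \<xi>|lborel. exp (- y * norm \<xi>) *\<^sub>R cis (x \<bullet> \<xi>)) = (LINT \<xi>|lborel. M (\<xi> \<bullet> \<xi>) *\<^sub>R cis (x \<bullet> \<xi>))"
    by (rule integral_cong_AE[OF borel_measurable_integrable[OF sup(1)] meas ae, symmetric])
  moreover have "x \<bullet> x \<ge> 0" by simp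
  ultimately show ?thesis
    using sup(2) has_bochner_integral_integral_eq[OF poisson_weight_heat[OF y, of "x \<bullet> x"]]
    by (simp add: has_bochner_integral_iff)
qed

text \<open>At infinity \<open>newton_weight\<close> decays only like t^(-1/2); in the difference
  the leading terms cancel and leave t^(-3/2), which is integrable.\<close>

definition weight_diff :: "real \<Rightarrow> real \<Rightarrow> real \<Rightarrow> real" where
  "weight_diff y Y t = indicator {0<..} t * (newton_weight y t - newton_weight Y t)"

lemma weight_diff_measurable [measurable]: "weight_diff y Y \<in> borel_measurable borel"
  unfolding weight_diff_def[abs_def] by measurable

lemma weight_diff_nonneg:
  assumes "0 < y" "y < Y"
  shows "weight_diff y Y t \<ge> 0"
proof (cases "t > 0")
  case True
  have "exp (- Y\<^sup>2 / (4 * t)) \<le> exp (- y\<^sup>2 / (4 * t))"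
    using True assms by (simp add: divide_right_mono power_mono)
  then show ?thesis
    using True by (simp add: weight_diff_def newton_weight_def divide_right_mono mult_left_mono)
qed (simp add: weight_diff_def)

text \<open>The factor 1 + 1 / t^2 is lost when 1 / (t + |x|^2)^2 is compared with 1 / (1 + |x|^4)
  in \<open>half_heat_equation_imp_poisson\<close>. Near 0 the factor exp (-y^2 / (4 t)) absorbs it,
  and the majorant is a multiple of (1 + t)^(-3/2).\<close>

lemma weight_diff_integrable:
  assumes "0 < y" "y < Y"
  shows "integrable lborel (\<lambda>t. weight_diff y Y t * (1 + 1 / t\<^sup>2))"
proof -
  define K where "K = exp (y\<^sup>2 / 4) * fact 4 / (y\<^sup>2 / 4) ^ 4"
  have K: "K > 0" using assms by (simp add: K_def)
  define c where "c = (Y\<^sup>2 - y\<^sup>2) / 4 / sqrt pi * K"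
  have Yy: "Y\<^sup>2 - y\<^sup>2 \<ge> 0" using assms by (simp add: power_mono)
  have "has_bochner_integral lborel (\<lambda>t::real. indicator {0..} t * (if t \<ge> 0 then (1 + t) powr (- (3 / 2)) else 0)) (0 - (- 2 * (1 + 0) powr (- (1 / 2))))"
  proof (rule FTC_nonneg_atLeast[where G = "\<lambda>t. - 2 * (1 + t) powr (- (1 / 2))" and S = "{}"])
    show "continuous_on {0..} (\<lambda>t::real. - 2 * (1 + t) powr (- (1 / 2)))"
      by (intro continuous_intros) auto
    show "((\<lambda>t. - 2 * (1 + t) powr (- (1 / 2))) has_real_derivative (if t \<ge> 0 then (1 + t) powr (- (3 / 2)) else 0)) (at t)"
      if "t > 0" for t :: real
      using that by (auto intro!: derivative_eq_intros)
    show "((\<lambda>t::real. - 2 * (1 + t) powr (- (1 / 2))) \<longlongrightarrow> 0) at_top" by real_asymp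
  qed auto
  then have int: "integrable lborel (\<lambda>t::real. c * (indicator {0..} t * (if t \<ge> 0 then (1 + t) powr (- (3 / 2)) else 0)))"
    by (auto simp: has_bochner_integral_iff)
  show ?thesis
  proof (rule Bochner_Integration.integrable_bound[OF int])
    show "AE t in lborel. norm (weight_diff y Y t * (1 + 1 / t\<^sup>2)) \<le>
        norm (c * (indicator {0..} t * (if t \<ge> 0 then (1 + t) powr (- (3 / 2)) else 0)))"
    proof (intro AE_I2)
      fix t :: real
      show "norm (weight_diff y Y t * (1 + 1 / t\<^sup>2)) \<le>
        norm (c * (indicator {0..} t * (if t \<ge> 0 then (1 + t) powr (- (3 / 2)) else 0)))"
      proof (cases "t > 0")
        case True
        \<comment> \<open>The inequality 1 - exp (-a) \<le> a with a = (Y^2 - y^2) / (4 t) supplies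
          the extra factor 1 / t.\<close>
        have 1: "exp (- y\<^sup>2 / (4 * t)) - exp (- Y\<^sup>2 / (4 * t)) \<le> (Y\<^sup>2 - y\<^sup>2) / (4 * t) * exp (- y\<^sup>2 / (4 * t))"
        proof -
          have "exp (- Y\<^sup>2 / (4 * t)) = exp (- y\<^sup>2 / (4 * t)) * exp (- ((Y\<^sup>2 - y\<^sup>2) / (4 * t)))"
            by (simp add: diff_divide_distrib flip: exp_add)
          moreover have "1 - (Y\<^sup>2 - y\<^sup>2) / (4 * t) \<le> exp (- ((Y\<^sup>2 - y\<^sup>2) / (4 * t)))"
            using exp_ge_add_one_self[of "- ((Y\<^sup>2 - y\<^sup>2) / (4 * t))"] by simp
          then have "exp (- y\<^sup>2 / (4 * t)) * (1 - (Y\<^sup>2 - y\<^sup>2) / (4 * t)) \<le> exp (- y\<^sup>2 / (4 * t)) * exp (- ((Y\<^sup>2 - y\<^sup>2) / (4 * t)))"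
            by (intro mult_left_mono) auto
          ultimately show ?thesis by (simp add: algebra_simps)
        qed
        \<comment> \<open>\<open>power_mult_exp_neg_le\<close> at w = 1 / t with exponent 4: the
          power t^4 outweighs the factors t^(-1/2), t^(-1) and t^(-2) near 0.\<close>
        have 2: "exp (- y\<^sup>2 / (4 * t)) \<le> K * t ^ 4 / (1 + t) ^ 4"
        proof -
          have "(1 + 1 / t) ^ 4 * exp (- (y\<^sup>2 / 4) * (1 / t)) \<le> K"
            unfolding K_def using True assms by (intro power_mult_exp_neg_le) auto
          moreover have "1 + 1 / t = (1 + t) / t" using True by (simp add: field_simps)
          ultimately show ?thesis using True by (simp add: power_divide field_simps)
        qed
        have "weight_diff y Y t = t powr (- (1 / 2)) / sqrt pi * (exp (- y\<^sup>2 / (4 * t)) - exp (- Y\<^sup>2 / (4 * t)))"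
          using True by (simp add: weight_diff_def newton_weight_def diff_divide_distrib right_diff_distrib)
        also have "\<dots> \<le> t powr (- (1 / 2)) / sqrt pi * ((Y\<^sup>2 - y\<^sup>2) / (4 * t) * (K * t ^ 4 / (1 + t) ^ 4))"
        proof -
          have "exp (- y\<^sup>2 / (4 * t)) - exp (- Y\<^sup>2 / (4 * t)) \<le> (Y\<^sup>2 - y\<^sup>2) / (4 * t) * (K * t ^ 4 / (1 + t) ^ 4)"
            using 1 mult_left_mono[OF 2, of "(Y\<^sup>2 - y\<^sup>2) / (4 * t)"] Yy True by fastforce
          then show ?thesis by (intro mult_left_mono) auto
        qed
        finally have "weight_diff y Y t * (1 + 1 / t\<^sup>2) \<le>
            t powr (- (1 / 2)) / sqrt pi * ((Y\<^sup>2 - y\<^sup>2) / (4 * t) * (K * t ^ 4 / (1 + t) ^ 4)) * (1 + 1 / t\<^sup>2)"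
          by (intro mult_right_mono) auto
        also have "\<dots> = c * (t powr (- (1 / 2)) * t * ((t\<^sup>2 + 1) / (1 + t) ^ 4))"
        proof -
          have "P / s * (Z / (4 * t) * (K * t ^ 4 / D)) * (1 + 1 / t\<^sup>2) = Z / 4 / s * K * (P * t * ((t\<^sup>2 + 1) / D))"
            if "s > 0" "D > 0" for P s Z D :: real
            using that True by (simp add: field_simps power4_eq_xxxx power2_eq_square)
          then show ?thesis unfolding c_def using True by simp
        qed
        also have "t powr (- (1 / 2)) * t = t powr (1 / 2)"
          using True powr_add[of t "- (1 / 2)" 1] by simp
        also have "c * (t powr (1 / 2) * ((t\<^sup>2 + 1) / (1 + t) ^ 4)) \<le> c * ((1 + t) powr (1 / 2) * (1 / (1 + t)\<^sup>2))"
        proof (intro mult_left_mono mult_mono)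
          show "t powr (1 / 2) \<le> (1 + t) powr (1 / 2)" using True by (intro powr_mono2) auto
          have "t\<^sup>2 + 1 \<le> (1 + t)\<^sup>2" using True by (simp add: power2_eq_square algebra_simps)
          then show "(t\<^sup>2 + 1) / (1 + t) ^ 4 \<le> 1 / (1 + t)\<^sup>2"
            using True by (simp add: divide_le_eq power4_eq_xxxx power2_eq_square)
          show "c \<ge> 0" using Yy K by (simp add: c_def)
        qed (use True in auto)
        also have "(1 + t) powr (1 / 2) * (1 / (1 + t)\<^sup>2) = (1 + t) powr (- (3 / 2))"
          using True powr_diff[of "1 + t" "1 / 2" 2] by simp
        finally have "weight_diff y Y t * (1 + 1 / t\<^sup>2) \<le> c * (1 + t) powr (- (3 / 2))" .
        moreover have "weight_diff y Y t * (1 + 1 / t\<^sup>2) \<ge> 0"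
          using weight_diff_nonneg[OF assms, of t] by (intro mult_nonneg_nonneg) auto
        ultimately show ?thesis using True by simp
      qed (simp add: weight_diff_def)
    qed
  qed simp
qed

text \<open>On the Fourier side, |\<xi>| times the Laplace transform of the weight at |\<xi>|^2 is
  exp (-y |\<xi>|) - exp (-Y |\<xi>|). The weight is nonnegative, so integrability of this
  difference gives absolute convergence of the double integral.\<close>

lemma weight_diff_half_heat:
  fixes x :: "'a::euclidean_space"
  assumes dim: "DIM('a) = 3" and y: "0 < y" "y < Y"
  shows "(LINT t|lborel. weight_diff y Y t * half_heat t (x \<bullet> x)) = poisson y (x \<bullet> x) - poisson Y (x \<bullet> x)"
proof -
  define F where "F \<xi> t = (weight_diff y Y t * exp (- t * (norm \<xi>)\<^sup>2)) *\<^sub>R (norm \<xi> *\<^sub>R cis (x \<bullet> \<xi>))" for \<xi> :: 'a and t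
  have cis_meas [measurable]: "(\<lambda>\<xi>. cis (x \<bullet> \<xi>)) \<in> borel_measurable borel"
    by (intro borel_measurable_continuous_onI continuous_intros)
  have [measurable]: "case_prod F \<in> borel_measurable (lborel \<Otimes>\<^sub>M lborel)"
    unfolding F_def by measurable
  define E where "E (\<xi>::'a) = exp (- y * norm \<xi>) - exp (- Y * norm \<xi>)" for \<xi>
  have wd: "has_bochner_integral lborel (\<lambda>t. weight_diff y Y t * exp (- t * z\<^sup>2)) (exp (- y * z) / z - exp (- Y * z) / z)"
    if "z > 0" for z
  proof -
    have "has_bochner_integral lborel (\<lambda>t. indicator {0<..} t * (newton_weight y t * exp (- t * z\<^sup>2)) -
        indicator {0<..} t * (newton_weight Y t * exp (- t * z\<^sup>2))) (exp (- y * z) / z - exp (- Y * z) / z)"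
      using y that by (intro has_bochner_integral_diff newton_weight_exp) auto
    then show ?thesis by (simp add: weight_diff_def algebra_simps)
  qed
  have I: "has_bochner_integral lborel (F \<xi>) (E \<xi> *\<^sub>R cis (x \<bullet> \<xi>))" for \<xi>
  proof (cases "\<xi> = 0")
    case False
    then have n: "norm \<xi> > 0" by simp
    have "has_bochner_integral lborel (F \<xi>) ((exp (- y * norm \<xi>) / norm \<xi> - exp (- Y * norm \<xi>) / norm \<xi>) *\<^sub>R (norm \<xi> *\<^sub>R cis (x \<bullet> \<xi>)))"
      unfolding F_def by (rule has_bochner_integral_scaleR_left) (rule wd[OF n])
    moreover have "(exp (- y * norm \<xi>) / norm \<xi> - exp (- Y * norm \<xi>) / norm \<xi>) * norm \<xi> = E \<xi>"
      using n by (simp add: E_def field_simps)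
    ultimately show ?thesis by simp
  qed (simp add: F_def[abs_def] E_def has_bochner_integral_zero)
  have E_nonneg: "E \<xi> \<ge> 0" for \<xi>
    unfolding E_def using y by (simp add: mult_right_mono)
  have n: "norm (F \<xi> t) = (weight_diff y Y t * exp (- t * (norm \<xi>)\<^sup>2)) * norm \<xi>" for \<xi> t
    using weight_diff_nonneg[OF y, of t] by (simp add: F_def abs_mult)
  have N: "(LINT t|lborel. norm (F \<xi> t)) = E \<xi>" for \<xi>
  proof (cases "\<xi> = 0")
    case False
    then have z: "norm \<xi> > 0" by simp
    then have "(exp (- y * norm \<xi>) / norm \<xi> - exp (- Y * norm \<xi>) / norm \<xi>) * norm \<xi> = E \<xi>"
      by (simp add: E_def field_simps)
    then show ?thesis
      unfolding n
      using has_bochner_integral_integral_eq[OF has_bochner_integral_mult_left[OF wd[OF z], of "norm \<xi>"]]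
      by (simp only:)
  qed (simp add: n E_def)
  have Ei: "integrable lborel E"
  proof -
    have "integrable lborel (\<lambda>\<xi>::'a. complex_of_real (exp (- c * norm \<xi>)))" if "c > 0" for c
      using exp_norm_fourier[OF dim that, of 0] by (simp add: has_bochner_integral_iff scaleR_conv_of_real)
    then show ?thesis unfolding E_def complex_of_real_integrable_eq using y by auto
  qed
  have FI: "integrable (lborel \<Otimes>\<^sub>M lborel) (case_prod F)"
  proof (rule lborel_pair.Fubini_integrable)
    show "integrable lborel (\<lambda>\<xi>. LINT t|lborel. norm (case_prod F (\<xi>, t)))" using Ei by (simp add: N)
    show "AE \<xi> in lborel. integrable lborel (\<lambda>t. case_prod F (\<xi>, t))"
      using I by (auto simp: has_bochner_integral_iff)
  qed auto
  have "(LINT t|lborel. complex_of_real ((2 * pi) ^ 3 * (weight_diff y Y t * half_heat t (x \<bullet> x)))) =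
      (LINT t|lborel. (LINT \<xi>|lborel. F \<xi> t))"
  proof (rule Bochner_Integration.integral_cong[OF refl])
    fix t
    show "complex_of_real ((2 * pi) ^ 3 * (weight_diff y Y t * half_heat t (x \<bullet> x))) = (LINT \<xi>|lborel. F \<xi> t)"
    proof (cases "t > 0")
      case True
      have "(LINT \<xi>|lborel. F \<xi> t) = (LINT \<xi>|lborel. weight_diff y Y t *\<^sub>R ((norm \<xi> * exp (- t * (\<xi> \<bullet> \<xi>))) *\<^sub>R cis (x \<bullet> \<xi>)))"
        by (simp add: F_def power2_norm_eq_inner mult_ac)
      also have "\<dots> = weight_diff y Y t *\<^sub>R complex_of_real ((2 * pi) ^ 3 * half_heat t (x \<bullet> x))"
        by (simp only: integral_scaleR_right half_heat_fourier[OF True dim])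
      finally show ?thesis by (simp add: scaleR_conv_of_real)
    qed (simp add: F_def weight_diff_def)
  qed
  also have "\<dots> = (LINT \<xi>|lborel. (LINT t|lborel. F \<xi> t))"
    using lborel_pair.Fubini_integral[OF FI] by simp
  also have "\<dots> = (LINT \<xi>|lborel. exp (- y * norm \<xi>) *\<^sub>R cis (x \<bullet> \<xi>) - exp (- Y * norm \<xi>) *\<^sub>R cis (x \<bullet> \<xi>))"
    using I by (simp add: has_bochner_integral_iff E_def scaleR_left_diff_distrib)
  also have "\<dots> = complex_of_real ((2 * pi) ^ 3 * poisson y (x \<bullet> x)) - complex_of_real ((2 * pi) ^ 3 * poisson Y (x \<bullet> x))"
    using y by (intro has_bochner_integral_integral_eq has_bochner_integral_diff exp_norm_fourier dim) auto
  finally have "(2 * pi) ^ 3 * (LINT t|lborel. weight_diff y Y t * half_heat t (x \<bullet> x)) =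
      (2 * pi) ^ 3 * (poisson y (x \<bullet> x) - poisson Y (x \<bullet> x))"
    by (simp only: integral_complex_of_real integral_mult_right_zero of_real_eq_iff right_diff_distrib flip: of_real_diff)
  then show ?thesis by (subst (asm) mult_cancel_left) simp
qed

text \<open>The equation tested with Gaussians is integrated over t against
  \<open>weight_diff\<close>, which turns heat kernels into \<open>newton\<close> and their half
  Laplacians into \<open>poisson\<close>. Fubini rests on the left on the decay of
  \<open>half_heat\<close> together with \<open>weight_diff_integrable\<close>, on the right on the
  boundedness of \<open>newton\<close>.\<close>

lemma half_heat_equation_imp_poisson:
  fixes v f :: "'a::euclidean_space \<Rightarrow> real"
  assumes dim: "DIM('a) = 3" and y: "0 < y" "y < Y"
    and [measurable]: "v \<in> borel_measurable borel"
    and v: "integrable lborel (\<lambda>x. \<bar>v x\<bar> / (1 + norm x ^ 4))"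
    and f: "integrable lborel f"
    and eq: "\<And>t. t > 0 \<Longrightarrow> (LINT x|lborel. v x * half_heat t (x \<bullet> x)) = (LINT x|lborel. f x * heat t (x \<bullet> x))"
  shows "(LINT x|lborel. v x * (poisson y (x \<bullet> x) - poisson Y (x \<bullet> x))) =
    (LINT x|lborel. f x * (newton y (x \<bullet> x) - newton Y (x \<bullet> x)))"
proof -
  have [measurable]: "f \<in> borel_measurable borel" using borel_measurable_integrable[OF f] by simp
  define n where "n = weight_diff y Y"
  have [measurable]: "n \<in> borel_measurable borel" by (simp add: n_def)
  have n0: "n t \<ge> 0" for t using weight_diff_nonneg[OF y] by (simp add: n_def)
  have nt: "n t = 0" if "\<not> t > 0" for t using that by (simp add: n_def weight_diff_def)
  have bound: "\<bar>v x * half_heat t (x \<bullet> x)\<bar> \<le> 2 * heat_bound * (1 + 1 / t\<^sup>2) * (\<bar>v x\<bar> / (1 + norm x ^ 4))" if "t > 0" for t x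
  proof -
    have "1 + norm x ^ 4 \<le> (1 + 1 / t\<^sup>2) * (t + x \<bullet> x)\<^sup>2"
    proof -
      define r where "r = x \<bullet> x"
      have r: "r \<ge> 0" "norm x ^ 4 = r\<^sup>2"
        by (simp_all add: r_def power2_norm_eq_inner[symmetric])
      \<comment> \<open>The two squares dominate the two summands of 1 + r^2, whatever the size of
        t.\<close>
      have "(1 + 1 / t\<^sup>2) * (t + r)\<^sup>2 = (t + r)\<^sup>2 + (1 + r / t)\<^sup>2"
        using that by (simp add: field_simps power2_eq_square)
      moreover have "r\<^sup>2 \<le> (t + r)\<^sup>2" using that r by (intro power_mono) auto
      moreover have "1 \<le> (1 + r / t)\<^sup>2" using that r by simp
      ultimately show ?thesis using r by (simp add: r_def)
    qed
    moreover have p: "(t + x \<bullet> x)\<^sup>2 > 0" "1 + norm x ^ 4 > 0"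
      using add_pos_nonneg[OF that inner_ge_zero[of x]] by (simp_all add: add_pos_nonneg)
    ultimately have "1 / (t + x \<bullet> x)\<^sup>2 \<le> (1 + 1 / t\<^sup>2) / (1 + norm x ^ 4)"
      by (simp add: divide_le_eq le_divide_eq mult.commute)
    then have "\<bar>half_heat t (x \<bullet> x)\<bar> \<le> 2 * heat_bound * ((1 + 1 / t\<^sup>2) / (1 + norm x ^ 4))"
      using heat_diff_integrable(2)[OF that, of "x \<bullet> x"] heat_bound_pos
        mult_left_mono[of "1 / (t + x \<bullet> x)\<^sup>2" "(1 + 1 / t\<^sup>2) / (1 + norm x ^ 4)" "2 * heat_bound"]
      by simp
    then have "\<bar>v x\<bar> * \<bar>half_heat t (x \<bullet> x)\<bar> \<le> \<bar>v x\<bar> * (2 * heat_bound * ((1 + 1 / t\<^sup>2) / (1 + norm x ^ 4)))"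
      by (intro mult_left_mono) auto
    then show ?thesis by (simp add: abs_mult mult_ac)
  qed
  have iv: "integrable lborel (\<lambda>x. v x * half_heat t (x \<bullet> x))" if "t > 0" for t
  proof (rule Bochner_Integration.integrable_bound)
    show "integrable lborel (\<lambda>x. 2 * heat_bound * (1 + 1 / t\<^sup>2) * (\<bar>v x\<bar> / (1 + norm x ^ 4)))"
      by (rule integrable_mult_right) (rule v)
    show "AE x in lborel. norm (v x * half_heat t (x \<bullet> x)) \<le>
        norm (2 * heat_bound * (1 + 1 / t\<^sup>2) * (\<bar>v x\<bar> / (1 + norm x ^ 4)))"
      unfolding real_norm_def by (intro AE_I2 order_trans[OF bound[OF that] abs_ge_self])
  qed simp
  define Cv where "Cv = (LINT x|lborel. \<bar>v x\<bar> / (1 + norm x ^ 4))"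
  define G where "G t x = n t * (v x * half_heat t (x \<bullet> x))" for t x
  have [measurable]: "case_prod G \<in> borel_measurable (lborel \<Otimes>\<^sub>M lborel)"
    unfolding G_def by measurable
  have GI: "integrable (lborel \<Otimes>\<^sub>M lborel) (case_prod G)"
  proof (rule lborel_pair.Fubini_integrable)
    show "integrable lborel (\<lambda>t. LINT x|lborel. norm (case_prod G (t, x)))"
    proof (rule Bochner_Integration.integrable_bound)
      show "integrable lborel (\<lambda>t. 2 * heat_bound * Cv * (n t * (1 + 1 / t\<^sup>2)))"
        using weight_diff_integrable[OF y] by (simp add: n_def)
      show "AE t in lborel. norm (LINT x|lborel. norm (case_prod G (t, x))) \<le> norm (2 * heat_bound * Cv * (n t * (1 + 1 / t\<^sup>2)))"
      proof (intro AE_I2)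
        fix t
        show "norm (LINT x|lborel. norm (case_prod G (t, x))) \<le> norm (2 * heat_bound * Cv * (n t * (1 + 1 / t\<^sup>2)))"
        proof (cases "t > 0")
          case True
          have "(LINT x|lborel. norm (G t x)) \<le> (LINT x|lborel. n t * (2 * heat_bound * (1 + 1 / t\<^sup>2)) * (\<bar>v x\<bar> / (1 + norm x ^ 4)))"
          proof (rule integral_mono)
            show "integrable lborel (\<lambda>x. norm (G t x))" using iv[OF True] by (simp add: G_def)
            show "integrable lborel (\<lambda>x. n t * (2 * heat_bound * (1 + 1 / t\<^sup>2)) * (\<bar>v x\<bar> / (1 + norm x ^ 4)))"
              by (rule integrable_mult_right) (rule v)
            show "norm (G t x) \<le> n t * (2 * heat_bound * (1 + 1 / t\<^sup>2)) * (\<bar>v x\<bar> / (1 + norm x ^ 4))" for x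
              using mult_left_mono[OF bound[OF True, of x] n0[of t]] n0[of t] by (simp add: G_def abs_mult mult.assoc)
          qed
          also have "\<dots> = 2 * heat_bound * Cv * (n t * (1 + 1 / t\<^sup>2))"
            by (simp only: integral_mult_right_zero Cv_def) simp
          finally show ?thesis
            by (simp add: abs_of_nonneg[OF integral_nonneg_AE] order_trans[OF _ abs_ge_self])
        qed (simp add: G_def nt)
      qed
    qed auto
    show "AE t in lborel. integrable lborel (\<lambda>x. case_prod G (t, x))"
    proof (intro AE_I2)
      fix t show "integrable lborel (\<lambda>x. case_prod G (t, x))"
        using iv[of t] by (cases "t > 0") (auto simp: G_def nt)
    qed
  qed auto
  define F where "F t x = n t * (f x * heat t (x \<bullet> x))" for t x
  have [measurable]: "case_prod F \<in> borel_measurable (lborel \<Otimes>\<^sub>M lborel)"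
    unfolding F_def by measurable
  have nh: "has_bochner_integral lborel (\<lambda>t. n t * heat t (x \<bullet> x)) (newton y (x \<bullet> x) - newton Y (x \<bullet> x))" for x :: 'a
  proof -
    have "has_bochner_integral lborel (\<lambda>t. indicator {0<..} t * (newton_weight y t * heat t (x \<bullet> x)) -
        indicator {0<..} t * (newton_weight Y t * heat t (x \<bullet> x))) (newton y (x \<bullet> x) - newton Y (x \<bullet> x))"
      using y by (intro has_bochner_integral_diff newton_weight_heat) auto
    then show ?thesis by (simp add: n_def weight_diff_def algebra_simps)
  qed
  have FI: "integrable (lborel \<Otimes>\<^sub>M lborel) (\<lambda>(x, t). F t x)"
  proof (rule lborel_pair.Fubini_integrable)
    have nF: "norm (F t x) = \<bar>f x\<bar> * (n t * heat t (x \<bullet> x))" for t x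
      using n0[of t] heat_nonneg[of t "x \<bullet> x"] by (simp add: F_def abs_mult)
    have eqn: "(LINT t|lborel. norm (F t x)) = \<bar>f x\<bar> * (newton y (x \<bullet> x) - newton Y (x \<bullet> x))" for x
      unfolding nF using has_bochner_integral_integral_eq[OF nh[of x]] by simp
    have nn: "\<bar>newton y r - newton Y r\<bar> \<le> newton y 0 + newton Y 0" if "r \<ge> 0" for r
    proof -
      have "0 \<le> newton c r \<and> newton c r \<le> newton c 0" if "c > 0" for c
        unfolding newton_def using that \<open>r \<ge> 0\<close> by (auto intro!: divide_left_mono mult_pos_pos simp: add_pos_nonneg)
      from this[of y] this[of Y] show ?thesis using y by (simp add: abs_le_iff)
    qed
    have "integrable lborel (\<lambda>x. \<bar>f x\<bar> * (newton y (x \<bullet> x) - newton Y (x \<bullet> x)))"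
    proof (rule Bochner_Integration.integrable_bound)
      show "integrable lborel (\<lambda>x. \<bar>f x\<bar> * (newton y 0 + newton Y 0))" using f by auto
      show "(\<lambda>x. \<bar>f x\<bar> * (newton y (x \<bullet> x) - newton Y (x \<bullet> x))) \<in> borel_measurable lborel"
        unfolding newton_def by measurable
      show "AE x in lborel. norm (\<bar>f x\<bar> * (newton y (x \<bullet> x) - newton Y (x \<bullet> x))) \<le> norm (\<bar>f x\<bar> * (newton y 0 + newton Y 0))"
        using nn by (auto simp: abs_mult intro!: mult_left_mono order_trans[OF nn abs_ge_self])
    qed
    then show "integrable lborel (\<lambda>x. LINT t|lborel. norm (case (x, t) of (x, t) \<Rightarrow> F t x))"
      by (simp only: prod.case eqn)
    show "AE x in lborel. integrable lborel (\<lambda>t. case (x, t) of (x, t) \<Rightarrow> F t x)"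
    proof (intro AE_I2)
      fix x
      have "integrable lborel (\<lambda>t. f x * (n t * heat t (x \<bullet> x)))" using nh[of x] by (auto simp: has_bochner_integral_iff)
      then show "integrable lborel (\<lambda>t. case (x, t) of (x, t) \<Rightarrow> F t x)" by (simp add: F_def mult_ac)
    qed
  qed measurable
  have "(LINT x|lborel. v x * (poisson y (x \<bullet> x) - poisson Y (x \<bullet> x))) = (LINT x|lborel. (LINT t|lborel. G t x))"
  proof (rule Bochner_Integration.integral_cong[OF refl])
    fix x
    have "(LINT t|lborel. G t x) = (LINT t|lborel. v x * (n t * half_heat t (x \<bullet> x)))"
      by (simp add: G_def mult_ac)
    then show "v x * (poisson y (x \<bullet> x) - poisson Y (x \<bullet> x)) = (LINT t|lborel. G t x)"
      using weight_diff_half_heat[OF dim y, of x] by (simp add: n_def)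
  qed
  also have "\<dots> = (LINT t|lborel. (LINT x|lborel. G t x))"
    using lborel_pair.Fubini_integral[OF GI] .
  also have "\<dots> = (LINT t|lborel. (LINT x|lborel. F t x))"
  proof (rule Bochner_Integration.integral_cong[OF refl])
    fix t show "(LINT x|lborel. G t x) = (LINT x|lborel. F t x)"
      using eq[of t] by (cases "t > 0") (simp_all add: G_def F_def nt)
  qed
  also have "\<dots> = (LINT x|lborel. (LINT t|lborel. F t x))"
    using lborel_pair.Fubini_integral[OF FI] .
  also have "\<dots> = (LINT x|lborel. f x * (newton y (x \<bullet> x) - newton Y (x \<bullet> x)))"
  proof (rule Bochner_Integration.integral_cong[OF refl])
    fix x
    have "(LINT t|lborel. F t x) = (LINT t|lborel. f x * (n t * heat t (x \<bullet> x)))"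
      by (simp add: F_def mult_ac)
    then show "(LINT t|lborel. F t x) = f x * (newton y (x \<bullet> x) - newton Y (x \<bullet> x))"
      using has_bochner_integral_integral_eq[OF nh[of x]] by simp
  qed
  finally show ?thesis .
qed

subsection \<open>The Riesz potential in dimension three\<close>

lemma continuous_mult_ln_abs: "continuous_on UNIV (\<lambda>z::real. z * ln \<bar>z\<bar>)"
proof (rule continuous_at_imp_continuous_on, rule ballI)
  fix z :: real
  show "isCont (\<lambda>z. z * ln \<bar>z\<bar>) z"
  proof (cases "z = 0")
    case False
    then show ?thesis by (intro continuous_intros) auto
  next
    case True
    have "((\<lambda>z. z * ln \<bar>z\<bar>) \<longlongrightarrow> 0) (at_right (0::real))" by real_asymp
    moreover have "((\<lambda>z. z * ln \<bar>z\<bar>) \<longlongrightarrow> 0) (at_left (0::real))" by real_asymp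
    ultimately have "((\<lambda>z. z * ln \<bar>z\<bar>) \<longlongrightarrow> 0) (at (0::real))" by (simp add: filterlim_split_at)
    then show ?thesis using True by (simp add: isCont_def)
  qed
qed

text \<open>By the conventions for division by 0 and \<open>ln 0\<close> the value at r = s is 0, so
  that products with r - s extend continuously across the singularity.\<close>

definition log_ratio :: "real \<Rightarrow> real \<Rightarrow> real" where
  "log_ratio r s = ln ((r + s) / \<bar>r - s\<bar>)"

lemma log_ratio_measurable [measurable (raw)]:
  assumes [measurable]: "f \<in> borel_measurable M" "g \<in> borel_measurable M"
  shows "(\<lambda>x. log_ratio (f x) (g x)) \<in> borel_measurable M"
  unfolding log_ratio_def by measurable

lemma log_ratio_same [simp]: "log_ratio s s = 0"
  by (simp add: log_ratio_def)

lemma log_ratio_nonneg: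
  assumes "r \<ge> 0" "s \<ge> 0"
  shows "log_ratio r s \<ge> 0"
  using assms by (cases "r = s") (auto simp: log_ratio_def field_simps intro!: ln_ge_zero)

lemma log_ratio_eq:
  assumes "r \<ge> 0" "s > 0" "r \<noteq> s"
  shows "log_ratio r s = ln (r + s) - ln \<bar>r - s\<bar>"
  unfolding log_ratio_def using assms by (intro ln_divide_pos) auto

text \<open>The factor \<rho> - s^2 = (sqrt \<rho> + s) (sqrt \<rho> - s) tames the logarithm, since
  z ln |z| is continuous at 0.\<close>

lemma continuous_diff_mult_log_ratio:
  assumes s: "s > 0"
  shows "continuous_on {0..} (\<lambda>\<rho>. (\<rho> - s\<^sup>2) * log_ratio (sqrt \<rho>) s)"
proof -
  have "(\<rho> - s\<^sup>2) * log_ratio (sqrt \<rho>) s =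
      (sqrt \<rho> + s) * ((sqrt \<rho> - s) * ln (sqrt \<rho> + s) - (sqrt \<rho> - s) * ln \<bar>sqrt \<rho> - s\<bar>)" if "\<rho> \<ge> 0" for \<rho>
  proof (cases "sqrt \<rho> = s")
    case False
    have e: "(\<rho> - s\<^sup>2) * B = (sqrt \<rho> + s) * ((sqrt \<rho> - s) * B)" for B
    proof -
      have "(sqrt \<rho> + s) * (sqrt \<rho> - s) = \<rho> - s\<^sup>2"
        using that by (simp add: algebra_simps power2_eq_square)
      then show ?thesis by (metis mult.assoc)
    qed
    show ?thesis
      unfolding e using False that s by (simp add: log_ratio_eq right_diff_distrib)
  qed simp
  moreover have "continuous_on {0..} (\<lambda>\<rho>. (sqrt \<rho> + s) * ((sqrt \<rho> - s) * ln (sqrt \<rho> + s) - (sqrt \<rho> - s) * ln \<bar>sqrt \<rho> - s\<bar>))"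
  proof -
    have "sqrt x + s \<noteq> 0" if "x \<ge> 0" for x using s that real_sqrt_ge_zero[of x] by linarith
    then show ?thesis
      by (intro continuous_on_mult continuous_on_diff continuous_on_add continuous_on_ln
          continuous_on_compose2[OF continuous_mult_ln_abs] continuous_intros) auto
  qed
  ultimately show ?thesis
    by (subst continuous_on_cong[OF refl]) auto
qed

lemma log_ratio_deriv:
  assumes "\<rho> > 0" "s > 0" "\<rho> \<noteq> s\<^sup>2"
  shows "((\<lambda>\<rho>. log_ratio (sqrt \<rho>) s) has_real_derivative - s / ((\<rho> - s\<^sup>2) * sqrt \<rho>)) (at \<rho>)"
proof -
  have ne: "sqrt \<rho> \<noteq> s" using assms by auto
  have "\<forall>\<^sub>F x in nhds \<rho>. x > 0 \<and> sqrt x \<noteq> s"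
  proof -
    have "\<forall>\<^sub>F x in nhds \<rho>. x \<in> {0<..} - {s\<^sup>2}"
      using assms by (intro eventually_nhds_in_open) (auto intro!: open_Diff)
    then show ?thesis by eventually_elim (use assms in auto)
  qed
  then have ev: "\<forall>\<^sub>F x in nhds \<rho>. log_ratio (sqrt x) s = ln (sqrt x + s) - ln \<bar>sqrt x - s\<bar>"
    by eventually_elim (use assms in \<open>simp add: log_ratio_eq\<close>)
  have p: "sqrt \<rho> + s > 0" using assms by (simp add: add_pos_pos)
  have d1: "((\<lambda>x. sqrt x + s) has_real_derivative inverse (sqrt \<rho>) / 2) (at \<rho>)"
    "((\<lambda>x. sqrt x - s) has_real_derivative inverse (sqrt \<rho>) / 2) (at \<rho>)"
    using assms by (auto intro!: derivative_eq_intros)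
  have l: "((\<lambda>z. ln \<bar>z\<bar>) has_real_derivative 1 / z) (at z)" if "z \<noteq> 0" for z :: real
  proof (cases "z > 0")
    case True
    have "\<forall>\<^sub>F x in nhds z. ln \<bar>x\<bar> = ln x"
      using eventually_nhds_in_open[of "{0<..}" z] True by (auto elim!: eventually_mono)
    from iffD2[OF DERIV_cong_ev[OF refl this refl] DERIV_ln_divide[OF True]] show ?thesis .
  next
    case False
    have "\<forall>\<^sub>F x in nhds z. ln \<bar>x\<bar> = ln (- x)"
      using eventually_nhds_in_open[of "{..<0}" z] False that by (auto elim!: eventually_mono)
    moreover have "((\<lambda>x. ln (- x)) has_real_derivative 1 / z) (at z)"
      using False that by (auto intro!: derivative_eq_intros)
    ultimately show ?thesis by (subst DERIV_cong_ev[OF refl _ refl])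
  qed
  have "((\<lambda>x. ln (sqrt x + s) - ln \<bar>sqrt x - s\<bar>) has_real_derivative
      1 / (sqrt \<rho> + s) * (inverse (sqrt \<rho>) / 2) - 1 / (sqrt \<rho> - s) * (inverse (sqrt \<rho>) / 2)) (at \<rho>)"
    using ne p by (intro DERIV_diff DERIV_chain2[OF DERIV_ln_divide] DERIV_chain2[OF l] d1) auto
  moreover have "1 / (sqrt \<rho> + s) * (inverse (sqrt \<rho>) / 2) - 1 / (sqrt \<rho> - s) * (inverse (sqrt \<rho>) / 2) =
      - s / ((\<rho> - s\<^sup>2) * sqrt \<rho>)"
  proof -
    have "1 / (a + s) * (inverse a / 2) - 1 / (a - s) * (inverse a / 2) = - s / ((a\<^sup>2 - s\<^sup>2) * a)"
      if "a > 0" "a - s \<noteq> 0" "a + s \<noteq> 0" for a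
    proof -
      have "a\<^sup>2 - s\<^sup>2 = (a + s) * (a - s)" by (simp add: algebra_simps power2_eq_square)
      then show ?thesis using that by (simp add: divide_simps)
    qed
    from this[of "sqrt \<rho>"] show ?thesis using assms ne p by simp
  qed
  ultimately show ?thesis
    using DERIV_cong_ev[OF refl ev refl] by simp
qed

text \<open>The average of \<open>1 / |x - y|\<^sup>2\<close> over all \<open>x\<close> in three-space with \<open>|x|\<^sup>2 = \<rho>\<close>, where \<open>s = |y|\<close>.\<close>

definition riesz_kernel :: "real \<Rightarrow> real \<Rightarrow> real" where
  "riesz_kernel \<rho> s = log_ratio (sqrt \<rho>) s / (2 * sqrt \<rho> * s)"

lemma riesz_kernel_measurable [measurable (raw)]:
  assumes [measurable]: "f \<in> borel_measurable M" "g \<in> borel_measurable M"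
  shows "(\<lambda>x. riesz_kernel (f x) (g x)) \<in> borel_measurable M"
  unfolding riesz_kernel_def by measurable

lemma riesz_kernel_nonneg: "\<rho> \<ge> 0 \<Longrightarrow> s \<ge> 0 \<Longrightarrow> riesz_kernel \<rho> s \<ge> 0"
  by (simp add: riesz_kernel_def log_ratio_nonneg)

lemma radial_weight_3:
  assumes "\<rho> \<ge> 0"
  shows "radial_weight 3 \<rho> = 2 * pi * sqrt \<rho>"
  using assms unit_ball_vol_numeral(2)[of Num.One]
  by (auto simp: radial_weight_def eval_unit_ball_vol powr_half_sqrt)

lemma radial_weight_riesz_kernel:
  assumes "\<rho> \<ge> 0" "s > 0"
  shows "radial_weight 3 \<rho> * riesz_kernel \<rho> s = pi / s * (if \<rho> = 0 then 0 else log_ratio (sqrt \<rho>) s)"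
  using assms by (simp add: radial_weight_3 riesz_kernel_def field_simps)

text \<open>In Fourier terms 1 / (2 pi^2 |x|^2) has symbol 1 / |\<xi>|, so its convolution with
  \<open>poisson y\<close> is \<open>newton y\<close>; taking spherical means reduces the
  convolution at distance s to this integral. The value is obtained from an explicit primitive in
  \<rho>.\<close>

lemma riesz_kernel_poisson:
  assumes s: "s > 0" and y: "y > 0" and dim: "DIM('a::euclidean_space) = 3"
  shows "has_bochner_integral lborel (\<lambda>x::'a. riesz_kernel (x \<bullet> x) s * poisson y (x \<bullet> x)) (2 * pi\<^sup>2 * newton y (s\<^sup>2))"
proof -
  \<comment> \<open>From integration by parts: (\<rho> - s^2) / ((y^2 + \<rho>) (s^2 + y^2)) is the
    primitive of 1 / (y^2 + \<rho>)^2 that vanishes at \<rho> = s^2, where the logarithm is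
    singular.\<close>
  define G where "G \<rho> = y / (pi * s) * ((\<rho> - s\<^sup>2) * log_ratio (sqrt \<rho>) s / ((y\<^sup>2 + \<rho>) * (s\<^sup>2 + y\<^sup>2)) +
      2 * s * arctan (sqrt \<rho> / y) / (y * (s\<^sup>2 + y\<^sup>2)))" for \<rho>
  define g where "g \<rho> = (if \<rho> \<ge> 0 then radial_weight 3 \<rho> * (riesz_kernel \<rho> s * poisson y \<rho>) else 0)" for \<rho>
  have [measurable]: "g \<in> borel_measurable borel"
    unfolding g_def poisson_def by measurable
  have yr: "y\<^sup>2 + \<rho> > 0" if "\<rho> \<ge> 0" for \<rho> using y that by (simp add: add_pos_nonneg)
  have ys: "s\<^sup>2 + y\<^sup>2 > 0" using y s by (simp add: add_pos_pos)
  have "has_bochner_integral lborel (\<lambda>\<rho>. indicator {0..} \<rho> * g \<rho>)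
      (y / (pi * s) * (0 + 2 * s * (pi / 2) / (y * (s\<^sup>2 + y\<^sup>2))) - G 0)"
  proof (rule FTC_nonneg_atLeast[where S = "{s\<^sup>2}"])
    show "continuous_on {0..} G"
      unfolding G_def using ys
      by (intro continuous_intros continuous_diff_mult_log_ratio[OF s]) (use yr y in \<open>auto simp: less_imp_neq[symmetric]\<close>)
    show "(G has_real_derivative g \<rho>) (at \<rho>)" if "\<rho> > 0" "\<rho> \<notin> {s\<^sup>2}" for \<rho>
    proof -
      define l where "l = log_ratio (sqrt \<rho>) s"
      have \<rho>: "\<rho> > 0" "\<rho> - s\<^sup>2 \<noteq> 0" using that by auto
      have e: "1 + (sqrt \<rho> / y)\<^sup>2 = (y\<^sup>2 + \<rho>) / y\<^sup>2" using \<rho> y by (simp add: power_divide field_simps)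
      have "((\<lambda>\<rho>. (\<rho> - s\<^sup>2) * log_ratio (sqrt \<rho>) s) has_real_derivative
          1 * l + (- s / ((\<rho> - s\<^sup>2) * sqrt \<rho>)) * (\<rho> - s\<^sup>2)) (at \<rho>)"
        unfolding l_def using \<rho> s by (intro DERIV_mult log_ratio_deriv) (auto intro!: derivative_eq_intros)
      then have d1: "((\<lambda>\<rho>. (\<rho> - s\<^sup>2) * log_ratio (sqrt \<rho>) s) has_real_derivative l - s / sqrt \<rho>) (at \<rho>)"
        using \<rho> by simp
      have d2: "((\<lambda>\<rho>. arctan (sqrt \<rho> / y)) has_real_derivative inverse ((y\<^sup>2 + \<rho>) / y\<^sup>2) * (inverse (sqrt \<rho>) / 2 / y)) (at \<rho>)"
        unfolding e[symmetric] using \<rho>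
        by (intro DERIV_chain2[OF DERIV_arctan] DERIV_cdivide DERIV_real_sqrt) auto
      have d3: "((\<lambda>\<rho>. (y\<^sup>2 + \<rho>) * (s\<^sup>2 + y\<^sup>2)) has_real_derivative s\<^sup>2 + y\<^sup>2) (at \<rho>)"
        by (auto intro!: derivative_eq_intros)
      have "(G has_real_derivative y / (pi * s) * (((l - s / sqrt \<rho>) * ((y\<^sup>2 + \<rho>) * (s\<^sup>2 + y\<^sup>2)) -
          ((\<rho> - s\<^sup>2) * l) * (s\<^sup>2 + y\<^sup>2)) / (((y\<^sup>2 + \<rho>) * (s\<^sup>2 + y\<^sup>2)) * ((y\<^sup>2 + \<rho>) * (s\<^sup>2 + y\<^sup>2))) +
          2 * s * (inverse ((y\<^sup>2 + \<rho>) / y\<^sup>2) * (inverse (sqrt \<rho>) / 2 / y)) / (y * (s\<^sup>2 + y\<^sup>2)))) (at \<rho>)"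
        unfolding G_def l_def using \<rho> yr[of \<rho>] ys
        by (intro DERIV_cmult DERIV_add DERIV_divide DERIV_cdivide d1[unfolded l_def] d2 d3) auto
      moreover have "y / (pi * s) * (((l - s / sqrt \<rho>) * ((y\<^sup>2 + \<rho>) * (s\<^sup>2 + y\<^sup>2)) -
          ((\<rho> - s\<^sup>2) * l) * (s\<^sup>2 + y\<^sup>2)) / (((y\<^sup>2 + \<rho>) * (s\<^sup>2 + y\<^sup>2)) * ((y\<^sup>2 + \<rho>) * (s\<^sup>2 + y\<^sup>2))) +
          2 * s * (inverse ((y\<^sup>2 + \<rho>) / y\<^sup>2) * (inverse (sqrt \<rho>) / 2 / y)) / (y * (s\<^sup>2 + y\<^sup>2))) = g \<rho>"
      proof -
        define A where "A = y\<^sup>2 + \<rho>"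
        define B where "B = s\<^sup>2 + y\<^sup>2"
        define q where "q = sqrt \<rho>"
        have p: "A > 0" "B > 0" "q > 0" using yr[of \<rho>] ys \<rho> by (auto simp: A_def B_def q_def)
        have rs: "\<rho> - s\<^sup>2 = A - B" by (simp add: A_def B_def)
        have g: "g \<rho> = y / (pi * s) * (l / A\<^sup>2)"
          unfolding g_def using \<rho> s radial_weight_riesz_kernel[of \<rho> s] y
          by (simp add: mult.assoc[symmetric] l_def A_def poisson_def power2_eq_square) (simp add: mult_ac)
        have "((l - s / q) * (A * B) - ((A - B) * l) * B) / ((A * B) * (A * B)) +
            2 * s * (inverse (A / y\<^sup>2) * (inverse q / 2 / y)) / (y * B) = l / A\<^sup>2"
          using p y by (simp add: divide_simps) (simp add: algebra_simps power2_eq_square)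
        then show ?thesis
          unfolding g rs A_def[symmetric] B_def[symmetric] q_def[symmetric] by (simp only:)
      qed
      ultimately show ?thesis by (simp only:)
    qed
    show "0 \<le> g \<rho>" if "\<rho> \<ge> 0" for \<rho>
      using that s y by (simp add: g_def radial_weight_nonneg riesz_kernel_nonneg poisson_def)
    have "((\<lambda>\<rho>. (\<rho> - s\<^sup>2) * log_ratio (sqrt \<rho>) s / ((y\<^sup>2 + \<rho>) * (s\<^sup>2 + y\<^sup>2))) \<longlongrightarrow> 0) at_top"
      unfolding log_ratio_def using s ys y by real_asymp
    moreover have "((\<lambda>\<rho>. arctan (sqrt \<rho> / y)) \<longlongrightarrow> pi / 2) at_top"
    proof -
      have "filterlim (\<lambda>\<rho>. sqrt \<rho> / y) at_top at_top" using y by real_asymp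
      then show ?thesis by (rule filterlim_compose[OF tendsto_arctan_at_top])
    qed
    ultimately show "(G \<longlongrightarrow> y / (pi * s) * (0 + 2 * s * (pi / 2) / (y * (s\<^sup>2 + y\<^sup>2)))) at_top"
      unfolding G_def using y ys by (intro tendsto_mult_left tendsto_add tendsto_divide tendsto_const) auto
  qed simp_all
  moreover have "indicator {0..} \<rho> * g \<rho> = radial_weight 3 \<rho> * (riesz_kernel \<rho> s * poisson y \<rho>)" for \<rho>
    by (auto simp: g_def indicator_def radial_weight_def)
  moreover have "y / (pi * s) * (0 + 2 * s * (pi / 2) / (y * (s\<^sup>2 + y\<^sup>2))) - G 0 = 2 * pi\<^sup>2 * newton y (s\<^sup>2)"
  proof -
    have "G 0 = 0" using s by (simp add: G_def log_ratio_def)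
    then show ?thesis using s y by (simp add: newton_def add.commute)
  qed
  ultimately have *: "has_bochner_integral lborel (\<lambda>\<rho>. radial_weight 3 \<rho> * (riesz_kernel \<rho> s * poisson y \<rho>)) (2 * pi\<^sup>2 * newton y (s\<^sup>2))"
    by simp
  have m: "(\<lambda>\<rho>. riesz_kernel \<rho> s * poisson y \<rho>) \<in> borel_measurable borel"
    unfolding poisson_def by measurable
  show ?thesis
    using * integrable_radial_iff[OF m, where 'a = 'a] integral_radial[OF m, where 'a = 'a] dim
    by (simp add: has_bochner_integral_iff)
qed

lemma poisson_integral:
  assumes y: "y > 0" and dim: "DIM('a::euclidean_space) = 3"
  shows "has_bochner_integral lborel (\<lambda>x::'a. poisson y (x \<bullet> x)) 1"
proof -
  define G where "G \<rho> = 2 * y / pi * (arctan (sqrt \<rho> / y) / y - sqrt \<rho> / (y\<^sup>2 + \<rho>))" for \<rho>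
  define g where "g \<rho> = (if \<rho> \<ge> 0 then radial_weight 3 \<rho> * poisson y \<rho> else 0)" for \<rho>
  have [measurable]: "g \<in> borel_measurable borel"
    unfolding g_def poisson_def by measurable
  have yr: "y\<^sup>2 + \<rho> > 0" if "\<rho> \<ge> 0" for \<rho> using y that by (simp add: add_pos_nonneg)
  have "has_bochner_integral lborel (\<lambda>\<rho>. indicator {0..} \<rho> * g \<rho>) (2 * y / pi * (pi / 2 / y - 0) - G 0)"
  proof (rule FTC_nonneg_atLeast[where S = "{}"])
    show "continuous_on {0..} G"
      unfolding G_def by (intro continuous_intros) (use yr y in \<open>auto simp: less_imp_neq[symmetric]\<close>)
    show "(G has_real_derivative g \<rho>) (at \<rho>)" if \<rho>: "\<rho> > 0" for \<rho>
    proof -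
      have e: "1 + (sqrt \<rho> / y)\<^sup>2 = (y\<^sup>2 + \<rho>) / y\<^sup>2" using \<rho> y by (simp add: power_divide field_simps)
      have d2: "((\<lambda>\<rho>. arctan (sqrt \<rho> / y)) has_real_derivative inverse ((y\<^sup>2 + \<rho>) / y\<^sup>2) * (inverse (sqrt \<rho>) / 2 / y)) (at \<rho>)"
        unfolding e[symmetric] using \<rho>
        by (intro DERIV_chain2[OF DERIV_arctan] DERIV_cdivide DERIV_real_sqrt) auto
      have d3: "((\<lambda>\<rho>. y\<^sup>2 + \<rho>) has_real_derivative 1) (at \<rho>)"
        by (auto intro!: derivative_eq_intros)
      have "(G has_real_derivative 2 * y / pi * (inverse ((y\<^sup>2 + \<rho>) / y\<^sup>2) * (inverse (sqrt \<rho>) / 2 / y) / y -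
          ((inverse (sqrt \<rho>) / 2) * (y\<^sup>2 + \<rho>) - sqrt \<rho> * 1) / ((y\<^sup>2 + \<rho>) * (y\<^sup>2 + \<rho>)))) (at \<rho>)"
        unfolding G_def using \<rho> yr[of \<rho>]
        by (intro DERIV_cmult DERIV_diff DERIV_divide DERIV_cdivide DERIV_real_sqrt d2 d3) auto
      moreover have "2 * y / pi * (inverse ((y\<^sup>2 + \<rho>) / y\<^sup>2) * (inverse (sqrt \<rho>) / 2 / y) / y -
          ((inverse (sqrt \<rho>) / 2) * (y\<^sup>2 + \<rho>) - sqrt \<rho> * 1) / ((y\<^sup>2 + \<rho>) * (y\<^sup>2 + \<rho>))) = g \<rho>"
      proof -
        define A where "A = y\<^sup>2 + \<rho>"
        define q where "q = sqrt \<rho>"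
        have p: "A > 0" "q > 0" using yr[of \<rho>] \<rho> by (auto simp: A_def q_def)
        have g: "g \<rho> = 2 * y / pi * (q / A\<^sup>2)"
          unfolding g_def using \<rho> by (simp add: radial_weight_3 A_def q_def poisson_def power2_eq_square)
        have "inverse (A / y\<^sup>2) * (inverse q / 2 / y) / y - ((inverse q / 2) * A - q * 1) / (A * A) = q / A\<^sup>2"
          using p y by (simp add: divide_simps) (simp add: algebra_simps power2_eq_square)
        then show ?thesis unfolding g A_def[symmetric] q_def[symmetric] by (simp only:)
      qed
      ultimately show ?thesis by (simp only:)
    qed
    show "0 \<le> g \<rho>" if "\<rho> \<ge> 0" for \<rho>
      using that y by (simp add: g_def radial_weight_nonneg poisson_def)
    have "((\<lambda>\<rho>. sqrt \<rho> / (y\<^sup>2 + \<rho>)) \<longlongrightarrow> 0) at_top" using y by real_asymp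
    moreover have "((\<lambda>\<rho>. arctan (sqrt \<rho> / y)) \<longlongrightarrow> pi / 2) at_top"
    proof -
      have "filterlim (\<lambda>\<rho>. sqrt \<rho> / y) at_top at_top" using y by real_asymp
      then show ?thesis by (rule filterlim_compose[OF tendsto_arctan_at_top])
    qed
    ultimately show "(G \<longlongrightarrow> 2 * y / pi * (pi / 2 / y - 0)) at_top"
      unfolding G_def using y by (intro tendsto_mult_left tendsto_diff tendsto_divide tendsto_const) auto
  qed simp_all
  moreover have "indicator {0..} \<rho> * g \<rho> = radial_weight 3 \<rho> * poisson y \<rho>" for \<rho>
    by (auto simp: g_def indicator_def radial_weight_def)
  moreover have "2 * y / pi * (pi / 2 / y - 0) - G 0 = 1" using y by (simp add: G_def)
  ultimately have *: "has_bochner_integral lborel (\<lambda>\<rho>. radial_weight 3 \<rho> * poisson y \<rho>) 1"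
    by simp
  have m: "poisson y \<in> borel_measurable borel"
    unfolding poisson_def[abs_def] by measurable
  show ?thesis
    using * integrable_radial_iff[OF m, where 'a = 'a] integral_radial[OF m, where 'a = 'a] dim
    by (simp add: has_bochner_integral_iff)
qed

lemma FTC_integrable_Icc:
  fixes G g :: "real \<Rightarrow> real"
  assumes "a \<le> b" "finite S" "continuous_on {a..b} G"
    and "\<And>x. x \<in> {a<..<b} - S \<Longrightarrow> (G has_real_derivative g x) (at x)"
    and int: "integrable lborel (\<lambda>x. indicator {a..b} x * g x)"
  shows "(LINT x|lborel. indicator {a..b} x * g x) = G b - G a"
proof -
  have "(g has_integral G b - G a) {a..b}"
    using assms by (intro fundamental_theorem_of_calculus_interior_strong[of S])
      (auto simp: has_real_derivative_iff_has_vector_derivative)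
  then have "((\<lambda>x. if x \<in> {a..b} then g x else 0) has_integral G b - G a) UNIV"
    by (simp only: has_integral_restrict_UNIV)
  moreover have "(\<lambda>x. if x \<in> {a..b} then g x else 0) = (\<lambda>x. indicator {a..b} x * g x)"
    by (auto simp: indicator_def)
  ultimately have "((\<lambda>x. indicator {a..b} x * g x) has_integral G b - G a) UNIV" by simp
  with has_integral_integral_lborel[OF int] show ?thesis
    by (rule has_integral_unique)
qed

section \<open>Uniqueness for generalised Stieltjes transforms\<close>

lemma stieltjes_power_eq_0:
  fixes W :: "'a::euclidean_space \<Rightarrow> real"
  assumes W: "integrable lborel (\<lambda>x. W x / (1 + x \<bullet> x)\<^sup>2)" and [measurable]: "W \<in> borel_measurable borel"
    and zero: "\<And>\<sigma>. \<sigma> > 0 \<Longrightarrow> (LINT x|lborel. W x / (\<sigma> + x \<bullet> x)\<^sup>2) = 0"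
    and "\<sigma> > 0"
  shows "integrable lborel (\<lambda>x. W x / (\<sigma> + x \<bullet> x) ^ (k + 2))"
    and "(LINT x|lborel. W x / (\<sigma> + x \<bullet> x) ^ (k + 2)) = 0"
proof -
  have bound: "1 / (\<sigma> + r) ^ (k + 2) \<le> (1 / \<sigma> ^ k * (1 + 1 / \<sigma>)\<^sup>2) * (1 / (1 + r)\<^sup>2)"
    if "\<sigma> > 0" "r \<ge> 0" for \<sigma> r :: real and k
  proof -
    have "1 + r \<le> (1 + 1 / \<sigma>) * (\<sigma> + r)"
      using that by (simp add: field_simps)
    then have "(1 + r)\<^sup>2 \<le> ((1 + 1 / \<sigma>) * (\<sigma> + r))\<^sup>2"
      using that by (intro power_mono) auto
    moreover have "\<sigma> ^ k \<le> (\<sigma> + r) ^ k" using that by (intro power_mono) auto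
    ultimately have "(1 + r)\<^sup>2 * \<sigma> ^ k \<le> ((1 + 1 / \<sigma>) * (\<sigma> + r))\<^sup>2 * (\<sigma> + r) ^ k"
      using that by (intro mult_mono) auto
    also have "\<dots> = (1 + 1 / \<sigma>)\<^sup>2 * (\<sigma> + r) ^ (k + 2)"
      by (simp add: power_mult_distrib power_add power2_eq_square)
    finally have "(1 + r)\<^sup>2 * \<sigma> ^ k \<le> (1 + 1 / \<sigma>)\<^sup>2 * (\<sigma> + r) ^ (k + 2)" .
    then have "(1 + r)\<^sup>2 * \<sigma> ^ k * (1 / ((\<sigma> + r) ^ (k + 2) * ((1 + r)\<^sup>2 * \<sigma> ^ k))) \<le>
        (1 + 1 / \<sigma>)\<^sup>2 * (\<sigma> + r) ^ (k + 2) * (1 / ((\<sigma> + r) ^ (k + 2) * ((1 + r)\<^sup>2 * \<sigma> ^ k)))"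
      using that by (intro mult_right_mono) auto
    then show ?thesis
      using that by (simp add: add_pos_nonneg less_imp_neq[symmetric] mult.commute[of _ "\<sigma> ^ k"])
  qed
  have int: "integrable lborel (\<lambda>x. W x / (\<sigma> + x \<bullet> x) ^ (k + 2))" if "\<sigma> > 0" for \<sigma> k
  proof (rule Bochner_Integration.integrable_bound)
    show "integrable lborel (\<lambda>x. (1 / \<sigma> ^ k * (1 + 1 / \<sigma>)\<^sup>2) * (W x / (1 + x \<bullet> x)\<^sup>2))"
      by (rule integrable_mult_right) (rule W)
    show "AE x in lborel. norm (W x / (\<sigma> + x \<bullet> x) ^ (k + 2)) \<le> norm ((1 / \<sigma> ^ k * (1 + 1 / \<sigma>)\<^sup>2) * (W x / (1 + x \<bullet> x)\<^sup>2))"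
    proof (intro AE_I2)
      fix x :: 'a
      have "norm (W x / (\<sigma> + x \<bullet> x) ^ (k + 2)) = \<bar>W x\<bar> * (1 / (\<sigma> + x \<bullet> x) ^ (k + 2))"
        using that by (simp add: abs_divide power_abs abs_of_nonneg)
      also have "\<dots> \<le> \<bar>W x\<bar> * ((1 / \<sigma> ^ k * (1 + 1 / \<sigma>)\<^sup>2) * (1 / (1 + x \<bullet> x)\<^sup>2))"
        using bound[OF that, of "x \<bullet> x" k] by (intro mult_left_mono) auto
      also have "\<dots> = norm ((1 / \<sigma> ^ k * (1 + 1 / \<sigma>)\<^sup>2) * (W x / (1 + x \<bullet> x)\<^sup>2))"
        using that by (simp add: abs_mult abs_divide power_abs)
      finally show "norm (W x / (\<sigma> + x \<bullet> x) ^ (k + 2)) \<le> norm ((1 / \<sigma> ^ k * (1 + 1 / \<sigma>)\<^sup>2) * (W x / (1 + x \<bullet> x)\<^sup>2))" .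
    qed
  qed simp
  show "integrable lborel (\<lambda>x. W x / (\<sigma> + x \<bullet> x) ^ (k + 2))" by (rule int) fact
  show "(LINT x|lborel. W x / (\<sigma> + x \<bullet> x) ^ (k + 2)) = 0"
    using \<open>\<sigma> > 0\<close>
  proof (induction k arbitrary: \<sigma>)
    case 0
    show ?case using zero[OF 0] by (simp only: add_0)
  next
    case (Suc k)
    \<comment> \<open>Difference quotients in \<sigma> with step 1 / (m + 1): each induction step
      differentiates the vanishing transform once. By the mean value theorem every quotient is
      bounded by the derivative at the left end, which is the dominating function.\<close>
    define D where "D m x = real (Suc m) * (W x / (\<sigma> + x \<bullet> x) ^ (k + 2) - W x / (\<sigma> + 1 / real (Suc m) + x \<bullet> x) ^ (k + 2))" for m x
    have diff: "\<exists>z. a < z \<and> z < a + h \<and> 1 / a ^ (k + 2) - 1 / (a + h) ^ (k + 2) = h * (real (k + 2) / z ^ (k + 3))"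
      if "a > 0" "h > 0" for a h :: real
    proof -
      have "\<exists>z>a. z < a + h \<and> (- 1 / (a + h) ^ (k + 2)) - (- 1 / a ^ (k + 2)) = (a + h - a) * (real (k + 2) / z ^ (k + 3))"
      proof (rule MVT2)
        show "((\<lambda>z. - 1 / z ^ (k + 2)) has_real_derivative real (k + 2) / z ^ (k + 3)) (at z)"
          if "a \<le> z" "z \<le> a + h" for z
        proof -
          have z: "z > 0" using that \<open>a > 0\<close> by simp
          have "((\<lambda>z. - 1 / z ^ (k + 2)) has_real_derivative (0 * z ^ (k + 2) - (- 1) * (real (k + 2) * z ^ (k + 1))) / (z ^ (k + 2) * z ^ (k + 2))) (at z)"
            using z DERIV_pow[of "k + 2" z] by (intro DERIV_divide DERIV_const) auto
          moreover have "(0 * z ^ (k + 2) - (- 1) * (real (k + 2) * z ^ (k + 1))) / (z ^ (k + 2) * z ^ (k + 2)) = real (k + 2) / z ^ (k + 3)"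
          proof -
            have "(k + 2) + (k + 2) = (k + 1) + (k + 3)" by simp
            then have "z ^ (k + 2) * z ^ (k + 2) = z ^ (k + 1) * z ^ (k + 3)"
              unfolding power_add[symmetric] by (simp only:)
            then show ?thesis using z by (simp only:) simp
          qed
          ultimately show ?thesis by (simp only:)
        qed
      qed (use that in simp)
      then show ?thesis by auto
    qed
    have "(\<lambda>m. LINT x|lborel. D m x) \<longlonglongrightarrow> (LINT x|lborel. real (k + 2) * (W x / (\<sigma> + x \<bullet> x) ^ (Suc k + 2)))"
    proof (rule integral_dominated_convergence[where w = "\<lambda>x. real (k + 2) * \<bar>W x / (\<sigma> + x \<bullet> x) ^ (Suc k + 2)\<bar>"])
      show "integrable lborel (\<lambda>x. real (k + 2) * \<bar>W x / (\<sigma> + x \<bullet> x) ^ (Suc k + 2)\<bar>)"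
        by (intro integrable_mult_right integrable_abs int[OF Suc.prems])
      show "(\<lambda>x. real (k + 2) * (W x / (\<sigma> + x \<bullet> x) ^ (Suc k + 2))) \<in> borel_measurable lborel" by simp
      show "D m \<in> borel_measurable lborel" for m unfolding D_def by simp
      show "AE x in lborel. (\<lambda>m. D m x) \<longlonglongrightarrow> real (k + 2) * (W x / (\<sigma> + x \<bullet> x) ^ (Suc k + 2))"
      proof (intro AE_I2)
        fix x :: 'a
        define a where "a = \<sigma> + x \<bullet> x"
        have a: "a > 0" using Suc.prems by (simp add: a_def add_pos_nonneg)
        have "\<forall>m. \<exists>z. a < z \<and> z < a + 1 / real (Suc m) \<and>
            1 / a ^ (k + 2) - 1 / (a + 1 / real (Suc m)) ^ (k + 2) = 1 / real (Suc m) * (real (k + 2) / z ^ (k + 3))"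
          by (intro allI diff[OF a]) simp
        then obtain z where z: "\<And>m. a < z m" "\<And>m. z m < a + 1 / real (Suc m)"
          "\<And>m. 1 / a ^ (k + 2) - 1 / (a + 1 / real (Suc m)) ^ (k + 2) = 1 / real (Suc m) * (real (k + 2) / z m ^ (k + 3))"
          by metis
        have "z \<longlonglongrightarrow> a"
        proof (rule tendsto_sandwich[of "\<lambda>_. a" _ _ "\<lambda>m. a + 1 / real (Suc m)"])
          show "(\<lambda>m. a + 1 / real (Suc m)) \<longlonglongrightarrow> a"
            using tendsto_add[OF tendsto_const LIMSEQ_inverse_real_of_nat, of a] by (simp add: inverse_eq_divide)
        qed (use z in \<open>auto intro!: always_eventually less_imp_le simp del: of_nat_Suc\<close>)
        then have "(\<lambda>m. W x * (real (k + 2) / z m ^ (k + 3))) \<longlonglongrightarrow> W x * (real (k + 2) / a ^ (k + 3))"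
          using a by (intro tendsto_intros) auto
        moreover have "D m x = W x * (real (k + 2) / z m ^ (k + 3))" for m
        proof -
          have "D m x = real (Suc m) * (W x * (1 / a ^ (k + 2) - 1 / (a + 1 / real (Suc m)) ^ (k + 2)))"
            by (simp only: D_def a_def right_diff_distrib[of "W x"] times_divide_eq_right mult_1_right add.assoc add.commute[of _ "x \<bullet> x"])
          also have "\<dots> = W x * (real (k + 2) / z m ^ (k + 3))"
            unfolding z(3) by (simp del: of_nat_Suc)
          finally show ?thesis .
        qed
        moreover have "W x * (real (k + 2) / a ^ (k + 3)) = real (k + 2) * (W x / a ^ (Suc k + 2))"
          by (simp add: numeral_3_eq_3)
        ultimately show "(\<lambda>m. D m x) \<longlonglongrightarrow> real (k + 2) * (W x / (\<sigma> + x \<bullet> x) ^ (Suc k + 2))"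
          by (simp only: a_def)
      qed
      show "AE x in lborel. norm (D m x) \<le> real (k + 2) * \<bar>W x / (\<sigma> + x \<bullet> x) ^ (Suc k + 2)\<bar>" for m
      proof (intro AE_I2)
        fix x :: 'a
        define a where "a = \<sigma> + x \<bullet> x"
        have a: "a > 0" using Suc.prems by (simp add: a_def add_pos_nonneg)
        obtain z where z: "a < z" 
          "1 / a ^ (k + 2) - 1 / (a + 1 / real (Suc m)) ^ (k + 2) = 1 / real (Suc m) * (real (k + 2) / z ^ (k + 3))"
        proof -
          have "1 / real (Suc m) > 0" by simp
          from diff[OF a this] show ?thesis using that by blast
        qed
        have "D m x = real (Suc m) * (W x * (1 / a ^ (k + 2) - 1 / (a + 1 / real (Suc m)) ^ (k + 2)))"
          by (simp only: D_def a_def right_diff_distrib[of "W x"] times_divide_eq_right mult_1_right add.assoc add.commute[of _ "x \<bullet> x"])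
        also have "\<dots> = W x * (real (k + 2) / z ^ (k + 3))"
          unfolding z(2) by (simp del: of_nat_Suc)
        finally have "norm (D m x) = \<bar>W x\<bar> * (real (k + 2) / z ^ (k + 3))"
          using a z(1) by (simp add: abs_mult power_abs)
        also have "\<dots> \<le> \<bar>W x\<bar> * (real (k + 2) / a ^ (k + 3))"
          using a z(1) by (intro mult_left_mono divide_left_mono power_mono) auto
        also have "\<dots> = real (k + 2) * \<bar>W x / a ^ (Suc k + 2)\<bar>"
          using a by (simp add: abs_divide abs_mult power_abs numeral_3_eq_3)
        finally show "norm (D m x) \<le> real (k + 2) * \<bar>W x / (\<sigma> + x \<bullet> x) ^ (Suc k + 2)\<bar>"
          by (simp only: a_def)
      qed
    qed
    moreover have "(LINT x|lborel. D m x) = 0" for m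
    proof -
      have s: "\<sigma> + 1 / real (Suc m) > 0" using Suc.prems by (simp add: add_pos_pos)
      show ?thesis
        unfolding D_def integral_mult_right_zero
        by (subst Bochner_Integration.integral_diff[OF int[OF Suc.prems] int[OF s]])
          (simp only: Suc.IH[OF Suc.prems] Suc.IH[OF s], simp)
    qed
    ultimately have "(LINT x|lborel. real (k + 2) * (W x / (\<sigma> + x \<bullet> x) ^ (Suc k + 2))) = 0"
      by (simp only: LIMSEQ_const_iff)
    then show ?case by (simp only: integral_mult_right_zero) simp
  qed
qed

text \<open>In the variable \<open>t = 1 / (1 + |x|\<^sup>2)\<close> the vanishing integrals are the moments of a finite
  signed measure on the unit interval, so Weierstrass approximation applies.\<close>

lemma stieltjes_unique:
  fixes W :: "'a::euclidean_space \<Rightarrow> real"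
  assumes W: "integrable lborel (\<lambda>x. W x / (1 + x \<bullet> x)\<^sup>2)" and [measurable]: "W \<in> borel_measurable borel"
    and zero: "\<And>\<sigma>. \<sigma> > 0 \<Longrightarrow> (LINT x|lborel. W x / (\<sigma> + x \<bullet> x)\<^sup>2) = 0"
    and z: "continuous_on UNIV \<zeta>" "\<And>\<rho>. \<rho> \<ge> b \<Longrightarrow> \<zeta> \<rho> = 0"
  shows "(LINT x|lborel. W x * \<zeta> (x \<bullet> x)) = 0"
proof -
  have [measurable]: "\<zeta> \<in> borel_measurable borel" using z(1) by (rule borel_measurable_continuous_onI)
  define B where "B = max b 0"
  \<comment> \<open>Chosen so that \<zeta> (|x|^2) = c (t) t^2 for t = 1 / (1 + |x|^2); the factor
    t^2 goes into the finite signed measure \<open>W'\<close>. Infinity corresponds to t = 0, and c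
    vanishes near it because \<zeta> vanishes beyond b.\<close>
  define c where "c t = (if t \<le> 1 / (1 + B) then 0 else \<zeta> (1 / t - 1) / t\<^sup>2)" for t :: real
  have B: "B \<ge> 0" "b \<le> B" by (auto simp: B_def)
  have tB: "\<zeta> (1 / t - 1) / t\<^sup>2 = c t" if "t > 0" for t
  proof (cases "t \<le> 1 / (1 + B)")
    case True
    then have "1 / t \<ge> 1 + B" using that B by (simp add: field_simps)
    then have "\<zeta> (1 / t - 1) = 0" using B by (intro z(2)) linarith
    then show ?thesis using True by (simp only: c_def if_True div_0)
  qed (simp only: c_def if_False)
  have c: "continuous_on {0..1} c"
  proof -
    have "continuous_on ({0..1 / (1 + B)} \<union> {1 / (1 + B)..1}) c"
    proof (rule continuous_on_closed_Un)
      show "continuous_on {0..1 / (1 + B)} c"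
        by (rule continuous_on_eq[of _ "\<lambda>_. 0"]) (auto simp: c_def)
      have p: "x > 0" if "x \<in> {1 / (1 + B)..1}" for x
      proof -
        have "0 < 1 / (1 + B)" using B by simp
        then show ?thesis using that unfolding atLeastAtMost_iff by linarith
      qed
      have "continuous_on {1 / (1 + B)..1} (\<lambda>t. \<zeta> (1 / t - 1) / t\<^sup>2)"
        by (intro continuous_on_divide continuous_on_compose2[OF z(1)] continuous_on_diff
            continuous_on_power continuous_on_const continuous_on_id ballI subset_UNIV)
          (auto simp only: power_eq_0_iff dest!: p)
      then show "continuous_on {1 / (1 + B)..1} c"
        by (rule continuous_on_eq) (rule tB[OF p], assumption)
    qed auto
    moreover have "{0..1 / (1 + B)} \<union> {1 / (1 + B)..1} = {0..1}"
      using B by (intro ivl_disj_un_two_touch) (auto simp: divide_le_eq)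
    ultimately show ?thesis by (simp only:)
  qed
  define t where "t x = 1 / (1 + x \<bullet> x)" for x :: 'a
  have t: "t x > 0" "t x \<le> 1" for x by (auto simp: t_def add_pos_nonneg)
  have [measurable]: "t \<in> borel_measurable borel" unfolding t_def[abs_def] by simp
  define W' where "W' x = W x * (t x)\<^sup>2" for x
  have W': "integrable lborel W'" using W by (simp add: W'_def[abs_def] t_def power_divide)
  have zc: "W x * \<zeta> (x \<bullet> x) = W' x * c (t x)" for x
  proof -
    have "1 / t x - 1 = x \<bullet> x" by (simp add: t_def)
    then have c: "c (t x) = \<zeta> (x \<bullet> x) / (t x)\<^sup>2" using tB[OF t(1)[of x]] by (simp only:)
    have "t x \<noteq> 0" using t(1)[of x] by simp
    then show ?thesis unfolding c W'_def by simp
  qed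
  have mom: "integrable lborel (\<lambda>x. W' x * t x ^ k)" "(LINT x|lborel. W' x * t x ^ k) = 0" for k
  proof -
    have e: "W' x * t x ^ k = W x / (1 + x \<bullet> x) ^ (k + 2)" for x
      by (simp add: W'_def t_def power_divide power_add power2_eq_square mult.commute)
    show "integrable lborel (\<lambda>x. W' x * t x ^ k)" "(LINT x|lborel. W' x * t x ^ k) = 0"
      unfolding e by (rule stieltjes_power_eq_0[OF W _ zero]; simp)+
  qed
  have "\<bar>LINT x|lborel. W x * \<zeta> (x \<bullet> x)\<bar> \<le> e * (LINT x|lborel. \<bar>W' x\<bar>)" if e: "e > 0" for e
  proof -
    obtain p where p: "real_polynomial_function p" "\<And>s. s \<in> {0..1} \<Longrightarrow> \<bar>c s - p s\<bar> < e"
      using Stone_Weierstrass_real_polynomial_function[OF compact_Icc c e] by blast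
    obtain a n where pa: "p = (\<lambda>s. \<Sum>i\<le>n. a i * s ^ i)"
      using p(1) unfolding real_polynomial_function_iff_sum by blast
    have P: "W' x * p (t x) = (\<Sum>i\<le>n. a i * (W' x * t x ^ i))" for x
      by (simp add: pa sum_distrib_left mult_ac)
    have pi: "integrable lborel (\<lambda>x. W' x * p (t x))"
      unfolding P using mom by (intro Bochner_Integration.integrable_sum integrable_mult_right) auto
    have p0: "(LINT x|lborel. W' x * p (t x)) = 0"
      unfolding P using mom by (subst Bochner_Integration.integral_sum) auto
    have mz: "(\<lambda>x. W x * \<zeta> (x \<bullet> x)) \<in> borel_measurable lborel" by simp
    have le: "\<bar>W x * \<zeta> (x \<bullet> x) - W' x * p (t x)\<bar> \<le> e * \<bar>W' x\<bar>" for x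
    proof -
      have "\<bar>W' x\<bar> * \<bar>c (t x) - p (t x)\<bar> \<le> \<bar>W' x\<bar> * e"
        using p(2)[of "t x"] t[of x] by (intro mult_left_mono) auto
      then show ?thesis unfolding zc by (simp add: right_diff_distrib[symmetric] abs_mult mult.commute)
    qed
    have di: "integrable lborel (\<lambda>x. W x * \<zeta> (x \<bullet> x) - W' x * p (t x))"
    proof (rule Bochner_Integration.integrable_bound)
      show "integrable lborel (\<lambda>x. e * W' x)" using W' by simp
      show "AE x in lborel. norm (W x * \<zeta> (x \<bullet> x) - W' x * p (t x)) \<le> norm (e * W' x)"
        using le e by (auto simp: abs_mult)
      show "(\<lambda>x. W x * \<zeta> (x \<bullet> x) - W' x * p (t x)) \<in> borel_measurable lborel"
        using mz borel_measurable_integrable[OF pi] by (rule borel_measurable_diff)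
    qed
    have "integrable lborel (\<lambda>x. (W x * \<zeta> (x \<bullet> x) - W' x * p (t x)) + W' x * p (t x))"
      by (intro Bochner_Integration.integrable_add di pi)
    then have zi: "integrable lborel (\<lambda>x. W x * \<zeta> (x \<bullet> x))" by simp
    have "(LINT x|lborel. W x * \<zeta> (x \<bullet> x)) = (LINT x|lborel. W x * \<zeta> (x \<bullet> x) - W' x * p (t x))"
      using p0 by (simp add: Bochner_Integration.integral_diff[OF zi pi])
    also have "\<bar>\<dots>\<bar> \<le> (LINT x|lborel. \<bar>W x * \<zeta> (x \<bullet> x) - W' x * p (t x)\<bar>)"
      by (rule integral_abs_bound)
    also have "\<dots> \<le> (LINT x|lborel. e * \<bar>W' x\<bar>)"
      by (rule integral_mono) (use le di W' in \<open>auto intro!: integrable_abs\<close>)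
    also have "\<dots> = e * (LINT x|lborel. \<bar>W' x\<bar>)" by simp
    finally show ?thesis .
  qed
  moreover define M where "M = (LINT x|lborel. \<bar>W' x\<bar>)"
  ultimately have le: "\<bar>LINT x|lborel. W x * \<zeta> (x \<bullet> x)\<bar> \<le> e * M" if "e > 0" for e using that by simp
  have "M \<ge> 0" by (simp add: M_def)
  show ?thesis
  proof (rule ccontr)
    assume ne: "(LINT x|lborel. W x * \<zeta> (x \<bullet> x)) \<noteq> 0"
    define d where "d = \<bar>LINT x|lborel. W x * \<zeta> (x \<bullet> x)\<bar>"
    have d: "d > 0" using ne by (simp add: d_def)
    have "d \<le> d / (2 * (M + 1)) * M"
      using le[of "d / (2 * (M + 1))"] d \<open>M \<ge> 0\<close> by (simp add: d_def)
    moreover have "0 \<le> M * d" using d \<open>M \<ge> 0\<close> by simp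
    ultimately show False using d \<open>M \<ge> 0\<close> by (simp add: field_simps)
  qed
qed

text \<open>Let I be the potential of f with kernel \<open>riesz_kernel\<close>. By
  \<open>riesz_kernel_poisson\<close> the difference w = v - I / (2 pi^2) has the same integral c0
  against every Poisson kernel. These kernels have integral one, so w - c0 integrates to 0 against
  all of them, and \<open>stieltjes_unique\<close> applies. The constant c0 is invisible to \<zeta>,
  whose integral is 0.\<close>

lemma riesz_potential_pairing:
  fixes v f :: "'a::euclidean_space \<Rightarrow> real"
  assumes dim: "DIM('a) = 3"
    and [measurable]: "v \<in> borel_measurable borel"
    and v: "integrable lborel (\<lambda>x. \<bar>v x\<bar> / (1 + norm x ^ 4))"
    and f: "integrable lborel f" "\<And>x. f x \<ge> 0"
    and eq: "\<And>y Y. 0 < y \<Longrightarrow> y < Y \<Longrightarrow> (LINT x|lborel. v x * (poisson y (x \<bullet> x) - poisson Y (x \<bullet> x))) =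
      (LINT x|lborel. f x * (newton y (x \<bullet> x) - newton Y (x \<bullet> x)))"
    and z: "continuous_on UNIV \<zeta>" "\<And>\<rho>. \<rho> \<ge> b \<Longrightarrow> \<zeta> \<rho> = 0" and z0: "(LINT x|(lborel :: 'a measure). \<zeta> (x \<bullet> x)) = 0"
  shows "(LINT x|lborel. v x * \<zeta> (x \<bullet> x)) =
    1 / (2 * pi\<^sup>2) * (LINT y|lborel. f y * (LINT x|(lborel :: 'a measure). riesz_kernel (x \<bullet> x) (norm y) * \<zeta> (x \<bullet> x)))"
proof -
  have [measurable]: "f \<in> borel_measurable borel" using borel_measurable_integrable[OF f(1)] by simp
  have [measurable]: "\<zeta> \<in> borel_measurable borel" using z(1) by (rule borel_measurable_continuous_onI)
  have mp [measurable]: "poisson y \<in> borel_measurable borel" "newton y \<in> borel_measurable borel" for y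
    unfolding poisson_def[abs_def] newton_def[abs_def] by measurable
  define F where "F y x = f y * riesz_kernel (x \<bullet> x) (norm y)" for y x :: 'a
  have F0: "F y x \<ge> 0" for y x using f(2) by (simp add: F_def riesz_kernel_nonneg)
  have [measurable]: "case_prod F \<in> borel_measurable (lborel \<Otimes>\<^sub>M lborel)" unfolding F_def by measurable
  have ne: "AE y::'a in lborel. y \<noteq> 0" using AE_lborel_singleton[of "0::'a"] by simp
  have kp: "has_bochner_integral lborel (\<lambda>x. F y x * poisson c (x \<bullet> x)) (f y * (2 * pi\<^sup>2 * newton c (y \<bullet> y)))"
    if "c > 0" "y \<noteq> 0" for c and y :: 'a
    using has_bochner_integral_mult_right[OF riesz_kernel_poisson[OF _ that(1) dim, of "norm y"], of "f y"] that(2)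
    by (simp add: F_def power2_norm_eq_inner mult.assoc)
  have nle: "0 \<le> newton c r \<and> newton c r \<le> newton c 0" if "c > 0" "r \<ge> 0" for c r
    unfolding newton_def using that by (auto intro!: divide_left_mono mult_pos_pos simp: add_pos_nonneg)
  have fn: "integrable lborel (\<lambda>y. f y * (2 * pi\<^sup>2 * newton c (y \<bullet> y)))" if "c > 0" for c
  proof (rule Bochner_Integration.integrable_bound)
    show "integrable lborel (\<lambda>y. f y * (2 * pi\<^sup>2 * newton c 0))" using f(1) by auto
    show "AE y in lborel. norm (f y * (2 * pi\<^sup>2 * newton c (y \<bullet> y))) \<le> norm (f y * (2 * pi\<^sup>2 * newton c 0))"
    proof (intro AE_I2)
      fix y :: 'a
      have "\<bar>newton c (y \<bullet> y)\<bar> \<le> \<bar>newton c 0\<bar>"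
        using nle[OF that, of "y \<bullet> y"] by simp
      then show "norm (f y * (2 * pi\<^sup>2 * newton c (y \<bullet> y))) \<le> norm (f y * (2 * pi\<^sup>2 * newton c 0))"
        unfolding real_norm_def abs_mult by (intro mult_left_mono) auto
    qed
  qed simp
  have p0: "poisson c r \<ge> 0" if "c > 0" for c r using that by (simp add: poisson_def)
  have FI: "integrable (lborel \<Otimes>\<^sub>M lborel) (\<lambda>(y, x). F y x * poisson c (x \<bullet> x))" if c: "c > 0" for c
  proof (rule lborel_pair.Fubini_integrable)
    have "integrable lborel (\<lambda>y. LINT x|lborel. norm (F y x * poisson c (x \<bullet> x))) \<longleftrightarrow>
        integrable lborel (\<lambda>y. f y * (2 * pi\<^sup>2 * newton c (y \<bullet> y)))"
    proof (rule integrable_cong_AE)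
      show "AE y in lborel. (LINT x|lborel. norm (F y x * poisson c (x \<bullet> x))) = f y * (2 * pi\<^sup>2 * newton c (y \<bullet> y))"
        using ne
      proof eventually_elim
        case (elim y)
        have "(LINT x|lborel. norm (F y x * poisson c (x \<bullet> x))) = (LINT x|lborel. F y x * poisson c (x \<bullet> x))"
          using F0 p0[OF c] by (simp add: abs_mult)
        then show ?case by (simp only: has_bochner_integral_integral_eq[OF kp[OF c elim]])
      qed
    qed measurable
    then show "integrable lborel (\<lambda>y. LINT x|lborel. norm (case (y, x) of (y, x) \<Rightarrow> F y x * poisson c (x \<bullet> x)))"
      using fn[OF c] by simp
    show "AE y in lborel. integrable lborel (\<lambda>x. case (y, x) of (y, x) \<Rightarrow> F y x * poisson c (x \<bullet> x))"
      using ne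
    proof eventually_elim
      case (elim y)
      show ?case unfolding prod.case using kp[OF c elim] unfolding has_bochner_integral_iff by blast
    qed
  qed measurable
  define I where "I x = (LINT y|lborel. F y x)" for x
  have [measurable]: "I \<in> borel_measurable borel"
    unfolding I_def[abs_def] F_def by measurable
  have Ip: "integrable lborel (\<lambda>x. I x * poisson c (x \<bullet> x))"
    "(LINT x|lborel. I x * poisson c (x \<bullet> x)) = 2 * pi\<^sup>2 * (LINT y|lborel. f y * newton c (y \<bullet> y))" if c: "c > 0" for c
  proof -
    show "integrable lborel (\<lambda>x. I x * poisson c (x \<bullet> x))"
      using lborel_pair.integrable_snd[OF FI[OF c]] by (simp add: I_def)
    have "(LINT x|lborel. I x * poisson c (x \<bullet> x)) = (LINT y|lborel. (LINT x|lborel. F y x * poisson c (x \<bullet> x)))"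
      using lborel_pair.Fubini_integral[OF FI[OF c]] by (simp add: I_def)
    also have "\<dots> = (LINT y|lborel. f y * (2 * pi\<^sup>2 * newton c (y \<bullet> y)))"
    proof (rule integral_cong_AE)
      show "AE y in lborel. (LINT x|lborel. F y x * poisson c (x \<bullet> x)) = f y * (2 * pi\<^sup>2 * newton c (y \<bullet> y))"
        using ne by eventually_elim (rule has_bochner_integral_integral_eq[OF kp[OF c]])
    qed measurable
    also have "\<dots> = 2 * pi\<^sup>2 * (LINT y|lborel. f y * newton c (y \<bullet> y))"
    proof -
      have e: "f y * (2 * pi\<^sup>2 * newton c (y \<bullet> y)) = 2 * pi\<^sup>2 * (f y * newton c (y \<bullet> y))" for y by simp
      show ?thesis unfolding e by (rule integral_mult_right_zero)
    qed
    finally show "(LINT x|lborel. I x * poisson c (x \<bullet> x)) = 2 * pi\<^sup>2 * (LINT y|lborel. f y * newton c (y \<bullet> y))" .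
  qed
  have vp: "integrable lborel (\<lambda>x. v x * poisson c (x \<bullet> x))" if c: "c > 0" for c
  proof (rule Bochner_Integration.integrable_bound)
    show "integrable lborel (\<lambda>x. (c / pi\<^sup>2 * (1 + 1 / c ^ 4)) * (\<bar>v x\<bar> / (1 + norm x ^ 4)))"
      by (rule integrable_mult_right) (rule v)
    show "AE x in lborel. norm (v x * poisson c (x \<bullet> x)) \<le> norm ((c / pi\<^sup>2 * (1 + 1 / c ^ 4)) * (\<bar>v x\<bar> / (1 + norm x ^ 4)))"
    proof (intro AE_I2)
      fix x :: 'a
      define r where "r = x \<bullet> x"
      have r: "r \<ge> 0" "norm x ^ 4 = r\<^sup>2" by (simp_all add: r_def power2_norm_eq_inner[symmetric])
      have "(1 + 1 / c ^ 4) * (c\<^sup>2 + r)\<^sup>2 = (c\<^sup>2 + r)\<^sup>2 + (1 + r / c\<^sup>2)\<^sup>2"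
        using c by (simp add: field_simps power2_eq_square power4_eq_xxxx)
      moreover have "r\<^sup>2 \<le> (c\<^sup>2 + r)\<^sup>2" using r by (intro power_mono) auto
      moreover have "1 \<le> (1 + r / c\<^sup>2)\<^sup>2" using r by simp
      ultimately have "1 + r\<^sup>2 \<le> (1 + 1 / c ^ 4) * (c\<^sup>2 + r)\<^sup>2" by linarith
      moreover have "c\<^sup>2 + r > 0" "1 + r\<^sup>2 > 0" using c r by (simp_all add: add_pos_nonneg)
      ultimately have "1 / (c\<^sup>2 + r)\<^sup>2 \<le> (1 + 1 / c ^ 4) / (1 + r\<^sup>2)"
        by (simp add: divide_le_eq le_divide_eq mult.commute)
      then have "\<bar>v x\<bar> * (c / pi\<^sup>2) * (1 / (c\<^sup>2 + r)\<^sup>2) \<le> \<bar>v x\<bar> * (c / pi\<^sup>2) * ((1 + 1 / c ^ 4) / (1 + r\<^sup>2))"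
        using c by (intro mult_left_mono) auto
      then show "norm (v x * poisson c (x \<bullet> x)) \<le> norm ((c / pi\<^sup>2 * (1 + 1 / c ^ 4)) * (\<bar>v x\<bar> / (1 + norm x ^ 4)))"
        unfolding r(2) r_def[symmetric] using c by (simp add: poisson_def abs_mult power_abs mult_ac)
    qed
  qed simp
  define w where "w x = v x - 1 / (2 * pi\<^sup>2) * I x" for x
  have [measurable]: "w \<in> borel_measurable borel" unfolding w_def[abs_def] by measurable
  have wp: "integrable lborel (\<lambda>x. w x * poisson c (x \<bullet> x))"
    "(LINT x|lborel. w x * poisson c (x \<bullet> x)) = (LINT x|lborel. v x * poisson c (x \<bullet> x)) - (LINT y|lborel. f y * newton c (y \<bullet> y))"
    if c: "c > 0" for c
  proof -
    have e: "w x * poisson c (x \<bullet> x) = v x * poisson c (x \<bullet> x) - 1 / (2 * pi\<^sup>2) * (I x * poisson c (x \<bullet> x))" for x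
      by (simp add: w_def left_diff_distrib)
    show "integrable lborel (\<lambda>x. w x * poisson c (x \<bullet> x))"
      unfolding e by (intro Bochner_Integration.integrable_diff integrable_mult_right vp Ip c)
    show "(LINT x|lborel. w x * poisson c (x \<bullet> x)) = (LINT x|lborel. v x * poisson c (x \<bullet> x)) - (LINT y|lborel. f y * newton c (y \<bullet> y))"
      unfolding e by (subst Bochner_Integration.integral_diff)
        (use vp[OF c] Ip[OF c] in auto)
  qed
  have fn': "integrable lborel (\<lambda>y. f y * newton c (y \<bullet> y))" if "c > 0" for c
    using integrable_mult_right[OF fn[OF that], of "1 / (2 * pi\<^sup>2)"] by simp
  have weq: "(LINT x|lborel. w x * poisson y (x \<bullet> x)) = (LINT x|lborel. w x * poisson Y (x \<bullet> x))" if "0 < y" "y < Y" for y Y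
  proof -
    have Y: "Y > 0" using that by simp
    have "(LINT x|lborel. v x * poisson y (x \<bullet> x)) - (LINT x|lborel. v x * poisson Y (x \<bullet> x)) =
        (LINT x|lborel. f x * newton y (x \<bullet> x)) - (LINT x|lborel. f x * newton Y (x \<bullet> x))"
      using eq[OF that] by (simp add: right_diff_distrib vp that(1) Y fn')
    then show ?thesis using wp(2)[OF that(1)] wp(2)[OF Y] by simp
  qed
  define c0 where "c0 = (LINT x|lborel. w x * poisson 1 (x \<bullet> x))"
  have wc: "(LINT x|lborel. w x * poisson y (x \<bullet> x)) = c0" if "y > 0" for y
  proof (cases y "1::real" rule: linorder_cases)
    case less
    show ?thesis unfolding c0_def by (rule weq[OF that less])
  next
    case greater
    show ?thesis unfolding c0_def by (rule weq[OF zero_less_one greater, symmetric])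
  qed (simp add: c0_def)
  define W where "W x = w x - c0" for x
  have [measurable]: "W \<in> borel_measurable borel" unfolding W_def[abs_def] by measurable
  have Wp: "integrable lborel (\<lambda>x. W x * poisson c (x \<bullet> x))" "(LINT x|lborel. W x * poisson c (x \<bullet> x)) = 0" if c: "c > 0" for c
  proof -
    note P = poisson_integral[OF c dim, unfolded has_bochner_integral_iff]
    have e: "W x * poisson c (x \<bullet> x) = w x * poisson c (x \<bullet> x) - c0 * poisson c (x \<bullet> x)" for x
      by (simp add: W_def left_diff_distrib)
    show "integrable lborel (\<lambda>x. W x * poisson c (x \<bullet> x))"
      unfolding e using P by (intro Bochner_Integration.integrable_diff integrable_mult_right wp c) auto
    show "(LINT x|lborel. W x * poisson c (x \<bullet> x)) = 0"
    proof -
      have "(LINT x|lborel. w x * poisson c (x \<bullet> x) - c0 * poisson c ((x::'a) \<bullet> x)) = c0 - c0 * 1"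
        using P by (subst Bochner_Integration.integral_diff[OF wp(1)[OF c]]) (simp_all only: wc[OF c] integral_mult_right_zero integrable_mult_right)
      then show ?thesis unfolding e by simp
    qed
  qed
  have Wz: "(LINT x|lborel. W x * \<zeta> (x \<bullet> x)) = 0"
  proof (rule stieltjes_unique[OF _ _ _ z])
    have "integrable lborel (\<lambda>x. pi\<^sup>2 * (W x * poisson 1 (x \<bullet> x)))" using Wp(1)[of 1] by simp
    then show "integrable lborel (\<lambda>x. W x / (1 + x \<bullet> x)\<^sup>2)" by (simp add: poisson_def)
    show "(LINT x|lborel. W x / (\<sigma> + x \<bullet> x)\<^sup>2) = 0" if "\<sigma> > 0" for \<sigma>
    proof -
      \<comment> \<open>The height y = sqrt \<sigma> turns the denominator of the Poisson kernel
        into (\<sigma> + |x|^2)^2.\<close>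
      have "(LINT x|lborel. (sqrt \<sigma> / pi\<^sup>2) * (W x / (\<sigma> + x \<bullet> x)\<^sup>2)) = 0"
        using Wp(2)[of "sqrt \<sigma>"] that by (simp add: poisson_def mult_ac)
      then show ?thesis using that by (simp only: integral_mult_right_zero) simp
    qed
  qed measurable
  \<comment> \<open>Domination by the Poisson kernel of height 1 hands the integrability known for v
    and I on to their products with \<zeta>.\<close>
  obtain Cz where Cz: "Cz \<ge> 0" "\<And>r. r \<ge> 0 \<Longrightarrow> \<bar>\<zeta> r\<bar> \<le> Cz * poisson 1 r"
  proof -
    have "compact (\<zeta> ` {0..max b 0})"
      by (intro compact_continuous_image continuous_on_subset[OF z(1)]) auto
    then obtain C where C: "\<And>r. r \<in> {0..max b 0} \<Longrightarrow> \<bar>\<zeta> r\<bar> \<le> C"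
      using compact_imp_bounded by (force simp: bounded_iff)
    define m where "m = poisson 1 (max b 0)"
    have m: "m > 0" by (simp add: m_def poisson_def add_pos_nonneg)
    have C0: "C \<ge> 0" using C[of 0] by simp
    show ?thesis
    proof (rule that[of "C / m"])
      show "C / m \<ge> 0" using C0 m by simp
      fix r :: real assume r: "r \<ge> 0"
      show "\<bar>\<zeta> r\<bar> \<le> C / m * poisson 1 r"
      proof (cases "r \<le> max b 0")
        case True
        have "m \<le> poisson 1 r"
          unfolding m_def poisson_def using r True
          by (auto intro!: divide_left_mono mult_left_mono power_mono mult_pos_pos simp: add_pos_nonneg)
        then have "C \<le> C / m * poisson 1 r" using C0 m by (simp add: field_simps mult_left_mono)
        then show ?thesis using C[of r] r True by simp
      next
        case False
        then show ?thesis using z(2)[of r] C0 m p0[of 1 r] by simp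
      qed
    qed
  qed
  have dom: "integrable lborel (\<lambda>x. u x * \<zeta> (x \<bullet> x))"
    if "integrable lborel (\<lambda>x. u x * poisson 1 (x \<bullet> x))" "u \<in> borel_measurable borel" for u :: "'a \<Rightarrow> real"
  proof (rule Bochner_Integration.integrable_bound)
    show "integrable lborel (\<lambda>x. Cz * (u x * poisson 1 (x \<bullet> x)))" using that(1) by simp
    show "(\<lambda>x. u x * \<zeta> (x \<bullet> x)) \<in> borel_measurable lborel" using that(2) by simp
    show "AE x in lborel. norm (u x * \<zeta> (x \<bullet> x)) \<le> norm (Cz * (u x * poisson 1 (x \<bullet> x)))"
    proof (intro AE_I2)
      fix x
      have "\<bar>u x\<bar> * \<bar>\<zeta> (x \<bullet> x)\<bar> \<le> \<bar>u x\<bar> * (Cz * poisson 1 (x \<bullet> x))"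
        using Cz(2)[of "x \<bullet> x"] by (intro mult_left_mono) auto
      then show "norm (u x * \<zeta> (x \<bullet> x)) \<le> norm (Cz * (u x * poisson 1 (x \<bullet> x)))"
        using Cz(1) p0[of 1 "x \<bullet> x"] by (simp add: abs_mult mult_ac)
    qed
  qed
  have vz: "integrable lborel (\<lambda>x. v x * \<zeta> (x \<bullet> x))" by (intro dom vp) auto
  have Iz: "integrable lborel (\<lambda>x. I x * \<zeta> (x \<bullet> x))" by (intro dom Ip) auto
  have zi: "integrable lborel (\<lambda>x::'a. \<zeta> (x \<bullet> x))"
    using dom[of "\<lambda>_. 1"] poisson_integral[of 1, where 'a = 'a] dim by (simp add: has_bochner_integral_iff)
  have "W x * \<zeta> (x \<bullet> x) = v x * \<zeta> (x \<bullet> x) - 1 / (2 * pi\<^sup>2) * (I x * \<zeta> (x \<bullet> x)) - c0 * \<zeta> (x \<bullet> x)" for x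
    by (simp add: W_def w_def algebra_simps)
  then have "0 = (LINT x|lborel. v x * \<zeta> (x \<bullet> x) - 1 / (2 * pi\<^sup>2) * (I x * \<zeta> (x \<bullet> x)) - c0 * \<zeta> (x \<bullet> x))"
    using Wz by simp
  also have "\<dots> = (LINT x|lborel. v x * \<zeta> (x \<bullet> x)) - 1 / (2 * pi\<^sup>2) * (LINT x|lborel. I x * \<zeta> (x \<bullet> x)) -
      c0 * (LINT x|(lborel :: 'a measure). \<zeta> (x \<bullet> x))"
    by (subst Bochner_Integration.integral_diff, (use vz Iz zi in auto)[2],
        subst Bochner_Integration.integral_diff) (use vz Iz zi in auto)
  finally have "(LINT x|lborel. v x * \<zeta> (x \<bullet> x)) = 1 / (2 * pi\<^sup>2) * (LINT x|lborel. I x * \<zeta> (x \<bullet> x))"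
    using z0 by simp
  also have "(LINT x|lborel. I x * \<zeta> (x \<bullet> x)) = (LINT y|lborel. (LINT x|lborel. F y x * \<zeta> (x \<bullet> x)))"
  proof -
    have "integrable (lborel \<Otimes>\<^sub>M lborel) (\<lambda>(y, x). F y x * \<zeta> (x \<bullet> x))"
    proof (rule Bochner_Integration.integrable_bound)
      show "integrable (lborel \<Otimes>\<^sub>M lborel) (\<lambda>p. Cz * (case p of (y, x) \<Rightarrow> F y x * poisson 1 (x \<bullet> x)))"
        using FI[of 1] by (intro integrable_mult_right) simp
      show "AE p in lborel \<Otimes>\<^sub>M lborel. norm (case p of (y, x) \<Rightarrow> F y x * \<zeta> (x \<bullet> x)) \<le>
          norm (Cz * (case p of (y, x) \<Rightarrow> F y x * poisson 1 (x \<bullet> x)))"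
      proof (intro AE_I2, clarify)
        fix y x
        have "F y x * \<bar>\<zeta> (x \<bullet> x)\<bar> \<le> F y x * (Cz * poisson 1 (x \<bullet> x))"
          using Cz(2)[of "x \<bullet> x"] F0 by (intro mult_left_mono) auto
        then show "norm (F y x * \<zeta> (x \<bullet> x)) \<le> norm (Cz * (F y x * poisson 1 (x \<bullet> x)))"
          using Cz(1) p0[of 1 "x \<bullet> x"] F0[of y x] by (simp add: abs_mult mult_ac)
      qed
    qed measurable
    from lborel_pair.Fubini_integral[OF this] show ?thesis by (simp add: I_def)
  qed
  also have "\<dots> = (LINT y|lborel. f y * (LINT x|(lborel :: 'a measure). riesz_kernel (x \<bullet> x) (norm y) * \<zeta> (x \<bullet> x)))"
    by (simp add: F_def mult.assoc)
  finally show ?thesis .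
qed

subsection \<open>Kernels of the radial logarithmic potential\<close>

text \<open>\<open>log_kernel_n (|y| / r)\<close> is the mean of \<open>x \<bullet> (x - y) / |x - y|\<^sup>2\<close> over the sphere \<open>|x| = r\<close> in
  dimension \<open>n\<close>.\<close>

definition log_kernel_3 :: "real \<Rightarrow> real" where
  "log_kernel_3 x = 1 / 2 + (1 - x\<^sup>2) / (4 * x) * log_ratio 1 x"

definition log_kernel_4 :: "real \<Rightarrow> real" where
  "log_kernel_4 x = (if x \<le> 1 then 1 - x\<^sup>2 / 2 else 1 / (2 * x\<^sup>2))"

text \<open>The sum rule comes from x \<bullet> (x - y) / |x - y|^2 + y \<bullet> (y - x) / |x -
  y|^2 = 1 by averaging over both spheres: interchanging x and y replaces the ratio of the radii by
  its inverse.\<close>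

locale symmetric_kernel =
  fixes g :: "real \<Rightarrow> real"
  assumes kernel_nonneg: "\<And>x. x > 0 \<Longrightarrow> 0 \<le> g x"
    and kernel_sum: "\<And>x. x > 0 \<Longrightarrow> g x + g (1 / x) = 1"
    and kernel_continuous: "continuous_on {0<..} g"
    and kernel_measurable [measurable]: "g \<in> borel_measurable borel"
begin

lemma kernel_le_1: "x > 0 \<Longrightarrow> g x \<le> 1"
  using kernel_sum[of x] kernel_nonneg[of "1 / x"] by simp

end

lemma log_ratio_scale:
  assumes "c > 0"
  shows "log_ratio (c * r) (c * s) = log_ratio r s"
proof -
  have "c * r + c * s = c * (r + s)" "\<bar>c * r - c * s\<bar> = c * \<bar>r - s\<bar>"
    using assms by (simp_all add: distrib_left flip: right_diff_distrib) (simp add: abs_mult)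
  then show ?thesis using assms by (simp add: log_ratio_def)
qed

lemma log_ratio_commute: "log_ratio r s = log_ratio s r"
  by (simp add: log_ratio_def add.commute abs_minus_commute)

lemma sqrt_mult_log_kernel_3:
  assumes "\<rho> > 0" "s > 0"
  shows "sqrt \<rho> * log_kernel_3 (s / sqrt \<rho>) = sqrt \<rho> / 2 + (\<rho> - s\<^sup>2) * log_ratio (sqrt \<rho>) s / (4 * s)"
proof -
  have "log_ratio 1 (s / sqrt \<rho>) = log_ratio (sqrt \<rho> * 1) (sqrt \<rho> * (s / sqrt \<rho>))"
    using assms by (intro log_ratio_scale[symmetric]) auto
  also have "\<dots> = log_ratio (sqrt \<rho>) s" using assms by simp
  finally have l: "log_ratio 1 (s / sqrt \<rho>) = log_ratio (sqrt \<rho>) s" .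
  have "q * (1 / 2 + (1 - (s / q)\<^sup>2) / (4 * (s / q)) * L) = q / 2 + (q\<^sup>2 - s\<^sup>2) * L / (4 * s)" if "q > 0" for q L
    using that assms(2) by (simp add: field_simps power2_eq_square)
  from this[of "sqrt \<rho>"] show ?thesis
    unfolding log_kernel_3_def l using assms by simp
qed

text \<open>The right-hand side is sinh (ln z). The estimate is what bounds
  \<open>log_kernel_3\<close> by 1 on the unit interval.\<close>

lemma ln_le_half_diff_inverse:
  fixes z :: real
  assumes "z \<ge> 1"
  shows "ln z \<le> (z - 1 / z) / 2"
proof -
  define h where "h z = (z - 1 / z) / 2 - ln z" for z :: real
  have "h 1 \<le> h z"
  proof (rule DERIV_nonneg_imp_nondecreasing[OF assms])
    fix x :: real assume "1 \<le> x" "x \<le> z"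
    then have x: "x > 0" by simp
    have "(h has_real_derivative (1 - 1 / x)\<^sup>2 / 2) (at x)"
      unfolding h_def using x by (auto intro!: derivative_eq_intros simp: power2_eq_square field_simps)
    then show "\<exists>y. (h has_real_derivative y) (at x) \<and> 0 \<le> y" by (auto intro!: exI[of _ "(1 - 1 / x)\<^sup>2 / 2"])
  qed
  then show ?thesis by (simp add: h_def)
qed

lemma symmetric_kernel_log_kernel_3: "symmetric_kernel log_kernel_3"
proof
  have sum: "log_kernel_3 x + log_kernel_3 (1 / x) = 1" if x: "x > 0" for x
  proof -
    have "log_ratio 1 (1 / x) = log_ratio (x * 1) (x * (1 / x))"
      using x by (intro log_ratio_scale[symmetric])
    also have "\<dots> = log_ratio 1 x" using x by (simp add: log_ratio_commute)
    finally have l: "log_ratio 1 (1 / x) = log_ratio 1 x" .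
    have "(1 - x\<^sup>2) / (4 * x) + (1 - (1 / x)\<^sup>2) / (4 * (1 / x)) = 0"
      using x by (simp add: field_simps power2_eq_square)
    then have "((1 - x\<^sup>2) / (4 * x) + (1 - (1 / x)\<^sup>2) / (4 * (1 / x))) * log_ratio 1 x = 0" by simp
    then show ?thesis unfolding log_kernel_3_def l by (simp only: distrib_right)
  qed
  show "log_kernel_3 x + log_kernel_3 (1 / x) = 1" if "x > 0" for x using sum[OF that] .
  have le: "1 / 2 \<le> log_kernel_3 x \<and> log_kernel_3 x \<le> 1" if x: "x > 0" "x < 1" for x
  proof -
    \<comment> \<open>With this z the logarithmic ratio is ln z, while (z - 1 / z) / 2 becomes 2 x /
      (1 - x^2) and cancels the prefactor of the kernel.\<close>
    define z where "z = (1 + x) / (1 - x)"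
    have z: "z \<ge> 1" using x by (simp add: z_def field_simps)
    have l: "log_ratio 1 x = ln z" using x by (simp add: log_ratio_def z_def)
    have "(z - 1 / z) / 2 = 2 * x / (1 - x\<^sup>2)"
    proof -
      have "1 - x\<^sup>2 = (1 - x) * (1 + x)" by (simp add: algebra_simps power2_eq_square)
      then show ?thesis using x by (simp add: z_def divide_simps) (simp add: algebra_simps)
    qed
    then have "log_ratio 1 x \<le> 2 * x / (1 - x\<^sup>2)"
      using ln_le_half_diff_inverse[OF z] l by (simp only:)
    moreover have x2: "1 - x\<^sup>2 > 0" using x by (simp add: power_less_one_iff abs_square_less_1)
    ultimately have "(1 - x\<^sup>2) / (4 * x) * log_ratio 1 x \<le> (1 - x\<^sup>2) / (4 * x) * (2 * x / (1 - x\<^sup>2))"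
      using x by (intro mult_left_mono) auto
    also have "\<dots> = 1 / 2" using x x2 by (simp add: field_simps)
    finally have "(1 - x\<^sup>2) / (4 * x) * log_ratio 1 x \<le> 1 / 2" .
    moreover have "(1 - x\<^sup>2) / (4 * x) * log_ratio 1 x \<ge> 0"
      using x x2 log_ratio_nonneg[of 1 x] by (intro mult_nonneg_nonneg) auto
    ultimately show ?thesis unfolding log_kernel_3_def by linarith
  qed
  show "0 \<le> log_kernel_3 x" if x: "x > 0" for x
  proof -
    consider "x < 1" | "x = 1" | "x > 1" by linarith
    then show ?thesis
    proof cases
      case 3
      then have "1 / x > 0" "1 / x < 1" by auto
      with sum[OF x] le[of "1 / x"] show ?thesis by linarith
    qed (use le[of x] x in \<open>auto simp: log_kernel_3_def\<close>)
  qed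
  show "continuous_on {0<..} log_kernel_3"
  proof -
    have c: "continuous_on {0<..} (\<lambda>x. (x\<^sup>2 - 1\<^sup>2) * log_ratio (sqrt (x\<^sup>2)) 1)"
      by (rule continuous_on_compose2[OF continuous_diff_mult_log_ratio[OF zero_less_one]])
        (auto intro!: continuous_intros)
    have "continuous_on {0<..} (\<lambda>x::real. 1 / 2 + - ((x\<^sup>2 - 1\<^sup>2) * log_ratio (sqrt (x\<^sup>2)) 1) / (4 * x))"
      by (intro continuous_intros c) auto
    then show ?thesis
    proof (rule continuous_on_eq)
      fix x :: real assume "x \<in> {0<..}"
      then have "sqrt (x\<^sup>2) = x" by simp
      then show "1 / 2 + - ((x\<^sup>2 - 1\<^sup>2) * log_ratio (sqrt (x\<^sup>2)) 1) / (4 * x) = log_kernel_3 x"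
        unfolding log_kernel_3_def by (simp add: log_ratio_commute[of x] left_diff_distrib)
    qed
  qed
  show "log_kernel_3 \<in> borel_measurable borel"
    unfolding log_kernel_3_def[abs_def] by measurable
qed

lemma symmetric_kernel_log_kernel_4: "symmetric_kernel log_kernel_4"
proof
  show "0 \<le> log_kernel_4 x" if "x > 0" for x
    using that by (auto simp: log_kernel_4_def power_le_one_iff abs_square_le_1 intro: order_trans[of _ 1])
  show "log_kernel_4 x + log_kernel_4 (1 / x) = 1" if "x > 0" for x
    using that by (cases "x = 1") (auto simp: log_kernel_4_def power_divide field_simps)
  show "continuous_on {0<..} log_kernel_4"
    unfolding log_kernel_4_def[abs_def]
    by (rule continuous_on_cases_le) (auto intro!: continuous_intros)
  show "log_kernel_4 \<in> borel_measurable borel"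
    unfolding log_kernel_4_def[abs_def] by measurable
qed

section \<open>Pairing the kernels with radial test functions\<close>

lemma radial_weight_4:
  assumes "\<rho> \<ge> 0"
  shows "radial_weight 4 \<rho> = pi\<^sup>2 * \<rho>"
  using assms by (auto simp: radial_weight_def eval_unit_ball_vol)

lemma smooth_real_on_DERIV: "smooth_real_on UNIV g \<Longrightarrow> (g has_real_derivative deriv g x) (at x)"
  using smooth_real_on_field_differentiable[of UNIV g x] by (simp add: DERIV_deriv_iff_field_differentiable)

lemma deriv_eq_0_beyond:
  assumes "\<And>\<rho>. \<rho> \<ge> b \<Longrightarrow> g \<rho> = (0::real)" "x > b"
  shows "deriv g x = 0"
proof -
  have "\<forall>\<^sub>F y in nhds x. g y = 0"
    using eventually_nhds_in_open[of "{b<..}" x] assms by (auto elim!: eventually_mono)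
  from iffD2[OF DERIV_cong_ev[OF refl this refl] DERIV_const] show ?thesis
    by (rule DERIV_imp_deriv)
qed

lemma integral_weight_kernel_eq:
  fixes z :: "real \<Rightarrow> real"
  assumes "b \<ge> 0" "\<And>\<rho>. \<rho> > b \<Longrightarrow> z \<rho> = 0" "P 0 = 0"
    and "\<And>\<rho>. 0 < \<rho> \<Longrightarrow> radial_weight n \<rho> * g \<rho> = c * P \<rho>"
  shows "(LINT \<rho>|lborel. radial_weight n \<rho> * g \<rho> * z \<rho>) =
    c * (LINT \<rho>|lborel. indicator {0..b} \<rho> * (P \<rho> * z \<rho>))"
proof -
  have "radial_weight n \<rho> * g \<rho> * z \<rho> = c * (indicator {0..b} \<rho> * (P \<rho> * z \<rho>))" for \<rho>
  proof -
    consider "\<rho> < 0" | "\<rho> = 0" | "0 < \<rho> \<and> \<rho> \<le> b" | "\<rho> > b" by linarith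
    then show ?thesis
      using assms(2,4)[of \<rho>] assms(1,3) by cases (auto simp: radial_weight_def)
  qed
  then show ?thesis by (simp only: integral_mult_right_zero)
qed

text \<open>In dimension three \<Delta> log |x - y| = |x - y|^(-2), so by the divergence theorem the
  flux of (x - y) / |x - y|^2 through a sphere is the integral of |x - y|^(-2) over the ball. Here
  this appears as P' = p, where P is sqrt \<rho> times the logarithmic kernel and p is half of sqrt
  \<rho> times the Riesz kernel; integration by parts moves the derivative to \<zeta>.\<close>

lemma riesz_kernel_pairing:
  fixes \<zeta> :: "real \<Rightarrow> real"
  assumes dim: "DIM('a::euclidean_space) = 3" and s: "s > 0"
    and z: "smooth_real_on UNIV \<zeta>" and zb: "\<And>\<rho>. \<rho> \<ge> b \<Longrightarrow> \<zeta> \<rho> = 0" and b: "b > 0"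
  shows "(LINT x|(lborel :: 'a measure). riesz_kernel (x \<bullet> x) s * \<zeta> (x \<bullet> x)) =
    - 2 * (LINT \<rho>|lborel. radial_weight 3 \<rho> * log_kernel_3 (s / sqrt \<rho>) * deriv \<zeta> \<rho>)"
proof -
  define P where "P \<rho> = sqrt \<rho> / 2 + (\<rho> - s\<^sup>2) * log_ratio (sqrt \<rho>) s / (4 * s)" for \<rho>
  define p where "p \<rho> = log_ratio (sqrt \<rho>) s / (4 * s)" for \<rho>
  have zc: "continuous_on A \<zeta>" "continuous_on A (deriv \<zeta>)" for A
    using smooth_real_on_continuous_on[OF z] smooth_real_on_continuous_on[OF smooth_real_on_deriv[OF z]]
      continuous_on_subset by blast+
  have [measurable]: "\<zeta> \<in> borel_measurable borel" using zc(1) by (rule borel_measurable_continuous_onI)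
  have [measurable]: "p \<in> borel_measurable borel" unfolding p_def[abs_def] by measurable
  have Pc: "continuous_on {0..b} P"
    unfolding P_def using s
    by (intro continuous_intros continuous_on_subset[OF continuous_diff_mult_log_ratio[OF s]]) auto
  have P': "(P has_real_derivative p \<rho>) (at \<rho>)" if "\<rho> > 0" "\<rho> \<noteq> s\<^sup>2" for \<rho>
  proof -
    have "(P has_real_derivative (inverse (sqrt \<rho>) / 2) / 2 +
        (1 * log_ratio (sqrt \<rho>) s + (- s / ((\<rho> - s\<^sup>2) * sqrt \<rho>)) * (\<rho> - s\<^sup>2)) / (4 * s)) (at \<rho>)"
      unfolding P_def using that s
      by (intro DERIV_add DERIV_cdivide DERIV_mult log_ratio_deriv DERIV_real_sqrt) (auto intro!: derivative_eq_intros)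
    moreover have "(inverse q / 2) / 2 + (1 * L + (- s / (d * q)) * d) / (4 * s) = L / (4 * s)"
      if "d \<noteq> 0" "q > 0" for d q L :: real
      using that s by (simp add: field_simps)
    from this[of "\<rho> - s\<^sup>2" "sqrt \<rho>"] have "(inverse (sqrt \<rho>) / 2) / 2 +
        (1 * log_ratio (sqrt \<rho>) s + (- s / ((\<rho> - s\<^sup>2) * sqrt \<rho>)) * (\<rho> - s\<^sup>2)) / (4 * s) = p \<rho>"
      using that by (simp add: p_def)
    ultimately show ?thesis by (simp only:)
  qed
  have p0: "p \<rho> \<ge> 0" if "\<rho> \<ge> 0" for \<rho> using that s by (simp add: p_def log_ratio_nonneg)
  have "has_bochner_integral lborel (\<lambda>\<rho>. indicator {0..b} \<rho> * p \<rho>) (P b - P 0)"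
    by (rule FTC_nonneg_Icc[of _ _ "{s\<^sup>2}"]) (use b Pc P' p0 in auto)
  then have ip: "integrable lborel (\<lambda>\<rho>. indicator {0..b} \<rho> * p \<rho>)" by (simp add: has_bochner_integral_iff)
  have "compact (\<zeta> ` {0..b})" by (intro compact_continuous_image zc) auto
  then obtain C where C: "\<And>r. r \<in> {0..b} \<Longrightarrow> \<bar>\<zeta> r\<bar> \<le> C"
    using compact_imp_bounded by (force simp: bounded_iff)
  have ipz: "integrable lborel (\<lambda>\<rho>. indicator {0..b} \<rho> * (p \<rho> * \<zeta> \<rho>))"
  proof (rule Bochner_Integration.integrable_bound)
    show "integrable lborel (\<lambda>\<rho>. C * (indicator {0..b} \<rho> * p \<rho>))" using ip by simp
    show "AE \<rho> in lborel. norm (indicator {0..b} \<rho> * (p \<rho> * \<zeta> \<rho>)) \<le> norm (C * (indicator {0..b} \<rho> * p \<rho>))"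
    proof (intro AE_I2)
      fix \<rho>
      show "norm (indicator {0..b} \<rho> * (p \<rho> * \<zeta> \<rho>)) \<le> norm (C * (indicator {0..b} \<rho> * p \<rho>))"
      proof (cases "\<rho> \<in> {0..b}")
        case True
        then have "\<bar>\<zeta> \<rho>\<bar> * \<bar>p \<rho>\<bar> \<le> \<bar>C\<bar> * \<bar>p \<rho>\<bar>"
          using C[OF True] by (intro mult_right_mono) auto
        then show ?thesis using True by (simp add: abs_mult mult.commute)
      qed simp
    qed
  qed simp
  have iPz: "integrable lborel (\<lambda>\<rho>. indicator {0..b} \<rho> * (P \<rho> * deriv \<zeta> \<rho>))"
    by (intro integrable_indicator_continuous continuous_intros Pc zc)
  have sum: "indicator {0..b} \<rho> * (p \<rho> * \<zeta> \<rho> + P \<rho> * deriv \<zeta> \<rho>) =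
      indicator {0..b} \<rho> * (p \<rho> * \<zeta> \<rho>) + indicator {0..b} \<rho> * (P \<rho> * deriv \<zeta> \<rho>)" for \<rho>
    by (simp add: distrib_left)
  have "(LINT \<rho>|lborel. indicator {0..b} \<rho> * (p \<rho> * \<zeta> \<rho> + P \<rho> * deriv \<zeta> \<rho>)) = P b * \<zeta> b - P 0 * \<zeta> 0"
  proof (rule FTC_integrable_Icc[of _ _ "{s\<^sup>2}"])
    show "((\<lambda>\<rho>. P \<rho> * \<zeta> \<rho>) has_real_derivative p \<rho> * \<zeta> \<rho> + P \<rho> * deriv \<zeta> \<rho>) (at \<rho>)"
      if "\<rho> \<in> {0<..<b} - {s\<^sup>2}" for \<rho>
    proof -
      have "((\<lambda>\<rho>. P \<rho> * \<zeta> \<rho>) has_real_derivative p \<rho> * \<zeta> \<rho> + deriv \<zeta> \<rho> * P \<rho>) (at \<rho>)"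
        using that by (intro DERIV_mult P' smooth_real_on_DERIV z) auto
      then show ?thesis by (simp only: mult.commute)
    qed
    show "integrable lborel (\<lambda>\<rho>. indicator {0..b} \<rho> * (p \<rho> * \<zeta> \<rho> + P \<rho> * deriv \<zeta> \<rho>))"
      unfolding sum using ipz iPz by (rule Bochner_Integration.integrable_add)
  qed (use b Pc zc in \<open>auto intro!: continuous_on_mult\<close>)
  moreover have P0: "P 0 = 0" using s by (simp add: P_def log_ratio_def)
  ultimately have parts: "(LINT \<rho>|lborel. indicator {0..b} \<rho> * (p \<rho> * \<zeta> \<rho>)) = - (LINT \<rho>|lborel. indicator {0..b} \<rho> * (P \<rho> * deriv \<zeta> \<rho>))"
    using zb[of b] unfolding sum by (simp add: Bochner_Integration.integral_add[OF ipz iPz])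
  have "(LINT x|(lborel :: 'a measure). riesz_kernel (x \<bullet> x) s * \<zeta> (x \<bullet> x)) =
      (LINT \<rho>|lborel. radial_weight 3 \<rho> * (riesz_kernel \<rho> s * \<zeta> \<rho>))"
    using integral_radial[of "\<lambda>\<rho>. riesz_kernel \<rho> s * \<zeta> \<rho>", where 'a = 'a] dim by simp
  also have "\<dots> = (LINT \<rho>|lborel. (4 * pi) * (indicator {0..b} \<rho> * (p \<rho> * \<zeta> \<rho>)))"
  proof (rule Bochner_Integration.integral_cong[OF refl])
    fix \<rho> :: real
    consider "\<rho> < 0" | "0 \<le> \<rho> \<and> \<rho> \<le> b" | "\<rho> > b" by linarith
    then show "radial_weight 3 \<rho> * (riesz_kernel \<rho> s * \<zeta> \<rho>) = (4 * pi) * (indicator {0..b} \<rho> * (p \<rho> * \<zeta> \<rho>))"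
    proof cases
      case 2
      have "radial_weight 3 \<rho> * riesz_kernel \<rho> s = 4 * pi * p \<rho>"
        using radial_weight_riesz_kernel[of \<rho> s] 2 s by (simp add: p_def log_ratio_def)
      then have "(radial_weight 3 \<rho> * riesz_kernel \<rho> s) * \<zeta> \<rho> = (4 * pi * p \<rho>) * \<zeta> \<rho>" by (simp only:)
      then show ?thesis using 2 by (simp add: mult.assoc)
    qed (simp_all add: radial_weight_def zb)
  qed
  also have "\<dots> = - 2 * (2 * pi * (LINT \<rho>|lborel. indicator {0..b} \<rho> * (P \<rho> * deriv \<zeta> \<rho>)))"
    by (simp add: parts)
  also have "2 * pi * (LINT \<rho>|lborel. indicator {0..b} \<rho> * (P \<rho> * deriv \<zeta> \<rho>)) =
      (LINT \<rho>|lborel. radial_weight 3 \<rho> * log_kernel_3 (s / sqrt \<rho>) * deriv \<zeta> \<rho>)"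
  proof (rule integral_weight_kernel_eq[symmetric])
    show "deriv \<zeta> \<rho> = 0" if "\<rho> > b" for \<rho>
      by (rule deriv_eq_0_beyond[of b]) (use zb that in auto)
    show "radial_weight 3 \<rho> * log_kernel_3 (s / sqrt \<rho>) = 2 * pi * P \<rho>" if "0 < \<rho>" for \<rho>
      using sqrt_mult_log_kernel_3[OF that s] that by (simp add: radial_weight_3 P_def mult.assoc)
  qed (use b P0 in auto)
  finally show ?thesis .
qed

text \<open>Green's formula for \<Delta>^2 with the logarithmic fundamental solution of dimension
  four, averaged over a sphere. As \<rho> times the kernel is the piecewise polynomial P, explicit
  primitives of P \<zeta>' exist on each side of \<rho> = s^2.\<close>

lemma log_kernel_4_pairing:
  fixes \<zeta> \<eta> :: "real \<Rightarrow> real"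
  assumes s: "s > 0" and z: "smooth_real_on UNIV \<zeta>" "smooth_real_on UNIV \<eta>"
    and zb: "\<And>\<rho>. \<rho> \<ge> b \<Longrightarrow> \<zeta> \<rho> = 0" "\<And>\<rho>. \<rho> \<ge> b \<Longrightarrow> \<eta> \<rho> = 0"
    and eq: "radial_neg_laplacian 4 \<eta> = \<zeta>"
  shows "\<eta> (s\<^sup>2) = - 1 / (4 * pi\<^sup>2) * (LINT \<rho>|lborel. radial_weight 4 \<rho> * log_kernel_4 (s / sqrt \<rho>) * deriv \<zeta> \<rho>)"
proof -
  define B where "B = max b (s\<^sup>2) + 1"
  have "b \<le> max b (s\<^sup>2)" "s\<^sup>2 \<le> max b (s\<^sup>2)" "0 \<le> s\<^sup>2" by auto
  then have B: "B > b" "B > s\<^sup>2" "B > 0" unfolding B_def by linarith+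
  define P where "P \<rho> = (if \<rho> \<le> s\<^sup>2 then \<rho>\<^sup>2 / (2 * s\<^sup>2) else \<rho> - s\<^sup>2 / 2)" for \<rho>
  define G1 where "G1 \<rho> = \<rho>\<^sup>2 / (2 * s\<^sup>2) * \<zeta> \<rho> + 4 / s\<^sup>2 * (\<rho>\<^sup>2 * deriv \<eta> \<rho>)" for \<rho>
  \<comment> \<open>G1 and G2 become primitives of P \<zeta>' once \<zeta> is replaced by -4 \<rho>
    \<eta>'' - 8 \<eta>'. The constant -4 \<eta> (s^2) makes them agree at \<rho> = s^2, and it is
    the only term left at the upper end B.\<close>
  define G2 where "G2 \<rho> = (\<rho> - s\<^sup>2 / 2) * \<zeta> \<rho> + 4 * (\<rho> * deriv \<eta> \<rho> + \<eta> \<rho>) - 4 * \<eta> (s\<^sup>2)" for \<rho>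
  define G where "G \<rho> = (if \<rho> \<le> s\<^sup>2 then G1 \<rho> else G2 \<rho>)" for \<rho>
  note d = smooth_real_on_DERIV[OF z(1)] smooth_real_on_DERIV[OF z(2)] smooth_real_on_DERIV[OF smooth_real_on_deriv[OF z(2)]]
  have c: "continuous_on A \<zeta>" "continuous_on A \<eta>" "continuous_on A (deriv \<zeta>)" "continuous_on A (deriv \<eta>)" for A
    using smooth_real_on_continuous_on z smooth_real_on_deriv continuous_on_subset by (metis subset_UNIV)+
  have zeta: "\<zeta> \<rho> = - (4 * \<rho> * deriv (deriv \<eta>) \<rho> + 8 * deriv \<eta> \<rho>)" for \<rho>
    using fun_cong[OF eq, of \<rho>] by (simp add: radial_neg_laplacian_def)
  have s2: "s\<^sup>2 > 0" using s by simp
  have G1': "(G1 has_real_derivative \<rho>\<^sup>2 / (2 * s\<^sup>2) * deriv \<zeta> \<rho>) (at \<rho>)" for \<rho>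
  proof -
    have "(G1 has_real_derivative (2 * \<rho> / (2 * s\<^sup>2)) * \<zeta> \<rho> + deriv \<zeta> \<rho> * (\<rho>\<^sup>2 / (2 * s\<^sup>2)) +
        4 / s\<^sup>2 * (2 * \<rho> * deriv \<eta> \<rho> + deriv (deriv \<eta>) \<rho> * \<rho>\<^sup>2)) (at \<rho>)"
      unfolding G1_def by (intro DERIV_add DERIV_mult DERIV_cmult DERIV_cdivide d) (auto intro!: derivative_eq_intros)
    moreover have "(2 * \<rho> / (2 * s\<^sup>2)) * \<zeta> \<rho> + deriv \<zeta> \<rho> * (\<rho>\<^sup>2 / (2 * s\<^sup>2)) +
        4 / s\<^sup>2 * (2 * \<rho> * deriv \<eta> \<rho> + deriv (deriv \<eta>) \<rho> * \<rho>\<^sup>2) = \<rho>\<^sup>2 / (2 * s\<^sup>2) * deriv \<zeta> \<rho>"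
    proof -
      define k where "k = 1 / s\<^sup>2"
      have e: "2 * \<rho> / (2 * s\<^sup>2) = \<rho> * k" "\<rho>\<^sup>2 / (2 * s\<^sup>2) = \<rho>\<^sup>2 * k / 2" "4 / s\<^sup>2 = 4 * k"
        by (simp_all add: k_def)
      show ?thesis unfolding zeta[of \<rho>] e by (simp add: algebra_simps power2_eq_square)
    qed
    ultimately show ?thesis by (simp only:)
  qed
  have G2': "(G2 has_real_derivative (\<rho> - s\<^sup>2 / 2) * deriv \<zeta> \<rho>) (at \<rho>)" for \<rho>
  proof -
    have "(G2 has_real_derivative (1 - 0) * \<zeta> \<rho> + deriv \<zeta> \<rho> * (\<rho> - s\<^sup>2 / 2) +
        4 * (1 * deriv \<eta> \<rho> + deriv (deriv \<eta>) \<rho> * \<rho> + deriv \<eta> \<rho>) - 0) (at \<rho>)"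
      unfolding G2_def by (intro DERIV_add DERIV_diff DERIV_mult DERIV_cmult DERIV_const DERIV_ident d)
    moreover have "(1 - 0) * \<zeta> \<rho> + deriv \<zeta> \<rho> * (\<rho> - s\<^sup>2 / 2) +
        4 * (1 * deriv \<eta> \<rho> + deriv (deriv \<eta>) \<rho> * \<rho> + deriv \<eta> \<rho>) - 0 = (\<rho> - s\<^sup>2 / 2) * deriv \<zeta> \<rho>"
      unfolding zeta[of \<rho>] by (simp add: algebra_simps)
    ultimately show ?thesis by (simp only:)
  qed
  have Pc: "continuous_on {0..B} P"
    unfolding P_def using s2
    by (intro continuous_on_cases_le) (auto intro!: continuous_intros simp: power2_eq_square)
  have Gc: "continuous_on {0..B} G"
    unfolding G_def
  proof (rule continuous_on_cases_le)
    show "continuous_on {x \<in> {0..B}. x \<le> s\<^sup>2} G1" "continuous_on {x \<in> {0..B}. s\<^sup>2 \<le> x} G2"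
      using G1' G2' by (meson DERIV_isCont continuous_at_imp_continuous_on)+
    show "G1 t = G2 t" if "t \<in> {0..B}" "t = s\<^sup>2" for t
      using s2 that(2) by (simp add: G1_def G2_def field_simps power2_eq_square)
  qed (auto intro: continuous_intros)
  have "(LINT \<rho>|lborel. indicator {0..B} \<rho> * (P \<rho> * deriv \<zeta> \<rho>)) = G B - G 0"
  proof (rule FTC_integrable_Icc[of _ _ "{s\<^sup>2}"])
    show "(G has_real_derivative P \<rho> * deriv \<zeta> \<rho>) (at \<rho>)" if \<rho>: "\<rho> \<in> {0<..<B} - {s\<^sup>2}" for \<rho>
    proof (cases "\<rho> < s\<^sup>2")
      case True
      have "\<forall>\<^sub>F y in nhds \<rho>. G y = G1 y"
        using eventually_nhds_in_open[of "{..<s\<^sup>2}" \<rho>] True by (auto simp: G_def elim!: eventually_mono)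
      from iffD2[OF DERIV_cong_ev[OF refl this refl] G1'] show ?thesis using True by (simp add: P_def)
    next
      case False
      then have gt: "\<rho> > s\<^sup>2" using \<rho> by auto
      have "\<forall>\<^sub>F y in nhds \<rho>. G y = G2 y"
        using eventually_nhds_in_open[of "{s\<^sup>2<..}" \<rho>] gt by (auto simp: G_def elim!: eventually_mono)
      from iffD2[OF DERIV_cong_ev[OF refl this refl] G2'] show ?thesis using gt by (simp add: P_def)
    qed
    show "integrable lborel (\<lambda>\<rho>. indicator {0..B} \<rho> * (P \<rho> * deriv \<zeta> \<rho>))"
      by (intro integrable_indicator_continuous continuous_intros Pc c)
  qed (use B Gc in auto)
  also have "G B = - 4 * \<eta> (s\<^sup>2)"
  proof -
    have "deriv \<eta> B = 0" by (rule deriv_eq_0_beyond[of b]) (use zb(2) B in auto)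
    then show ?thesis using B zb(1)[of B] zb(2)[of B] by (simp add: G_def G2_def)
  qed
  also have "G 0 = 0" by (simp add: G_def G1_def)
  finally have I: "(LINT \<rho>|lborel. indicator {0..B} \<rho> * (P \<rho> * deriv \<zeta> \<rho>)) = - 4 * \<eta> (s\<^sup>2)" by simp
  have "(LINT \<rho>|lborel. radial_weight 4 \<rho> * log_kernel_4 (s / sqrt \<rho>) * deriv \<zeta> \<rho>) =
      pi\<^sup>2 * (LINT \<rho>|lborel. indicator {0..B} \<rho> * (P \<rho> * deriv \<zeta> \<rho>))"
  proof (rule integral_weight_kernel_eq)
    show "deriv \<zeta> \<rho> = 0" if "\<rho> > B" for \<rho> by (rule deriv_eq_0_beyond[of b]) (use zb(1) B that in auto)
    show "radial_weight 4 \<rho> * log_kernel_4 (s / sqrt \<rho>) = pi\<^sup>2 * P \<rho>" if "0 < \<rho>" for \<rho>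
    proof -
      have le: "s / sqrt \<rho> \<le> 1 \<longleftrightarrow> s\<^sup>2 \<le> \<rho>"
        using that s real_le_rsqrt[of s \<rho>] real_sqrt_le_iff[of "s\<^sup>2" \<rho>] by (auto simp: divide_le_eq)
      have sq: "(s / sqrt \<rho>)\<^sup>2 = s\<^sup>2 / \<rho>" using that by (simp add: power_divide)
      have "\<rho> * log_kernel_4 (s / sqrt \<rho>) = P \<rho>"
        unfolding log_kernel_4_def le sq P_def using that s2
        by (auto simp: field_simps power2_eq_square)
      then show ?thesis using that by (simp add: radial_weight_4 mult.assoc)
    qed
    show "P 0 = 0" by (simp add: P_def)
  qed (use B in auto)
  then show ?thesis unfolding I by simp
qed

subsection \<open>Radial solutions\<close>

text \<open>The radial projection of a measurable radial set is known to be measurable only up to null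
  sets; it is squeezed between images of \<open>\<sigma>\<close>-compact sets.\<close>

lemma borel_image_fsigma:
  fixes h :: "'a::euclidean_space \<Rightarrow> real"
  assumes "fsigma C" "continuous_on UNIV h"
  shows "h ` C \<in> sets borel"
proof -
  obtain F :: "nat \<Rightarrow> 'a set" where F: "range F \<subseteq> Collect compact" "C = \<Union> (range F)"
    using assms(1) unfolding fsigma_Union_compact by blast
  have "h ` C = (\<Union>i. h ` F i)" using F(2) by auto
  moreover have "h ` F i \<in> sets borel" for i
    using F(1) by (intro borel_closed compact_imp_closed compact_continuous_image
        continuous_on_subset[OF assms(2)]) auto
  then have "(\<Union>i. h ` F i) \<in> sets borel" by (intro sets.countable_UN) auto
  ultimately show ?thesis by (simp only:)
qed

lemma radial_eq_borel_AE:
  fixes u :: "'a::euclidean_space \<Rightarrow> real"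
  assumes u: "u \<in> borel_measurable lebesgue" and rad: "\<And>x y. norm x = norm y \<Longrightarrow> u x = u y"
  obtains H where "H \<in> borel_measurable borel" "AE x in lborel. u x = H (x \<bullet> x)"
proof -
  define sq where "sq x = x \<bullet> x" for x :: 'a
  have sqc: "continuous_on UNIV sq" unfolding sq_def by (intro continuous_intros)
  then have [measurable]: "sq \<in> borel_measurable borel" by (rule borel_measurable_continuous_onI)
  define M where "M = distr lborel borel sq"
  have [simp]: "space M = UNIV" "sets M = sets borel" by (simp_all add: M_def)
  obtain e :: 'a where e: "norm e = 1" using vector_choose_size[of 1] by auto
  define ur where "ur \<rho> = u (sqrt \<rho> *\<^sub>R e)" for \<rho>
  have ur: "ur (sq x) = u x" for x
    unfolding ur_def sq_def by (rule rad) (simp add: e flip: norm_eq_sqrt_inner)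
  have "ur \<in> borel_measurable (completion M)"
  proof (rule borel_measurableI_less)
    fix c :: real
    define E where "E = {x. u x < c}"
    have E: "E \<in> sets lebesgue"
      using borel_measurable_less[OF u borel_measurable_const[of c]] by (simp add: E_def)
    then have E': "- E \<in> sets lebesgue" by (metis Compl_in_sets_lebesgue)
    obtain C1 T1 where C1: "fsigma C1" "T1 \<in> null_sets lebesgue" "C1 \<union> T1 = E" "disjnt C1 T1"
      by (rule lebesgue_set_almost_fsigma[OF E])
    obtain C2 T2 where C2: "fsigma C2" "T2 \<in> null_sets lebesgue" "C2 \<union> T2 = - E" "disjnt C2 T2"
      by (rule lebesgue_set_almost_fsigma[OF E'])
    \<comment> \<open>The image of C1 lies inside the sublevel set of \<open>ur\<close> and the
      image of C2 outside it, so N contains every point left undecided. Its preimage lies in the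
      union of the null sets T1 and T2.\<close>
    define N where "N = - (sq ` C1 \<union> sq ` C2)"
    have b: "sq ` C1 \<in> sets borel" "sq ` C2 \<in> sets borel"
      using C1(1) C2(1) sqc by (auto intro: borel_image_fsigma)
    then have Nb: "N \<in> sets borel" by (simp add: N_def borel_comp)
    have "sq -` N \<subseteq> T1 \<union> T2"
    proof
      fix x assume "x \<in> sq -` N"
      then have "x \<notin> C1" "x \<notin> C2" by (auto simp: N_def)
      then show "x \<in> T1 \<union> T2" using C1(3) C2(3) by blast
    qed
    then have "negligible (sq -` N)"
      using C1(2) C2(2) negligible_Un negligible_subset unfolding negligible_iff_null_sets[symmetric] by blast
    moreover have "sq -` N \<in> sets borel"
      using measurable_sets[OF \<open>sq \<in> borel_measurable borel\<close> Nb] by simp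
    ultimately have "emeasure lborel (sq -` N) = 0"
      by (simp add: negligible_iff_emeasure0)
    then have N0: "N \<in> null_sets M"
      using Nb by (simp add: null_sets_def M_def emeasure_distr)
    have "{\<rho> \<in> space (completion M). ur \<rho> < c} = sq ` C1 \<union> ({\<rho>. ur \<rho> < c} - sq ` C1)"
    proof -
      have "ur (sq x) < c" if "x \<in> C1" for x
      proof -
        have "x \<in> E" using that C1(3) by blast
        then show ?thesis by (simp add: ur E_def)
      qed
      then show ?thesis by auto
    qed
    moreover have "{\<rho>. ur \<rho> < c} - sq ` C1 \<subseteq> N"
    proof
      fix \<rho> assume a: "\<rho> \<in> {\<rho>. ur \<rho> < c} - sq ` C1"
      have "\<rho> \<notin> sq ` C2"
      proof
        assume "\<rho> \<in> sq ` C2"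
        then obtain x where x: "x \<in> C2" "\<rho> = sq x" by auto
        then have "x \<in> - E" using C2(3) by blast
        then show False using a x by (simp add: ur E_def)
      qed
      then show "\<rho> \<in> N" using a by (simp add: N_def)
    qed
    ultimately show "{\<rho> \<in> space (completion M). ur \<rho> < c} \<in> sets (completion M)"
      using N0 b(1) by (intro sets_completionI[of _ "sq ` C1" _ N]) auto
  qed
  then obtain H where H: "H \<in> borel_measurable M" "AE \<rho> in M. ur \<rho> = H \<rho>"
    using completion_ex_borel_measurable_real[of ur M] by auto
  have Hb: "H \<in> borel_measurable borel" using H(1) by (simp add: M_def)
  have "AE x in lborel. ur (sq x) = H (sq x)"
    using H(2) unfolding M_def by (rule AE_distrD[rotated]) simp
  then have "AE x in lborel. u x = H (x \<bullet> x)" by (simp add: ur) (simp add: sq_def)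
  with Hb show ?thesis by (rule that)
qed

lemma primitive_greaterThan_0:
  fixes V :: "real \<Rightarrow> real"
  assumes "continuous_on {0<..} V"
  obtains U where "\<And>\<rho>. \<rho> > 0 \<Longrightarrow> (U has_real_derivative V \<rho>) (at \<rho>)"
proof -
  have "\<exists>U. \<forall>\<rho>. ereal 0 < ereal \<rho> \<longrightarrow> ereal \<rho> < \<infinity> \<longrightarrow> (U has_vector_derivative V \<rho>) (at \<rho>)"
  proof (rule einterval_antiderivative)
    show "isCont V x" if "ereal 0 < ereal x" "ereal x < \<infinity>" for x
      using assms that by (simp add: continuous_on_eq_continuous_at)
  qed simp
  then show ?thesis
    using that by (auto simp: has_real_derivative_iff_has_vector_derivative)
qed

text \<open>Both sides are \<open>2\<close> times the integral of \<open>U' (\<rho>) \<rho>\<^sup>p \<zeta>' (\<rho>)\<close> up to a constant, \<open>p = n / 2\<close>.\<close>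

lemma radial_weight_parts:
  assumes n: "n > 0" and a: "0 < a" "a < b"
    and z: "smooth_real_on UNIV \<zeta>" "\<And>\<rho>. \<rho> \<ge> b \<Longrightarrow> \<zeta> \<rho> = 0" "\<And>\<rho>. \<rho> < a \<Longrightarrow> deriv \<zeta> \<rho> = 0"
    and V: "continuous_on {0<..} V" and U: "\<And>\<rho>. \<rho> > 0 \<Longrightarrow> (U has_real_derivative V \<rho> / (2 * \<rho>)) (at \<rho>)"
  shows "(LINT \<rho>|lborel. radial_weight n \<rho> * U \<rho> * radial_neg_laplacian n \<zeta> \<rho>) =
    2 * (LINT \<rho>|lborel. radial_weight n \<rho> * V \<rho> * deriv \<zeta> \<rho>)"
proof -
  define \<alpha> where "\<alpha> = a / 2"
  define \<beta> where "\<beta> = b + 1"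
  have ab: "0 < \<alpha>" "\<alpha> < a" "b < \<beta>" "\<alpha> \<le> \<beta>" using a by (auto simp: \<alpha>_def \<beta>_def)
  define c where "c = real n * unit_ball_vol n / 2"
  define p where "p = real n / 2"
  have w: "radial_weight n \<rho> = c * \<rho> powr (p - 1)" if "\<rho> > 0" for \<rho> using that by (simp add: radial_weight_def c_def p_def)
  define q where "q \<rho> = \<rho> powr p * deriv \<zeta> \<rho>" for \<rho>
  define q' where "q' \<rho> = p * \<rho> powr (p - 1) * deriv \<zeta> \<rho> + deriv (deriv \<zeta>) \<rho> * \<rho> powr p" for \<rho>
  have d2: "(deriv \<zeta> has_real_derivative deriv (deriv \<zeta>) \<rho>) (at \<rho>)" for \<rho>
    using smooth_real_on_field_differentiable[OF smooth_real_on_deriv[OF z(1)], of \<rho>]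
    by (simp add: DERIV_deriv_iff_field_differentiable)
  have zc: "continuous_on A (deriv \<zeta>)" "continuous_on A (deriv (deriv \<zeta>))" for A
    using smooth_real_on_continuous_on[OF smooth_real_on_deriv[OF z(1)]]
      smooth_real_on_continuous_on[OF smooth_real_on_deriv[OF smooth_real_on_deriv[OF z(1)]]]
      continuous_on_subset by blast+
  have q': "(q has_real_derivative q' \<rho>) (at \<rho>)" if "\<rho> > 0" for \<rho>
    unfolding q_def q'_def using that by (intro DERIV_mult d2) (auto intro!: derivative_eq_intros)
  have Uc: "continuous_on {\<alpha>..\<beta>} U"
    using DERIV_isCont[OF U] ab by (intro continuous_at_imp_continuous_on ballI) auto
  have Vc: "continuous_on {\<alpha>..\<beta>} V" using ab by (intro continuous_on_subset[OF V]) auto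
  have qc: "continuous_on {\<alpha>..\<beta>} q" "continuous_on {\<alpha>..\<beta>} q'"
    unfolding q_def q'_def using ab by (intro continuous_intros zc; auto)+
  have zb: "deriv \<zeta> x = 0" "deriv (deriv \<zeta>) x = 0" if "x > b" for x
  proof -
    have 1: "deriv \<zeta> y = 0" if "y > b" for y
    proof -
      have "\<forall>\<^sub>F t in nhds y. \<zeta> t = 0"
        using eventually_nhds_in_open[of "{b<..}" y] that z(2) by (auto elim!: eventually_mono)
      from iffD2[OF DERIV_cong_ev[OF refl this refl] DERIV_const] show ?thesis by (rule DERIV_imp_deriv)
    qed
    then show "deriv \<zeta> x = 0" using that .
    have "\<forall>\<^sub>F t in nhds x. deriv \<zeta> t = 0"
      using eventually_nhds_in_open[of "{b<..}" x] that 1 by (auto elim!: eventually_mono)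
    from iffD2[OF DERIV_cong_ev[OF refl this refl] DERIV_const] show "deriv (deriv \<zeta>) x = 0" by (rule DERIV_imp_deriv)
  qed
  have za: "deriv \<zeta> x = 0" "deriv (deriv \<zeta>) x = 0" if "x < a" for x
  proof -
    show "deriv \<zeta> x = 0" using z(3) that .
    have "\<forall>\<^sub>F t in nhds x. deriv \<zeta> t = 0"
      using eventually_nhds_in_open[of "{..<a}" x] that z(3) by (auto elim!: eventually_mono)
    from iffD2[OF DERIV_cong_ev[OF refl this refl] DERIV_const] show "deriv (deriv \<zeta>) x = 0" by (rule DERIV_imp_deriv)
  qed
  have i1: "integrable lborel (\<lambda>\<rho>. indicator {\<alpha>..\<beta>} \<rho> * (V \<rho> / (2 * \<rho>) * q \<rho>))"
    using ab by (intro integrable_indicator_continuous continuous_intros Vc qc) auto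
  have i2: "integrable lborel (\<lambda>\<rho>. indicator {\<alpha>..\<beta>} \<rho> * (U \<rho> * q' \<rho>))"
    by (intro integrable_indicator_continuous continuous_intros Uc qc)
  have sum: "indicator {\<alpha>..\<beta>} \<rho> * (V \<rho> / (2 * \<rho>) * q \<rho> + U \<rho> * q' \<rho>) =
      indicator {\<alpha>..\<beta>} \<rho> * (V \<rho> / (2 * \<rho>) * q \<rho>) + indicator {\<alpha>..\<beta>} \<rho> * (U \<rho> * q' \<rho>)" for \<rho>
    by (simp only: distrib_left)
  have "(LINT \<rho>|lborel. indicator {\<alpha>..\<beta>} \<rho> * (V \<rho> / (2 * \<rho>) * q \<rho> + U \<rho> * q' \<rho>)) = U \<beta> * q \<beta> - U \<alpha> * q \<alpha>"
  proof (rule FTC_integrable_Icc[of _ _ "{}"])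
    show "((\<lambda>\<rho>. U \<rho> * q \<rho>) has_real_derivative V \<rho> / (2 * \<rho>) * q \<rho> + U \<rho> * q' \<rho>) (at \<rho>)" if "\<rho> \<in> {\<alpha><..<\<beta>} - {}" for \<rho>
    proof -
      have "((\<lambda>\<rho>. U \<rho> * q \<rho>) has_real_derivative V \<rho> / (2 * \<rho>) * q \<rho> + q' \<rho> * U \<rho>) (at \<rho>)"
        using that ab by (intro DERIV_mult U q') auto
      then show ?thesis by (simp only: mult.commute[of "q' \<rho>"])
    qed
    show "integrable lborel (\<lambda>\<rho>. indicator {\<alpha>..\<beta>} \<rho> * (V \<rho> / (2 * \<rho>) * q \<rho> + U \<rho> * q' \<rho>))"
      unfolding sum using i1 i2 by (rule Bochner_Integration.integrable_add)
  qed (use ab Uc qc in \<open>auto intro!: continuous_on_mult\<close>)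
  moreover have q0: "q \<alpha> = 0" "q \<beta> = 0" using za(1)[OF ab(2)] zb(1)[OF ab(3)] by (simp_all add: q_def)
  ultimately have "(LINT \<rho>|lborel. indicator {\<alpha>..\<beta>} \<rho> * (V \<rho> / (2 * \<rho>) * q \<rho>)) +
      (LINT \<rho>|lborel. indicator {\<alpha>..\<beta>} \<rho> * (U \<rho> * q' \<rho>)) = 0"
    unfolding sum by (simp only: Bochner_Integration.integral_add[OF i1 i2] q0 mult_zero_right diff_self)
  then have parts: "(LINT \<rho>|lborel. indicator {\<alpha>..\<beta>} \<rho> * (U \<rho> * q' \<rho>)) = - (LINT \<rho>|lborel. indicator {\<alpha>..\<beta>} \<rho> * (V \<rho> / (2 * \<rho>) * q \<rho>))"
    by linarith
  have 1: "radial_weight n \<rho> * U \<rho> * radial_neg_laplacian n \<zeta> \<rho> = (- 4 * c) * (indicator {\<alpha>..\<beta>} \<rho> * (U \<rho> * q' \<rho>))" for \<rho>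
  proof (cases "\<rho> \<in> {\<alpha>..\<beta>}")
    case True
    then have \<rho>: "\<rho> > 0" using ab by auto
    have pw: "\<rho> powr p = \<rho> powr (p - 1) * \<rho>" using \<rho> powr_add[of \<rho> "p - 1" 1] by simp
    have np: "real n = 2 * p" by (simp add: p_def)
    show ?thesis
      using True unfolding w[OF \<rho>] radial_neg_laplacian_def q'_def pw np by (simp add: algebra_simps)
  next
    case False
    then consider "\<rho> < a" | "\<rho> > b" using ab by auto
    then show ?thesis using False za[of \<rho>] zb[of \<rho>] by cases (auto simp: radial_neg_laplacian_def)
  qed
  have 2: "radial_weight n \<rho> * V \<rho> * deriv \<zeta> \<rho> = (2 * c) * (indicator {\<alpha>..\<beta>} \<rho> * (V \<rho> / (2 * \<rho>) * q \<rho>))" for \<rho>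
  proof (cases "\<rho> \<in> {\<alpha>..\<beta>}")
    case True
    then have \<rho>: "\<rho> > 0" using ab by auto
    have pw: "\<rho> powr p = \<rho> powr (p - 1) * \<rho>" using \<rho> powr_add[of \<rho> "p - 1" 1] by simp
    show ?thesis
      using True \<rho> unfolding w[OF \<rho>] q_def pw by simp
  next
    case False
    then consider "\<rho> < a" | "\<rho> > b" using ab by auto
    then show ?thesis using False za[of \<rho>] zb[of \<rho>] by cases auto
  qed
  show ?thesis unfolding 1 2 integral_mult_right_zero parts by simp
qed

text \<open>The kernel and \<gamma> stay abstract so that dimensions three and four share the
  representation of u and the mass estimate; only the pairing with test functions is specific to the
  dimension.\<close>

locale radial_potential = symmetric_kernel g for g :: "real \<Rightarrow> real" +
  fixes f :: "'a::euclidean_space \<Rightarrow> real" and \<gamma> :: real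
  assumes f_integrable: "integrable lborel f" and f_nonneg: "\<And>x. f x \<ge> 0" and gamma_pos: "\<gamma> > 0"
begin

definition V :: "real \<Rightarrow> real" where
  "V \<rho> = - 1 / \<gamma> * (LINT y|lborel. f y * g (norm y / sqrt \<rho>))"

lemma f_measurable [measurable]: "f \<in> borel_measurable borel"
  using borel_measurable_integrable[OF f_integrable] by simp

lemma AE_nonzero: "AE y::'a in lborel. y \<noteq> 0"
  using AE_lborel_singleton[of "0::'a"] by simp

lemma kernel_bound:
  assumes "\<rho> > 0" "y \<noteq> (0::'a)"
  shows "0 \<le> f y * g (norm y / sqrt \<rho>)" "f y * g (norm y / sqrt \<rho>) \<le> f y"
proof -
  have p: "norm y / sqrt \<rho> > 0" using assms by simp
  show "0 \<le> f y * g (norm y / sqrt \<rho>)" using kernel_nonneg[OF p] f_nonneg[of y] by simp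
  show "f y * g (norm y / sqrt \<rho>) \<le> f y" using kernel_le_1[OF p] f_nonneg[of y] by (simp add: mult_left_le)
qed

lemma integrable_kernel:
  assumes "\<rho> > 0"
  shows "integrable lborel (\<lambda>y. f y * g (norm y / sqrt \<rho>))"
proof (rule Bochner_Integration.integrable_bound[OF f_integrable])
  show "AE y in lborel. norm (f y * g (norm y / sqrt \<rho>)) \<le> norm (f y)"
    using AE_nonzero
  proof eventually_elim
    case (elim y)
    then show ?case using kernel_bound[OF assms elim] f_nonneg[of y] by simp
  qed
qed measurable

lemma V_bounds:
  assumes "\<rho> > 0"
  shows "V \<rho> \<le> 0" "V \<rho> \<ge> - (1 / \<gamma>) * (LINT y|lborel. f y)"
proof -
  have "0 \<le> (LINT y|lborel. f y * g (norm y / sqrt \<rho>))"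
    by (rule integral_nonneg_AE, rule eventually_mono[OF AE_nonzero], erule kernel_bound(1)[OF assms])
  then show "V \<rho> \<le> 0" using gamma_pos by (simp add: V_def divide_nonneg_pos)
  have "(LINT y|lborel. f y * g (norm y / sqrt \<rho>)) \<le> (LINT y|lborel. f y)"
    by (rule integral_mono_AE[OF integrable_kernel[OF assms] f_integrable],
        rule eventually_mono[OF AE_nonzero], erule kernel_bound(2)[OF assms])
  then have "1 / \<gamma> * (LINT y|lborel. f y * g (norm y / sqrt \<rho>)) \<le> 1 / \<gamma> * (LINT y|lborel. f y)"
    using gamma_pos by (intro mult_left_mono) auto
  then show "V \<rho> \<ge> - (1 / \<gamma>) * (LINT y|lborel. f y)" by (simp add: V_def)
qed

lemma V_continuous: "continuous_on {0<..} V"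
  unfolding continuous_on_sequentially
proof (intro ballI allI impI, elim conjE)
  fix x and X :: "nat \<Rightarrow> real" assume x: "x \<in> {0<..}" and X: "\<forall>n. X n \<in> {0<..}" "X \<longlonglongrightarrow> x"
  have "(\<lambda>n. LINT y|lborel. f y * g (norm y / sqrt (X n))) \<longlonglongrightarrow> (LINT y|lborel. f y * g (norm y / sqrt x))"
  proof (rule integral_dominated_convergence[where w = f])
    show "AE y in lborel. (\<lambda>n. f y * g (norm y / sqrt (X n))) \<longlonglongrightarrow> f y * g (norm y / sqrt x)"
      using AE_nonzero
    proof eventually_elim
      case (elim y)
      have "isCont g (norm y / sqrt x)"
        using kernel_continuous x elim by (simp add: continuous_on_eq_continuous_at)
      moreover have "(\<lambda>n. norm y / sqrt (X n)) \<longlonglongrightarrow> norm y / sqrt x"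
        using x by (intro tendsto_intros X) auto
      ultimately have "(\<lambda>n. g (norm y / sqrt (X n))) \<longlonglongrightarrow> g (norm y / sqrt x)"
        by (rule isCont_tendsto_compose)
      then show ?case by (rule tendsto_mult_left)
    qed
    show "AE y in lborel. norm (f y * g (norm y / sqrt (X n))) \<le> f y" for n
      using AE_nonzero
    proof eventually_elim
      case (elim y)
      then show ?case using kernel_bound[of "X n" y] X(1) by simp
    qed
  qed (use f_integrable in auto)
  then show "(V \<circ> X) \<longlonglongrightarrow> V x"
    unfolding V_def o_def by (rule tendsto_mult_left)
qed

lemma V_measurable: "(\<lambda>\<rho>. V \<rho>) \<in> borel_measurable borel"
  unfolding V_def by measurable

lemma integral_weight_V:
  assumes z: "continuous_on UNIV z" "\<And>x. x \<notin> {a..b} \<Longrightarrow> z x = 0" and ab: "0 < a" "a < b"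
  shows "(LINT \<rho>|lborel. radial_weight n \<rho> * V \<rho> * z \<rho>) =
    - 1 / \<gamma> * (LINT y|lborel. f y * (LINT \<rho>|lborel. radial_weight n \<rho> * g (norm y / sqrt \<rho>) * z \<rho>))"
proof -
  have [measurable]: "z \<in> borel_measurable borel" using z(1) by (rule borel_measurable_continuous_onI)
  define F where "F y \<rho> = f y * (radial_weight n \<rho> * g (norm y / sqrt \<rho>) * z \<rho>)" for y \<rho>
  have [measurable]: "case_prod F \<in> borel_measurable (lborel \<Otimes>\<^sub>M lborel)" unfolding F_def by measurable
  have wz: "integrable lborel (\<lambda>\<rho>. radial_weight n \<rho> * z \<rho>)"
  proof (rule integrable_mult_compactly_supported[where a = a and b = b])
    have "continuous_on {a..b} (\<lambda>\<rho>. real n * unit_ball_vol n / 2 * \<rho> powr (real n / 2 - 1))"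
      using ab by (intro continuous_intros) auto
    from integrable_indicator_continuous[OF this]
    show "integrable lborel (\<lambda>\<rho>. indicator {a..b} \<rho> * radial_weight n \<rho>)"
      by (rule Bochner_Integration.integrable_cong[THEN iffD1, rotated 2])
        (use ab in \<open>auto simp: radial_weight_def indicator_def\<close>)
  qed (use z in auto)
  have FI: "integrable (lborel \<Otimes>\<^sub>M lborel) (case_prod F)"
  proof (rule Bochner_Integration.integrable_bound)
    show "integrable (lborel \<Otimes>\<^sub>M lborel) (\<lambda>p. case p of (y, \<rho>) \<Rightarrow> f y * (radial_weight n \<rho> * z \<rho>))"
    proof (rule lborel_pair.Fubini_integrable)
      show "integrable lborel (\<lambda>y. LINT \<rho>|lborel. norm (case (y, \<rho>) of (y, \<rho>) \<Rightarrow> f y * (radial_weight n \<rho> * z \<rho>)))"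
        using f_integrable by (simp add: abs_mult)
      show "AE y in lborel. integrable lborel (\<lambda>\<rho>. case (y, \<rho>) of (y, \<rho>) \<Rightarrow> f y * (radial_weight n \<rho> * z \<rho>))"
        unfolding prod.case by (intro AE_I2 integrable_mult_right wz)
    qed measurable
    have "AE y in lborel. AE \<rho>::real in lborel. norm (F y \<rho>) \<le> norm (f y * (radial_weight n \<rho> * z \<rho>))"
      using AE_nonzero
    proof eventually_elim
      case (elim y)
      show ?case
      proof (intro AE_I2)
        fix \<rho> :: real
        show "norm (F y \<rho>) \<le> norm (f y * (radial_weight n \<rho> * z \<rho>))"
        proof (cases "\<rho> > 0")
          case True
          then have p: "norm y / sqrt \<rho> > 0" using elim by simp
          have "\<bar>g (norm y / sqrt \<rho>)\<bar> \<le> 1" using kernel_nonneg[OF p] kernel_le_1[OF p] by simp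
          then have "\<bar>f y * (radial_weight n \<rho> * z \<rho>)\<bar> * \<bar>g (norm y / sqrt \<rho>)\<bar> \<le> \<bar>f y * (radial_weight n \<rho> * z \<rho>)\<bar> * 1"
            by (intro mult_left_mono) auto
          then show ?thesis by (simp add: F_def abs_mult mult_ac)
        qed (simp add: F_def radial_weight_def)
      qed
    qed
    then have ae: "AE y in lborel. AE \<rho> in lborel. norm (case_prod F (y, \<rho>)) \<le>
        norm (case (y, \<rho>) of (y, \<rho>) \<Rightarrow> f y * (radial_weight n \<rho> * z \<rho>))"
      by (simp only: prod.case)
    show "AE p in lborel \<Otimes>\<^sub>M lborel. norm (case_prod F p) \<le> norm (case p of (y, \<rho>) \<Rightarrow> f y * (radial_weight n \<rho> * z \<rho>))"
      by (rule lborel_pair.AE_pair_measure[OF _ ae]) measurable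
  qed measurable
  have "(LINT \<rho>|lborel. radial_weight n \<rho> * V \<rho> * z \<rho>) = (LINT \<rho>|lborel. - 1 / \<gamma> * (LINT y|lborel. F y \<rho>))"
  proof (rule Bochner_Integration.integral_cong[OF refl])
    fix \<rho> :: real
    have "(LINT y|lborel. F y \<rho>) = (LINT y|lborel. (radial_weight n \<rho> * z \<rho>) * (f y * g (norm y / sqrt \<rho>)))"
      unfolding F_def by (intro Bochner_Integration.integral_cong) (auto simp: mult_ac)
    also have "\<dots> = (radial_weight n \<rho> * z \<rho>) * (LINT y|lborel. f y * g (norm y / sqrt \<rho>))"
      by (rule integral_mult_right_zero)
    finally show "radial_weight n \<rho> * V \<rho> * z \<rho> = - 1 / \<gamma> * (LINT y|lborel. F y \<rho>)"
      by (simp add: V_def mult_ac)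
  qed
  also have "\<dots> = - 1 / \<gamma> * (LINT y|lborel. (LINT \<rho>|lborel. F y \<rho>))"
    using lborel_pair.Fubini_integral[OF FI] by (simp only: integral_mult_right_zero)
  finally show ?thesis unfolding F_def by (simp only: integral_mult_right_zero)
qed

text \<open>The hypothesis \<open>pair\<close> is the equation in the form common to both
  dimensions. By \<open>radial_weight_parts\<close> and \<open>integral_weight_V\<close> the
  function U satisfies the same identity, so H - U annihilates every \<psi> with two vanishing
  moments and the du Bois-Reymond lemma applies.\<close>

lemma radial_representation:
  assumes n: "n = DIM('a)"
    and H [measurable]: "H \<in> borel_measurable borel"
    and loc: "\<And>R. integrable lborel (\<lambda>x::'a. indicator {..R} (x \<bullet> x) * H (x \<bullet> x))"
    and pair: "\<And>a b \<psi> \<zeta> \<eta>. 0 < a \<Longrightarrow> a < b \<Longrightarrow> smooth_real_on UNIV \<zeta> \<Longrightarrow> smooth_real_on UNIV \<eta> \<Longrightarrow>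
      (\<And>x. x \<ge> b \<Longrightarrow> \<zeta> x = 0) \<Longrightarrow> (\<And>x. x \<ge> b \<Longrightarrow> \<eta> x = 0) \<Longrightarrow>
      radial_neg_laplacian n \<zeta> = \<psi> \<Longrightarrow> radial_neg_laplacian n \<eta> = \<zeta> \<Longrightarrow>
      (LINT x|(lborel :: 'a measure). H (x \<bullet> x) * \<psi> (x \<bullet> x)) =
      - 2 / \<gamma> * (LINT y|lborel. f y * (LINT \<rho>|lborel. radial_weight n \<rho> * g (norm y / sqrt \<rho>) * deriv \<zeta> \<rho>))"
  obtains U A B where "\<And>\<rho>. \<rho> > 0 \<Longrightarrow> (U has_real_derivative V \<rho> / (2 * \<rho>)) (at \<rho>)"
    "AE x::'a in lborel. H (x \<bullet> x) = U (x \<bullet> x) + A + B * (x \<bullet> x)"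
proof -
  have n0: "n > 0" using n by simp
  have "continuous_on {0<..} (\<lambda>\<rho>. V \<rho> / (2 * \<rho>))"
    by (intro continuous_intros V_continuous) auto
  then obtain U0 where U0: "\<And>\<rho>. \<rho> > 0 \<Longrightarrow> (U0 has_real_derivative V \<rho> / (2 * \<rho>)) (at \<rho>)"
    by (rule primitive_greaterThan_0) blast
  \<comment> \<open>The extension by 0 makes U a Borel function on the whole line.\<close>
  define U where "U \<rho> = (if \<rho> > 0 then U0 \<rho> else 0)" for \<rho>
  have U: "(U has_real_derivative V \<rho> / (2 * \<rho>)) (at \<rho>)" if "\<rho> > 0" for \<rho>
  proof -
    have "\<forall>\<^sub>F y in nhds \<rho>. U y = U0 y"
      using eventually_nhds_in_open[of "{0<..}" \<rho>] that by (auto simp: U_def elim!: eventually_mono)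
    from iffD2[OF DERIV_cong_ev[OF refl this refl] U0[OF that]] show ?thesis .
  qed
  have Uc: "continuous_on {0<..} U"
    using DERIV_isCont[OF U] by (intro continuous_at_imp_continuous_on ballI) auto
  have Um [measurable]: "U \<in> borel_measurable borel"
  proof -
    have "(\<lambda>\<rho>. if \<rho> \<in> {0<..} then U \<rho> else 0) \<in> borel_measurable borel"
      by (rule borel_measurable_continuous_on_if) (use Uc in auto)
    moreover have "(\<lambda>\<rho>. if \<rho> \<in> {0<..} then U \<rho> else 0) = U" by (auto simp: U_def)
    ultimately show ?thesis by simp
  qed
  have locH: "integrable lborel (\<lambda>\<rho>. indicator {a..b} \<rho> * (radial_weight n \<rho> * H \<rho>))" if "0 < a" "a < b" for a b
  proof -
    have "integrable lborel (\<lambda>\<rho>. radial_weight n \<rho> * (indicator {..b} \<rho> * H \<rho>))"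
      using loc[of b] integrable_radial_iff[of "\<lambda>\<rho>. indicator {..b} \<rho> * H \<rho>", where 'a = 'a] n by simp
    then have "integrable lborel (\<lambda>\<rho>. indicator {a..b} \<rho> *\<^sub>R (radial_weight n \<rho> * (indicator {..b} \<rho> * H \<rho>)))"
      by (intro integrable_mult_indicator) auto
    then show ?thesis
      by (rule Bochner_Integration.integrable_cong[THEN iffD1, rotated 2]) (auto simp: indicator_def)
  qed
  have locU: "integrable lborel (\<lambda>\<rho>. indicator {a..b} \<rho> * (radial_weight n \<rho> * U \<rho>))" if "0 < a" "a < b" for a b
  proof -
    have "continuous_on {a..b} (\<lambda>\<rho>. (real n * unit_ball_vol n / 2 * \<rho> powr (real n / 2 - 1)) * U \<rho>)"
      using that by (intro continuous_intros continuous_on_subset[OF Uc]) auto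
    from integrable_indicator_continuous[OF this] show ?thesis
      by (rule Bochner_Integration.integrable_cong[THEN iffD1, rotated 2])
        (use that in \<open>auto simp: radial_weight_def indicator_def\<close>)
  qed
  have "\<exists>A B. AE \<rho> in lborel. \<rho> > 0 \<longrightarrow> H \<rho> - U \<rho> = A + B * \<rho>"
  proof (rule radial_du_bois_reymond[OF n0])
    fix a b :: real assume ab: "0 < a" "a < b"
    have "integrable lborel (\<lambda>\<rho>. indicator {a..b} \<rho> * (radial_weight n \<rho> * H \<rho>) - indicator {a..b} \<rho> * (radial_weight n \<rho> * U \<rho>))"
      by (intro Bochner_Integration.integrable_diff locH locU ab)
    then show "integrable lborel (\<lambda>\<rho>. indicator {a..b} \<rho> * (radial_weight n \<rho> * (H \<rho> - U \<rho>)))"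
      by (simp add: right_diff_distrib)
    fix \<psi> assume psi: "smooth_real_on UNIV \<psi>" "\<And>x. x \<notin> {a<..<b} \<Longrightarrow> \<psi> x = 0"
      and m: "(LINT \<rho>|lborel. radial_weight n \<rho> * \<psi> \<rho>) = 0" "(LINT \<rho>|lborel. radial_weight n \<rho> * \<rho> * \<psi> \<rho>) = 0"
    have pc: "continuous_on A \<psi>" for A
      using smooth_real_on_continuous_on[OF psi(1)] continuous_on_subset by blast
    have pz: "\<psi> x = 0" if "x \<notin> {a..b}" for x using psi(2) that by auto
    define c where "c = real n * unit_ball_vol n / 2"
    have c: "c > 0" using n0 by (simp add: c_def)
    have moment: "((\<lambda>\<rho>. \<rho> powr (n / 2 - 1) * (h \<rho> * \<psi> \<rho>)) has_integral 0) {a..b}"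
      if "(LINT \<rho>|lborel. radial_weight n \<rho> * h \<rho> * \<psi> \<rho>) = 0" "continuous_on {a..b} h" for h
    proof -
      have e: "radial_weight n \<rho> * h \<rho> * \<psi> \<rho> = c * (indicator {a..b} \<rho> * (\<rho> powr (n / 2 - 1) * (h \<rho> * \<psi> \<rho>)))" for \<rho>
        using pz[of \<rho>] ab by (cases "\<rho> \<in> {a..b}") (auto simp: radial_weight_def c_def)
      have i: "integrable lborel (\<lambda>\<rho>. indicator {a..b} \<rho> * (\<rho> powr (n / 2 - 1) * (h \<rho> * \<psi> \<rho>)))"
        by (intro integrable_indicator_continuous continuous_intros pc that(2)) (use ab in auto)
      have "(LINT \<rho>|lborel. indicator {a..b} \<rho> * (\<rho> powr (n / 2 - 1) * (h \<rho> * \<psi> \<rho>))) = 0"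
        using that(1) c unfolding e integral_mult_right_zero by simp
      with has_integral_integral_lborel[OF i]
      have "((\<lambda>\<rho>. indicator {a..b} \<rho> * (\<rho> powr (n / 2 - 1) * (h \<rho> * \<psi> \<rho>))) has_integral 0) UNIV" by simp
      moreover have "(\<lambda>\<rho>. indicator {a..b} \<rho> * (\<rho> powr (n / 2 - 1) * (h \<rho> * \<psi> \<rho>))) =
          (\<lambda>\<rho>. if \<rho> \<in> {a..b} then \<rho> powr (n / 2 - 1) * (h \<rho> * \<psi> \<rho>) else 0)" by (auto simp: indicator_def)
      ultimately show ?thesis by (simp only: has_integral_restrict_UNIV)
    qed
    have m1: "((\<lambda>\<rho>. \<rho> powr (n / 2 - 1) * \<psi> \<rho>) has_integral 0) {a..b}"
      using moment[of "\<lambda>_. 1"] m(1) by simp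
    have m2: "((\<lambda>\<rho>. \<rho> powr (n / 2) * \<psi> \<rho>) has_integral 0) {a..b}"
    proof (rule has_integral_eq)
      show "((\<lambda>\<rho>. \<rho> powr (n / 2 - 1) * (\<rho> * \<psi> \<rho>)) has_integral 0) {a..b}"
        using moment[of "\<lambda>\<rho>. \<rho>"] m(2) by (simp add: continuous_on_id)
      show "\<rho> powr (n / 2 - 1) * (\<rho> * \<psi> \<rho>) = \<rho> powr (n / 2) * \<psi> \<rho>" if "\<rho> \<in> {a..b}" for \<rho>
      proof -
        have "\<rho> powr (n / 2) = \<rho> powr (n / 2 - 1) * \<rho>" using that ab powr_add[of \<rho> "n / 2 - 1" 1] by simp
        then show ?thesis by simp
      qed
    qed
    obtain \<zeta> \<eta> where zz: "smooth_real_on UNIV \<zeta>" "smooth_real_on UNIV \<eta>"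
      "\<And>x. x \<ge> b \<Longrightarrow> \<zeta> x = 0" "\<And>x. x \<ge> b \<Longrightarrow> \<eta> x = 0" "\<And>x. x < a \<Longrightarrow> deriv \<zeta> x = 0"
      "radial_neg_laplacian n \<zeta> = \<psi>" "radial_neg_laplacian n \<eta> = \<zeta>"
    proof (rule radial_test_functions[OF n0 ab psi(1) _ m1 m2])
      show "\<psi> x = 0" if "x \<notin> {a<..<b}" for x using psi(2)[OF that] .
    qed (rule that)
    have dz: "deriv \<zeta> x = 0" if "x \<notin> {a..b}" for x
    proof (cases "x < a")
      case False
      then show ?thesis using that by (intro deriv_eq_0_beyond[of b]) (use zz(3) in auto)
    qed (rule zz(5))
    have pm [measurable]: "\<psi> \<in> borel_measurable borel" using pc by (rule borel_measurable_continuous_onI)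
    have HX: "(LINT \<rho>|lborel. radial_weight n \<rho> * H \<rho> * \<psi> \<rho>) = (LINT x|(lborel :: 'a measure). H (x \<bullet> x) * \<psi> (x \<bullet> x))"
      using integral_radial[of "\<lambda>\<rho>. H \<rho> * \<psi> \<rho>", where 'a = 'a] n by (simp add: mult.assoc)
    have UX: "(LINT \<rho>|lborel. radial_weight n \<rho> * U \<rho> * \<psi> \<rho>) = 2 * (LINT \<rho>|lborel. radial_weight n \<rho> * V \<rho> * deriv \<zeta> \<rho>)"
      unfolding zz(6)[symmetric]
      by (rule radial_weight_parts[OF n0 ab zz(1) _ _ V_continuous]) (erule zz(3) zz(5) U)+
    have VX: "(LINT \<rho>|lborel. radial_weight n \<rho> * V \<rho> * deriv \<zeta> \<rho>) =
        - 1 / \<gamma> * (LINT y|lborel. f y * (LINT \<rho>|lborel. radial_weight n \<rho> * g (norm y / sqrt \<rho>) * deriv \<zeta> \<rho>))"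
      by (rule integral_weight_V[OF smooth_real_on_continuous_on[OF smooth_real_on_deriv[OF zz(1)]] _ ab])
        (erule dz)
    have "radial_weight n \<rho> * (H \<rho> - U \<rho>) * \<psi> \<rho> = (radial_weight n \<rho> * H \<rho>) * \<psi> \<rho> - (radial_weight n \<rho> * U \<rho>) * \<psi> \<rho>" for \<rho>
      by (simp add: algebra_simps)
    moreover have "integrable lborel (\<lambda>\<rho>. (radial_weight n \<rho> * H \<rho>) * \<psi> \<rho>)"
      by (rule integrable_mult_compactly_supported[OF locH[OF ab] pc]) (erule pz)
    moreover have "integrable lborel (\<lambda>\<rho>. (radial_weight n \<rho> * U \<rho>) * \<psi> \<rho>)"
      by (rule integrable_mult_compactly_supported[OF locU[OF ab] pc]) (erule pz)
    ultimately have "(LINT \<rho>|lborel. radial_weight n \<rho> * (H \<rho> - U \<rho>) * \<psi> \<rho>) =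
        (LINT \<rho>|lborel. radial_weight n \<rho> * H \<rho> * \<psi> \<rho>) - (LINT \<rho>|lborel. radial_weight n \<rho> * U \<rho> * \<psi> \<rho>)"
      by (simp only: Bochner_Integration.integral_diff)
    also have "\<dots> = 0"
    proof -
      have "(LINT x|(lborel :: 'a measure). H (x \<bullet> x) * \<psi> (x \<bullet> x)) =
          - 2 / \<gamma> * (LINT y|lborel. f y * (LINT \<rho>|lborel. radial_weight n \<rho> * g (norm y / sqrt \<rho>) * deriv \<zeta> \<rho>))"
        by (rule pair[OF ab zz(1,2) _ _ zz(6,7)]) (erule zz(3) zz(4))+
      then show ?thesis unfolding HX UX VX by simp
    qed
    finally show "(LINT \<rho>|lborel. radial_weight n \<rho> * (H \<rho> - U \<rho>) * \<psi> \<rho>) = 0" .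
  qed
  then obtain A B where AB: "AE \<rho> in lborel. \<rho> > 0 \<longrightarrow> H \<rho> - U \<rho> = A + B * \<rho>" by blast
  have "AE x::'a in lborel. H (x \<bullet> x) - U (x \<bullet> x) = A + B * (x \<bullet> x)"
    using AB by (subst AE_radial_iff) auto
  then have "AE x::'a in lborel. H (x \<bullet> x) = U (x \<bullet> x) + A + B * (x \<bullet> x)"
    by eventually_elim simp
  with U show ?thesis by (rule that)
qed

end

section \<open>The value of \<open>Lambda1\<close> in dimensions three and four\<close>

lemma cone_over_sphere: "{r *\<^sub>R x | r x. 0 \<le> r \<and> r \<le> 1 \<and> x \<in> sphere (0 :: 'a::euclidean_space) 1} = cball 0 1"
proof (intro set_eqI iffI)
  fix z :: 'a assume "z \<in> cball 0 1"
  obtain e :: 'a where e: "norm e = 1" using vector_choose_size[of 1] by auto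
  show "z \<in> {r *\<^sub>R x | r x. 0 \<le> r \<and> r \<le> 1 \<and> x \<in> sphere 0 1}"
  proof (cases "z = 0")
    case True
    then have "z = 0 *\<^sub>R e \<and> (0::real) \<le> 0 \<and> (0::real) \<le> 1 \<and> e \<in> sphere 0 1" using e by simp
    then show ?thesis by blast
  next
    case False
    then have "z = norm z *\<^sub>R (z /\<^sub>R norm z) \<and> 0 \<le> norm z \<and> norm z \<le> 1 \<and> z /\<^sub>R norm z \<in> sphere 0 1"
      using \<open>z \<in> cball 0 1\<close> by simp
    then show ?thesis by blast
  qed
qed auto

lemma Lambda1_eq:
  "Lambda1 TYPE('n::finite) = fact (CARD('n) - 1) * (real (CARD('n) + 1) * unit_ball_vol (real (CARD('n) + 1)))"
  unfolding Lambda1_def sphere_surface_def cone_over_sphere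
  by (simp add: content_cball)

lemma Lambda1_3: "CARD('n::finite) = 3 \<Longrightarrow> Lambda1 TYPE('n) = 4 * pi\<^sup>2"
  by (simp add: Lambda1_eq eval_unit_ball_vol)

lemma Lambda1_4: "CARD('n::finite) = 4 \<Longrightarrow> Lambda1 TYPE('n) = 16 * pi\<^sup>2"
  by (simp add: Lambda1_eq eval_unit_ball_vol fact_numeral)

section \<open>The bound on the total mass\<close>

lemma lborel_scaleR:
  fixes F :: "'a::euclidean_space \<Rightarrow> real"
  assumes F: "integrable lborel F" and c: "c > 0"
  shows "integrable lborel (\<lambda>x. F (c *\<^sub>R x))" "(LINT x|lborel. F x) = c ^ DIM('a) * (LINT x|lborel. F (c *\<^sub>R x))"
proof -
  have [measurable]: "F \<in> borel_measurable borel" using borel_measurable_integrable[OF F] by simp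
  have eq: "lborel = density (distr lborel borel (\<lambda>x::'a. c *\<^sub>R x)) (\<lambda>_. ennreal (c ^ DIM('a)))"
    using lborel_affine[of c "0::'a"] c by simp
  have "integrable (density (distr lborel borel (\<lambda>x::'a. c *\<^sub>R x)) (\<lambda>_. ennreal (c ^ DIM('a)))) F"
    using F eq by simp
  then have "integrable lborel (\<lambda>x. c ^ DIM('a) * F (c *\<^sub>R x))"
    using c by (subst (asm) integrable_density) (auto simp: integrable_distr_eq)
  then show "integrable lborel (\<lambda>x. F (c *\<^sub>R x))" using c by simp
  have "(LINT x|lborel. F x) = (LINT x|density (distr lborel borel (\<lambda>x::'a. c *\<^sub>R x)) (\<lambda>_. ennreal (c ^ DIM('a))). F x)"
    using eq by simp
  also have "\<dots> = (LINT x|lborel. c ^ DIM('a) * F (c *\<^sub>R x))"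
    using c by (subst integral_density) (auto simp: integral_distr)
  finally show "(LINT x|lborel. F x) = c ^ DIM('a) * (LINT x|lborel. F (c *\<^sub>R x))" by simp
qed

context radial_potential
begin

text \<open>Symmetrisation in \<open>x\<close> and \<open>y\<close>: the two values of the kernel add up to one.\<close>

lemma integral_f_V:
  "(LINT x|lborel. f x * V (x \<bullet> x)) = - (LINT x|lborel. f x)\<^sup>2 / (2 * \<gamma>)"
proof -
  define \<kappa> where "\<kappa> = (LINT x|lborel. f x)"
  define F where "F x y = f x * (f y * g (norm y / norm x))" for x y
  have [measurable]: "case_prod F \<in> borel_measurable (lborel \<Otimes>\<^sub>M lborel)" unfolding F_def by measurable
  have nx: "norm x = sqrt (x \<bullet> x)" "x \<bullet> x > 0" if "x \<noteq> 0" for x :: 'a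
    using that by (simp_all add: norm_eq_sqrt_inner)
  have i1: "integrable lborel (\<lambda>y. F x y)" if "x \<noteq> 0" for x
    unfolding F_def nx(1)[OF that] by (intro integrable_mult_right integrable_kernel nx that)
  have g1: "0 \<le> g (norm y / norm x) \<and> g (norm y / norm x) \<le> 1" if "x \<noteq> 0" "y \<noteq> 0" for x y :: 'a
    using kernel_nonneg[of "norm y / norm x"] kernel_le_1[of "norm y / norm x"] that by simp
  have i2: "integrable lborel (\<lambda>y. F y x)" if "x \<noteq> 0" for x
  proof (rule Bochner_Integration.integrable_bound)
    show "integrable lborel (\<lambda>y. f x * f y)" using f_integrable by simp
    show "AE y in lborel. norm (F y x) \<le> norm (f x * f y)"
      using AE_nonzero
    proof eventually_elim
      case (elim y)
      then show ?case
        using g1[OF elim that] f_nonneg[of x] f_nonneg[of y]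
          mult_left_mono[of "g (norm x / norm y)" 1 "f x * f y"] by (simp add: F_def mult_ac)
    qed
  qed (simp add: F_def)
  have FI: "integrable (lborel \<Otimes>\<^sub>M lborel) (case_prod F)"
  proof (rule lborel_pair.Fubini_integrable)
    show "integrable lborel (\<lambda>x. LINT y|lborel. norm (case_prod F (x, y)))"
    proof (rule Bochner_Integration.integrable_bound)
      show "integrable lborel (\<lambda>x. \<kappa> * f x)" using f_integrable by simp
      show "AE x in lborel. norm (LINT y|lborel. norm (case_prod F (x, y))) \<le> norm (\<kappa> * f x)"
        using AE_nonzero
      proof eventually_elim
        case (elim x)
        have "(LINT y|lborel. norm (F x y)) \<le> (LINT y|lborel. f x * f y)"
        proof (rule integral_mono_AE)
          show "AE y in lborel. norm (F x y) \<le> f x * f y"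
            using AE_nonzero
          proof eventually_elim
            case (elim y)
            then show ?case
              using g1[OF \<open>x \<noteq> 0\<close> elim] f_nonneg[of x] f_nonneg[of y]
                mult_left_mono[of "g (norm y / norm x)" 1 "f x * f y"] by (simp add: F_def mult_ac)
          qed
        qed (use i1[OF elim] f_integrable in auto)
        also have "\<dots> = \<kappa> * f x" by (simp add: \<kappa>_def mult.commute)
        finally have le: "(LINT y|lborel. norm (F x y)) \<le> \<kappa> * f x" .
        have "0 \<le> (LINT y|lborel. norm (F x y))" by (rule integral_nonneg_AE) simp
        with le show ?case unfolding prod.case by (simp only: real_norm_def abs_of_nonneg)
      qed
    qed measurable
    show "AE x in lborel. integrable lborel (\<lambda>y. case_prod F (x, y))"
      unfolding prod.case by (rule eventually_mono[OF AE_nonzero]) (rule i1)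
  qed measurable
  define J where "J = (LINT x|lborel. (LINT y|lborel. F x y))"
  have J2: "J = (LINT x|lborel. (LINT y|lborel. F y x))"
    unfolding J_def using lborel_pair.Fubini_integral[OF FI] by simp
  have int1: "integrable lborel (\<lambda>x. LINT y|lborel. F x y)"
    using lborel_pair.integrable_fst[OF FI] .
  have int2: "integrable lborel (\<lambda>x. LINT y|lborel. F y x)"
    using lborel_pair.integrable_snd[OF FI] .
  have "J + J = (LINT x|lborel. (LINT y|lborel. F x y) + (LINT y|lborel. F y x))"
    using Bochner_Integration.integral_add[OF int1 int2] J2 by (simp add: J_def)
  also have "\<dots> = (LINT x|lborel. \<kappa> * f x)"
  proof (rule integral_cong_AE)
    show "AE x in lborel. (LINT y|lborel. F x y) + (LINT y|lborel. F y x) = \<kappa> * f x"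
      using AE_nonzero
    proof eventually_elim
      case (elim x)
      have "(LINT y|lborel. F x y) + (LINT y|lborel. F y x) = (LINT y|lborel. F x y + F y x)"
        using i1[OF elim] i2[OF elim] by simp
      also have "\<dots> = (LINT y|lborel. f x * f y)"
      proof (rule integral_cong_AE)
        show "AE y in lborel. F x y + F y x = f x * f y"
          using AE_nonzero
        proof eventually_elim
          case (elim y)
          have "norm y / norm x > 0" using elim \<open>x \<noteq> 0\<close> by simp
          from kernel_sum[OF this] have s: "g (norm y / norm x) + g (norm x / norm y) = 1" by simp
          have "F x y + F y x = f x * f y * (g (norm y / norm x) + g (norm x / norm y))"
            by (simp add: F_def algebra_simps)
          then show ?case unfolding s by simp
        qed
      qed (simp_all add: F_def)
      also have "\<dots> = \<kappa> * f x" by (simp add: \<kappa>_def mult.commute)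
      finally show ?case .
    qed
  qed (use int1 int2 in simp_all)
  also have "\<dots> = \<kappa>\<^sup>2" by (simp add: \<kappa>_def power2_eq_square)
  finally have J: "J = \<kappa>\<^sup>2 / 2" by simp
  have "(LINT x|lborel. f x * V (x \<bullet> x)) = (LINT x|lborel. - 1 / \<gamma> * (LINT y|lborel. F x y))"
    unfolding V_def F_def norm_eq_sqrt_inner by (simp add: mult.commute)
  also have "\<dots> = - 1 / \<gamma> * J" unfolding J_def by (rule integral_mult_right_zero)
  finally show ?thesis unfolding J \<kappa>_def by simp
qed

text \<open>As \<open>K\<close> decreases, \<open>f (e\<^sup>-\<^sup>\<epsilon> x) \<ge> f (x) exp (n D)\<close> with \<open>D = U (e\<^sup>-\<^sup>2\<^sup>\<epsilon> \<rho>) - U (\<rho>)\<close>; integrate, divide by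
  \<open>\<epsilon>\<close> and let \<open>\<epsilon> \<rightarrow> 0\<close>.\<close>

lemma total_mass_le:
  assumes U: "\<And>\<rho>. \<rho> > 0 \<Longrightarrow> (U has_real_derivative V \<rho> / (2 * \<rho>)) (at \<rho>)"
    and K: "\<And>\<rho>. K \<rho> \<ge> 0" "\<And>\<rho> \<sigma>. 0 \<le> \<rho> \<Longrightarrow> \<rho> \<le> \<sigma> \<Longrightarrow> K \<sigma> \<le> K \<rho>"
    and f: "AE x in lborel. f x = K (x \<bullet> x) * exp (real DIM('a) * U (x \<bullet> x))"
  shows "(LINT x|lborel. f x) \<le> 2 * \<gamma>"
proof -
  define \<kappa> where "\<kappa> = (LINT x|lborel. f x)"
  have k0: "\<kappa> \<ge> 0" unfolding \<kappa>_def by (rule integral_nonneg_AE) (simp add: f_nonneg)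
  define n where "n = real DIM('a)"
  define D where "D \<epsilon> \<rho> = U (exp (- 2 * \<epsilon>) * \<rho>) - U \<rho>" for \<epsilon> \<rho>
  have dU: "((\<lambda>\<epsilon>. U (exp (- 2 * \<epsilon>) * \<rho>)) has_real_derivative - V (exp (- 2 * \<epsilon>) * \<rho>)) (at \<epsilon>)" if "\<rho> > 0" for \<rho> \<epsilon>
  proof -
    have p: "exp (- 2 * \<epsilon>) * \<rho> > 0" using that by simp
    have "((\<lambda>\<epsilon>. exp (- 2 * \<epsilon>) * \<rho>) has_real_derivative (- 2 * (exp (- 2 * \<epsilon>) * \<rho>))) (at \<epsilon>)"
      by (auto intro!: derivative_eq_intros)
    from DERIV_chain2[OF U[OF p] this]
    have "((\<lambda>\<epsilon>. U (exp (- 2 * \<epsilon>) * \<rho>)) has_real_derivative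
        V (exp (- 2 * \<epsilon>) * \<rho>) / (2 * (exp (- 2 * \<epsilon>) * \<rho>)) * (- 2 * (exp (- 2 * \<epsilon>) * \<rho>))) (at \<epsilon>)" .
    moreover have "v / (2 * q) * (- 2 * q) = - v" if "q > 0" for v q :: real using that by simp
    from this[OF p] have "V (exp (- 2 * \<epsilon>) * \<rho>) / (2 * (exp (- 2 * \<epsilon>) * \<rho>)) * (- 2 * (exp (- 2 * \<epsilon>) * \<rho>)) = - V (exp (- 2 * \<epsilon>) * \<rho>)" .
    ultimately show ?thesis by (simp only:)
  qed
  \<comment> \<open>By the mean value theorem the quotient is a value of -V and hence at most
    \<kappa> / \<gamma>; this uniform bound is what permits the limit \<epsilon> \<rightarrow> 0
    under the integral.\<close>
  have D: "0 \<le> D \<epsilon> \<rho> / \<epsilon> \<and> D \<epsilon> \<rho> / \<epsilon> \<le> \<kappa> / \<gamma>" if "\<epsilon> > 0" "\<rho> > 0" for \<epsilon> \<rho>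
  proof -
    have "\<exists>z>0. z < \<epsilon> \<and> U (exp (- 2 * \<epsilon>) * \<rho>) - U (exp (- 2 * 0) * \<rho>) = (\<epsilon> - 0) * (- V (exp (- 2 * z) * \<rho>))"
      by (rule MVT2[OF that(1)]) (rule dU[OF that(2)])
    then obtain z where z: "D \<epsilon> \<rho> = \<epsilon> * (- V (exp (- 2 * z) * \<rho>))" by (auto simp: D_def)
    have "exp (- 2 * z) * \<rho> > 0" using that by simp
    from V_bounds[OF this] show ?thesis using that unfolding z \<kappa>_def by simp
  qed
  define E where "E m = 1 / real (Suc m)" for m
  have E: "E m > 0" "E \<longlonglongrightarrow> 0" for m
    using LIMSEQ_inverse_real_of_nat by (simp_all add: E_def[abs_def] inverse_eq_divide)
  have Dlim: "(\<lambda>m. D (E m) \<rho> / E m) \<longlonglongrightarrow> - V \<rho>" if "\<rho> > 0" for \<rho>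
  proof -
    have "((\<lambda>\<epsilon>. (U (exp (- 2 * (0 + \<epsilon>)) * \<rho>) - U (exp (- 2 * 0) * \<rho>)) / \<epsilon>) \<longlongrightarrow> - V (exp (- 2 * 0) * \<rho>)) (at 0)"
      using dU[OF that, of 0] unfolding DERIV_def .
    then have "((\<lambda>\<epsilon>. D \<epsilon> \<rho> / \<epsilon>) \<longlongrightarrow> - V \<rho>) (at 0)" by (simp add: D_def)
    moreover have "filterlim E (at 0) sequentially"
      using E less_imp_neq[OF E(1)] by (auto simp: filterlim_at)
    ultimately show ?thesis by (rule filterlim_compose)
  qed
  have [measurable]: "V \<in> borel_measurable borel" using V_measurable .
  have Uc: "continuous_on {0<..} U"
    using DERIV_isCont[OF U] by (intro continuous_at_imp_continuous_on ballI) auto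
  define U' where "U' \<rho> = (if \<rho> \<in> {0<..} then U \<rho> else 0)" for \<rho>
  have [measurable]: "U' \<in> borel_measurable borel"
    unfolding U'_def[abs_def] by (rule borel_measurable_continuous_on_if) (use Uc in auto)
  define D' where "D' \<epsilon> \<rho> = U' (exp (- 2 * \<epsilon>) * \<rho>) - U' \<rho>" for \<epsilon> \<rho>
  have D': "D' \<epsilon> \<rho> = D \<epsilon> \<rho>" if "\<rho> > 0" for \<epsilon> \<rho>
    using that by (simp add: D'_def D_def U'_def)
  have [measurable]: "(\<lambda>\<rho>. D' \<epsilon> \<rho>) \<in> borel_measurable borel" for \<epsilon> unfolding D'_def by measurable
  have pos: "AE x::'a in lborel. x \<bullet> x > 0" using AE_nonzero by eventually_elim simp
  have fD: "integrable lborel (\<lambda>x. f x * (D' \<epsilon> (x \<bullet> x) / \<epsilon>))" if "\<epsilon> > 0" for \<epsilon>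
  proof (rule Bochner_Integration.integrable_bound)
    show "integrable lborel (\<lambda>x. \<kappa> / \<gamma> * f x)" using f_integrable by simp
    show "AE x in lborel. norm (f x * (D' \<epsilon> (x \<bullet> x) / \<epsilon>)) \<le> norm (\<kappa> / \<gamma> * f x)"
      using pos
    proof eventually_elim
      case (elim x)
      have "\<bar>D' \<epsilon> (x \<bullet> x) / \<epsilon>\<bar> \<le> \<kappa> / \<gamma>" using D[OF that elim] by (simp only: D'[OF elim]) linarith
      then have "f x * \<bar>D' \<epsilon> (x \<bullet> x) / \<epsilon>\<bar> \<le> f x * (\<kappa> / \<gamma>)"
        using f_nonneg by (intro mult_left_mono)
      then show ?case using f_nonneg[of x] k0 gamma_pos by (simp add: abs_mult mult.commute)
    qed
  qed simp
  have key: "(exp (n * \<epsilon>) - 1) / \<epsilon> * \<kappa> \<ge> n * (LINT x|lborel. f x * (D' \<epsilon> (x \<bullet> x) / \<epsilon>))" if \<epsilon>: "\<epsilon> > 0" for \<epsilon>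
  proof -
    define c where "c = exp (- \<epsilon>)"
    have c: "c > 0" "c \<le> 1" using \<epsilon> by (simp_all add: c_def)
    \<comment> \<open>An identity valid almost everywhere is valid at almost every dilated point,
      because dilations multiply Lebesgue measure by a positive constant.\<close>
    have fc: "AE x in lborel. f (c *\<^sub>R x) = K ((c *\<^sub>R x) \<bullet> (c *\<^sub>R x)) * exp (n * U ((c *\<^sub>R x) \<bullet> (c *\<^sub>R x)))"
    proof -
      define P where "P z \<longleftrightarrow> f z = K (z \<bullet> z) * exp (n * U (z \<bullet> z))" for z
      have "AE z in lborel. P z" using f unfolding P_def n_def .
      moreover have "density (distr lborel borel (\<lambda>x::'a. 0 + c *\<^sub>R x)) (\<lambda>_. ennreal (\<bar>c\<bar> ^ DIM('a))) = lborel"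
        by (rule lborel_affine[symmetric]) (use c in simp)
      ultimately have "AE z in density (distr lborel borel (\<lambda>x::'a. 0 + c *\<^sub>R x)) (\<lambda>_. ennreal (\<bar>c\<bar> ^ DIM('a))). P z"
        by (simp only:)
      then have "AE z in distr lborel borel (\<lambda>x::'a. 0 + c *\<^sub>R x). P z"
        using c by (subst (asm) AE_density) auto
      then have "AE x in lborel. P (0 + c *\<^sub>R x)" by (rule AE_distrD[rotated]) simp
      then show ?thesis by (simp add: P_def)
    qed
    have "AE x in lborel. f x * (1 + n * D' \<epsilon> (x \<bullet> x)) \<le> f (c *\<^sub>R x)"
      using pos f fc
    proof eventually_elim
      case (elim x)
      define \<rho> where "\<rho> = x \<bullet> x"
      have \<rho>: "\<rho> > 0" using elim by (simp add: \<rho>_def)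
      have cx: "(c *\<^sub>R x) \<bullet> (c *\<^sub>R x) = exp (- 2 * \<epsilon>) * \<rho>"
        by (simp add: c_def \<rho>_def mult.assoc[symmetric] flip: exp_add)
      have fx: "f x = K \<rho> * exp (n * U \<rho>)" using elim by (simp add: \<rho>_def n_def)
      have fcx: "f (c *\<^sub>R x) = K (exp (- 2 * \<epsilon>) * \<rho>) * exp (n * U (exp (- 2 * \<epsilon>) * \<rho>))"
        using elim(3) unfolding cx .
      \<comment> \<open>Linearising by 1 + t \<le> exp t leaves an integrand that is linear in the
        difference quotient and integrable by \<open>fD\<close>.\<close>
      have "f x * (1 + n * D' \<epsilon> \<rho>) \<le> f x * exp (n * D' \<epsilon> \<rho>)"
        using f_nonneg exp_ge_add_one_self by (intro mult_left_mono) auto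
      also have "\<dots> = K \<rho> * exp (n * U (exp (- 2 * \<epsilon>) * \<rho>))"
        unfolding fx D'[OF \<rho>] D_def by (simp add: algebra_simps flip: exp_add)
      also have "\<dots> \<le> f (c *\<^sub>R x)"
        unfolding fcx using \<rho> \<epsilon> by (intro mult_right_mono K(2)) auto
      finally show ?case by (simp add: \<rho>_def)
    qed
    moreover have i: "integrable lborel (\<lambda>x. f x * (1 + n * D' \<epsilon> (x \<bullet> x)))"
    proof -
      have "integrable lborel (\<lambda>x. f x + (n * \<epsilon>) * (f x * (D' \<epsilon> (x \<bullet> x) / \<epsilon>)))"
        by (intro Bochner_Integration.integrable_add integrable_mult_right f_integrable fD \<epsilon>)
      then show ?thesis using \<epsilon> by (simp add: algebra_simps)
    qed
    ultimately have "(LINT x|lborel. f x * (1 + n * D' \<epsilon> (x \<bullet> x))) \<le> (LINT x|lborel. f (c *\<^sub>R x))"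
      by (intro integral_mono_AE lborel_scaleR f_integrable c)
    also have "(LINT x|lborel. f (c *\<^sub>R x)) = exp (n * \<epsilon>) * \<kappa>"
    proof -
      have "\<kappa> = c ^ DIM('a) * (LINT x|lborel. f (c *\<^sub>R x))"
        unfolding \<kappa>_def by (rule lborel_scaleR(2)[OF f_integrable c(1)])
      moreover have "exp (n * \<epsilon>) * c ^ DIM('a) = 1"
        by (simp add: c_def n_def flip: exp_of_nat_mult exp_add)
      ultimately show ?thesis by (metis mult.assoc mult_1)
    qed
    also have "(LINT x|lborel. f x * (1 + n * D' \<epsilon> (x \<bullet> x))) = \<kappa> + (n * \<epsilon>) * (LINT x|lborel. f x * (D' \<epsilon> (x \<bullet> x) / \<epsilon>))"
    proof -
      have "f x * (1 + n * D' \<epsilon> (x \<bullet> x)) = f x + (n * \<epsilon>) * (f x * (D' \<epsilon> (x \<bullet> x) / \<epsilon>))" for x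
        using \<epsilon> by (simp add: algebra_simps)
      then show ?thesis unfolding \<kappa>_def
        using Bochner_Integration.integral_add[OF f_integrable integrable_mult_right[OF fD[OF \<epsilon>], of "n * \<epsilon>"]]
        by (simp only: integral_mult_right_zero)
    qed
    finally have le: "\<kappa> + (n * \<epsilon>) * (LINT x|lborel. f x * (D' \<epsilon> (x \<bullet> x) / \<epsilon>)) \<le> exp (n * \<epsilon>) * \<kappa>" .
    have "n * (LINT x|lborel. f x * (D' \<epsilon> (x \<bullet> x) / \<epsilon>)) * \<epsilon> \<le> (exp (n * \<epsilon>) - 1) * \<kappa>"
    proof -
      have "n * (LINT x|lborel. f x * (D' \<epsilon> (x \<bullet> x) / \<epsilon>)) * \<epsilon> = (n * \<epsilon>) * (LINT x|lborel. f x * (D' \<epsilon> (x \<bullet> x) / \<epsilon>))"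
        by (simp only: mult_ac)
      then show ?thesis using le by (simp only: left_diff_distrib mult_1)
    qed
    then show ?thesis using \<epsilon> by (simp add: pos_le_divide_eq)
  qed
  have "(\<lambda>m. LINT x|lborel. f x * (D' (E m) (x \<bullet> x) / E m)) \<longlonglongrightarrow> (LINT x|lborel. f x * (- V (x \<bullet> x)))"
  proof (rule integral_dominated_convergence[where w = "\<lambda>x. \<kappa> / \<gamma> * f x"])
    show "integrable lborel (\<lambda>x. \<kappa> / \<gamma> * f x)" using f_integrable by simp
    show "AE x in lborel. (\<lambda>m. f x * (D' (E m) (x \<bullet> x) / E m)) \<longlonglongrightarrow> f x * (- V (x \<bullet> x))"
      using pos
    proof eventually_elim
      case (elim x)
      show ?case unfolding D'[OF elim] by (rule tendsto_mult_left[OF Dlim[OF elim]])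
    qed
    show "AE x in lborel. norm (f x * (D' (E m) (x \<bullet> x) / E m)) \<le> \<kappa> / \<gamma> * f x" for m
      using pos
    proof eventually_elim
      case (elim x)
      have "\<bar>D' (E m) (x \<bullet> x) / E m\<bar> \<le> \<kappa> / \<gamma>" using D[OF E(1) elim, of m] by (simp only: D'[OF elim]) linarith
      then have "f x * \<bar>D' (E m) (x \<bullet> x) / E m\<bar> \<le> f x * (\<kappa> / \<gamma>)"
        using f_nonneg by (intro mult_left_mono)
      then show ?case using f_nonneg[of x] by (simp add: abs_mult mult.commute)
    qed
  qed simp_all
  then have l1: "(\<lambda>m. n * (LINT x|lborel. f x * (D' (E m) (x \<bullet> x) / E m))) \<longlonglongrightarrow> n * (LINT x|lborel. f x * (- V (x \<bullet> x)))"
    by (rule tendsto_mult_left)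
  have "((\<lambda>\<epsilon>. (exp (n * \<epsilon>) - 1) / \<epsilon>) \<longlongrightarrow> n) (at 0)"
  proof -
    have "((\<lambda>\<epsilon>. exp (n * \<epsilon>)) has_real_derivative n) (at 0)" by (auto intro!: derivative_eq_intros)
    then show ?thesis unfolding DERIV_def by simp
  qed
  moreover have "filterlim E (at 0) sequentially"
    using E less_imp_neq[OF E(1)] by (auto simp: filterlim_at)
  ultimately have "(\<lambda>m. (exp (n * E m) - 1) / E m) \<longlonglongrightarrow> n" by (rule filterlim_compose)
  then have l2: "(\<lambda>m. (exp (n * E m) - 1) / E m * \<kappa>) \<longlonglongrightarrow> n * \<kappa>" by (rule tendsto_mult_right)
  have "n * (LINT x|lborel. f x * (- V (x \<bullet> x))) \<le> n * \<kappa>"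
    by (rule LIMSEQ_le[OF l1 l2]) (use key[OF E(1)] in blast)
  then have "(LINT x|lborel. f x * (- V (x \<bullet> x))) \<le> \<kappa>"
    by (rule mult_le_cancel_left_pos[THEN iffD1, rotated]) (simp add: n_def)
  then have "\<kappa>\<^sup>2 / (2 * \<gamma>) \<le> \<kappa>" using integral_f_V by (simp add: \<kappa>_def)
  then have "\<kappa>\<^sup>2 \<le> \<kappa> * (2 * \<gamma>)" using gamma_pos by (simp add: divide_le_eq)
  then have "\<kappa> * \<kappa> \<le> \<kappa> * (2 * \<gamma>)" by (simp add: power2_eq_square)
  show ?thesis
  proof (cases "\<kappa> > 0")
    case True
    then show ?thesis using \<open>\<kappa> * \<kappa> \<le> \<kappa> * (2 * \<gamma>)\<close> by (simp add: \<kappa>_def)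
  next
    case False
    then show ?thesis using gamma_pos by (simp add: \<kappa>_def)
  qed
qed

text \<open>From V \<ge> -b it follows that U falls at most like (b / 2) ln \<rho>, which the growth
  exp (s \<rho>) outweighs. Hence f \<ge> 1 outside a ball, and the whole space would have finite
  measure.\<close>

lemma not_integrable_if_growing:
  assumes U: "\<And>\<rho>. \<rho> > 0 \<Longrightarrow> (U has_real_derivative V \<rho> / (2 * \<rho>)) (at \<rho>)"
    and s: "s > 0" and K: "\<And>\<rho>. \<rho> \<ge> R \<Longrightarrow> K \<rho> \<ge> exp (s * \<rho>)"
    and f: "AE x in lborel. f x = K (x \<bullet> x) * exp (real DIM('a) * U (x \<bullet> x))"
  shows False
proof -
  define b where "b = 1 / \<gamma> * (LINT x|lborel. f x)"
  define n where "n = real DIM('a)"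
  have U_ge: "U \<rho> \<ge> U 1 - b / 2 * ln \<rho>" if "\<rho> \<ge> 1" for \<rho>
  proof -
    have "U 1 + b / 2 * ln 1 \<le> U \<rho> + b / 2 * ln \<rho>"
    proof (rule DERIV_nonneg_imp_nondecreasing[OF that])
      fix x :: real assume x: "1 \<le> x" "x \<le> \<rho>"
      then have d: "((\<lambda>x. U x + b / 2 * ln x) has_real_derivative V x / (2 * x) + b / 2 * (1 / x)) (at x)"
        by (auto intro!: derivative_eq_intros U)
      have "V x \<ge> - b" using V_bounds[of x] x by (simp add: b_def)
      then have "(V x + b) / (2 * x) \<ge> 0" using x by simp
      then have "V x / (2 * x) + b / 2 * (1 / x) \<ge> 0" using x by (simp add: add_divide_distrib)
      with d show "\<exists>y. ((\<lambda>x. U x + b / 2 * ln x) has_real_derivative y) (at x) \<and> y \<ge> 0" by blast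
    qed
    then show ?thesis by simp
  qed
  have "filterlim (\<lambda>\<rho>. s * \<rho> + n * (U 1 - b / 2 * ln \<rho>)) at_top at_top" using s by real_asymp
  then have "eventually (\<lambda>\<rho>. s * \<rho> + n * (U 1 - b / 2 * ln \<rho>) \<ge> 0) at_top" by (simp add: filterlim_at_top)
  then obtain N where N: "\<And>\<rho>. \<rho> \<ge> N \<Longrightarrow> s * \<rho> + n * (U 1 - b / 2 * ln \<rho>) \<ge> 0"
    by (auto simp: eventually_at_top_linorder)
  define M where "M = Max {1, N, R}"
  have M: "M \<ge> 1" "M \<ge> N" "M \<ge> R" by (simp_all add: M_def)
  have ge1: "K \<rho> * exp (n * U \<rho>) \<ge> 1" if "\<rho> \<ge> M" for \<rho>
  proof -
    have "0 \<le> s * \<rho> + n * (U 1 - b / 2 * ln \<rho>)" using N that M by simp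
    also have "\<dots> \<le> s * \<rho> + n * U \<rho>" using U_ge[of \<rho>] that M by (simp add: n_def)
    finally have "1 \<le> exp (s * \<rho>) * exp (n * U \<rho>)" by (simp flip: exp_add)
    also have "\<dots> \<le> K \<rho> * exp (n * U \<rho>)" using K that M by (intro mult_right_mono) auto
    finally show ?thesis .
  qed
  have "integrable lborel (\<lambda>x::'a. indicator {x. x \<bullet> x \<ge> M} x :: real)"
  proof (rule Bochner_Integration.integrable_bound[OF f_integrable])
    show "AE x in lborel. norm (indicator {x. x \<bullet> x \<ge> M} x :: real) \<le> norm (f x)"
      using f
    proof eventually_elim
      case (elim x)
      show ?case
      proof (cases "x \<bullet> x \<ge> M")
        case True
        then show ?thesis using ge1[OF True] elim by (simp add: n_def)
      qed simp
    qed
  qed measurable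
  moreover have "integrable lborel (\<lambda>x::'a. indicator (cball 0 (sqrt M)) x :: real)"
    by (rule integrable_real_indicator[OF _ emeasure_lborel_cball_finite]) simp
  ultimately have "integrable lborel (\<lambda>x::'a. (indicator {x. x \<bullet> x \<ge> M} x + indicator (cball 0 (sqrt M)) x) :: real)"
    by (rule Bochner_Integration.integrable_add)
  then have "integrable lborel (\<lambda>x::'a. 1 :: real)"
  proof (rule Bochner_Integration.integrable_bound)
    show "AE x::'a in lborel. norm (1::real) \<le> norm (indicator {x. x \<bullet> x \<ge> M} x + indicator (cball 0 (sqrt M)) x :: real)"
    proof (rule AE_I2)
      fix x :: 'a
      have "x \<bullet> x \<ge> M \<or> norm x \<le> sqrt M" by (simp add: norm_eq_sqrt_inner linear)
      then show "norm (1::real) \<le> norm (indicator {x. x \<bullet> x \<ge> M} x + indicator (cball 0 (sqrt M)) x :: real)"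
        by (auto simp: indicator_def)
    qed
  qed simp
  then show False by (simp add: integrable_iff_bounded emeasure_lborel_UNIV)
qed

text \<open>In the Gaussian case K is the exponential of an affine function of \<rho> with slope n B
  - lam; in the other case the sign of B decides, as ln Q is negligible against \<rho>. If the
  decisive number is at most 0, K is decreasing and \<open>total_mass_le\<close> applies; if it is
  positive, K grows exponentially, which \<open>not_integrable_if_growing\<close> excludes.\<close>

lemma total_mass_le_radial_weight:
  fixes Q :: "'a \<Rightarrow> real"
  assumes rad: "radially_symmetric Q" and decr: "radially_decreasing Q"
    and form: "(\<exists>\<delta> lam. \<delta> > 0 \<and> lam > 0 \<and> (\<forall>x. Q x = \<delta> * exp (- lam * (norm x)\<^sup>2))) \<or>
      (\<exists>\<xi>. (\<forall>x. Q x = exp (\<xi> x)) \<and> ((\<lambda>x. \<xi> x / (norm x)\<^sup>2) \<longlongrightarrow> 0) at_infinity)"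
    and U: "\<And>\<rho>. \<rho> > 0 \<Longrightarrow> (U has_real_derivative V \<rho> / (2 * \<rho>)) (at \<rho>)"
    and f: "AE x in lborel. f x = Q x * exp (real DIM('a) * (U (x \<bullet> x) + A + B * (x \<bullet> x)))"
  shows "(LINT x|lborel. f x) \<le> 2 * \<gamma>"
proof -
  obtain e :: 'a where e: "norm e = 1" using vector_choose_size[of 1] by auto
  define n where "n = real DIM('a)"
  define q where "q \<rho> = Q (sqrt \<rho> *\<^sub>R e)" for \<rho>
  define K where "K \<rho> = q \<rho> * exp (n * (A + B * \<rho>))" for \<rho>
  have n0: "n > 0" by (simp add: n_def)
  have Q: "Q x = q (x \<bullet> x)" for x
    using rad e unfolding radially_symmetric_def q_def by (metis abs_norm_cancel mult.right_neutral norm_eq_sqrt_inner norm_scaleR)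
  have f': "AE x in lborel. f x = K (x \<bullet> x) * exp (real DIM('a) * U (x \<bullet> x))"
    using f
  proof eventually_elim
    case (elim x)
    have "n * (u + A + B * r) = n * (A + B * r) + n * u" for u r by (simp add: algebra_simps)
    with elim show ?case by (simp add: K_def Q n_def[symmetric] exp_add mult.assoc)
  qed
  have Q0: "Q x > 0" for x using form by auto
  have K0: "K \<rho> \<ge> 0" for \<rho> using Q0[of "sqrt \<rho> *\<^sub>R e"] by (simp add: K_def q_def)
  have q_decr: "q \<sigma> \<le> q \<rho>" if "0 \<le> \<rho>" "\<rho> \<le> \<sigma>" for \<rho> \<sigma>
    using decr that e unfolding radially_decreasing_def q_def by simp
  have concl: ?thesis if "\<And>\<rho> \<sigma>. 0 \<le> \<rho> \<Longrightarrow> \<rho> \<le> \<sigma> \<Longrightarrow> K \<sigma> \<le> K \<rho>"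
    by (rule total_mass_le[OF U K0 that f'])
  have absurd: False if "s > 0" "\<And>\<rho>. \<rho> \<ge> R \<Longrightarrow> K \<rho> \<ge> exp (s * \<rho>)" for s R
    by (rule not_integrable_if_growing[OF U that(1) that(2) f'])
  from form show ?thesis
  proof
    assume "\<exists>\<delta> lam. \<delta> > 0 \<and> lam > 0 \<and> (\<forall>x. Q x = \<delta> * exp (- lam * (norm x)\<^sup>2))"
    then obtain \<delta> lam where d: "\<delta> > 0" "lam > 0" "\<And>x. Q x = \<delta> * exp (- lam * (norm x)\<^sup>2)" by blast
    have K: "K \<rho> = exp (ln \<delta> + n * A + (n * B - lam) * \<rho>)" if "\<rho> \<ge> 0" for \<rho>
    proof -
      have "(norm (sqrt \<rho> *\<^sub>R e))\<^sup>2 = \<rho>" using that e by simp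
      then have "K \<rho> = exp (ln \<delta>) * exp (- lam * \<rho>) * exp (n * (A + B * \<rho>))"
        using d(1) by (simp add: K_def q_def d(3))
      also have "\<dots> = exp (ln \<delta> + - lam * \<rho> + n * (A + B * \<rho>))" by (simp only: exp_add)
      also have "ln \<delta> + - lam * \<rho> + n * (A + B * \<rho>) = ln \<delta> + n * A + (n * B - lam) * \<rho>"
        by (simp add: algebra_simps)
      finally show ?thesis .
    qed
    show ?thesis
    proof (cases "n * B \<le> lam")
      case True
      then show ?thesis by (intro concl) (simp add: K mult_left_mono_neg)
    next
      case False
      \<comment> \<open>Half of the slope; the other half absorbs the constant ln \<delta> + n A
        once \<rho> \<ge> R.\<close>
      define s where "s = (n * B - lam) / 2"
      have s: "s > 0" "n * B - lam = 2 * s" using False by (simp_all add: s_def)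
      define R where "R = max 0 (- (ln \<delta> + n * A) / s)"
      have "exp (s * \<rho>) \<le> K \<rho>" if "\<rho> \<ge> R" for \<rho>
      proof -
        have r: "\<rho> \<ge> 0" "- (ln \<delta> + n * A) / s \<le> \<rho>" using that by (simp_all add: R_def)
        from r(2) have "- (ln \<delta> + n * A) \<le> \<rho> * s" using s(1) by (simp only: pos_divide_le_eq)
        then show ?thesis unfolding K[OF r(1)] s(2) by (simp add: algebra_simps)
      qed
      from absurd[OF s(1) this] show ?thesis by blast
    qed
  next
    assume "\<exists>\<xi>. (\<forall>x. Q x = exp (\<xi> x)) \<and> ((\<lambda>x. \<xi> x / (norm x)\<^sup>2) \<longlongrightarrow> 0) at_infinity"
    then obtain \<xi> where xi: "\<And>x. Q x = exp (\<xi> x)" "((\<lambda>x. \<xi> x / (norm x)\<^sup>2) \<longlongrightarrow> 0) at_infinity" by blast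
    show ?thesis
    proof (cases "B \<le> 0")
      case True
      show ?thesis
      proof (rule concl)
        fix \<rho> \<sigma> :: real assume r: "0 \<le> \<rho>" "\<rho> \<le> \<sigma>"
        have "exp (n * (A + B * \<sigma>)) \<le> exp (n * (A + B * \<rho>))"
          using r True n0 by (simp add: mult_left_mono_neg)
        then show "K \<sigma> \<le> K \<rho>" unfolding K_def
          using q_decr[OF r] Q0[of "sqrt \<rho> *\<^sub>R e"] by (intro mult_mono) (auto simp: q_def)
      qed
    next
      case False
      \<comment> \<open>The exponent 4 s \<rho> is split: one share s \<rho> pays for \<xi>, two
        absorb the constant n A, and one remains.\<close>
      define s where "s = n * B / 4"
      have s: "s > 0" "n * B = 4 * s" using False n0 by (simp_all add: s_def)
      from tendstoD[OF xi(2) s(1)] obtain b where b: "\<And>x. norm x \<ge> b \<Longrightarrow> dist (\<xi> x / (norm x)\<^sup>2) 0 < s"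
        by (auto simp: eventually_at_infinity)
      define R where "R = Max {1, b\<^sup>2, - (n * A) / (2 * s)}"
      have "exp (s * \<rho>) \<le> K \<rho>" if "\<rho> \<ge> R" for \<rho>
      proof -
        have r: "\<rho> \<ge> 1" "b\<^sup>2 \<le> \<rho>" "- (n * A) / (2 * s) \<le> \<rho>" using that by (simp_all add: R_def)
        have nr: "norm (sqrt \<rho> *\<^sub>R e) = sqrt \<rho>" "(norm (sqrt \<rho> *\<^sub>R e))\<^sup>2 = \<rho>" using r(1) e by simp_all
        have "b \<le> norm (sqrt \<rho> *\<^sub>R e)" unfolding nr(1) using r(2) by (rule real_le_rsqrt)
        from b[OF this] have "\<bar>\<xi> (sqrt \<rho> *\<^sub>R e) / \<rho>\<bar> < s" unfolding nr(2) by (simp only: dist_real_def diff_0_right)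
        then have "- s < \<xi> (sqrt \<rho> *\<^sub>R e) / \<rho>" by linarith
        then have x: "- s * \<rho> < \<xi> (sqrt \<rho> *\<^sub>R e)" using r(1) by (subst (asm) pos_less_divide_eq) auto
        have "- (n * A) \<le> \<rho> * (2 * s)" using r(3) s(1) by (subst (asm) pos_divide_le_eq) auto
        then have "s * \<rho> \<le> - s * \<rho> + (n * A + (n * B) * \<rho>)" unfolding s(2) by (simp add: algebra_simps)
        with x have "s * \<rho> \<le> \<xi> (sqrt \<rho> *\<^sub>R e) + n * (A + B * \<rho>)" by (simp only: distrib_left mult.assoc)
        then show ?thesis by (simp add: K_def q_def xi(1) flip: exp_add)
      qed
      from absurd[OF s(1) this] show ?thesis by blast
    qed
  qed
qed

text \<open>The interface to the equation: from here on the two dimensions differ only in the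
  verification of \<open>pair\<close>.\<close>

lemma total_mass_le_pairing:
  fixes Q :: "'a \<Rightarrow> real"
  assumes rad: "radially_symmetric Q" and decr: "radially_decreasing Q"
    and form: "(\<exists>\<delta> lam. \<delta> > 0 \<and> lam > 0 \<and> (\<forall>x. Q x = \<delta> * exp (- lam * (norm x)\<^sup>2))) \<or>
      (\<exists>\<xi>. (\<forall>x. Q x = exp (\<xi> x)) \<and> ((\<lambda>x. \<xi> x / (norm x)\<^sup>2) \<longlongrightarrow> 0) at_infinity)"
    and n: "n = DIM('a)"
    and H: "H \<in> borel_measurable borel"
    and loc: "\<And>R. integrable lborel (\<lambda>x::'a. indicator {..R} (x \<bullet> x) * H (x \<bullet> x))"
    and pair: "\<And>a b \<psi> \<zeta> \<eta>. 0 < a \<Longrightarrow> a < b \<Longrightarrow> smooth_real_on UNIV \<zeta> \<Longrightarrow> smooth_real_on UNIV \<eta> \<Longrightarrow>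
      (\<And>x. x \<ge> b \<Longrightarrow> \<zeta> x = 0) \<Longrightarrow> (\<And>x. x \<ge> b \<Longrightarrow> \<eta> x = 0) \<Longrightarrow>
      radial_neg_laplacian n \<zeta> = \<psi> \<Longrightarrow> radial_neg_laplacian n \<eta> = \<zeta> \<Longrightarrow>
      (LINT x|(lborel :: 'a measure). H (x \<bullet> x) * \<psi> (x \<bullet> x)) =
      - 2 / \<gamma> * (LINT y|lborel. f y * (LINT \<rho>|lborel. radial_weight n \<rho> * g (norm y / sqrt \<rho>) * deriv \<zeta> \<rho>))"
    and f: "AE x in lborel. f x = Q x * exp (real n * H (x \<bullet> x))"
  shows "(LINT x|lborel. f x) \<le> 2 * \<gamma>"
proof (rule radial_representation[OF n H loc pair])
  fix U A B
  assume U: "\<And>\<rho>. \<rho> > 0 \<Longrightarrow> (U has_real_derivative V \<rho> / (2 * \<rho>)) (at \<rho>)"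
    and HU: "AE x::'a in lborel. H (x \<bullet> x) = U (x \<bullet> x) + A + B * (x \<bullet> x)"
  show ?thesis
  proof (rule total_mass_le_radial_weight[OF rad decr form U])
    show "AE x in lborel. f x = Q x * exp (real DIM('a) * (U (x \<bullet> x) + A + B * (x \<bullet> x)))"
      using f HU by eventually_elim (simp add: n)
  qed
qed

end

subsection \<open>The weak equation on radial test functions\<close>

lemma borel_version:
  fixes f :: "'a::euclidean_space \<Rightarrow> real"
  assumes "f \<in> borel_measurable lebesgue"
  obtains f' where "f' \<in> borel_measurable borel" "AE x in lborel. f x = f' x"
  using completion_ex_borel_measurable_real[OF assms] by auto

lemma lebesgue_integral_borel_version:
  fixes F F' :: "'a::euclidean_space \<Rightarrow> 'b::{banach,second_countable_topology}"
  assumes [measurable]: "F \<in> borel_measurable lebesgue" and [measurable]: "F' \<in> borel_measurable borel"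
    and eq: "AE x in lborel. F x = F' x"
  shows "integrable lebesgue F \<longleftrightarrow> integrable lborel F'" "(LINT x|lebesgue. F x) = (LINT x|lborel. F' x)"
proof -
  have ae: "AE x in lebesgue. F x = F' x" using eq by (rule AE_completion)
  have [measurable]: "F' \<in> borel_measurable lebesgue" by (rule measurable_completion) simp
  show "integrable lebesgue F \<longleftrightarrow> integrable lborel F'"
    using integrable_cong_AE[OF _ _ ae] integrable_completion[of F' lborel] by simp
  show "(LINT x|lebesgue. F x) = (LINT x|lborel. F' x)"
    using integral_cong_AE[OF _ _ ae] integral_completion[of F' lborel] by simp
qed

lemma pairing_of_real:
  fixes u u' h :: "real ^ 'n::finite \<Rightarrow> real"
  assumes [measurable]: "u \<in> borel_measurable lebesgue" "u' \<in> borel_measurable borel" "h \<in> borel_measurable borel"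
    and eq: "AE x in lborel. u x = u' x"
  shows "pairing u (\<lambda>x. complex_of_real (h x)) = complex_of_real (LINT x|lborel. u' x * h x)"
proof -
  have [measurable]: "h \<in> borel_measurable lebesgue" by (rule measurable_completion) simp
  have "pairing u (\<lambda>x. complex_of_real (h x)) = (LINT x|lebesgue. complex_of_real (u x * h x))"
    by (simp add: pairing_def scaleR_conv_of_real)
  also have "\<dots> = complex_of_real (LINT x|lebesgue. u x * h x)" by (rule integral_complex_of_real)
  also have "(LINT x|lebesgue. u x * h x) = (LINT x|lborel. u' x * h x)"
  proof (rule lebesgue_integral_borel_version(2))
    show "AE x in lborel. u x * h x = u' x * h x" using eq by eventually_elim simp
  qed measurable
  finally show ?thesis .
qed

lemma locally_integrable_cball:
  "locally_integrable u \<Longrightarrow> integrable lebesgue (\<lambda>x. indicator (cball 0 r) x * u x)"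
  unfolding locally_integrable_def set_integrable_def by simp

lemma locally_integrable_measurable:
  fixes u :: "real ^ 'n::finite \<Rightarrow> real"
  assumes "locally_integrable u"
  shows "u \<in> borel_measurable lebesgue"
proof (rule borel_measurable_LIMSEQ_real)
  show "(\<lambda>x. indicator (cball 0 (real k)) x * u x) \<in> borel_measurable lebesgue" for k
    using borel_measurable_integrable[OF locally_integrable_cball[OF assms]] .
  show "(\<lambda>k. indicator (cball 0 (real k)) x * u x) \<longlonglongrightarrow> u x" for x
  proof (rule tendsto_eventually)
    obtain k0 where k0: "norm x \<le> real k0" using real_arch_simple by blast
    show "\<forall>\<^sub>F k in sequentially. indicator (cball 0 (real k)) x * u x = u x"
      using eventually_ge_at_top[of k0]
    proof eventually_elim
      case (elim k)
      then have "norm x \<le> real k" using k0 by linarith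
      then show ?case by simp
    qed
  qed
qed

lemma neg_laplacian_eq_radial_neg_laplacian:
  "smooth_real_on UNIV g \<Longrightarrow> neg_laplacian (\<lambda>x::real ^ 'n::finite. complex_of_real (g (x \<bullet> x))) =
    (\<lambda>x. complex_of_real (radial_neg_laplacian CARD('n) g (x \<bullet> x)))"
  unfolding radial_neg_laplacian_def by (rule neg_laplacian_radial_function)

lemma smooth_measurable_radial:
  "smooth_real_on UNIV g \<Longrightarrow> (\<lambda>x::'a::euclidean_space. g (x \<bullet> x)) \<in> borel_measurable borel"
  using borel_measurable_continuous_onI[OF smooth_real_on_continuous_on] by (rule measurable_compose[rotated]) auto

text \<open>The test function is \<eta> (|x|^2), whose bi-Laplacian is \<psi> (|x|^2). The
  right-hand side of the weak equation then pairs f with \<eta>, and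
  \<open>log_kernel_4_pairing\<close> rewrites \<eta> at each y \<noteq> 0.\<close>

lemma radial_kernel_pairing_4:
  fixes u f f' :: "real ^ 'n::finite \<Rightarrow> real"
  assumes dim: "CARD('n) = 4" and eq: "weak_neg_laplacian_power 2 u f"
    and H [measurable]: "H \<in> borel_measurable borel" and uH: "AE x in lborel. u x = H (x \<bullet> x)"
    and f' [measurable]: "f' \<in> borel_measurable borel" and ff': "AE x in lborel. f x = f' x"
    and z: "smooth_real_on UNIV \<zeta>" "smooth_real_on UNIV \<eta>"
    and zb: "\<And>\<rho>. \<rho> \<ge> b \<Longrightarrow> \<zeta> \<rho> = 0" "\<And>\<rho>. \<rho> \<ge> b \<Longrightarrow> \<eta> \<rho> = 0"
    and L: "radial_neg_laplacian 4 \<zeta> = \<psi>" "radial_neg_laplacian 4 \<eta> = \<zeta>"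
  shows "(LINT x|(lborel :: (real ^ 'n) measure). H (x \<bullet> x) * \<psi> (x \<bullet> x)) =
    - 2 / (8 * pi\<^sup>2) * (LINT y|lborel. f' y * (LINT \<rho>|lborel. radial_weight 4 \<rho> * log_kernel_4 (norm y / sqrt \<rho>) * deriv \<zeta> \<rho>))"
proof -
  define \<phi> where "\<phi> x = complex_of_real (\<eta> (x \<bullet> x))" for x :: "real ^ 'n"
  have T: "test_function \<phi>" unfolding \<phi>_def[abs_def] by (rule test_function_radial[OF z(2) zb(2)])
  have "neg_laplacian \<phi> = (\<lambda>x. complex_of_real (\<zeta> (x \<bullet> x)))"
    unfolding \<phi>_def[abs_def] neg_laplacian_eq_radial_neg_laplacian[OF z(2)] dim L ..
  then have "(neg_laplacian ^^ 2) \<phi> = (\<lambda>x. complex_of_real (\<psi> (x \<bullet> x)))"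
    by (simp add: numeral_2_eq_2 neg_laplacian_eq_radial_neg_laplacian[OF z(1)] dim L)
  then have P: "pairing u (\<lambda>x. complex_of_real (\<psi> (x \<bullet> x))) = pairing f (\<lambda>x. complex_of_real (\<eta> (x \<bullet> x)))"
    using eq T unfolding weak_neg_laplacian_power_def \<phi>_def[abs_def] by auto
  have m: "u \<in> borel_measurable lebesgue" "f \<in> borel_measurable lebesgue"
    using eq locally_integrable_measurable unfolding weak_neg_laplacian_power_def by blast+
  have "smooth_real_on UNIV (deriv \<zeta>)" "smooth_real_on UNIV (deriv (deriv \<zeta>))"
    using z(1) by (intro smooth_real_on_deriv; simp)+
  note mz = smooth_measurable_radial[OF this(1)] smooth_measurable_radial[OF this(2)]
  have mp: "(\<lambda>x::real ^ 'n. \<psi> (x \<bullet> x)) \<in> borel_measurable borel"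
    unfolding L(1)[symmetric] radial_neg_laplacian_def using mz by measurable
  have mh: "(\<lambda>x::real ^ 'n. \<eta> (x \<bullet> x)) \<in> borel_measurable borel" by (rule smooth_measurable_radial[OF z(2)])
  have mH: "(\<lambda>x::real ^ 'n. H (x \<bullet> x)) \<in> borel_measurable borel" by measurable
  have "complex_of_real (LINT x|(lborel :: (real ^ 'n) measure). H (x \<bullet> x) * \<psi> (x \<bullet> x)) = complex_of_real (LINT x|lborel. f' x * \<eta> (x \<bullet> x))"
    using P unfolding pairing_of_real[OF m(1) mH mp uH] pairing_of_real[OF m(2) f' mh ff'] .
  then have "(LINT x|(lborel :: (real ^ 'n) measure). H (x \<bullet> x) * \<psi> (x \<bullet> x)) = (LINT x|lborel. f' x * \<eta> (x \<bullet> x))" by (simp only: of_real_eq_iff)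
  also have "\<dots> = (LINT y|lborel. - 2 / (8 * pi\<^sup>2) *
      (f' y * (LINT \<rho>|lborel. radial_weight 4 \<rho> * log_kernel_4 (norm y / sqrt \<rho>) * deriv \<zeta> \<rho>)))"
  proof (rule integral_cong_AE)
    have "AE y::real ^ 'n in lborel. y \<noteq> 0" using AE_lborel_singleton[of "0 :: real ^ 'n"] by simp
    then show "AE y in lborel. f' y * \<eta> (y \<bullet> y) = - 2 / (8 * pi\<^sup>2) *
      (f' y * (LINT \<rho>|lborel. radial_weight 4 \<rho> * log_kernel_4 (norm y / sqrt \<rho>) * deriv \<zeta> \<rho>))"
    proof eventually_elim
      case (elim y)
      then have "norm y > 0" by simp
      from log_kernel_4_pairing[OF this z zb L(2)]
      have "\<eta> (y \<bullet> y) = - 1 / (4 * pi\<^sup>2) * (LINT \<rho>|lborel. radial_weight 4 \<rho> * log_kernel_4 (norm y / sqrt \<rho>) * deriv \<zeta> \<rho>)"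
        unfolding power2_norm_eq_inner .
      then show ?case by simp
    qed
    have [measurable]: "deriv \<zeta> \<in> borel_measurable borel"
      by (intro borel_measurable_continuous_onI smooth_real_on_continuous_on smooth_real_on_deriv z)
    note symmetric_kernel.kernel_measurable[OF symmetric_kernel_log_kernel_4, measurable]
    show "(\<lambda>y. - 2 / (8 * pi\<^sup>2) *
      (f' y * (LINT \<rho>|lborel. radial_weight 4 \<rho> * log_kernel_4 (norm y / sqrt \<rho>) * deriv \<zeta> \<rho>))) \<in> borel_measurable lborel"
      by measurable
  qed (use mh in measurable)
  also have "\<dots> = - 2 / (8 * pi\<^sup>2) * (LINT y|lborel. f' y * (LINT \<rho>|lborel. radial_weight 4 \<rho> * log_kernel_4 (norm y / sqrt \<rho>) * deriv \<zeta> \<rho>))"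
    by (rule integral_mult_right_zero)
  finally show ?thesis .
qed

text \<open>The divergence theorem in the variable \<rho>: sqrt \<rho> times the radial Laplacian is
  the derivative of -4 \<rho>^(3/2) \<eta>'. It provides the vanishing integral of \<zeta> that
  \<open>riesz_potential_pairing\<close> requires.\<close>

lemma integral_radial_neg_laplacian_3:
  assumes dim: "DIM('a::euclidean_space) = 3" and z: "smooth_real_on UNIV \<eta>" and zb: "\<And>\<rho>. \<rho> \<ge> b \<Longrightarrow> \<eta> \<rho> = 0"
  shows "(LINT x|(lborel :: 'a measure). radial_neg_laplacian 3 \<eta> (x \<bullet> x)) = 0"
proof -
  define c where "c = 3 * unit_ball_vol 3 / (2::real)"
  define B where "B = max 0 b + 1"
  have B: "B > 0" "B > b" by (simp_all add: B_def)
  have cont: "continuous_on A \<eta>" "continuous_on A (deriv \<eta>)" "continuous_on A (deriv (deriv \<eta>))" for A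
    using smooth_real_on_continuous_on[OF z] smooth_real_on_continuous_on[OF smooth_real_on_deriv[OF z]]
      smooth_real_on_continuous_on[OF smooth_real_on_deriv[OF smooth_real_on_deriv[OF z]]] continuous_on_subset by blast+
  have [measurable]: "radial_neg_laplacian 3 \<eta> \<in> borel_measurable borel"
    unfolding radial_neg_laplacian_def[abs_def] by (intro borel_measurable_continuous_onI continuous_intros cont)
  have d0: "deriv \<eta> x = 0" if "x > b" for x by (rule deriv_eq_0_beyond[OF zb that])
  have d00: "deriv (deriv \<eta>) x = 0" if "x > B" for x
    by (rule deriv_eq_0_beyond[OF d0 that]) (use B in simp)
  define g where "g \<rho> = c * (\<rho> powr (1/2) * radial_neg_laplacian 3 \<eta> \<rho>)" for \<rho>
  have gc: "continuous_on {0..B} g"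
    unfolding g_def radial_neg_laplacian_def by (intro continuous_intros cont continuous_on_powr') auto
  have "(LINT x|(lborel :: 'a measure). radial_neg_laplacian 3 \<eta> (x \<bullet> x)) =
      (LINT \<rho>|lborel. radial_weight 3 \<rho> * radial_neg_laplacian 3 \<eta> \<rho>)"
    using integral_radial[where 'a = 'a, of "radial_neg_laplacian 3 \<eta>"] by (simp add: dim)
  also have "\<dots> = (LINT \<rho>|lborel. indicator {0..B} \<rho> * g \<rho>)"
  proof (rule Bochner_Integration.integral_cong[OF refl])
    fix \<rho> :: real
    consider "\<rho> \<le> 0" | "0 < \<rho>" "\<rho> \<le> B" | "\<rho> > B" by linarith
    then show "radial_weight 3 \<rho> * radial_neg_laplacian 3 \<eta> \<rho> = indicator {0..B} \<rho> * g \<rho>"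
    proof cases
      case 1
      then show ?thesis by (cases "\<rho> = 0") (auto simp: radial_weight_def g_def)
    next
      case 2
      then show ?thesis by (simp add: radial_weight_def g_def c_def)
    next
      case 3
      then show ?thesis using B by (simp add: radial_neg_laplacian_def d0 d00)
    qed
  qed
  also have "\<dots> = c * (- 4 * (B powr (3/2) * deriv \<eta> B)) - c * (- 4 * (0 powr (3/2) * deriv \<eta> 0))"
  proof (rule FTC_integrable_Icc[where S = "{}"])
    show "continuous_on {0..B} (\<lambda>\<rho>. c * (- 4 * (\<rho> powr (3/2) * deriv \<eta> \<rho>)))"
      by (intro continuous_intros cont continuous_on_powr') auto
    show "integrable lborel (\<lambda>x. indicator {0..B} x * g x)"
      using borel_integrable_atLeastAtMost'[OF gc] by (simp add: set_integrable_def)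
  next
    fix x assume x: "x \<in> {0<..<B} - {}"
    then have x0: "x > 0" by simp
    have p: "x powr (3/2) = x * x powr (1/2)" using x0 powr_mult_base[of x "1/2"] by simp
    have "((\<lambda>\<rho>. c * (- 4 * (\<rho> powr (3/2) * deriv \<eta> \<rho>))) has_real_derivative
        c * (- 4 * (3/2 * x powr (3/2 - 1) * deriv \<eta> x + deriv (deriv \<eta>) x * x powr (3/2)))) (at x)"
      by (intro DERIV_cmult DERIV_mult has_real_derivative_powr x0 smooth_real_on_DERIV smooth_real_on_deriv z)
    moreover have "c * (- 4 * (3/2 * x powr (3/2 - 1) * deriv \<eta> x + deriv (deriv \<eta>) x * x powr (3/2))) = g x"
      unfolding g_def radial_neg_laplacian_def p by (simp add: algebra_simps)
    ultimately show "((\<lambda>\<rho>. c * (- 4 * (\<rho> powr (3/2) * deriv \<eta> \<rho>))) has_real_derivative g x) (at x)" by (simp only:)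
  qed (use B in simp_all)
  also have "\<dots> = 0" using d0[OF B(2)] by simp
  finally show ?thesis .
qed

text \<open>This Gaussian is (4 pi t)^(3/2) times \<open>heat t\<close>, so its Fourier transform is
  a multiple of exp (-t |\<xi>|^2) and \<open>half_heat_fourier\<close> applies.\<close>

lemma half_laplacian_gaussian:
  fixes t :: real
  assumes dim: "CARD('n::finite) = 3" and t: "t > 0"
  shows "half_laplacian (\<lambda>x::real ^ 'n. complex_of_real (exp (- (1 / (4 * t)) * (x \<bullet> x)))) =
    (\<lambda>x. complex_of_real ((4 * pi * t) powr (3 / 2) * half_heat t (x \<bullet> x)))"
proof
  fix x :: "real ^ 'n"
  define \<phi> where "\<phi> x = complex_of_real (exp (- (1 / (4 * t)) * (x \<bullet> x)))" for x :: "real ^ 'n"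
  define c where "c = (4 * pi * t) powr (3 / 2)"
  have \<tau>: "1 / (4 * t) > 0" using t by simp
  have F: "fourier \<phi> \<xi> = complex_of_real (c * exp (- t * (\<xi> \<bullet> \<xi>)))" for \<xi>
  proof -
    have "fourier \<phi> \<xi> = (LINT x|lebesgue. exp (- (1 / (4 * t)) * (x \<bullet> x)) *\<^sub>R cis (x \<bullet> - \<xi>))"
      by (simp add: fourier_def \<phi>_def scaleR_conv_of_real)
    also have "\<dots> = (LINT x|lborel. exp (- (1 / (4 * t)) * (x \<bullet> x)) *\<^sub>R cis (x \<bullet> - \<xi>))"
      by (rule integral_completion)
        (use has_bochner_integral_iff gaussian_fourier[OF \<tau>] borel_measurable_integrable in blast)
    also have "\<dots> = complex_of_real ((pi / (1 / (4 * t))) powr (DIM(real ^ 'n) / 2) * exp (- (- \<xi> \<bullet> - \<xi>) / (4 * (1 / (4 * t)))))"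
      by (rule has_bochner_integral_integral_eq[OF gaussian_fourier[OF \<tau>]])
    also have "\<dots> = complex_of_real (c * exp (- t * (\<xi> \<bullet> \<xi>)))"
      using t by (simp add: c_def dim mult_ac)
    finally show ?thesis .
  qed
  have "half_laplacian \<phi> x = (1 / (2 * pi) ^ 3) *\<^sub>R
      (LINT \<xi>|lebesgue. c *\<^sub>R ((norm \<xi> * exp (- t * (\<xi> \<bullet> \<xi>))) *\<^sub>R cis (x \<bullet> \<xi>)))"
    unfolding half_laplacian_def F dim by (simp add: scaleR_conv_of_real mult_ac)
  also have "(LINT \<xi>|lebesgue. c *\<^sub>R ((norm \<xi> * exp (- t * (\<xi> \<bullet> \<xi>))) *\<^sub>R cis (x \<bullet> \<xi>))) =
      (LINT \<xi>|lborel. c *\<^sub>R ((norm \<xi> * exp (- t * (\<xi> \<bullet> \<xi>))) *\<^sub>R cis (x \<bullet> \<xi>)))"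
  proof (rule integral_completion)
    have "continuous_on UNIV (\<lambda>\<xi>. c *\<^sub>R ((norm \<xi> * exp (- t * (\<xi> \<bullet> \<xi>))) *\<^sub>R cis (x \<bullet> \<xi>)))"
      by (intro continuous_intros)
    then show "(\<lambda>\<xi>. c *\<^sub>R ((norm \<xi> * exp (- t * (\<xi> \<bullet> \<xi>))) *\<^sub>R cis (x \<bullet> \<xi>))) \<in> borel_measurable lborel"
      by (simp add: borel_measurable_continuous_onI)
  qed
  also have "\<dots> = c *\<^sub>R (LINT \<xi>|lborel. (norm \<xi> * exp (- t * (\<xi> \<bullet> \<xi>))) *\<^sub>R cis (x \<bullet> \<xi>))"
    by (rule integral_scaleR_right)
  also have "\<dots> = c *\<^sub>R complex_of_real ((2 * pi) ^ 3 * half_heat t (x \<bullet> x))"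
    by (subst half_heat_fourier[OF t]) (simp_all add: dim)
  finally have "half_laplacian \<phi> x = (1 / (2 * pi) ^ 3) *\<^sub>R c *\<^sub>R complex_of_real ((2 * pi) ^ 3 * half_heat t (x \<bullet> x))" .
  also have "\<dots> = complex_of_real (1 / (2 * pi) ^ 3 * (c * ((2 * pi) ^ 3 * half_heat t (x \<bullet> x))))"
    by (simp only: scaleR_conv_of_real of_real_mult)
  also have "1 / (2 * pi) ^ 3 * (c * ((2 * pi) ^ 3 * half_heat t (x \<bullet> x))) = c * half_heat t (x \<bullet> x)"
    by simp
  finally show "half_laplacian (\<lambda>x::real ^ 'n. complex_of_real (exp (- (1 / (4 * t)) * (x \<bullet> x)))) x =
      complex_of_real ((4 * pi * t) powr (3 / 2) * half_heat t (x \<bullet> x))"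
    unfolding \<phi>_def[abs_def] c_def .
qed

lemma half_heat_equation:
  fixes v f v' f' :: "real ^ 'n::finite \<Rightarrow> real"
  assumes dim: "CARD('n) = 3" and t: "t > 0"
    and eq: "\<And>\<phi>. schwartz \<phi> \<Longrightarrow> pairing v (half_laplacian \<phi>) = pairing f \<phi>"
    and m: "v \<in> borel_measurable lebesgue" "f \<in> borel_measurable lebesgue"
    and [measurable]: "v' \<in> borel_measurable borel" "f' \<in> borel_measurable borel"
    and ae: "AE x in lborel. v x = v' x" "AE x in lborel. f x = f' x"
  shows "(LINT x|lborel. v' x * half_heat t (x \<bullet> x)) = (LINT x|lborel. f' x * heat t (x \<bullet> x))"
proof -
  define c where "c = (4 * pi * t) powr (3 / 2)"
  have c: "c > 0" "(4 * pi * t) powr (- (3 / 2)) * c = 1" using t by (simp_all add: c_def powr_minus)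
  have "schwartz (\<lambda>x::real ^ 'n. complex_of_real (exp (- (1 / (4 * t)) * (x \<bullet> x))))"
    by (rule schwartz_gaussian) (use t in simp)
  from eq[OF this, unfolded half_laplacian_gaussian[OF dim t]]
  have P: "pairing v (\<lambda>x. complex_of_real ((4 * pi * t) powr (3 / 2) * half_heat t (x \<bullet> x))) =
      pairing f (\<lambda>x. complex_of_real (exp (- (1 / (4 * t)) * (x \<bullet> x))))" .
  have m1: "(\<lambda>x::real ^ 'n. (4 * pi * t) powr (3 / 2) * half_heat t (x \<bullet> x)) \<in> borel_measurable borel" by measurable
  have m2: "(\<lambda>x::real ^ 'n. exp (- (1 / (4 * t)) * (x \<bullet> x))) \<in> borel_measurable borel" by measurable
  have "(LINT x|lborel. v' x * (c * half_heat t (x \<bullet> x))) = (LINT x|lborel. f' x * exp (- (1 / (4 * t)) * (x \<bullet> x)))"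
    using P unfolding pairing_of_real[OF m(1) assms(6) m1 ae(1)] pairing_of_real[OF m(2) assms(7) m2 ae(2)] of_real_eq_iff c_def .
  moreover have "v' x * (c * half_heat t (x \<bullet> x)) = c * (v' x * half_heat t (x \<bullet> x))" for x by simp
  moreover have "f' x * exp (- (1 / (4 * t)) * (x \<bullet> x)) = c * (f' x * heat t (x \<bullet> x))" for x
  proof -
    have "c * (f' x * heat t (x \<bullet> x)) = ((4 * pi * t) powr (- (3 / 2)) * c) * (f' x * exp (- (x \<bullet> x) / (4 * t)))"
      unfolding heat_def by (simp only: mult_ac)
    then have "c * (f' x * heat t (x \<bullet> x)) = f' x * exp (- (1 / (4 * t)) * (x \<bullet> x))" unfolding c(2) by simp
    then show ?thesis by (rule sym)
  qed
  ultimately have "c * (LINT x|lborel. v' x * half_heat t (x \<bullet> x)) = c * (LINT x|lborel. f' x * heat t (x \<bullet> x))"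
    by (simp only: integral_mult_right_zero)
  then show ?thesis using c(1) by simp
qed

text \<open>Pairing u with \<psi> = -\<Delta>\<zeta> amounts to pairing v with \<zeta>. Since
  \<zeta> = -\<Delta>\<eta> has integral 0, v may be replaced by the Riesz potential of f despite
  the constant left open, and \<open>riesz_kernel_pairing\<close> integrates by parts.\<close>

lemma radial_kernel_pairing_3:
  fixes u v f f' :: "real ^ 'n::finite \<Rightarrow> real"
  assumes dim: "CARD('n) = 3" and eq1: "weak_neg_laplacian_power 1 u v" and v: "L_half v"
    and eq2: "\<And>\<phi>. schwartz \<phi> \<Longrightarrow> pairing v (half_laplacian \<phi>) = pairing f \<phi>"
    and f: "f \<in> borel_measurable lebesgue"
    and H [measurable]: "H \<in> borel_measurable borel" and uH: "AE x in lborel. u x = H (x \<bullet> x)"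
    and f': "integrable lborel f'" "\<And>x. f' x \<ge> 0" and ff': "AE x in lborel. f x = f' x"
    and b: "b > 0" and z: "smooth_real_on UNIV \<zeta>" "smooth_real_on UNIV \<eta>"
    and zb: "\<And>\<rho>. \<rho> \<ge> b \<Longrightarrow> \<zeta> \<rho> = 0" "\<And>\<rho>. \<rho> \<ge> b \<Longrightarrow> \<eta> \<rho> = 0"
    and L: "radial_neg_laplacian 3 \<zeta> = \<psi>" "radial_neg_laplacian 3 \<eta> = \<zeta>"
  shows "(LINT x|(lborel :: (real ^ 'n) measure). H (x \<bullet> x) * \<psi> (x \<bullet> x)) =
    - 2 / (2 * pi\<^sup>2) * (LINT y|lborel. f' y * (LINT \<rho>|lborel. radial_weight 3 \<rho> * log_kernel_3 (norm y / sqrt \<rho>) * deriv \<zeta> \<rho>))"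
proof -
  have [measurable]: "f' \<in> borel_measurable borel" using borel_measurable_integrable[OF f'(1)] by simp
  have m: "u \<in> borel_measurable lebesgue" "v \<in> borel_measurable lebesgue"
    using eq1 locally_integrable_measurable unfolding weak_neg_laplacian_power_def by blast+
  obtain v' where v' [measurable]: "v' \<in> borel_measurable borel" and vv': "AE x in lborel. v x = v' x"
    using borel_version[OF m(2)] by blast
  have d3: "DIM(real ^ 'n) = 3" using dim by simp
  have iv: "integrable lborel (\<lambda>x. \<bar>v' x\<bar> / (1 + norm x ^ 4))"
  proof -
    have i: "integrable lebesgue (\<lambda>x. \<bar>v x\<bar> / (1 + norm x ^ 4))" using v dim unfolding L_half_def by simp
    have "AE x in lborel. \<bar>v x\<bar> / (1 + norm x ^ 4) = \<bar>v' x\<bar> / (1 + norm x ^ 4)"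
      using vv' by eventually_elim simp
    with i show ?thesis
      using lebesgue_integral_borel_version(1)[OF borel_measurable_integrable[OF i], of "\<lambda>x. \<bar>v' x\<bar> / (1 + norm x ^ 4)"]
      by simp
  qed
  have heat: "(LINT x|lborel. v' x * half_heat t (x \<bullet> x)) = (LINT x|lborel. f' x * heat t (x \<bullet> x))" if "t > 0" for t
    by (rule half_heat_equation[OF dim that eq2 m(2) f v' _ vv' ff']) measurable
  have T: "test_function (\<lambda>x::real ^ 'n. complex_of_real (\<zeta> (x \<bullet> x)))" by (rule test_function_radial[OF z(1) zb(1)])
  have "neg_laplacian (\<lambda>x::real ^ 'n. complex_of_real (\<zeta> (x \<bullet> x))) = (\<lambda>x. complex_of_real (\<psi> (x \<bullet> x)))"
    unfolding neg_laplacian_eq_radial_neg_laplacian[OF z(1)] dim L ..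
  then have P: "pairing u (\<lambda>x. complex_of_real (\<psi> (x \<bullet> x))) = pairing v (\<lambda>x. complex_of_real (\<zeta> (x \<bullet> x)))"
    using eq1 T unfolding weak_neg_laplacian_power_def by auto
  have "smooth_real_on UNIV (deriv \<zeta>)" "smooth_real_on UNIV (deriv (deriv \<zeta>))"
    using z(1) by (intro smooth_real_on_deriv; simp)+
  note mz = smooth_measurable_radial[OF this(1)] smooth_measurable_radial[OF this(2)]
  have mp: "(\<lambda>x::real ^ 'n. \<psi> (x \<bullet> x)) \<in> borel_measurable borel"
    unfolding L(1)[symmetric] radial_neg_laplacian_def using mz by measurable
  have mh: "(\<lambda>x::real ^ 'n. \<zeta> (x \<bullet> x)) \<in> borel_measurable borel" by (rule smooth_measurable_radial[OF z(1)])
  have mH: "(\<lambda>x::real ^ 'n. H (x \<bullet> x)) \<in> borel_measurable borel" by measurable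
  have "(LINT x|(lborel :: (real ^ 'n) measure). H (x \<bullet> x) * \<psi> (x \<bullet> x)) = (LINT x|lborel. v' x * \<zeta> (x \<bullet> x))"
    using P unfolding pairing_of_real[OF m(1) mH mp uH] pairing_of_real[OF m(2) v' mh vv'] of_real_eq_iff .
  also have "\<dots> = 1 / (2 * pi\<^sup>2) * (LINT y|lborel. f' y * (LINT x|(lborel :: (real ^ 'n) measure). riesz_kernel (x \<bullet> x) (norm y) * \<zeta> (x \<bullet> x)))"
  proof (rule riesz_potential_pairing[OF d3 v' iv f'])
    show "continuous_on UNIV \<zeta>" by (rule smooth_real_on_continuous_on[OF z(1)])
    show "(LINT x|(lborel :: (real ^ 'n) measure). \<zeta> (x \<bullet> x)) = 0"
      using integral_radial_neg_laplacian_3[OF d3 z(2) zb(2)] by (simp add: L(2))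
    show "(LINT x|lborel. v' x * (poisson y (x \<bullet> x) - poisson Y (x \<bullet> x))) =
        (LINT x|lborel. f' x * (newton y (x \<bullet> x) - newton Y (x \<bullet> x)))" if "0 < y" "y < Y" for y Y
      by (rule half_heat_equation_imp_poisson[OF d3 that v' iv f'(1) heat])
  qed (rule zb(1))
  also have "(LINT y|lborel. f' y * (LINT x|(lborel :: (real ^ 'n) measure). riesz_kernel (x \<bullet> x) (norm y) * \<zeta> (x \<bullet> x))) =
      (LINT y|lborel. - 2 * (f' y * (LINT \<rho>|lborel. radial_weight 3 \<rho> * log_kernel_3 (norm y / sqrt \<rho>) * deriv \<zeta> \<rho>)))"
  proof (rule integral_cong_AE)
    have "AE y::real ^ 'n in lborel. y \<noteq> 0" using AE_lborel_singleton[of "0 :: real ^ 'n"] by simp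
    then show "AE y in lborel. f' y * (LINT x|(lborel :: (real ^ 'n) measure). riesz_kernel (x \<bullet> x) (norm y) * \<zeta> (x \<bullet> x)) =
        - 2 * (f' y * (LINT \<rho>|lborel. radial_weight 3 \<rho> * log_kernel_3 (norm y / sqrt \<rho>) * deriv \<zeta> \<rho>))"
    proof eventually_elim
      case (elim y)
      then have "norm y > 0" by simp
      from riesz_kernel_pairing[OF d3 this z(1) zb(1) b] show ?case by simp
    qed
    have [measurable]: "deriv \<zeta> \<in> borel_measurable borel" "\<zeta> \<in> borel_measurable borel"
      by (intro borel_measurable_continuous_onI smooth_real_on_continuous_on smooth_real_on_deriv z)+
    note symmetric_kernel.kernel_measurable[OF symmetric_kernel_log_kernel_3, measurable]
    show "(\<lambda>y. - 2 * (f' y * (LINT \<rho>|lborel. radial_weight 3 \<rho> * log_kernel_3 (norm y / sqrt \<rho>) * deriv \<zeta> \<rho>))) \<in> borel_measurable lborel"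
      by measurable
    show "(\<lambda>y. f' y * (LINT x|(lborel :: (real ^ 'n) measure). riesz_kernel (x \<bullet> x) (norm y) * \<zeta> (x \<bullet> x))) \<in> borel_measurable lborel"
      by measurable
  qed
  also have "\<dots> = - 2 * (LINT y|lborel. f' y * (LINT \<rho>|lborel. radial_weight 3 \<rho> * log_kernel_3 (norm y / sqrt \<rho>) * deriv \<zeta> \<rho>))"
    by (rule integral_mult_right_zero)
  finally show ?thesis by simp
qed

theorem lemma3p5:
  fixes Q :: "real ^ 'n::finite \<Rightarrow> real"
  assumes dim: "CARD('n) = 3 \<or> CARD('n) = 4"
    and C1: "C1_function Q"
    and radial: "radially_symmetric Q"
    and decreasing: "radially_decreasing Q"
    and form: "(\<exists>\<delta> lam. \<delta> > 0 \<and> lam > 0 \<and> (\<forall>x. Q x = \<delta> * exp (- lam * (norm x)\<^sup>2))) \<or>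
      (\<exists>\<xi>. (\<forall>x. Q x = exp (\<xi> x)) \<and>
        (\<exists>C. \<forall>x. \<bar>x \<bullet> gradient Q x\<bar> \<le> C) \<and>
        ((\<lambda>x. \<xi> x / (norm x)\<^sup>2) \<longlongrightarrow> 0) at_infinity)"
  shows "\<forall>\<kappa> > Lambda1 TYPE('n).
    \<not> (\<exists>u :: real ^ 'n \<Rightarrow> real. radially_symmetric u \<and>
      solves_half_n_laplace u (\<lambda>x. Q x * exp (real CARD('n) * u x)) \<and>
      has_bochner_integral lebesgue (\<lambda>x. Q x * exp (real CARD('n) * u x)) \<kappa>)"
proof (intro allI impI notI)
  fix \<kappa> assume \<kappa>: "\<kappa> > Lambda1 TYPE('n)"
  define n where "n = real CARD('n)"
  assume "\<exists>u :: real ^ 'n \<Rightarrow> real. radially_symmetric u \<and>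
      solves_half_n_laplace u (\<lambda>x. Q x * exp (real CARD('n) * u x)) \<and>
      has_bochner_integral lebesgue (\<lambda>x. Q x * exp (real CARD('n) * u x)) \<kappa>"
  then obtain u :: "real ^ 'n \<Rightarrow> real" where u: "radially_symmetric u"
      "solves_half_n_laplace u (\<lambda>x. Q x * exp (n * u x))"
      "has_bochner_integral lebesgue (\<lambda>x. Q x * exp (n * u x)) \<kappa>"
    unfolding n_def by blast
  define f where "f = (\<lambda>x. Q x * exp (n * u x))"
  note sol = u(2)[folded f_def]
  have f: "integrable lebesgue f" "(LINT x|lebesgue. f x) = \<kappa>"
    using u(3)[folded f_def] by (simp_all add: has_bochner_integral_iff)
  have fm: "f \<in> borel_measurable lebesgue" using f(1) by (rule borel_measurable_integrable)
  have Q0: "Q x > 0" for x using form by auto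
  have ul: "locally_integrable u"
    using sol unfolding solves_half_n_laplace_def weak_neg_laplacian_power_def by (auto split: if_splits)
  note um = locally_integrable_measurable[OF ul]
  obtain H where H [measurable]: "H \<in> borel_measurable borel" and uH: "AE x in lborel. u x = H (x \<bullet> x)"
    using radial_eq_borel_AE[OF um] u(1) unfolding radially_symmetric_def by blast
  obtain f0 where f0 [measurable]: "f0 \<in> borel_measurable borel" and ff0: "AE x in lborel. f x = f0 x"
    using borel_version[OF fm] by blast
  \<comment> \<open>Truncation at 0 makes the Borel version nonnegative everywhere and not only
    almost everywhere, as \<open>radial_potential\<close> demands.\<close>
  define f' where "f' x = max 0 (f0 x)" for x
  have f'm [measurable]: "f' \<in> borel_measurable borel" unfolding f'_def by measurable
  have f'0: "f' x \<ge> 0" for x by (simp add: f'_def)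
  have ff': "AE x in lborel. f x = f' x"
    using ff0
  proof eventually_elim
    case (elim x)
    moreover have "f x \<ge> 0" using Q0[of x] by (simp add: f_def)
    ultimately show ?case by (simp add: f'_def)
  qed
  have f'i: "integrable lborel f'" "(LINT x|lborel. f' x) = \<kappa>"
    using lebesgue_integral_borel_version[OF fm f'm ff'] f by simp_all
  have f'H: "AE x in lborel. f' x = Q x * exp (n * H (x \<bullet> x))"
    using ff' uH by eventually_elim (simp add: f_def)
  have loc: "integrable lborel (\<lambda>x::real ^ 'n. indicator {..R} (x \<bullet> x) * H (x \<bullet> x))" for R
  proof -
    have i: "integrable lebesgue (\<lambda>x. indicator (cball 0 (sqrt R)) x * u x)" by (rule locally_integrable_cball[OF ul])
    have "AE x in lborel. indicator (cball 0 (sqrt R)) x * u x = indicator {..R} (x \<bullet> x) * H (x \<bullet> x)"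
      using uH
    proof eventually_elim
      case (elim x)
      have "x \<in> cball 0 (sqrt R) \<longleftrightarrow> x \<bullet> x \<le> R" by (simp add: norm_eq_sqrt_inner)
      with elim show ?case by (simp add: indicator_def)
    qed
    with i show ?thesis
      using lebesgue_integral_borel_version(1)[OF borel_measurable_integrable[OF i],
          of "\<lambda>x. indicator {..R} (x \<bullet> x) * H (x \<bullet> x)"] by simp
  qed
  have form': "(\<exists>\<delta> lam. \<delta> > 0 \<and> lam > 0 \<and> (\<forall>x. Q x = \<delta> * exp (- lam * (norm x)\<^sup>2))) \<or>
      (\<exists>\<xi>. (\<forall>x. Q x = exp (\<xi> x)) \<and> ((\<lambda>x. \<xi> x / (norm x)\<^sup>2) \<longlongrightarrow> 0) at_infinity)"
    using form by blast
  from dim have "\<kappa> \<le> Lambda1 TYPE('n)"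
  proof
    assume d: "CARD('n) = 3"
    obtain v where v: "weak_neg_laplacian_power 1 u v" "L_half v"
        "\<And>\<phi>. schwartz \<phi> \<Longrightarrow> pairing v (half_laplacian \<phi>) = pairing f \<phi>"
      using sol d unfolding solves_half_n_laplace_def by auto
    \<comment> \<open>log (1 / |x|) / (2 pi^2) is the fundamental solution of (-\<Delta>)^(3/2) in
      three-space: -\<Delta> takes log (1 / |x|) to |x|^(-2), and |x|^(-2) / (2 pi^2) has symbol 1 /
      |\<xi>|.\<close>
    interpret radial_potential log_kernel_3 f' "2 * pi\<^sup>2"
      by (intro radial_potential.intro symmetric_kernel_log_kernel_3 radial_potential_axioms.intro f'i f'0) simp
    have "(LINT x|lborel. f' x) \<le> 2 * (2 * pi\<^sup>2)"
    proof (rule total_mass_le_pairing[OF radial decreasing form' _ H loc])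
      show "AE x in lborel. f' x = Q x * exp (real 3 * H (x \<bullet> x))" using f'H by (simp add: n_def d)
      show "(LINT x|(lborel :: (real ^ 'n) measure). H (x \<bullet> x) * \<psi> (x \<bullet> x)) = - 2 / (2 * pi\<^sup>2) *
          (LINT y|lborel. f' y * (LINT \<rho>|lborel. radial_weight 3 \<rho> * log_kernel_3 (norm y / sqrt \<rho>) * deriv \<zeta> \<rho>))"
        if "0 < a" "a < b" and z: "smooth_real_on UNIV \<zeta>" "smooth_real_on UNIV \<eta>"
          "\<And>x. x \<ge> b \<Longrightarrow> \<zeta> x = 0" "\<And>x. x \<ge> b \<Longrightarrow> \<eta> x = 0"
          "radial_neg_laplacian 3 \<zeta> = \<psi>" "radial_neg_laplacian 3 \<eta> = \<zeta>" for a b :: real and \<psi> \<zeta> \<eta>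
        by (rule radial_kernel_pairing_3[OF d v fm H uH f'i(1) f'0 ff' less_trans[OF that(1,2)] z])
    qed (simp add: d)
    then show ?thesis unfolding f'i(2) Lambda1_3[OF d] by simp
  next
    assume d: "CARD('n) = 4"
    have w: "weak_neg_laplacian_power 2 u f"
      using sol d unfolding solves_half_n_laplace_def by simp
    \<comment> \<open>In dimension four \<Delta>^2 takes log (1 / |x|) to 8 pi^2 times the Dirac
      mass at the origin.\<close>
    interpret radial_potential log_kernel_4 f' "8 * pi\<^sup>2"
      by (intro radial_potential.intro symmetric_kernel_log_kernel_4 radial_potential_axioms.intro f'i f'0) simp
    have "(LINT x|lborel. f' x) \<le> 2 * (8 * pi\<^sup>2)"
    proof (rule total_mass_le_pairing[OF radial decreasing form' _ H loc])
      show "AE x in lborel. f' x = Q x * exp (real 4 * H (x \<bullet> x))" using f'H by (simp add: n_def d)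
      show "(LINT x|(lborel :: (real ^ 'n) measure). H (x \<bullet> x) * \<psi> (x \<bullet> x)) = - 2 / (8 * pi\<^sup>2) *
          (LINT y|lborel. f' y * (LINT \<rho>|lborel. radial_weight 4 \<rho> * log_kernel_4 (norm y / sqrt \<rho>) * deriv \<zeta> \<rho>))"
        if "0 < a" "a < b" and z: "smooth_real_on UNIV \<zeta>" "smooth_real_on UNIV \<eta>"
          "\<And>x. x \<ge> b \<Longrightarrow> \<zeta> x = 0" "\<And>x. x \<ge> b \<Longrightarrow> \<eta> x = 0"
          "radial_neg_laplacian 4 \<zeta> = \<psi>" "radial_neg_laplacian 4 \<eta> = \<zeta>" for a b :: real and \<psi> \<zeta> \<eta>
        by (rule radial_kernel_pairing_4[OF d w H uH f'm ff' z])
    qed (simp add: d)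
    then show ?thesis unfolding f'i(2) Lambda1_4[OF d] by simp
  qed
  with \<kappa> show False by simp
qed

end
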